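(* Suppose $d_k(n,p)=0$. Then $H^0(\mathcal S_k,\partial)=0$, and $H^1(\mathcal S_k,\partial)$ is a free $\mathfrak O_q$-module of rank $\frac1{n+1}\binom{n+k}{n}$ with basis $\{e^{\underline i}\}_{\underline i\in B_k}$. Further, for $\xi\in\mathrm{Fil}^N\mathcal S_k$ there exist $C(\underline i,\xi)\in\mathfrak O_q$ ($\underline i\in B_k$) satisfying $\mathrm{ord}_pC(\underline i,\xi)\ge w(\underline i)-N$ such that in $H^1(\mathcal S_k,\partial)$ $$\xi=\sum_{\underline i\in B_k}C(\underline i,\xi)\,e^{\underline i}\quad\mod\partial.$$
   Context: $p$ is a prime, $q=p^a$ with $a\ge1$, $n,k\ge1$ integers with $\gcd(n+1,p)=1$. $\mathbb Q_q$ is the unramified extension of $\mathbb Q_p$ of degree $a$; $\mathrm{ord}_p p=1$. $\gamma\in\overline{\mathbb Q}_p$ is a root of $\sum_{j\ge0}T^{p^j}/p^j$ with $\mathrm{ord}_p\gamma=1/(p-1)$; fix a $q$-th root $\gamma^{1/q}$; $\mathfrak O_q$ is the ring of integers of $\mathbb Q_q(\gamma^{1/q})$. For $u\in\mathbb Z^n$ let $m(u)=\max\{0,-u_1,\dots,-u_n\}$ and $w(u)=u_1+\cdots+u_n+(n+1)m(u)$. Let $$\mathcal O=\Big\{\sum_{r\ge0}a(r)\gamma^{r(n+1)}t^r\ \Big|\ a(r)\in\mathfrak O_q,\ a(r)\to0\Big\},\quad\mathcal C=\Big\{\sum_{u\in\mathbb Z^n}\xi(u)\gamma^{w(u)}t^{m(u)}x^u\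 \Big|\ \xi(u)\in\mathcal O,\ \xi(u)\to0\text{ as }w(u)\to\infty\Big\}.$$ $K(t,x)=x_1+\cdots+x_n+t/(x_1\cdots x_n)$, $\gamma_i=\sum_{j=0}^i\gamma^{p^j}/p^j$, $H(t,x)=\sum_{i\ge0}\gamma_iK(t^{p^i},x^{p^i})$, $D_{t,l}=x_l\frac\partial{\partial x_l}+x_l\frac{\partial H(t,x)}{\partial x_l}$ ($1\le l\le n$), $\partial=t\frac{\partial}{\partial t}+t\frac{\partial H(t,x)}{\partial t}$ on $\mathcal C$. $H^n(\mathcal C,D_t)=\mathcal C/\sum_lD_{t,l}\mathcal C$ is known to be free over $\mathcal O$ with basis $e_0=1$, $e_i=\gamma^ix_1\cdots x_i$ ($1\le i\le n$); $\partial$ commutes with the $D_{t,l}$ and induces a connection on $H^n(\mathcal C,D_t)$. $\mathcal S_k=\mathrm{Sym}^k_{\mathcal O}H^n(\mathcal C,D_t)$, free over $\mathcal O$ with basis $e^{\underline i}=e_0^{i_0}\cdots e_n^{i_n}$, $\underline i\in I_k=\{\underline i\in\mathbb Z_{\ge0}^{n+1}\mid i_0+\cdots+i_n=k\}$; write $w(\underline i)=i_1+2i_2+\cdots+ni_n$. Extend $\partial$ to $\mathcal S_k$ by $\partial(\xi e^{\underline i})=t\frac{d\xi}{dt}e^{\underline i}+\sum_{j=0}^ni_j\xi\,e_0^{i_0}\cdots e_j^{i_j-1}\cdots e_n^{i_n}\cdot\partial(e_j)$. $H^0(\mathcal S_k,\partial)$, $H^1(\mathcal S_k,\partial)$ are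 the kernel and cokernel of $\mathcal S_k\to\mathcal S_k\frac{dt}t$, $\eta\mapsto\partial(\eta)\frac{dt}t$. $\mathrm{Fil}^N\mathcal S_k$ is the $\mathfrak O_q$-module generated by the $\gamma^{(n+1)r}t^re^{\underline i}$ with $\underline i\in I_k$, $r\ge0$ and $(n+1)r+w(\underline i)\le N$. Let $\zeta_{n+1}$ be a primitive $(n+1)$-th root of unity in $\overline{\mathbb F}_p$ and $d_k(n,p)=\#\{\underline i\in I_k\mid\sum_{j=0}^ni_j\zeta_{n+1}^j=0\text{ in }\overline{\mathbb F}_p\}$. The set $B_k\subseteq I_k$: let $M$ be the free $\mathbb F_q[t]$-module on $\bar e_0,\dots,\bar e_n$, $\overline G(\bar e_i)=\bar e_{i+1}$ ($i<n$), $\overline G(\bar e_n)=t\bar e_0$, $\overline{\mathcal S}_k=\mathrm{Sym}^k_{\mathbb F_q[t]}M$ and $\nabla_{\overline G}$ the $\mathbb F_q[t]$-linear map $\nabla_{\overline G}(\bar e^{\underline i})=\sum_ji_j\bar e_0^{i_0}\cdots\bar e_j^{i_j-1}\cdots\bar e_n^{i_n}\overline G(\bar e_j)$; then $B_k$ is a fixed subset of $I_k$ such that $\{\bar e^{\underline i}:\underline i\in B_k\}$ is an $\mathbb F_q$-basis of $\overline{\mathcal S}_k/\nabla_{\overline G}\overline{\mathcal S}_k$ (it exists when $d_k(n,p)=0$). *)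

theory Defs
  imports
    "HOL-Algebra.Algebraic_Closure_Type"
    "HOL-Algebra.Generated_Fields"
    "HOL-Computational_Algebra.Formal_Power_Series"
    "HOL-Library.Extended_Real"
    "HOL-Library.Multiset"
    "HOL-Library.FuncSet"
    "HOL-Library.Groups_Big_Fun"
begin

section \<open>Modules: quotients, spans, bases, symmetric powers\<close>

text \<open>Module records extend ring records; the fields \<open>mult\<close> and \<open>one\<close> play no role
  for modules and are left undefined.\<close>

definition quot_module :: "('r, 'm, 'x) module_scheme \<Rightarrow> 'm set \<Rightarrow> ('r, 'm set) module" where
  "quot_module M N =
     \<lparr>carrier = a_rcosets\<^bsub>M\<^esub> N, monoid.mult = undefined, one = undefined, ring.zero = N, add = set_add M,
      module.smult = (\<lambda>c Y. \<Union>x\<in>Y. N +>\<^bsub>M\<^esub> (c \<odot>\<^bsub>M\<^esub> x))\<rparr>"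

text \<open>The map on cosets of \<open>N\<close> induced by a map \<open>f\<close> that respects \<open>N\<close>.\<close>

definition induced_map :: "('r, 'm, 'x) module_scheme \<Rightarrow> 'm set \<Rightarrow> ('m \<Rightarrow> 'm) \<Rightarrow> 'm set \<Rightarrow> 'm set" where
  "induced_map M N f Y = (\<Union>x\<in>Y. N +>\<^bsub>M\<^esub> f x)"

definition restrict_scalars :: "('s \<Rightarrow> 'r) \<Rightarrow> ('r, 'm) module \<Rightarrow> ('s, 'm) module" where
  "restrict_scalars \<iota> M =
     \<lparr>carrier = carrier M, monoid.mult = monoid.mult M, one = one M, ring.zero = ring.zero M, add = add M,
      module.smult = (\<lambda>c. module.smult M (\<iota> c))\<rparr>"

definition module_span :: "('r, 'y) ring_scheme \<Rightarrow> ('r, 'm, 'x) module_scheme \<Rightarrow> 'm set \<Rightarrow> 'm set" where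
  "module_span R M Y = \<Inter> {H. submodule H R M \<and> Y \<subseteq> H}"

definition free_with_basis ::
  "('r, 'y) ring_scheme \<Rightarrow> ('r, 'm, 'x) module_scheme \<Rightarrow> 'i set \<Rightarrow> ('i \<Rightarrow> 'm) \<Rightarrow> bool" where
  "free_with_basis R M B e \<longleftrightarrow>
     module R M \<and> finite B \<and> e \<in> B \<rightarrow> carrier M \<and>
     (\<forall>x \<in> carrier M. \<exists>!c. c \<in> B \<rightarrow>\<^sub>E carrier R \<and> x = (\<Oplus>\<^bsub>M\<^esub>i\<in>B. c i \<odot>\<^bsub>M\<^esub> e i))"

definition free_module :: "('r, 'y) ring_scheme \<Rightarrow> 'i set \<Rightarrow> ('r, 'i \<Rightarrow> 'r) module" where
  "free_module R Y =
     \<lparr>carrier = {f. (\<forall>x. f x \<in> carrier R) \<and> (\<forall>x. x \<notin> Y \<longrightarrow> f x = \<zero>\<^bsub>R\<^esub>) \<and> finite {x. f x \<noteq> \<zero>\<^bsub>R\<^esub>}},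
      monoid.mult = undefined, one = undefined,
      ring.zero = (\<lambda>x. \<zero>\<^bsub>R\<^esub>), add = (\<lambda>f g x. f x \<oplus>\<^bsub>R\<^esub> g x), module.smult = (\<lambda>c f x. c \<otimes>\<^bsub>R\<^esub> f x)\<rparr>"

definition unit_vec :: "('r, 'y) ring_scheme \<Rightarrow> 'i \<Rightarrow> 'i \<Rightarrow> 'r" where
  "unit_vec R x = (\<lambda>y. if y = x then \<one>\<^bsub>R\<^esub> else \<zero>\<^bsub>R\<^esub>)"

text \<open>The \<open>k\<close>-th symmetric power of an \<open>R\<close>-module \<open>M\<close>: the free module on the formal
  commutative products (multisets) of \<open>k\<close> elements of \<open>M\<close>, modulo the relations saying that
  the product is \<open>R\<close>-linear in each factor.\<close>

definition mset_power :: "('r, 'm, 'x) module_scheme \<Rightarrow> nat \<Rightarrow> 'm multiset set" where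
  "mset_power M k = {A. set_mset A \<subseteq> carrier M \<and> size A = k}"

definition sym_relations ::
  "('r, 'y) ring_scheme \<Rightarrow> ('r, 'm, 'x) module_scheme \<Rightarrow> nat \<Rightarrow> ('m multiset \<Rightarrow> 'r) set" where
  "sym_relations R M k =
     (let F = free_module R (mset_power M k); \<delta> = unit_vec R in
      module_span R F
       ({\<delta> (add_mset (x \<oplus>\<^bsub>M\<^esub> y) A) \<ominus>\<^bsub>F\<^esub> (\<delta> (add_mset x A) \<oplus>\<^bsub>F\<^esub> \<delta> (add_mset y A)) | x y A.
           x \<in> carrier M \<and> y \<in> carrier M \<and> set_mset A \<subseteq> carrier M \<and> Suc (size A) = k} \<union>
        {\<delta> (add_mset (c \<odot>\<^bsub>M\<^esub> x) A) \<ominus>\<^bsub>F\<^esub> (c \<odot>\<^bsub>F\<^esub> \<delta> (add_mset x A)) | c x A.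
           c \<in> carrier R \<and> x \<in> carrier M \<and> set_mset A \<subseteq> carrier M \<and> Suc (size A) = k}))"

definition sym_power ::
  "('r, 'y) ring_scheme \<Rightarrow> ('r, 'm, 'x) module_scheme \<Rightarrow> nat \<Rightarrow> ('r, ('m multiset \<Rightarrow> 'r) set) module" where
  "sym_power R M k = quot_module (free_module R (mset_power M k)) (sym_relations R M k)"

definition sym_prod ::
  "('r, 'y) ring_scheme \<Rightarrow> ('r, 'm, 'x) module_scheme \<Rightarrow> nat \<Rightarrow> 'm multiset \<Rightarrow> ('m multiset \<Rightarrow> 'r) set" where
  "sym_prod R M k A = sym_relations R M k +>\<^bsub>free_module R (mset_power M k)\<^esub> unit_vec R A"

text \<open>The index set \<open>I\<^sub>k\<close>; vectors \<open>(i\<^sub>0,\<dots>,i\<^sub>n)\<close> are functions on \<open>nat\<close> vanishing beyond \<open>n\<close>.\<close>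

definition sym_index :: "nat \<Rightarrow> nat \<Rightarrow> (nat \<Rightarrow> nat) set" where
  "sym_index n k = {i. (\<forall>j>n. i j = 0) \<and> (\<Sum>j\<le>n. i j) = k}"

definition index_weight :: "nat \<Rightarrow> (nat \<Rightarrow> nat) \<Rightarrow> nat" where
  "index_weight n i = (\<Sum>j\<le>n. j * i j)"

definition basis_mset :: "nat \<Rightarrow> (nat \<Rightarrow> 'm) \<Rightarrow> (nat \<Rightarrow> nat) \<Rightarrow> 'm multiset" where
  "basis_mset n e i = (\<Sum>j\<le>n. replicate_mset (i j) (e j))"

definition sym_monom ::
  "('r, 'y) ring_scheme \<Rightarrow> ('r, 'm, 'x) module_scheme \<Rightarrow> nat \<Rightarrow> (nat \<Rightarrow> 'm) \<Rightarrow> nat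
    \<Rightarrow> (nat \<Rightarrow> nat) \<Rightarrow> ('m multiset \<Rightarrow> 'r) set" where
  "sym_monom R M n e k i = sym_prod R M k (basis_mset n e i)"

text \<open>Let \<open>M\<close> be free with basis \<open>e\<^sub>0,\<dots>,e\<^sub>n\<close>, let \<open>\<phi>\<close> be a map on \<open>M\<close> and \<open>d\<close> a map on
  \<open>R\<close>.  \<open>sym_extend\<close> is the additive map on the \<open>k\<close>-th symmetric power given by
  \<open>\<xi> e\<^sup>i \<mapsto> d(\<xi>) e\<^sup>i + \<Sum>\<^sub>j i\<^sub>j \<xi> e\<^sub>0\<^bsup>i\<^sub>0\<^esup> \<cdots> e\<^sub>j\<^bsup>i\<^sub>j-1\<^esup> \<cdots> e\<^sub>n\<^bsup>i\<^sub>n\<^esup> \<cdot> \<phi>(e\<^sub>j)\<close>.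
  The choice operator picks the coordinates in the basis \<open>e\<^sup>i\<close>, which are unique.  The terms
  with \<open>i\<^sub>j = 0\<close> are zero and are left out, as \<open>e\<^sub>j\<close> cannot be removed from the product.\<close>

definition sym_coords ::
  "('r, 'y) ring_scheme \<Rightarrow> ('r, 'm, 'x) module_scheme \<Rightarrow> nat \<Rightarrow> (nat \<Rightarrow> 'm) \<Rightarrow> nat
    \<Rightarrow> ('m multiset \<Rightarrow> 'r) set \<Rightarrow> (nat \<Rightarrow> nat) \<Rightarrow> 'r" where
  "sym_coords R M n e k \<eta> =
     (SOME c. c \<in> sym_index n k \<rightarrow>\<^sub>E carrier R \<and>
        \<eta> = (\<Oplus>\<^bsub>sym_power R M k\<^esub>i\<in>sym_index n k. c i \<odot>\<^bsub>sym_power R M k\<^esub> sym_monom R M n e k i))"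

definition sym_extend ::
  "('r, 'y) ring_scheme \<Rightarrow> ('r, 'm, 'x) module_scheme \<Rightarrow> nat \<Rightarrow> (nat \<Rightarrow> 'm) \<Rightarrow> nat
    \<Rightarrow> ('r \<Rightarrow> 'r) \<Rightarrow> ('m \<Rightarrow> 'm) \<Rightarrow> ('m multiset \<Rightarrow> 'r) set \<Rightarrow> ('m multiset \<Rightarrow> 'r) set" where
  "sym_extend R M n e k d \<phi> \<eta> =
     (let S = sym_power R M k; c = sym_coords R M n e k \<eta> in
      \<Oplus>\<^bsub>S\<^esub>i\<in>sym_index n k.
        d (c i) \<odot>\<^bsub>S\<^esub> sym_monom R M n e k i \<oplus>\<^bsub>S\<^esub>
        (\<Oplus>\<^bsub>S\<^esub>j\<in>{j. j \<le> n \<and> i j > 0}.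
           ([i j] \<cdot>\<^bsub>R\<^esub> c i) \<odot>\<^bsub>S\<^esub>
             sym_prod R M k (add_mset (\<phi> (e j)) (basis_mset n e i - {#e j#}))))"


section \<open>The field of $p$-adic numbers and its extensions\<close>

text \<open>The type \<open>'k\<close> is the field of $p$-adic numbers and \<open>ord\<close> is the extension of the $p$-adic
  valuation to its algebraic closure: \<open>ord\<close> is a valuation with \<open>ord p = 1\<close>, \<open>'k\<close> is complete
  with respect to it and the rational numbers are dense in \<open>'k\<close>.\<close>

definition padic_closure :: "nat \<Rightarrow> ('k::field_char_0 alg_closure \<Rightarrow> ereal) \<Rightarrow> bool" where
  "padic_closure p ord \<longleftrightarrow>
     (\<forall>x. ord x = \<infinity> \<longleftrightarrow> x = 0) \<and> (\<forall>x. ord x \<noteq> -\<infinity>) \<and>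
     (\<forall>x y. ord (x * y) = ord x + ord y) \<and>
     (\<forall>x y. min (ord x) (ord y) \<le> ord (x + y)) \<and>
     ord (of_nat p) = 1 \<and>
     (\<forall>(x::'k) (b::real). \<exists>r\<in>\<rat>. ereal b \<le> ord (to_ac (x - r))) \<and>
     (\<forall>s :: nat \<Rightarrow> 'k.
        (\<forall>b::real. \<exists>m. \<forall>i\<ge>m. \<forall>j\<ge>m. ereal b \<le> ord (to_ac (s i - s j))) \<longrightarrow>
        (\<exists>x. ((\<lambda>i. ord (to_ac (s i - x))) \<longlongrightarrow> \<infinity>) sequentially))"

text \<open>Unramified of degree \<open>a\<close> over the $p$-adic numbers: the ramification index is 1, i.e. the
  value group does not grow.  (Separability of the residue field extension is automatic, as
  the residue field of the $p$-adic numbers is perfect.)\<close>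

definition unramified_extension ::
  "('k::field alg_closure \<Rightarrow> ereal) \<Rightarrow> nat \<Rightarrow> 'k alg_closure set \<Rightarrow> bool" where
  "unramified_extension ord a L \<longleftrightarrow>
     subfield L ring_of_type_algebra \<and> range to_ac \<subseteq> L \<and>
     ring.dimension ring_of_type_algebra a (range to_ac) L \<and>
     ord ` (L - {0}) = ord ` (range to_ac - {0})"

definition ring_of_integers :: "('f \<Rightarrow> ereal) \<Rightarrow> 'f set \<Rightarrow> 'f set" where
  "ring_of_integers ord L = {x \<in> L. 0 \<le> ord x}"


section \<open>The Kloosterman family\<close>

text \<open>Exponent vectors \<open>u \<in> \<int>\<^sup>n\<close> are functions on \<open>nat\<close> vanishing outside \<open>{1..n}\<close>.  A formal
  series \<open>\<Sum>\<^sub>u f\<^sub>u(t) x\<^sup>u\<close> is the function \<open>u \<mapsto> f\<^sub>u\<close> with values in the power series in \<open>t\<close>.\<close>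

type_synonym 'f series = "(nat \<Rightarrow> int) \<Rightarrow> 'f fps"

definition exponents :: "nat \<Rightarrow> (nat \<Rightarrow> int) set" where
  "exponents n = {u. \<forall>l. l \<notin> {1..n} \<longrightarrow> u l = 0}"

definition m_exp :: "nat \<Rightarrow> (nat \<Rightarrow> int) \<Rightarrow> nat" where
  "m_exp n u = nat (Max (insert 0 ((\<lambda>l. - u l) ` {1..n})))"

text \<open>\<open>w(u)\<close> is nonnegative, so no information is lost by \<open>nat\<close>.\<close>

definition w_exp :: "nat \<Rightarrow> (nat \<Rightarrow> int) \<Rightarrow> nat" where
  "w_exp n u = nat ((\<Sum>l=1..n. u l) + int ((n + 1) * m_exp n u))"

definition monom_x :: "'f::field fps \<Rightarrow> (nat \<Rightarrow> int) \<Rightarrow> 'f series" where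
  "monom_x c v = (\<lambda>u. if u = v then c else 0)"

text \<open>Multiplication of series.  If \<open>f\<^sub>u\<close> and \<open>g\<^sub>u\<close> are divisible by \<open>t\<^bsup>m(u)\<^esup>\<close>, as is the case
  below, then only finitely many \<open>v\<close> contribute to each coefficient of the product.\<close>

definition series_mult :: "'f::field series \<Rightarrow> 'f series \<Rightarrow> 'f series" where
  "series_mult f g = (\<lambda>u. Abs_fps (\<lambda>r. Sum_any (\<lambda>v. fps_nth (f v * g (\<lambda>l. u l - v l)) r)))"

definition theta_x :: "nat \<Rightarrow> 'f::field series \<Rightarrow> 'f series" where
  "theta_x l f = (\<lambda>u. of_int (u l) * f u)"

definition theta :: "'f::field fps \<Rightarrow> 'f fps" where
  "theta f = fps_X * fps_deriv f"

text \<open>\<open>K_pow n N\<close> is \<open>K(t\<^sup>N, x\<^sup>N)\<close>.\<close>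

definition K_pow :: "nat \<Rightarrow> nat \<Rightarrow> 'f::field series" where
  "K_pow n N = (\<lambda>u.
     (\<Sum>l=1..n. monom_x 1 (\<lambda>j. if j = l then int N else 0) u) +
     monom_x (fps_X ^ N) (\<lambda>j. if j \<in> {1..n} then - int N else 0) u)"

definition gamma_part :: "nat \<Rightarrow> 'f::field \<Rightarrow> nat \<Rightarrow> 'f" where
  "gamma_part p \<gamma> i = (\<Sum>j\<le>i. \<gamma> ^ (p ^ j) / of_nat (p ^ j))"

text \<open>For every \<open>u\<close>, at most one summand is nonzero.\<close>

definition H_series :: "nat \<Rightarrow> nat \<Rightarrow> 'f::field \<Rightarrow> 'f series" where
  "H_series p n \<gamma> = (\<lambda>u. Sum_any (\<lambda>i. fps_const (gamma_part p \<gamma> i) * K_pow n (p ^ i) u))"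

definition D_op :: "nat \<Rightarrow> nat \<Rightarrow> 'f::field \<Rightarrow> nat \<Rightarrow> 'f series \<Rightarrow> 'f series" where
  "D_op p n \<gamma> l f = (\<lambda>u. theta_x l f u + series_mult (theta_x l (H_series p n \<gamma>)) f u)"

definition del_op :: "nat \<Rightarrow> nat \<Rightarrow> 'f::field \<Rightarrow> 'f series \<Rightarrow> 'f series" where
  "del_op p n \<gamma> f = (\<lambda>u. theta (f u) + series_mult (\<lambda>v. theta (H_series p n \<gamma> v)) f u)"

context
  fixes ord :: "'f::field \<Rightarrow> ereal" and Oq :: "'f set" and p n :: nat and \<gamma> :: 'f
begin

text \<open>In the following, \<open>Oq\<close> is the coefficient ring \<open>\<OO>\<^sub>q\<close>.\<close>

definition Oq_ring :: "'f ring" where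
  "Oq_ring = ring_of_type_algebra\<lparr>carrier := Oq\<rparr>"

definition O_set :: "'f fps set" where
  "O_set = {f. \<exists>a. (\<forall>r. a r \<in> Oq \<and> fps_nth f r = a r * \<gamma> ^ (r * (n + 1))) \<and>
                   ((\<lambda>r. ord (a r)) \<longlongrightarrow> \<infinity>) sequentially}"

definition O_ring :: "'f fps ring" where
  "O_ring = ring_of_type_algebra\<lparr>carrier := O_set\<rparr>"

text \<open>The topology on \<open>O\<close> is that of the sup-norm of the coefficients \<open>a(r)\<close>.\<close>

definition O_ord :: "'f fps \<Rightarrow> ereal" where
  "O_ord f = (INF r. ord (fps_nth f r / \<gamma> ^ (r * (n + 1))))"

definition C_set :: "'f series set" where
  "C_set = {f. (\<forall>u. u \<notin> exponents n \<longrightarrow> f u = 0) \<and>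
     (\<exists>\<xi>. (\<forall>u\<in>exponents n. \<xi> u \<in> O_set \<and>
              f u = \<xi> u * fps_const (\<gamma> ^ w_exp n u) * fps_X ^ m_exp n u) \<and>
          (\<forall>b::real. \<exists>W. \<forall>u\<in>exponents n. W \<le> w_exp n u \<longrightarrow> ereal b \<le> O_ord (\<xi> u)))}"

definition C_module :: "('f fps, 'f series) module" where
  "C_module = \<lparr>carrier = C_set, monoid.mult = series_mult, one = monom_x 1 (\<lambda>_. 0),
     ring.zero = (\<lambda>_. 0), add = (\<lambda>f g u. f u + g u), module.smult = (\<lambda>c f u. c * f u)\<rparr>"

definition DC :: "'f series set" where
  "DC = {(\<lambda>u. \<Sum>l=1..n. D_op p n \<gamma> l (c l) u) | c. \<forall>l\<in>{1..n}. c l \<in> C_set}"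

definition Hn :: "('f fps, 'f series set) module" where
  "Hn = quot_module C_module DC"

definition Hn_basis :: "nat \<Rightarrow> 'f series set" where
  "Hn_basis j =
     DC +>\<^bsub>C_module\<^esub> monom_x (fps_const (\<gamma> ^ j)) (\<lambda>l. if l \<in> {1..j} then 1 else 0)"

definition Hn_del :: "'f series set \<Rightarrow> 'f series set" where
  "Hn_del = induced_map C_module DC (del_op p n \<gamma>)"

text \<open>\<open>S\<^sub>k\<close>, its basis \<open>e\<^sup>i\<close> and the connection on it; \<open>S\<^sub>k dt/t\<close> is identified with \<open>S\<^sub>k\<close>.\<close>

definition Sk :: "nat \<Rightarrow> ('f fps, ('f series set multiset \<Rightarrow> 'f fps) set) module" where
  "Sk k = sym_power O_ring Hn k"

definition Sk_basis :: "nat \<Rightarrow> (nat \<Rightarrow> nat) \<Rightarrow> ('f series set multiset \<Rightarrow> 'f fps) set" where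
  "Sk_basis k = sym_monom O_ring Hn n Hn_basis k"

definition Sk_del ::
  "nat \<Rightarrow> ('f series set multiset \<Rightarrow> 'f fps) set \<Rightarrow> ('f series set multiset \<Rightarrow> 'f fps) set" where
  "Sk_del k = sym_extend O_ring Hn n Hn_basis k theta Hn_del"

definition Sk_over_Oq :: "nat \<Rightarrow> ('f, ('f series set multiset \<Rightarrow> 'f fps) set) module" where
  "Sk_over_Oq k = restrict_scalars fps_const (Sk k)"

definition H0 :: "nat \<Rightarrow> ('f series set multiset \<Rightarrow> 'f fps) set set" where
  "H0 k = {\<eta> \<in> carrier (Sk k). Sk_del k \<eta> = \<zero>\<^bsub>Sk k\<^esub>}"

definition H1 :: "nat \<Rightarrow> ('f, ('f series set multiset \<Rightarrow> 'f fps) set set) module" where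
  "H1 k = quot_module (Sk_over_Oq k) (Sk_del k ` carrier (Sk k))"

definition H1_class ::
  "nat \<Rightarrow> ('f series set multiset \<Rightarrow> 'f fps) set \<Rightarrow> ('f series set multiset \<Rightarrow> 'f fps) set set" where
  "H1_class k \<eta> = Sk_del k ` carrier (Sk k) +>\<^bsub>Sk k\<^esub> \<eta>"

definition Fil :: "nat \<Rightarrow> int \<Rightarrow> ('f series set multiset \<Rightarrow> 'f fps) set set" where
  "Fil k N = module_span Oq_ring (Sk_over_Oq k)
     {(fps_const (\<gamma> ^ ((n + 1) * r)) * fps_X ^ r) \<odot>\<^bsub>Sk k\<^esub> Sk_basis k i | r i.
        i \<in> sym_index n k \<and> int ((n + 1) * r + index_weight n i) \<le> N}"

end


section \<open>Reduction modulo $p$\<close>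

definition d_number :: "nat \<Rightarrow> nat \<Rightarrow> 'f::field \<Rightarrow> nat" where
  "d_number n k \<zeta> = card {i \<in> sym_index n k. (\<Sum>j\<le>n. of_nat (i j) * \<zeta> ^ j) = 0}"

definition primitive_root_of_unity :: "nat \<Rightarrow> 'f::field \<Rightarrow> bool" where
  "primitive_root_of_unity m \<zeta> \<longleftrightarrow> \<zeta> ^ m = 1 \<and> (\<forall>j. 0 < j \<and> j < m \<longrightarrow> \<zeta> ^ j \<noteq> 1)"

definition M_bar :: "nat \<Rightarrow> ('q::field poly, nat \<Rightarrow> 'q poly) module" where
  "M_bar n = free_module ring_of_type_algebra {0..n}"

definition e_bar :: "nat \<Rightarrow> nat \<Rightarrow> 'q::field poly" where
  "e_bar = unit_vec ring_of_type_algebra"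

definition G_bar :: "nat \<Rightarrow> (nat \<Rightarrow> 'q::field poly) \<Rightarrow> nat \<Rightarrow> 'q poly" where
  "G_bar n f = (\<lambda>j. if j = 0 then [:0, 1:] * f n else if j \<le> n then f (j - 1) else 0)"

definition S_bar :: "nat \<Rightarrow> nat \<Rightarrow> ('q::field poly, ((nat \<Rightarrow> 'q poly) multiset \<Rightarrow> 'q poly) set) module" where
  "S_bar n k = sym_power ring_of_type_algebra (M_bar n) k"

definition nabla_bar ::
  "nat \<Rightarrow> nat \<Rightarrow> ((nat \<Rightarrow> 'q::field poly) multiset \<Rightarrow> 'q poly) set \<Rightarrow> ((nat \<Rightarrow> 'q poly) multiset \<Rightarrow> 'q poly) set" where
  "nabla_bar n k = sym_extend ring_of_type_algebra (M_bar n) n e_bar k (\<lambda>_. 0) (G_bar n)"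

text \<open>The property defining \<open>B\<^sub>k\<close>, where \<open>'q\<close> is the field with \<open>q\<close> elements.\<close>

definition reduced_basis_set :: "'q::field itself \<Rightarrow> nat \<Rightarrow> nat \<Rightarrow> (nat \<Rightarrow> nat) set \<Rightarrow> bool" where
  "reduced_basis_set _ n k B \<longleftrightarrow>
     (let S = restrict_scalars (\<lambda>c::'q. [:c:]) (S_bar n k);
          N = nabla_bar n k ` carrier (S_bar n k)
      in B \<subseteq> sym_index n k \<and>
         free_with_basis ring_of_type_algebra (quot_module S N) B
           (\<lambda>i. N +>\<^bsub>S\<^esub> sym_monom ring_of_type_algebra (M_bar n) n e_bar k i))"

end

theory Submission
  imports Defs "HOL-Library.Poly_Mapping"
begin

text \<open>Idea.  With \<open>X\<^sub>0 = \<gamma> t / (x\<^sub>1 \<cdots> x\<^sub>n)\<close> and \<open>X\<^sub>l = \<gamma> x\<^sub>l\<close> the module \<open>\<C>\<close> is a Tate algebra in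
  \<open>X\<^sub>0,\<dots>,X\<^sub>n\<close> on which the operators \<open>\<delta>\<^sub>l = X\<^sub>l d/dX\<^sub>l + X\<^sub>l + \<cdots>\<close> commute, and \<open>\<delta>\<^sub>l - \<delta>\<^sub>0\<close> and
  \<open>\<delta>\<^sub>0\<close> are \<open>D\<^bsub>t,l\<^esub>\<close> and \<open>\<partial>\<close>.  Writing power series as null families of coefficients, every map in sight is
  a matrix graded by the degree: its entries of positive degree \<open>d\<close> are divisible by \<open>p\<^sup>d\<close>, and its
  part of degree zero is an integer matrix modulo \<open>p\<close>.  If that integer matrix is invertible
  modulo \<open>p\<close>, then the map is bijective and its inverse respects the filtration by the degree.
  Applied to \<open>\<C>\<close> this gives the basis \<open>e\<^sub>0,\<dots>,e\<^sub>n\<close> of \<open>H\<^sup>n\<close> and \<open>\<partial> e\<^sub>j\<close> modulo \<open>p\<close>.  Applied to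
  \<open>(\<eta>, c) \<mapsto> \<partial> \<eta> + \<Sum>\<^sub>i c\<^sub>i e\<^sup>i\<close> on \<open>\<S>\<^sub>k \<oplus> \<O>\<^sub>q\<^bsup>B\<^esup>\<close> it gives the theorem, the invertibility modulo \<open>p\<close> being the
  defining property of \<open>B\<^sub>k\<close>: the homogeneous pieces of the source and the target have
  equal dimension in large degrees, where \<open>\<nabla>\<close> is therefore injective, and multiplication by
  powers of \<open>t\<close> transports this to small degrees.\<close>

text \<open>The divisibility by p^d rests on \<gamma> being a zero of the series: \<gamma>_j is
  minus the tail, so p^j \<gamma>_j / \<gamma>^(p^j), the coefficient of X_l^(p^j) in \<delta>_l,
  has order at least p^j - 1. One application of \<delta>_l thus costs a single unit of degree, and
  X^v |-> \<delta>^v 1 is the identity modulo p up to terms of lower degree. Its inverse turns each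
  \<delta>_l into multiplication by X_l; modulo all X_l - X_0 there remain series in one variable,
  one dimension in each degree, and the degree modulo n + 1 sorts these into e_0, ..., e_n. B_k is
  given over F_q, while O_q may be ramified and its residue field is not presented as F_q. Integers
  bridge the two: \<nabla> has an integer matrix, so its inverse over F_q has entries in F_p, and
  integer lifts of these act on O_q modulo p. The basis property yields surjectivity in each degree,
  but its uniqueness concerns only the coefficients at B_k; this is why injectivity of \<nabla> has
  to come from counting.\<close>

section \<open>Quotient modules and free modules with a finite basis\<close>

locale quot_mod = module R M for R (structure) and M (structure) +
  fixes N
  assumes sub: "submodule N R M"

sublocale quot_mod \<subseteq> N?: abelian_subgroup N M
proof -
  have "additive_subgroup N M"
    using sub by (simp add: additive_subgroup_def submodule_def)
  then show "abelian_subgroup N M"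
    by (rule abelian_subgroupI3[OF _ M.abelian_group_axioms])
qed

context quot_mod
begin

abbreviation Q where "Q \<equiv> quot_module M N"

lemma quot_carrier: "carrier Q = (\<lambda>x. N +>\<^bsub>M\<^esub> x) ` carrier M"
  by (auto simp: quot_module_def A_RCOSETS_def')

lemma quot_eq_iff:
  assumes "x \<in> carrier M" "y \<in> carrier M"
  shows "N +>\<^bsub>M\<^esub> x = N +>\<^bsub>M\<^esub> y \<longleftrightarrow> x \<ominus>\<^bsub>M\<^esub> y \<in> N"
proof -
  have "N +>\<^bsub>M\<^esub> x = N +>\<^bsub>M\<^esub> y \<longleftrightarrow> x \<in> N +>\<^bsub>M\<^esub> y"
  proof
    assume "N +>\<^bsub>M\<^esub> x = N +>\<^bsub>M\<^esub> y"
    then show "x \<in> N +>\<^bsub>M\<^esub> y"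
      using N.a_rcos_self[OF assms(1)] by simp
  next
    assume "x \<in> N +>\<^bsub>M\<^esub> y"
    then show "N +>\<^bsub>M\<^esub> x = N +>\<^bsub>M\<^esub> y"
      using N.a_repr_independence'[OF _ assms(2)] by simp
  qed
  also have "\<dots> \<longleftrightarrow> x \<ominus>\<^bsub>M\<^esub> y \<in> N"
    using N.a_rcos_module[OF assms(2,1)] by (simp add: a_minus_def)
  finally show ?thesis .
qed

lemma quot_add:
  assumes "x \<in> carrier M" "y \<in> carrier M"
  shows "(N +>\<^bsub>M\<^esub> x) \<oplus>\<^bsub>Q\<^esub> (N +>\<^bsub>M\<^esub> y) = N +>\<^bsub>M\<^esub> (x \<oplus>\<^bsub>M\<^esub> y)"
  using a_rcos_sum[OF assms] by (simp add: quot_module_def)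

lemma coset_mem_iff:
  assumes "x \<in> carrier M"
  shows "y \<in> N +>\<^bsub>M\<^esub> x \<longleftrightarrow> y \<in> carrier M \<and> y \<ominus>\<^bsub>M\<^esub> x \<in> N"
  using N.a_rcos_module[OF assms] N.a_elemrcos_carrier[OF assms] by (auto simp: a_minus_def)

lemma smult_minus_distr:
  assumes "c \<in> carrier R" "x \<in> carrier M" "y \<in> carrier M"
  shows "c \<odot>\<^bsub>M\<^esub> x \<ominus>\<^bsub>M\<^esub> c \<odot>\<^bsub>M\<^esub> y = c \<odot>\<^bsub>M\<^esub> (x \<ominus>\<^bsub>M\<^esub> y)"
  using assms by (simp add: a_minus_def smult_r_distr smult_r_minus)

text \<open>Both the scalar action on a quotient and a map induced on cosets are defined as unions
  over representatives. Such a union is a single coset as soon as the map respects differences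
  modulo \<open>N\<close>, since all its members then coincide. The two uses are the scalar action
  and the connection on H^n.\<close>

lemma induced_eq:
  assumes f: "\<And>y. y \<in> carrier M \<Longrightarrow> f y \<in> carrier M"
    and d: "\<And>y z. y \<in> carrier M \<Longrightarrow> z \<in> carrier M \<Longrightarrow> y \<ominus>\<^bsub>M\<^esub> z \<in> N \<Longrightarrow> f y \<ominus>\<^bsub>M\<^esub> f z \<in> N"
    and x: "x \<in> carrier M"
  shows "(\<Union>y\<in>N +>\<^bsub>M\<^esub> x. N +>\<^bsub>M\<^esub> f y) = N +>\<^bsub>M\<^esub> f x"
proof -
  have "N +>\<^bsub>M\<^esub> f y = N +>\<^bsub>M\<^esub> f x" if "y \<in> N +>\<^bsub>M\<^esub> x" for y
  proof -
    have y: "y \<in> carrier M" "y \<ominus>\<^bsub>M\<^esub> x \<in> N"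
      using that coset_mem_iff[OF x] by auto
    then show ?thesis
      using d[OF y(1) x y(2)] quot_eq_iff[OF f[OF y(1)] f[OF x]] by simp
  qed
  moreover have "N +>\<^bsub>M\<^esub> x \<noteq> {}" using N.a_rcos_self[OF x] by auto
  ultimately show ?thesis by (intro SUP_eq_const)
qed

lemma quot_smult:
  assumes "c \<in> carrier R" "x \<in> carrier M"
  shows "c \<odot>\<^bsub>Q\<^esub> (N +>\<^bsub>M\<^esub> x) = N +>\<^bsub>M\<^esub> (c \<odot>\<^bsub>M\<^esub> x)"
proof -
  have "(\<Union>y\<in>N +>\<^bsub>M\<^esub> x. N +>\<^bsub>M\<^esub> (c \<odot>\<^bsub>M\<^esub> y)) = N +>\<^bsub>M\<^esub> (c \<odot>\<^bsub>M\<^esub> x)"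
    by (rule induced_eq) (use assms smult_minus_distr submoduleE(4)[OF sub] in auto)
  then show ?thesis by (simp add: quot_module_def)
qed

lemma quot_zero: "\<zero>\<^bsub>Q\<^esub> = N +>\<^bsub>M\<^esub> \<zero>\<^bsub>M\<^esub>"
  using a_coset_add_zero N.a_subset by (simp add: quot_module_def)

lemma quot_is_module: "module R Q"
proof (rule moduleI)
  show "cring R" by (rule R.is_cring)
  show "abelian_group Q"
  proof (rule abelian_groupI)
    fix x assume "x \<in> carrier Q"
    then obtain y where y: "y \<in> carrier M" "x = N +>\<^bsub>M\<^esub> y" by (auto simp: quot_carrier)
    have "(N +>\<^bsub>M\<^esub> (\<ominus>\<^bsub>M\<^esub> y)) \<oplus>\<^bsub>Q\<^esub> x = \<zero>\<^bsub>Q\<^esub>"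
      using y by (simp add: quot_add quot_zero M.l_neg)
    then show "\<exists>y\<in>carrier Q. y \<oplus>\<^bsub>Q\<^esub> x = \<zero>\<^bsub>Q\<^esub>"
      using y by (auto simp: quot_carrier)
  qed (auto simp: quot_carrier quot_add quot_zero M.a_ac)
qed (auto simp: quot_carrier quot_add quot_smult smult_l_distr smult_r_distr smult_assoc1)

lemma quot_finsum:
  assumes "finite B" "\<And>i. i \<in> B \<Longrightarrow> f i \<in> carrier M"
  shows "(\<Oplus>\<^bsub>Q\<^esub>i\<in>B. N +>\<^bsub>M\<^esub> f i) = N +>\<^bsub>M\<^esub> (\<Oplus>\<^bsub>M\<^esub>i\<in>B. f i)"
proof -
  interpret QQ: module R Q by (rule quot_is_module)
  show ?thesis
    using assms
  proof (induction B rule: finite_induct)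
    case (insert x F)
    have "(\<Oplus>\<^bsub>Q\<^esub>i\<in>insert x F. N +>\<^bsub>M\<^esub> f i) = (N +>\<^bsub>M\<^esub> f x) \<oplus>\<^bsub>Q\<^esub> (\<Oplus>\<^bsub>Q\<^esub>i\<in>F. N +>\<^bsub>M\<^esub> f i)"
      using insert by (intro QQ.finsum_insert) (auto simp: quot_carrier)
    also have "\<dots> = N +>\<^bsub>M\<^esub> (f x \<oplus>\<^bsub>M\<^esub> (\<Oplus>\<^bsub>M\<^esub>i\<in>F. f i))"
      using insert by (simp add: quot_add)
    also have "f x \<oplus>\<^bsub>M\<^esub> (\<Oplus>\<^bsub>M\<^esub>i\<in>F. f i) = (\<Oplus>\<^bsub>M\<^esub>i\<in>insert x F. f i)"
      using insert by (intro M.finsum_insert[symmetric]) auto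
    finally show ?case .
  qed (simp add: quot_zero)
qed

lemma quot_lincomb:
  assumes "finite B" "\<And>i. i \<in> B \<Longrightarrow> e i \<in> carrier M" "\<And>i. i \<in> B \<Longrightarrow> c i \<in> carrier R"
  shows "(\<Oplus>\<^bsub>Q\<^esub>i\<in>B. c i \<odot>\<^bsub>Q\<^esub> (N +>\<^bsub>M\<^esub> e i)) = N +>\<^bsub>M\<^esub> (\<Oplus>\<^bsub>M\<^esub>i\<in>B. c i \<odot>\<^bsub>M\<^esub> e i)"
proof -
  interpret QQ: module R Q by (rule quot_is_module)
  have "(\<Oplus>\<^bsub>Q\<^esub>i\<in>B. c i \<odot>\<^bsub>Q\<^esub> (N +>\<^bsub>M\<^esub> e i)) = (\<Oplus>\<^bsub>Q\<^esub>i\<in>B. N +>\<^bsub>M\<^esub> (c i \<odot>\<^bsub>M\<^esub> e i))"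
    using assms by (intro QQ.finsum_cong') (auto simp: quot_smult quot_carrier)
  then show ?thesis using assms by (simp add: quot_finsum)
qed

text \<open>A basis of the quotient becomes unique solvability modulo \<open>N\<close> in
  \<open>M\<close>, without cosets. The rule serves in both directions: to extract the defining
  property of B_k, and to establish the bases of H^n and H^1.\<close>

lemma quot_free_iff:
  assumes "finite B" "\<And>i. i \<in> B \<Longrightarrow> e i \<in> carrier M"
  shows "free_with_basis R Q B (\<lambda>i. N +>\<^bsub>M\<^esub> e i) \<longleftrightarrow>
    (\<forall>x\<in>carrier M. \<exists>!c. c \<in> B \<rightarrow>\<^sub>E carrier R \<and> x \<ominus>\<^bsub>M\<^esub> (\<Oplus>\<^bsub>M\<^esub>i\<in>B. c i \<odot>\<^bsub>M\<^esub> e i) \<in> N)"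
proof -
  have eq: "(c \<in> B \<rightarrow>\<^sub>E carrier R \<and> N +>\<^bsub>M\<^esub> x = (\<Oplus>\<^bsub>Q\<^esub>i\<in>B. c i \<odot>\<^bsub>Q\<^esub> (N +>\<^bsub>M\<^esub> e i))) \<longleftrightarrow>
      (c \<in> B \<rightarrow>\<^sub>E carrier R \<and> x \<ominus>\<^bsub>M\<^esub> (\<Oplus>\<^bsub>M\<^esub>i\<in>B. c i \<odot>\<^bsub>M\<^esub> e i) \<in> N)"
    if "x \<in> carrier M" for x c
  proof (cases "c \<in> B \<rightarrow>\<^sub>E carrier R")
    case True
    then have c: "\<And>i. i \<in> B \<Longrightarrow> c i \<in> carrier R" by auto
    have "(\<Oplus>\<^bsub>M\<^esub>i\<in>B. c i \<odot>\<^bsub>M\<^esub> e i) \<in> carrier M"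
      using assms c by (intro M.finsum_closed) auto
    then show ?thesis using True that c assms by (simp add: quot_lincomb quot_eq_iff)
  qed simp
  show ?thesis
    unfolding free_with_basis_def
    using assms eq quot_is_module by (auto simp: quot_carrier Pi_def)
qed

end

definition coords ::
  "('r, 'y) ring_scheme \<Rightarrow> ('r, 'm, 'x) module_scheme \<Rightarrow> 'i set \<Rightarrow> ('i \<Rightarrow> 'm) \<Rightarrow> 'm \<Rightarrow> 'i \<Rightarrow> 'r" where
  "coords R M B e x = (THE c. c \<in> B \<rightarrow>\<^sub>E carrier R \<and> x = (\<Oplus>\<^bsub>M\<^esub>i\<in>B. c i \<odot>\<^bsub>M\<^esub> e i))"

locale free_mod = module R M for R (structure) and M (structure) +
  fixes B e
  assumes free: "free_with_basis R M B e"
begin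

lemma finite_basis [simp, intro]: "finite B"
  using free by (simp add: free_with_basis_def)

lemma basis_closed [simp, intro]: "i \<in> B \<Longrightarrow> e i \<in> carrier M"
  using free by (auto simp: free_with_basis_def)

abbreviation co where "co \<equiv> coords R M B e"

lemma coords_props:
  assumes "x \<in> carrier M"
  shows "co x \<in> B \<rightarrow>\<^sub>E carrier R \<and> x = (\<Oplus>\<^bsub>M\<^esub>i\<in>B. co x i \<odot>\<^bsub>M\<^esub> e i)"
proof -
  have "\<exists>!c. c \<in> B \<rightarrow>\<^sub>E carrier R \<and> x = (\<Oplus>\<^bsub>M\<^esub>i\<in>B. c i \<odot>\<^bsub>M\<^esub> e i)"
    using free assms by (simp add: free_with_basis_def)
  from theI'[OF this] show ?thesis by (simp add: coords_def)
qed

lemma coords_closed [simp, intro]: "x \<in> carrier M \<Longrightarrow> i \<in> B \<Longrightarrow> co x i \<in> carrier R"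
  using coords_props by blast

lemma coords_sum: "x \<in> carrier M \<Longrightarrow> (\<Oplus>\<^bsub>M\<^esub>i\<in>B. co x i \<odot>\<^bsub>M\<^esub> e i) = x"
  using coords_props by simp

lemma lincomb_closed [simp, intro]:
  "(\<And>i. i \<in> B \<Longrightarrow> c i \<in> carrier R) \<Longrightarrow> (\<Oplus>\<^bsub>M\<^esub>i\<in>B. c i \<odot>\<^bsub>M\<^esub> e i) \<in> carrier M"
  by (intro M.finsum_closed) auto

lemma coords_unique:
  assumes "x \<in> carrier M" "c \<in> B \<rightarrow>\<^sub>E carrier R" "x = (\<Oplus>\<^bsub>M\<^esub>i\<in>B. c i \<odot>\<^bsub>M\<^esub> e i)"
  shows "co x = c"
  using free assms coords_props[OF assms(1)] unfolding free_with_basis_def by blast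

lemma coords_lincomb:
  assumes c: "\<And>i. i \<in> B \<Longrightarrow> c i \<in> carrier R" and i: "i \<in> B"
  shows "co (\<Oplus>\<^bsub>M\<^esub>i\<in>B. c i \<odot>\<^bsub>M\<^esub> e i) i = c i"
proof -
  have "co (\<Oplus>\<^bsub>M\<^esub>i\<in>B. c i \<odot>\<^bsub>M\<^esub> e i) = restrict c B"
  proof (rule coords_unique)
    show "(\<Oplus>\<^bsub>M\<^esub>i\<in>B. c i \<odot>\<^bsub>M\<^esub> e i) = (\<Oplus>\<^bsub>M\<^esub>i\<in>B. restrict c B i \<odot>\<^bsub>M\<^esub> e i)"
      using c by (intro M.finsum_cong') auto
  qed (use c in auto)
  then show ?thesis using i by simp
qed

lemma coords_inj:
  assumes "x \<in> carrier M" "y \<in> carrier M" "\<And>i. i \<in> B \<Longrightarrow> co x i = co y i"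
  shows "x = y"
proof -
  have "x = (\<Oplus>\<^bsub>M\<^esub>i\<in>B. co x i \<odot>\<^bsub>M\<^esub> e i)" using coords_sum assms by simp
  also have "\<dots> = (\<Oplus>\<^bsub>M\<^esub>i\<in>B. co y i \<odot>\<^bsub>M\<^esub> e i)"
    using assms by (intro M.finsum_cong') auto
  also have "\<dots> = y" using coords_sum assms by simp
  finally show ?thesis .
qed

lemma coords_add:
  assumes "x \<in> carrier M" "y \<in> carrier M" and i: "i \<in> B"
  shows "co (x \<oplus>\<^bsub>M\<^esub> y) i = co x i \<oplus> co y i"
proof -
  have "x \<oplus>\<^bsub>M\<^esub> y = (\<Oplus>\<^bsub>M\<^esub>i\<in>B. co x i \<odot>\<^bsub>M\<^esub> e i) \<oplus>\<^bsub>M\<^esub> (\<Oplus>\<^bsub>M\<^esub>i\<in>B. co y i \<odot>\<^bsub>M\<^esub> e i)"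
    using assms by (simp add: coords_sum)
  also have "\<dots> = (\<Oplus>\<^bsub>M\<^esub>i\<in>B. co x i \<odot>\<^bsub>M\<^esub> e i \<oplus>\<^bsub>M\<^esub> co y i \<odot>\<^bsub>M\<^esub> e i)"
    using assms by (intro M.finsum_addf[symmetric]) auto
  also have "\<dots> = (\<Oplus>\<^bsub>M\<^esub>i\<in>B. (co x i \<oplus> co y i) \<odot>\<^bsub>M\<^esub> e i)"
    using assms by (intro M.finsum_cong') (auto simp: smult_l_distr)
  finally show ?thesis
    using assms coords_lincomb[of "\<lambda>i. co x i \<oplus> co y i" i] by simp
qed

lemma coords_smult:
  assumes "c \<in> carrier R" "x \<in> carrier M" and i: "i \<in> B"
  shows "co (c \<odot>\<^bsub>M\<^esub> x) i = c \<otimes> co x i"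
proof -
  have "c \<odot>\<^bsub>M\<^esub> x = c \<odot>\<^bsub>M\<^esub> (\<Oplus>\<^bsub>M\<^esub>i\<in>B. co x i \<odot>\<^bsub>M\<^esub> e i)"
    using assms by (simp add: coords_sum)
  also have "\<dots> = (\<Oplus>\<^bsub>M\<^esub>i\<in>B. c \<odot>\<^bsub>M\<^esub> (co x i \<odot>\<^bsub>M\<^esub> e i))"
    using assms by (intro finsum_smult_ldistr) auto
  also have "\<dots> = (\<Oplus>\<^bsub>M\<^esub>i\<in>B. (c \<otimes> co x i) \<odot>\<^bsub>M\<^esub> e i)"
    using assms by (intro M.finsum_cong') (auto simp: smult_assoc1)
  finally show ?thesis
    using assms coords_lincomb[of "\<lambda>i. c \<otimes> co x i" i] by simp
qed

lemma coords_zero: "i \<in> B \<Longrightarrow> co \<zero>\<^bsub>M\<^esub> i = \<zero>"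
  using coords_smult[of \<zero> "\<zero>\<^bsub>M\<^esub>" i] by simp

lemma coords_finsum:
  assumes "finite A" "\<And>a. a \<in> A \<Longrightarrow> f a \<in> carrier M" and i: "i \<in> B"
  shows "co (\<Oplus>\<^bsub>M\<^esub>a\<in>A. f a) i = (\<Oplus>a\<in>A. co (f a) i)"
  using assms
proof (induction A rule: finite_induct)
  case (insert a A)
  then show ?case by (simp add: coords_add Pi_def)
qed (simp add: coords_zero)

lemma coords_basis:
  assumes "j \<in> B" "i \<in> B"
  shows "co (e j) i = (if i = j then \<one> else \<zero>)"
proof -
  have "(\<Oplus>\<^bsub>M\<^esub>i\<in>B. (if i = j then \<one> else \<zero>) \<odot>\<^bsub>M\<^esub> e i) = (\<Oplus>\<^bsub>M\<^esub>i\<in>B. if j = i then e i else \<zero>\<^bsub>M\<^esub>)"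
    using assms by (intro M.finsum_cong') auto
  also have "\<dots> = e j" using assms by (intro M.finsum_singleton) auto
  finally show ?thesis using coords_lincomb[of "\<lambda>i. if i = j then \<one> else \<zero>" i] assms by auto
qed

end

lemma free_modI: "free_with_basis R M B e \<Longrightarrow> free_mod R M B e"
  by (simp add: free_mod_def free_mod_axioms_def free_with_basis_def)

text \<open>Restriction of scalars changes the type of the module record but not its additive
  structure; this rule carries finite sums across.\<close>

lemma finsum_record_cong:
  assumes "carrier M = carrier M'" "add M = add M'" "zero M = zero M'"
  shows "finsum M f A = finsum M' f A"
  using assms by (simp add: finsum_def finprod_def)

section \<open>Symmetric powers of free modules\<close>

lemma module_span_incl: "Y \<subseteq> module_span R M Y"
  by (auto simp: module_span_def)

lemma module_span_min: "submodule H R M \<Longrightarrow> Y \<subseteq> H \<Longrightarrow> module_span R M Y \<subseteq> H"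
  by (auto simp: module_span_def)

context module
begin

lemma submodule_carrier: "submodule (carrier M) R M"
  by (rule submoduleI) auto

lemma module_span_submodule:
  assumes "Y \<subseteq> carrier M"
  shows "submodule (module_span R M Y) R M"
proof (rule submoduleI)
  show "module_span R M Y \<subseteq> carrier M"
    by (rule module_span_min[OF submodule_carrier assms])
next
  show "\<zero>\<^bsub>M\<^esub> \<in> module_span R M Y"
    unfolding module_span_def
    by (auto simp: submodule_def dest!: subgroup.one_closed)
next
  fix a assume "a \<in> module_span R M Y"
  then show "\<ominus>\<^bsub>M\<^esub> a \<in> module_span R M Y"
    unfolding module_span_def using submoduleE(3) by auto
next
  fix a b assume "a \<in> module_span R M Y" "b \<in> module_span R M Y"
  then show "a \<oplus>\<^bsub>M\<^esub> b \<in> module_span R M Y"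
    unfolding module_span_def using submoduleE(5) by auto
next
  fix a x assume "a \<in> carrier R" "x \<in> module_span R M Y"
  then show "a \<odot>\<^bsub>M\<^esub> x \<in> module_span R M Y"
    unfolding module_span_def using submoduleE(4) by auto
qed

definition lincombs where
  "lincombs B e = {x. \<exists>c. (\<forall>i\<in>B. c i \<in> carrier R) \<and> x = (\<Oplus>\<^bsub>M\<^esub>i\<in>B. c i \<odot>\<^bsub>M\<^esub> e i)}"

lemma lincombs_add:
  assumes B: "finite B" "\<And>i. i \<in> B \<Longrightarrow> e i \<in> carrier M"
    and "x \<in> lincombs B e" "y \<in> lincombs B e"
  shows "x \<oplus>\<^bsub>M\<^esub> y \<in> lincombs B e"
proof -
  obtain c d where c: "\<forall>i\<in>B. c i \<in> carrier R" "x = (\<Oplus>\<^bsub>M\<^esub>i\<in>B. c i \<odot>\<^bsub>M\<^esub> e i)"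
    and d: "\<forall>i\<in>B. d i \<in> carrier R" "y = (\<Oplus>\<^bsub>M\<^esub>i\<in>B. d i \<odot>\<^bsub>M\<^esub> e i)"
    using assms(3,4) by (auto simp: lincombs_def)
  have "x \<oplus>\<^bsub>M\<^esub> y = (\<Oplus>\<^bsub>M\<^esub>i\<in>B. c i \<odot>\<^bsub>M\<^esub> e i \<oplus>\<^bsub>M\<^esub> d i \<odot>\<^bsub>M\<^esub> e i)"
    unfolding c d using B c d by (intro M.finsum_addf[symmetric]) auto
  also have "\<dots> = (\<Oplus>\<^bsub>M\<^esub>i\<in>B. (c i \<oplus> d i) \<odot>\<^bsub>M\<^esub> e i)"
    using B c d by (intro M.finsum_cong') (auto simp: smult_l_distr)
  finally show ?thesis using c d by (auto simp: lincombs_def intro!: exI[of _ "\<lambda>i. c i \<oplus> d i"])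
qed

lemma lincombs_smult:
  assumes B: "finite B" "\<And>i. i \<in> B \<Longrightarrow> e i \<in> carrier M"
    and "x \<in> lincombs B e" "a \<in> carrier R"
  shows "a \<odot>\<^bsub>M\<^esub> x \<in> lincombs B e"
proof -
  obtain c where c: "\<forall>i\<in>B. c i \<in> carrier R" "x = (\<Oplus>\<^bsub>M\<^esub>i\<in>B. c i \<odot>\<^bsub>M\<^esub> e i)"
    using assms(3) by (auto simp: lincombs_def)
  have "a \<odot>\<^bsub>M\<^esub> x = (\<Oplus>\<^bsub>M\<^esub>i\<in>B. a \<odot>\<^bsub>M\<^esub> (c i \<odot>\<^bsub>M\<^esub> e i))"
    unfolding c using B c assms(4) by (intro finsum_smult_ldistr) auto
  also have "\<dots> = (\<Oplus>\<^bsub>M\<^esub>i\<in>B. (a \<otimes> c i) \<odot>\<^bsub>M\<^esub> e i)"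
    using B c assms(4) by (intro M.finsum_cong') (auto simp: smult_assoc1)
  finally show ?thesis
    using c assms(4) by (auto simp: lincombs_def intro!: exI[of _ "\<lambda>i. a \<otimes> c i"])
qed

lemma lincombs_basis:
  assumes B: "finite B" "\<And>i. i \<in> B \<Longrightarrow> e i \<in> carrier M" and j: "j \<in> B"
  shows "e j \<in> lincombs B e"
proof -
  have "(\<Oplus>\<^bsub>M\<^esub>i\<in>B. (if i = j then \<one> else \<zero>) \<odot>\<^bsub>M\<^esub> e i) = (\<Oplus>\<^bsub>M\<^esub>i\<in>B. if j = i then e i else \<zero>\<^bsub>M\<^esub>)"
    using assms by (intro M.finsum_cong') auto
  also have "\<dots> = e j" using assms by (intro M.finsum_singleton) auto
  finally show ?thesis
    by (auto simp: lincombs_def intro!: exI[of _ "\<lambda>i. if i = j then \<one> else \<zero>"])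
qed

lemma lincombs_finsum:
  assumes B: "finite B" "\<And>i. i \<in> B \<Longrightarrow> e i \<in> carrier M"
    and A: "finite A" "\<And>a. a \<in> A \<Longrightarrow> f a \<in> lincombs B e"
  shows "(\<Oplus>\<^bsub>M\<^esub>a\<in>A. f a) \<in> lincombs B e"
proof -
  have car: "lincombs B e \<subseteq> carrier M"
    using B by (auto simp: lincombs_def intro!: M.finsum_closed)
  have "(\<Oplus>\<^bsub>M\<^esub>i\<in>B. \<zero> \<odot>\<^bsub>M\<^esub> e i) = (\<Oplus>\<^bsub>M\<^esub>i\<in>B. \<zero>\<^bsub>M\<^esub>)"
    using B by (intro M.finsum_cong') auto
  then have z: "\<zero>\<^bsub>M\<^esub> \<in> lincombs B e"
    by (auto simp: lincombs_def intro!: exI[of _ "\<lambda>i. \<zero>"])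
  show ?thesis
    using A
  proof (induction A rule: finite_induct)
    case (insert a A)
    have "(\<Oplus>\<^bsub>M\<^esub>a\<in>insert a A. f a) = f a \<oplus>\<^bsub>M\<^esub> (\<Oplus>\<^bsub>M\<^esub>a\<in>A. f a)"
      using insert car by (intro M.finsum_insert) auto
    then show ?case using insert lincombs_add[OF B] by simp
  qed (simp add: z)
qed

end

text \<open>Rings are taken as subsets of a type with ring operations, so that computations stay
  within ordinary arithmetic on the type. The instances are the complete field, O_q, the power
  series ring O, F_q and F_q[t].\<close>

locale type_subring =
  fixes S :: "'r::comm_ring_1 set"
  assumes one_S: "1 \<in> S" and diff_S: "x \<in> S \<Longrightarrow> y \<in> S \<Longrightarrow> x - y \<in> S"
    and mult_S: "x \<in> S \<Longrightarrow> y \<in> S \<Longrightarrow> x * y \<in> S"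
begin

abbreviation "RS \<equiv> (ring_of_type_algebra :: 'r ring)\<lparr>carrier := S\<rparr>"

lemma zero_S: "0 \<in> S" using diff_S[OF one_S one_S] by simp
lemma uminus_S: "x \<in> S \<Longrightarrow> - x \<in> S" using diff_S[OF zero_S] by simp
lemma add_S: "x \<in> S \<Longrightarrow> y \<in> S \<Longrightarrow> x + y \<in> S" using diff_S[OF _ uminus_S] by fastforce
lemma sum_S: "(\<And>i. i \<in> A \<Longrightarrow> f i \<in> S) \<Longrightarrow> sum f A \<in> S"
  by (induction A rule: infinite_finite_induct) (auto simp: zero_S add_S)
lemma of_nat_S: "of_nat m \<in> S"
  by (induction m) (auto simp: zero_S one_S add_S)

lemmas S_closed = one_S zero_S uminus_S add_S diff_S mult_S sum_S of_nat_S

lemma RS_simps [simp]: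
  "carrier RS = S" "add RS = (+)" "monoid.mult RS = (*)" "zero RS = 0" "one RS = 1"
  by (auto simp: ring_of_type_algebra_def)

lemma cring_RS: "cring RS"
proof (rule cringI)
  show "abelian_group RS"
    by (rule abelian_groupI) (use S_closed in \<open>auto simp: add_ac intro!: bexI[of _ "- _"]\<close>)
  show "comm_monoid RS"
    by (rule comm_monoidI) (use S_closed in \<open>auto simp: mult_ac\<close>)
qed (auto simp: algebra_simps)

end

sublocale type_subring \<subseteq> RS: cring RS by (rule cring_RS)

context type_subring
begin

lemma a_inv_RS: "x \<in> S \<Longrightarrow> \<ominus>\<^bsub>RS\<^esub> x = - x"
  using RS.minus_equality[of "- x" x] uminus_S by simp

lemma finsum_RS: "(\<And>i. i \<in> A \<Longrightarrow> f i \<in> S) \<Longrightarrow> finsum RS f A = sum f A"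
proof (induction A rule: infinite_finite_induct)
  case (insert x F)
  then have "finsum RS f (insert x F) = f x \<oplus>\<^bsub>RS\<^esub> finsum RS f F"
    by (intro RS.finsum_insert) auto
  then show ?case using insert by simp
qed (auto simp: RS.finsum_infinite)

lemma add_pow_RS: "x \<in> S \<Longrightarrow> add_pow RS (m::nat) x = of_nat m * x"
  by (induction m) (auto simp: RS.add.nat_pow_Suc algebra_simps)

lemma free_module_simps [simp]:
  "add (free_module RS Y) = (\<lambda>f g x. f x + g x)"
  "zero (free_module RS Y) = (\<lambda>x. 0)"
  "module.smult (free_module RS Y) = (\<lambda>c f x. c * f x)"
  by (auto simp: free_module_def)

lemma carrier_free_module:
  "carrier (free_module RS Y) = {f. (\<forall>x. f x \<in> S) \<and> (\<forall>x. x \<notin> Y \<longrightarrow> f x = 0) \<and> finite {x. f x \<noteq> 0}}"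
  by (auto simp: free_module_def)

lemma module_free_module: "module RS (free_module RS Y)"
proof (rule moduleI)
  show "abelian_group (free_module RS Y)"
  proof (rule abelian_groupI)
    fix f assume f: "f \<in> carrier (free_module RS Y)"
    then have "(\<lambda>x. - f x) \<in> carrier (free_module RS Y)"
      by (auto simp: carrier_free_module uminus_S)
    then show "\<exists>g\<in>carrier (free_module RS Y). g \<oplus>\<^bsub>free_module RS Y\<^esub> f = \<zero>\<^bsub>free_module RS Y\<^esub>"
      by (rule rev_bexI) auto
  next
    fix f g assume "f \<in> carrier (free_module RS Y)" "g \<in> carrier (free_module RS Y)"
    moreover have "{x. f x + g x \<noteq> 0} \<subseteq> {x. f x \<noteq> 0} \<union> {x. g x \<noteq> 0}" by auto
    ultimately show "f \<oplus>\<^bsub>free_module RS Y\<^esub> g \<in> carrier (free_module RS Y)"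
      by (auto simp: carrier_free_module add_S intro: finite_subset)
  qed (auto simp: carrier_free_module add_ac zero_S)
next
  fix c f assume "c \<in> carrier RS" "f \<in> carrier (free_module RS Y)"
  moreover have "{x. c * f x \<noteq> 0} \<subseteq> {x. f x \<noteq> 0}" by auto
  ultimately show "c \<odot>\<^bsub>free_module RS Y\<^esub> f \<in> carrier (free_module RS Y)"
    by (auto simp: carrier_free_module mult_S intro: finite_subset)
qed (auto simp: cring_RS algebra_simps)

lemma unit_vec_RS: "unit_vec RS x = (\<lambda>y. if y = x then 1 else 0)"
  by (auto simp: unit_vec_def)

lemma unit_vec_closed: "x \<in> Y \<Longrightarrow> unit_vec RS x \<in> carrier (free_module RS Y)"
  by (auto simp: carrier_free_module unit_vec_RS one_S zero_S)

lemma free_module_minus: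
  assumes "f \<in> carrier (free_module RS Y)" "g \<in> carrier (free_module RS Y)"
  shows "f \<ominus>\<^bsub>free_module RS Y\<^esub> g = (\<lambda>x. f x - g x)"
proof -
  interpret F: module RS "free_module RS Y" by (rule module_free_module)
  have "(\<lambda>x. - g x) \<in> carrier (free_module RS Y)"
    using assms by (auto simp: carrier_free_module uminus_S)
  then have "\<ominus>\<^bsub>free_module RS Y\<^esub> g = (\<lambda>x. - g x)"
    using assms by (intro F.M.minus_equality) auto
  then show ?thesis by (simp add: a_minus_def)
qed

lemma free_module_finsum:
  assumes "finite A" "\<And>a. a \<in> A \<Longrightarrow> f a \<in> carrier (free_module RS Y)"
  shows "finsum (free_module RS Y) f A = (\<lambda>x. \<Sum>a\<in>A. f a x)"
proof -
  interpret F: module RS "free_module RS Y" by (rule module_free_module)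
  show ?thesis using assms
  proof (induction A rule: finite_induct)
    case (insert a A)
    then have "finsum (free_module RS Y) f (insert a A) =
        f a \<oplus>\<^bsub>free_module RS Y\<^esub> finsum (free_module RS Y) f A"
      by (intro F.M.finsum_insert) auto
    then show ?case using insert by simp
  qed simp
qed

end

lemma finite_sym_index: "finite (sym_index n k)"
proof (rule finite_subset)
  show "sym_index n k \<subseteq> {i. \<forall>j. (j \<in> {..n} \<longrightarrow> i j \<in> {..k}) \<and> (j \<notin> {..n} \<longrightarrow> i j = 0)}"
    by (auto simp: sym_index_def intro: member_le_sum)
  show "finite {i. \<forall>j. (j \<in> {..n} \<longrightarrow> i j \<in> {..k}) \<and> (j \<notin> {..n} \<longrightarrow> i j = (0::nat))}"
    by (rule finite_set_of_finite_funs) auto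
qed

text \<open>The exponent vector of e^i e_l / e_j. The second update reads the vector already lowered
  at \<open>j\<close>, so that \<open>l = j\<close> returns \<open>i\<close> when
  \<open>i j > 0\<close>.\<close>

definition move_index :: "(nat \<Rightarrow> nat) \<Rightarrow> nat \<Rightarrow> nat \<Rightarrow> nat \<Rightarrow> nat" where
  "move_index i j l = (i(j := i j - 1))(l := (i(j := i j - 1)) l + 1)"

lemma basis_mset_Suc:
  assumes "l \<le> n"
  shows "basis_mset n e (i(l := Suc (i l))) = add_mset (e l) (basis_mset n e i)"
proof -
  have "basis_mset n e (i(l := Suc (i l))) =
      (\<Sum>j\<le>n. replicate_mset (i j) (e j) + (if j = l then {#e j#} else {#}))"
    unfolding basis_mset_def by (intro sum.cong) auto
  also have "\<dots> = basis_mset n e i + {#e l#}"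
    using assms by (simp add: sum.distrib basis_mset_def)
  finally show ?thesis by simp
qed

lemma basis_mset_remove:
  assumes "j \<le> n" "i j > 0"
  shows "basis_mset n e i - {#e j#} = basis_mset n e (i(j := i j - 1))"
proof -
  have "basis_mset n e i = add_mset (e j) (basis_mset n e (i(j := i j - 1)))"
    using basis_mset_Suc[OF assms(1), of e "i(j := i j - 1)"] assms by simp
  then show ?thesis by simp
qed

lemma basis_mset_move:
  assumes "j \<le> n" "i j > 0" "l \<le> n"
  shows "add_mset (e l) (basis_mset n e i - {#e j#}) = basis_mset n e (move_index i j l)"
  using basis_mset_Suc[OF assms(3), of e "i(j := i j - 1)"] assms
  by (simp add: basis_mset_remove move_index_def)

lemma size_basis_mset: "size (basis_mset n e i) = (\<Sum>j\<le>n. i j)"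
  by (simp add: basis_mset_def size_multiset_sum)

lemma set_basis_mset: "set_mset (basis_mset n e i) \<subseteq> e ` {..n}"
proof -
  have "x \<in># (\<Sum>j\<in>A. replicate_mset (i j) (e j)) \<Longrightarrow> x \<in> e ` A" if "finite A" for A x
    using that by (induction A rule: finite_induct) (auto split: if_splits)
  then show ?thesis by (auto simp: basis_mset_def)
qed

text \<open>One count for all weights \<open>f\<close>: the weight 1 shows that the degree k is
  preserved, and the weight \<open>\<lambda>a. a\<close> how w(i) changes. The additive form avoids
  subtraction of natural numbers.\<close>

lemma move_index_sum:
  assumes "j \<le> n" "i j > 0" "l \<le> n"
  shows "(\<Sum>a\<le>n. f a * move_index i j l a) + f j = (\<Sum>a\<le>n. f a * i a) + (f l :: nat)"
proof -
  have "(\<Sum>a\<le>n. f a * move_index i j l a) + (\<Sum>a\<le>n. if a = j then f a else 0) =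
      (\<Sum>a\<le>n. f a * i a) + (\<Sum>a\<le>n. if a = l then f a else 0)"
    unfolding sum.distrib[symmetric] using assms
    by (intro sum.cong) (auto simp: move_index_def algebra_simps gr0_conv_Suc)
  then show ?thesis using assms by simp
qed

lemma move_index_in:
  assumes "i \<in> sym_index n k" "j \<le> n" "i j > 0" "l \<le> n"
  shows "move_index i j l \<in> sym_index n k"
  using move_index_sum[of j n i l "\<lambda>_. 1"] assms by (auto simp: sym_index_def move_index_def)

locale sym_mod = type_subring S + free_mod "(ring_of_type_algebra :: 'r ring)\<lparr>carrier := S\<rparr>" M "{..n}" e
  for S :: "'r::comm_ring_1 set" and M :: "('r, 'm, 'x) module_scheme" and n :: nat and e +
  fixes k :: nat
begin

abbreviation "F \<equiv> free_module RS (mset_power M k)"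
abbreviation "Rel \<equiv> sym_relations RS M k"
abbreviation "P \<equiv> sym_power RS M k"
abbreviation "sp \<equiv> sym_prod RS M k"
abbreviation "smon \<equiv> sym_monom RS M n e k"
abbreviation "I \<equiv> sym_index n k"

lemma mset_powerI:
  "x \<in> carrier M \<Longrightarrow> set_mset A \<subseteq> carrier M \<Longrightarrow> Suc (size A) = k \<Longrightarrow> add_mset x A \<in> mset_power M k"
  by (auto simp: mset_power_def)

definition rel_gens where
  "rel_gens = {unit_vec RS (add_mset (x \<oplus>\<^bsub>M\<^esub> y) A) \<ominus>\<^bsub>F\<^esub> (unit_vec RS (add_mset x A) \<oplus>\<^bsub>F\<^esub> unit_vec RS (add_mset y A)) | x y A.
           x \<in> carrier M \<and> y \<in> carrier M \<and> set_mset A \<subseteq> carrier M \<and> Suc (size A) = k} \<union>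
        {unit_vec RS (add_mset (c \<odot>\<^bsub>M\<^esub> x) A) \<ominus>\<^bsub>F\<^esub> (c \<odot>\<^bsub>F\<^esub> unit_vec RS (add_mset x A)) | c x A.
           c \<in> carrier RS \<and> x \<in> carrier M \<and> set_mset A \<subseteq> carrier M \<and> Suc (size A) = k}"

lemma Rel_eq: "Rel = module_span RS F rel_gens"
  by (simp add: sym_relations_def rel_gens_def Let_def)

end

sublocale sym_mod \<subseteq> F: module RS F by (rule module_free_module)

context sym_mod
begin

lemma rel_gens_cases:
  assumes "g \<in> rel_gens"
  obtains (add) x y A where "x \<in> carrier M" "y \<in> carrier M" "set_mset A \<subseteq> carrier M" "Suc (size A) = k"
        "g = unit_vec RS (add_mset (x \<oplus>\<^bsub>M\<^esub> y) A) \<ominus>\<^bsub>F\<^esub> (unit_vec RS (add_mset x A) \<oplus>\<^bsub>F\<^esub> unit_vec RS (add_mset y A))"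
      | (smult) c x A where "c \<in> S" "x \<in> carrier M" "set_mset A \<subseteq> carrier M" "Suc (size A) = k"
        "g = unit_vec RS (add_mset (c \<odot>\<^bsub>M\<^esub> x) A) \<ominus>\<^bsub>F\<^esub> (c \<odot>\<^bsub>F\<^esub> unit_vec RS (add_mset x A))"
  using assms unfolding rel_gens_def RS_simps(1) by blast

lemma unit_vec_mset:
  assumes "x \<in> carrier M" "set_mset A \<subseteq> carrier M" "Suc (size A) = k"
  shows "unit_vec RS (add_mset x A) \<in> carrier F"
  using assms by (intro unit_vec_closed mset_powerI)

lemma rel_gens_closed: "rel_gens \<subseteq> carrier F"
proof
  fix g assume "g \<in> rel_gens"
  then show "g \<in> carrier F"
  proof (cases rule: rel_gens_cases)
    case (add x y A)
    show ?thesis unfolding add(5)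
      by (intro F.M.minus_closed F.M.a_closed unit_vec_mset M.a_closed add)
  next
    case (smult c x A)
    show ?thesis unfolding smult(5)
      by (intro F.M.minus_closed F.smult_closed unit_vec_mset smult_closed) (simp_all add: smult)
  qed
qed

lemma Rel_submodule: "submodule Rel RS F"
  unfolding Rel_eq by (rule F.module_span_submodule[OF rel_gens_closed])

end

sublocale sym_mod \<subseteq> Q: quot_mod RS F Rel
  by (simp add: quot_mod_def quot_mod_axioms_def Rel_submodule F.module_axioms)

context sym_mod
begin

lemma P_eq: "P = Q.Q" by (simp add: sym_power_def)

end

sublocale sym_mod \<subseteq> P: module RS P
  unfolding P_eq by (rule Q.quot_is_module)

context sym_mod
begin

lemma sp_closed:
  assumes "set_mset A \<subseteq> carrier M" "size A = k"
  shows "sp A \<in> carrier P"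
proof -
  have "A \<in> mset_power M k" using assms by (simp add: mset_power_def)
  then show ?thesis
    unfolding P_eq Q.quot_carrier sym_prod_def by (intro imageI unit_vec_closed)
qed

lemma sp_add:
  assumes "x \<in> carrier M" "y \<in> carrier M" "set_mset A \<subseteq> carrier M" "Suc (size A) = k"
  shows "sp (add_mset (x \<oplus>\<^bsub>M\<^esub> y) A) = sp (add_mset x A) \<oplus>\<^bsub>P\<^esub> sp (add_mset y A)"
proof -
  have c: "unit_vec RS (add_mset z A) \<in> carrier F" if "z \<in> carrier M" for z
    using that assms by (intro unit_vec_closed mset_powerI)
  have "unit_vec RS (add_mset (x \<oplus>\<^bsub>M\<^esub> y) A) \<ominus>\<^bsub>F\<^esub> (unit_vec RS (add_mset x A) \<oplus>\<^bsub>F\<^esub> unit_vec RS (add_mset y A)) \<in> Rel"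
    unfolding Rel_eq rel_gens_def
    by (rule subsetD[OF module_span_incl], intro UnI1 CollectI exI[of _ x] exI[of _ y] exI[of _ A] conjI refl)
      (rule assms)+
  then show ?thesis
    unfolding P_eq sym_prod_def using c assms
    by (simp add: Q.quot_add Q.quot_eq_iff del: free_module_simps)
qed

lemma sp_smult:
  assumes "c \<in> S" "x \<in> carrier M" "set_mset A \<subseteq> carrier M" "Suc (size A) = k"
  shows "sp (add_mset (c \<odot>\<^bsub>M\<^esub> x) A) = c \<odot>\<^bsub>P\<^esub> sp (add_mset x A)"
proof -
  have c: "unit_vec RS (add_mset z A) \<in> carrier F" if "z \<in> carrier M" for z
    using that assms by (intro unit_vec_closed mset_powerI)
  have "unit_vec RS (add_mset (c \<odot>\<^bsub>M\<^esub> x) A) \<ominus>\<^bsub>F\<^esub> (c \<odot>\<^bsub>F\<^esub> unit_vec RS (add_mset x A)) \<in> Rel"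
    unfolding Rel_eq rel_gens_def
    by (rule subsetD[OF module_span_incl], intro UnI2 CollectI exI[of _ c] exI[of _ x] exI[of _ A] conjI refl)
      (simp_all only: RS_simps(1) assms)
  then show ?thesis
    unfolding P_eq sym_prod_def using c assms
    by (simp add: Q.quot_smult Q.quot_eq_iff del: free_module_simps)
qed

lemma sp_zero:
  assumes "set_mset A \<subseteq> carrier M" "Suc (size A) = k"
  shows "sp (add_mset \<zero>\<^bsub>M\<^esub> A) = \<zero>\<^bsub>P\<^esub>"
proof -
  have "sp (add_mset (0 \<odot>\<^bsub>M\<^esub> \<zero>\<^bsub>M\<^esub>) A) = 0 \<odot>\<^bsub>P\<^esub> sp (add_mset \<zero>\<^bsub>M\<^esub> A)"
    by (rule sp_smult) (use assms zero_S in auto)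
  also have "\<dots> = \<zero>\<^bsub>P\<^esub>"
    using P.smult_l_null[OF sp_closed[of "add_mset \<zero>\<^bsub>M\<^esub> A"]] assms by simp
  finally show ?thesis using smult_r_null[of 0] zero_S by simp
qed

lemma sp_lincomb:
  assumes "finite L" "\<And>l. l \<in> L \<Longrightarrow> c l \<in> S" "\<And>l. l \<in> L \<Longrightarrow> x l \<in> carrier M"
    and A: "set_mset A \<subseteq> carrier M" "Suc (size A) = k"
  shows "sp (add_mset (\<Oplus>\<^bsub>M\<^esub>l\<in>L. c l \<odot>\<^bsub>M\<^esub> x l) A) = (\<Oplus>\<^bsub>P\<^esub>l\<in>L. c l \<odot>\<^bsub>P\<^esub> sp (add_mset (x l) A))"
  using assms(1-3)
proof (induction L rule: finite_induct)
  case empty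
  then show ?case using sp_zero[OF A] by simp
next
  case (insert a L)
  have 1: "(\<Oplus>\<^bsub>M\<^esub>l\<in>insert a L. c l \<odot>\<^bsub>M\<^esub> x l) = c a \<odot>\<^bsub>M\<^esub> x a \<oplus>\<^bsub>M\<^esub> (\<Oplus>\<^bsub>M\<^esub>l\<in>L. c l \<odot>\<^bsub>M\<^esub> x l)"
    using insert by (intro M.finsum_insert) auto
  have spc: "sp (add_mset z A) \<in> carrier P" if "z \<in> carrier M" for z
    using that A by (intro sp_closed) simp_all
  have 2: "(\<Oplus>\<^bsub>P\<^esub>l\<in>insert a L. c l \<odot>\<^bsub>P\<^esub> sp (add_mset (x l) A)) =
      c a \<odot>\<^bsub>P\<^esub> sp (add_mset (x a) A) \<oplus>\<^bsub>P\<^esub> (\<Oplus>\<^bsub>P\<^esub>l\<in>L. c l \<odot>\<^bsub>P\<^esub> sp (add_mset (x l) A))"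
    using insert.hyps insert.prems by (intro P.M.finsum_insert) (auto intro!: P.smult_closed spc)
  have c: "(\<Oplus>\<^bsub>M\<^esub>l\<in>L. c l \<odot>\<^bsub>M\<^esub> x l) \<in> carrier M"
    using insert by (intro M.finsum_closed) auto
  show ?case unfolding 1 2
    using insert.IH insert.prems c by (simp add: sp_add[OF _ _ A] sp_smult[OF _ _ A])
qed

lemma sp_expand:
  assumes "x \<in> carrier M" "set_mset A \<subseteq> carrier M" "Suc (size A) = k"
  shows "sp (add_mset x A) = (\<Oplus>\<^bsub>P\<^esub>l\<in>{..n}. co x l \<odot>\<^bsub>P\<^esub> sp (add_mset (e l) A))"
proof -
  have "sp (add_mset (\<Oplus>\<^bsub>M\<^esub>l\<in>{..n}. co x l \<odot>\<^bsub>M\<^esub> e l) A) = (\<Oplus>\<^bsub>P\<^esub>l\<in>{..n}. co x l \<odot>\<^bsub>P\<^esub> sp (add_mset (e l) A))"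
    using assms coords_closed[OF assms(1)] by (intro sp_lincomb) auto
  then show ?thesis using coords_sum[OF assms(1)] by simp
qed

lemma set_basis_mset_M: "set_mset (basis_mset n e i) \<subseteq> carrier M"
  using set_basis_mset[of n e i] basis_closed by blast

lemma mon_closed [simp, intro]: "i \<in> I \<Longrightarrow> smon i \<in> carrier P"
  unfolding sym_monom_def
  by (rule sp_closed[OF set_basis_mset_M]) (auto simp: size_basis_mset sym_index_def)

text \<open>Induction on the multiset: one factor of \<open>A\<close> is written in the basis, and
  each resulting basis vector joins the monomial part \<open>basis_mset n e i\<close>, where the
  induction hypothesis applies to a larger exponent vector.\<close>

lemma sp_in_lincombs:
  assumes "set_mset A \<subseteq> carrier M" "\<forall>j>n. i j = 0" "size A + (\<Sum>j\<le>n. i j) = k"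
  shows "sp (A + basis_mset n e i) \<in> P.lincombs I smon"
  using assms
proof (induction A arbitrary: i)
  case empty
  then have "i \<in> I" by (auto simp: sym_index_def)
  then have "smon i \<in> P.lincombs I smon"
    by (intro P.lincombs_basis[OF finite_sym_index]) auto
  then show ?case by (simp add: sym_monom_def[symmetric])
next
  case (add x A)
  have "sp (add_mset x (A + basis_mset n e i)) =
      (\<Oplus>\<^bsub>P\<^esub>l\<in>{..n}. co x l \<odot>\<^bsub>P\<^esub> sp (add_mset (e l) (A + basis_mset n e i)))"
    using add.prems set_basis_mset_M by (intro sp_expand) (simp_all add: size_basis_mset)
  also have "\<dots> \<in> P.lincombs I smon"
  proof (rule P.lincombs_finsum[OF finite_sym_index mon_closed])
    fix l assume l: "l \<in> {..n}"
    have "sp (A + basis_mset n e (i(l := Suc (i l)))) \<in> P.lincombs I smon"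
    proof (rule add.IH)
      have "(\<Sum>j\<le>n. (i(l := Suc (i l))) j) = (\<Sum>j\<le>n. i j + (if j = l then 1 else 0))"
        by (intro sum.cong) auto
      also have "\<dots> = (\<Sum>j\<le>n. i j) + 1" using l by (simp add: sum.distrib)
      finally show "size A + (\<Sum>j\<le>n. (i(l := Suc (i l))) j) = k" using add.prems by simp
    qed (use add.prems l in auto)
    then have "sp (add_mset (e l) (A + basis_mset n e i)) \<in> P.lincombs I smon"
      using basis_mset_Suc[of l n e i] l by simp
    then show "co x l \<odot>\<^bsub>P\<^esub> sp (add_mset (e l) (A + basis_mset n e i)) \<in> P.lincombs I smon"
      using coords_closed[of x l] add.prems l
      by (intro P.lincombs_smult[OF finite_sym_index mon_closed]) auto
  qed auto
  finally show ?case by simp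
qed

lemma carrier_P_lincombs:
  assumes "x \<in> carrier P"
  shows "x \<in> P.lincombs I smon"
proof -
  obtain f where f: "f \<in> carrier F" "x = Rel +>\<^bsub>F\<^esub> f"
    using assms by (auto simp: P_eq Q.quot_carrier)
  define T where "T = {A. f A \<noteq> 0}"
  have T: "finite T" "T \<subseteq> mset_power M k" "\<And>A. f A \<in> S"
    using f(1) by (auto simp: carrier_free_module T_def)
  have u: "unit_vec RS A \<in> carrier F" if "A \<in> T" for A using T(2) that by (intro unit_vec_closed) auto
  have "(\<Oplus>\<^bsub>F\<^esub>A\<in>T. f A \<odot>\<^bsub>F\<^esub> unit_vec RS A) = (\<lambda>B. \<Sum>A\<in>T. (f A \<odot>\<^bsub>F\<^esub> unit_vec RS A) B)"
    using T u by (intro free_module_finsum F.smult_closed) auto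
  also have "\<dots> = f"
  proof
    fix B
    have "(\<Sum>A\<in>T. (f A \<odot>\<^bsub>F\<^esub> unit_vec RS A) B) = (\<Sum>A\<in>T. if A = B then f A else 0)"
      by (intro sum.cong) (auto simp: unit_vec_RS)
    then show "(\<Sum>A\<in>T. (f A \<odot>\<^bsub>F\<^esub> unit_vec RS A) B) = f B"
      using T by (simp add: T_def)
  qed
  finally have "x = Rel +>\<^bsub>F\<^esub> (\<Oplus>\<^bsub>F\<^esub>A\<in>T. f A \<odot>\<^bsub>F\<^esub> unit_vec RS A)" using f by simp
  also have "\<dots> = (\<Oplus>\<^bsub>P\<^esub>A\<in>T. f A \<odot>\<^bsub>P\<^esub> sp A)"
    unfolding P_eq sym_prod_def using T u by (intro Q.quot_lincomb[symmetric]) auto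
  also have "\<dots> \<in> P.lincombs I smon"
  proof (rule P.lincombs_finsum[OF finite_sym_index mon_closed _ _ ])
    fix A assume "A \<in> T"
    then have "sp (A + basis_mset n e (\<lambda>_. 0)) \<in> P.lincombs I smon"
      using T by (intro sp_in_lincombs) (auto simp: mset_power_def)
    then have "sp A \<in> P.lincombs I smon" by (simp add: basis_mset_def)
    then show "f A \<odot>\<^bsub>P\<^esub> sp A \<in> P.lincombs I smon"
      using T by (intro P.lincombs_smult[OF finite_sym_index mon_closed]) auto
  qed (use T in auto)
  finally show ?thesis .
qed

text \<open>Independence of the monomials is tested in the polynomial ring over \<open>'r\<close>, to which the
  free module maps by multiplying out the linear forms given by coordinates.\<close>

definition lin_form :: "'m \<Rightarrow> (nat \<Rightarrow>\<^sub>0 nat) \<Rightarrow>\<^sub>0 'r" where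
  "lin_form x = (\<Sum>j\<le>n. Poly_Mapping.single (Poly_Mapping.single j 1) (co x j))"

definition to_poly :: "('m multiset \<Rightarrow> 'r) \<Rightarrow> (nat \<Rightarrow>\<^sub>0 nat) \<Rightarrow>\<^sub>0 'r" where
  "to_poly f = (\<Sum>A | f A \<noteq> 0. Poly_Mapping.single 0 (f A) * prod_mset (image_mset lin_form A))"

lemma to_poly_superset:
  assumes "finite T" "{A. f A \<noteq> 0} \<subseteq> T"
  shows "to_poly f = (\<Sum>A\<in>T. Poly_Mapping.single 0 (f A) * prod_mset (image_mset lin_form A))"
  unfolding to_poly_def using assms by (intro sum.mono_neutral_left) auto

lemma to_poly_add:
  assumes "f \<in> carrier F" "g \<in> carrier F"
  shows "to_poly (\<lambda>x. f x + g x) = to_poly f + to_poly g"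
proof -
  define T where "T = {A. f A \<noteq> 0} \<union> {A. g A \<noteq> 0}"
  have T: "finite T" using assms by (auto simp: T_def carrier_free_module)
  have "{A. f A \<noteq> 0} \<subseteq> T" "{A. g A \<noteq> 0} \<subseteq> T" "{A. f A + g A \<noteq> 0} \<subseteq> T"
    by (auto simp: T_def)
  then show ?thesis
    using T by (simp add: to_poly_superset[of T] single_add algebra_simps sum.distrib)
qed

lemma to_poly_smult:
  assumes "f \<in> carrier F"
  shows "to_poly (\<lambda>x. c * f x) = Poly_Mapping.single 0 c * to_poly f"
proof -
  define T where "T = {A. f A \<noteq> 0}"
  have T: "finite T" using assms by (auto simp: T_def carrier_free_module)
  have "{A. f A \<noteq> 0} \<subseteq> T" "{A. c * f A \<noteq> 0} \<subseteq> T"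
    by (auto simp: T_def)
  then show ?thesis
    using T by (simp add: to_poly_superset[of T] sum_distrib_left mult.assoc[symmetric] mult_single)
qed

lemma to_poly_minus:
  assumes "f \<in> carrier F" "g \<in> carrier F"
  shows "to_poly (f \<ominus>\<^bsub>F\<^esub> g) = to_poly f - to_poly g"
proof -
  have g: "(\<lambda>x. - 1 * g x) \<in> carrier F" using assms by (auto simp: carrier_free_module uminus_S)
  have "to_poly (f \<ominus>\<^bsub>F\<^esub> g) = to_poly (\<lambda>x. f x + (- 1 * g x))"
    using assms by (simp add: free_module_minus)
  also have "\<dots> = to_poly f + Poly_Mapping.single 0 (- 1) * to_poly g"
    using to_poly_add[OF assms(1) g] to_poly_smult[OF assms(2), of "- 1"] by simp
  also have "Poly_Mapping.single 0 (- 1 :: 'r) = - (1 :: (nat \<Rightarrow>\<^sub>0 nat) \<Rightarrow>\<^sub>0 'r)"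
    by (simp add: single_uminus)
  finally show ?thesis by simp
qed

lemma to_poly_unit: "to_poly (unit_vec RS A) = prod_mset (image_mset lin_form A)"
  by (subst to_poly_superset[of "{A}"]) (auto simp: unit_vec_RS)

text \<open>The kernel of \<open>to_poly\<close> is a submodule, and it contains the generating
  relations because \<open>lin_form\<close> is additive and homogeneous; hence it contains their
  span.\<close>

lemma to_poly_Rel:
  assumes "f \<in> Rel"
  shows "to_poly f = 0"
proof -
  have c: "unit_vec RS (add_mset z A) \<in> carrier F"
    if "z \<in> carrier M" "set_mset A \<subseteq> carrier M" "Suc (size A) = k" for z A
    using that by (intro unit_vec_closed mset_powerI)
  have z: "to_poly (\<lambda>x. 0) = 0" by (simp add: to_poly_def)
  have la: "lin_form (x \<oplus>\<^bsub>M\<^esub> y) = lin_form x + lin_form y" if "x \<in> carrier M" "y \<in> carrier M" for x y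
    unfolding lin_form_def sum.distrib[symmetric] using that
    by (intro sum.cong) (auto simp: coords_add single_add)
  have lm: "lin_form (c \<odot>\<^bsub>M\<^esub> x) = Poly_Mapping.single 0 c * lin_form x" if "x \<in> carrier M" "c \<in> S" for x c
    unfolding lin_form_def sum_distrib_left using that
    by (intro sum.cong) (auto simp: coords_smult mult_single)
  define H where "H = {f \<in> carrier F. to_poly f = 0}"
  have "submodule H RS F"
  proof (rule F.submoduleI)
    fix a assume a: "a \<in> H"
    have "\<ominus>\<^bsub>F\<^esub> a = \<zero>\<^bsub>F\<^esub> \<ominus>\<^bsub>F\<^esub> a" using a by (simp add: H_def F.M.minus_eq)
    then show "\<ominus>\<^bsub>F\<^esub> a \<in> H"
      using a z to_poly_minus[OF F.M.zero_closed, of a] F.M.minus_closed[OF F.M.zero_closed, of a]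
      by (simp add: H_def)
  next
    fix a b assume "a \<in> H" "b \<in> H"
    then show "a \<oplus>\<^bsub>F\<^esub> b \<in> H" using F.M.a_closed[of a b] by (auto simp: H_def to_poly_add)
  next
    fix a b assume "a \<in> carrier RS" "b \<in> H"
    then show "a \<odot>\<^bsub>F\<^esub> b \<in> H" using F.smult_closed[of a b] by (auto simp: H_def to_poly_smult)
  qed (use z F.M.zero_closed in \<open>auto simp: H_def\<close>)
  moreover have "rel_gens \<subseteq> H"
  proof
    fix g assume g: "g \<in> rel_gens"
    then have "to_poly g = 0"
    proof (cases rule: rel_gens_cases)
      case (add x y A)
      have "to_poly (unit_vec RS (add_mset x A) \<oplus>\<^bsub>F\<^esub> unit_vec RS (add_mset y A)) =
          to_poly (unit_vec RS (add_mset x A)) + to_poly (unit_vec RS (add_mset y A))"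
        using add c by (simp add: to_poly_add)
      then show ?thesis
        using add c F.M.a_closed[OF c[of x A] c[of y A]] la
        by (simp add: to_poly_minus to_poly_unit algebra_simps del: free_module_simps)
    next
      case (smult c' x A)
      have "to_poly (c' \<odot>\<^bsub>F\<^esub> unit_vec RS (add_mset x A)) =
          Poly_Mapping.single 0 c' * to_poly (unit_vec RS (add_mset x A))"
        using smult c by (simp add: to_poly_smult)
      then show ?thesis
        using smult c F.smult_closed[OF _ c[of x A]] lm
        by (simp add: to_poly_minus to_poly_unit algebra_simps del: free_module_simps)
    qed
    then show "g \<in> H" using g rel_gens_closed by (auto simp: H_def)
  qed
  ultimately have "Rel \<subseteq> H" unfolding Rel_eq by (rule module_span_min)
  then show ?thesis using assms by (auto simp: H_def)
qed

definition mon_exp :: "(nat \<Rightarrow> nat) \<Rightarrow> nat \<Rightarrow>\<^sub>0 nat" where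
  "mon_exp i = (\<Sum>j\<le>n. Poly_Mapping.single j (i j))"

lemma to_poly_mon: "to_poly (unit_vec RS (basis_mset n e i)) = Poly_Mapping.single (mon_exp i) 1"
proof -
  have lf: "lin_form (e j) = Poly_Mapping.single (Poly_Mapping.single j 1) 1" if "j \<le> n" for j
  proof -
    have "lin_form (e j) = (\<Sum>l\<le>n. if l = j then Poly_Mapping.single (Poly_Mapping.single l 1) 1 else 0)"
      unfolding lin_form_def using that by (intro sum.cong) (auto simp: coords_basis)
    then show ?thesis using that by simp
  qed
  have pw: "Poly_Mapping.single (Poly_Mapping.single j 1) (1::'r) ^ m =
      Poly_Mapping.single (Poly_Mapping.single j m) 1" for j :: nat and m
    by (induction m) (auto simp: mult_single single_add[symmetric])
  have "prod_mset (image_mset lin_form (\<Sum>j\<in>A. replicate_mset (i j) (e j))) = (\<Prod>j\<in>A. lin_form (e j) ^ i j)"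
    if "finite A" for A
    using that by (induction A rule: finite_induct) auto
  then have "to_poly (unit_vec RS (basis_mset n e i)) = (\<Prod>j\<le>n. lin_form (e j) ^ i j)"
    by (simp add: to_poly_unit basis_mset_def)
  also have "\<dots> = (\<Prod>j\<le>n. Poly_Mapping.single (Poly_Mapping.single j (i j)) 1)"
    by (intro prod.cong) (simp_all add: lf pw del: One_nat_def)
  also have "\<dots> = Poly_Mapping.single (mon_exp i) 1"
  proof -
    have "(\<Prod>j\<in>A. Poly_Mapping.single (Poly_Mapping.single j (i j)) 1) =
        Poly_Mapping.single (\<Sum>j\<in>A. Poly_Mapping.single j (i j)) (1::'r)" if "finite A" for A :: "nat set"
      using that by (induction A rule: finite_induct) (auto simp: mult_single)
    then show ?thesis by (simp add: mon_exp_def)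
  qed
  finally show ?thesis .
qed

lemma mon_exp_inj: "inj_on mon_exp I"
proof (rule inj_onI)
  fix i i' assume *: "i \<in> I" "i' \<in> I" "mon_exp i = mon_exp i'"
  have l: "Poly_Mapping.lookup (mon_exp i) j = (if j \<le> n then i j else 0)" for i j
    by (simp add: mon_exp_def lookup_sum lookup_single when_def)
  show "i = i'"
  proof
    fix j show "i j = i' j"
      using * l[of i j] l[of i' j] by (cases "j \<le> n") (auto simp: sym_index_def)
  qed
qed

text \<open>Multilinear expansion gives generation. For independence, two coefficient families with
  the same sum are lifted to the free module on formal products; their difference lies in the span
  of the relations, \<open>to_poly\<close> kills it, and distinct index vectors give distinct
  monomials of the polynomial ring.\<close>

theorem sym_power_free: "free_with_basis RS P I smon"
  unfolding free_with_basis_def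
proof (intro conjI ballI)
  fix x assume "x \<in> carrier P"
  then obtain c where c: "\<forall>i\<in>I. c i \<in> S" "x = (\<Oplus>\<^bsub>P\<^esub>i\<in>I. c i \<odot>\<^bsub>P\<^esub> smon i)"
    using carrier_P_lincombs by (auto simp: P.lincombs_def)
  show "\<exists>!c. c \<in> I \<rightarrow>\<^sub>E carrier RS \<and> x = (\<Oplus>\<^bsub>P\<^esub>i\<in>I. c i \<odot>\<^bsub>P\<^esub> smon i)"
  proof (rule ex1I)
    have "(\<Oplus>\<^bsub>P\<^esub>i\<in>I. c i \<odot>\<^bsub>P\<^esub> smon i) = (\<Oplus>\<^bsub>P\<^esub>i\<in>I. restrict c I i \<odot>\<^bsub>P\<^esub> smon i)"
      using c by (intro P.M.finsum_cong') auto
    then show "restrict c I \<in> I \<rightarrow>\<^sub>E carrier RS \<and> x = (\<Oplus>\<^bsub>P\<^esub>i\<in>I. restrict c I i \<odot>\<^bsub>P\<^esub> smon i)"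
      using c by simp
  next
    fix d assume d: "d \<in> I \<rightarrow>\<^sub>E carrier RS \<and> x = (\<Oplus>\<^bsub>P\<^esub>i\<in>I. d i \<odot>\<^bsub>P\<^esub> smon i)"
    have u: "unit_vec RS (basis_mset n e i) \<in> carrier F" if "i \<in> I" for i
      using that set_basis_mset_M
      by (intro unit_vec_closed) (auto simp: mset_power_def size_basis_mset sym_index_def)
    define f where "f c = (\<Oplus>\<^bsub>F\<^esub>i\<in>I. c i \<odot>\<^bsub>F\<^esub> unit_vec RS (basis_mset n e i))" for c
    have f: "f c \<in> carrier F \<and> Rel +>\<^bsub>F\<^esub> f c = (\<Oplus>\<^bsub>P\<^esub>i\<in>I. c i \<odot>\<^bsub>P\<^esub> smon i) \<and>
        to_poly (f c) = (\<Sum>i\<in>I. Poly_Mapping.single (mon_exp i) (c i))"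
      if c: "\<And>i. i \<in> I \<Longrightarrow> c i \<in> S" for c
    proof (intro conjI)
      show "f c \<in> carrier F" unfolding f_def
        by (intro F.M.finsum_closed Pi_I F.smult_closed) (simp_all add: u c)
      show "Rel +>\<^bsub>F\<^esub> f c = (\<Oplus>\<^bsub>P\<^esub>i\<in>I. c i \<odot>\<^bsub>P\<^esub> smon i)"
        unfolding P_eq sym_prod_def sym_monom_def f_def using u c finite_sym_index
        by (intro Q.quot_lincomb[symmetric]) auto
      have "to_poly (\<Oplus>\<^bsub>F\<^esub>i\<in>A. c i \<odot>\<^bsub>F\<^esub> unit_vec RS (basis_mset n e i)) =
          (\<Sum>i\<in>A. Poly_Mapping.single (mon_exp i) (c i))" if "finite A" "A \<subseteq> I" for A
        using that
      proof (induction A rule: finite_induct)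
        case empty
        show ?case by (simp add: to_poly_def)
      next
        case (insert a A)
        have 1: "(\<Oplus>\<^bsub>F\<^esub>i\<in>insert a A. c i \<odot>\<^bsub>F\<^esub> unit_vec RS (basis_mset n e i)) =
          c a \<odot>\<^bsub>F\<^esub> unit_vec RS (basis_mset n e a) \<oplus>\<^bsub>F\<^esub> (\<Oplus>\<^bsub>F\<^esub>i\<in>A. c i \<odot>\<^bsub>F\<^esub> unit_vec RS (basis_mset n e i))"
          using insert u c by (intro F.M.finsum_insert F.smult_closed Pi_I) auto
        have 2: "c a \<odot>\<^bsub>F\<^esub> unit_vec RS (basis_mset n e a) \<in> carrier F"
          using insert u c by (intro F.smult_closed) auto
        have 3: "(\<Oplus>\<^bsub>F\<^esub>i\<in>A. c i \<odot>\<^bsub>F\<^esub> unit_vec RS (basis_mset n e i)) \<in> carrier F"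
          using insert u c by (intro F.M.finsum_closed F.smult_closed Pi_I) auto
        have 4: "to_poly (c a \<odot>\<^bsub>F\<^esub> unit_vec RS (basis_mset n e a)) = Poly_Mapping.single (mon_exp a) (c a)"
          using to_poly_smult[OF u[of a], of "c a"] insert by (simp add: to_poly_mon mult_single)
        have "to_poly (x \<oplus>\<^bsub>F\<^esub> y) = to_poly x + to_poly y" if "x \<in> carrier F" "y \<in> carrier F" for x y
          using to_poly_add[OF that] by simp
        from this[OF 2 3] show ?case unfolding 1 4 using insert by simp
      qed
      from this[OF finite_sym_index order.refl]
      show "to_poly (f c) = (\<Sum>i\<in>I. Poly_Mapping.single (mon_exp i) (c i))" unfolding f_def .
    qed
    have dS: "\<And>i. i \<in> I \<Longrightarrow> d i \<in> S" using d by auto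
    have "f c \<ominus>\<^bsub>F\<^esub> f d \<in> Rel"
      using f[of c] f[of d] c d dS Q.quot_eq_iff[of "f c" "f d"] by auto
    then have "to_poly (f c) = to_poly (f d)"
      using to_poly_Rel[of "f c \<ominus>\<^bsub>F\<^esub> f d"] to_poly_minus[of "f c" "f d"] f[of c] f[of d] c dS by auto
    then have eq: "(\<Sum>i\<in>I. Poly_Mapping.single (mon_exp i) (c i)) = (\<Sum>i\<in>I. Poly_Mapping.single (mon_exp i) (d i))"
      using f[of c] f[of d] c dS by auto
    have lk: "Poly_Mapping.lookup (\<Sum>i\<in>I. Poly_Mapping.single (mon_exp i) (c i)) (mon_exp j) = c j"
      if "j \<in> I" for c :: "(nat \<Rightarrow> nat) \<Rightarrow> 'r" and j
    proof -
      have "Poly_Mapping.lookup (\<Sum>i\<in>I. Poly_Mapping.single (mon_exp i) (c i)) (mon_exp j) =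
          (\<Sum>i\<in>I. if i = j then c i else 0)"
        unfolding lookup_sum using that mon_exp_inj
        by (intro sum.cong) (auto simp: lookup_single when_def inj_on_def)
      then show ?thesis using that finite_sym_index by simp
    qed
    have "c j = d j" if "j \<in> I" for j using lk[OF that, of c] lk[OF that, of d] eq by simp
    then show "d = restrict c I" using d by (auto simp: restrict_def PiE_def extensional_def)
  qed
qed (auto simp: finite_sym_index P.module_axioms)

end

sublocale sym_mod \<subseteq> SP: free_mod RS P I smon
  by (rule free_modI[OF sym_power_free])

context sym_mod
begin

lemma sym_coords_eq:
  assumes "x \<in> carrier P"
  shows "sym_coords RS M n e k x = SP.co x"
proof -
  let ?P = "\<lambda>c. c \<in> I \<rightarrow>\<^sub>E carrier RS \<and> x = (\<Oplus>\<^bsub>P\<^esub>i\<in>I. c i \<odot>\<^bsub>P\<^esub> smon i)"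
  have c: "?P (SP.co x)" by (rule SP.coords_props[OF assms])
  have u: "d = SP.co x" if "?P d" for d
    using SP.coords_unique[OF assms, of d] that by simp
  have "(SOME c. ?P c) = SP.co x" 
    by (rule some_equality[where P = ?P]) (rule c, rule u)
  then show ?thesis unfolding sym_coords_def .
qed

lemma sp_move:
  assumes x: "x \<in> carrier M" and i: "i \<in> I" "j \<le> n" "i j > 0"
  shows "sp (add_mset x (basis_mset n e i - {#e j#})) = (\<Oplus>\<^bsub>P\<^esub>l\<in>{..n}. co x l \<odot>\<^bsub>P\<^esub> smon (move_index i j l))"
proof -
  have sz: "Suc (size (basis_mset n e i - {#e j#})) = k"
  proof -
    have "size (add_mset (e j) (basis_mset n e i - {#e j#})) = k"
      unfolding basis_mset_move[of j n i j e, OF i(2,3) i(2)] size_basis_mset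
      using move_index_in[OF i(1-3) i(2)] by (auto simp: sym_index_def)
    then show ?thesis by simp
  qed
  have "sp (add_mset x (basis_mset n e i - {#e j#})) =
      (\<Oplus>\<^bsub>P\<^esub>l\<in>{..n}. co x l \<odot>\<^bsub>P\<^esub> sp (add_mset (e l) (basis_mset n e i - {#e j#})))"
    using set_basis_mset_M sz by (intro sp_expand x) (auto dest: in_diffD)
  also have "\<dots> = (\<Oplus>\<^bsub>P\<^esub>l\<in>{..n}. co x l \<odot>\<^bsub>P\<^esub> smon (move_index i j l))"
  proof (rule P.M.finsum_cong')
    fix l assume l: "l \<in> {..n}"
    show "co x l \<odot>\<^bsub>P\<^esub> sp (add_mset (e l) (basis_mset n e i - {#e j#})) = co x l \<odot>\<^bsub>P\<^esub> smon (move_index i j l)"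
      using basis_mset_move[of j n i l e] i l by (simp add: sym_monom_def)
  next
    show "(\<lambda>l. co x l \<odot>\<^bsub>P\<^esub> smon (move_index i j l)) \<in> {..n} \<rightarrow> carrier P"
      using coords_closed[OF x] move_index_in[OF i] by (intro Pi_I P.smult_closed mon_closed) simp_all
  qed simp
  finally show ?thesis .
qed

text \<open>Replacing a factor e_j of a monomial by \<phi>(e_j), a combination of the e_l, produces
  the monomials \<open>move_index i' j l\<close> with the coordinates of \<phi>(e_j) as
  coefficients. Both connections are handled through this matrix form: \<open>nabla_bar\<close> with
  \<open>d\<close> zero, and \<partial> with \<open>d\<close> equal to \<open>theta\<close>.\<close>

theorem sym_extend_coords:
  assumes d: "\<And>x. x \<in> S \<Longrightarrow> d x \<in> S" and \<phi>: "\<And>j. j \<le> n \<Longrightarrow> \<phi> (e j) \<in> carrier M"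
    and x: "x \<in> carrier P"
  shows "sym_extend RS M n e k d \<phi> x \<in> carrier P"
    and "i \<in> I \<Longrightarrow> SP.co (sym_extend RS M n e k d \<phi> x) i = d (SP.co x i) +
      (\<Sum>i'\<in>I. \<Sum>j | j \<le> n \<and> i' j > 0. \<Sum>l\<le>n.
         if move_index i' j l = i then of_nat (i' j) * SP.co x i' * co (\<phi> (e j)) l else 0)"
proof -
  define c where "c = SP.co x"
  have c: "\<And>i. i \<in> I \<Longrightarrow> c i \<in> S" using x SP.coords_closed by (auto simp: c_def)
  define t where "t i' j = ([i' j] \<cdot>\<^bsub>RS\<^esub> c i') \<odot>\<^bsub>P\<^esub> sp (add_mset (\<phi> (e j)) (basis_mset n e i' - {#e j#}))" for i' j
  define s where "s i' = d (c i') \<odot>\<^bsub>P\<^esub> smon i' \<oplus>\<^bsub>P\<^esub> (\<Oplus>\<^bsub>P\<^esub>j\<in>{j. j \<le> n \<and> i' j > 0}. t i' j)" for i'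
  have ext: "sym_extend RS M n e k d \<phi> x = (\<Oplus>\<^bsub>P\<^esub>i'\<in>I. s i')"
    using x by (simp add: sym_extend_def Let_def sym_coords_eq s_def t_def c_def)
  have m: "co (\<phi> (e j)) l \<odot>\<^bsub>P\<^esub> smon (move_index i' j l) \<in> carrier P"
    if "i' \<in> I" "j \<le> n" "i' j > 0" "l \<le> n" for i' j l
    using that coords_closed[OF \<phi>[of j], of l] by (auto intro!: P.smult_closed mon_closed move_index_in)
  have tc: "t i' j \<in> carrier P" if "i' \<in> I" "j \<le> n" "i' j > 0" for i' j
  proof -
    have "(\<Oplus>\<^bsub>P\<^esub>l\<in>{..n}. co (\<phi> (e j)) l \<odot>\<^bsub>P\<^esub> smon (move_index i' j l)) \<in> carrier P"
      using that m by (intro P.M.finsum_closed) auto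
    then show ?thesis
      unfolding t_def using that sp_move[OF \<phi>] c
      by (intro P.smult_closed) (auto simp: add_pow_RS mult_S of_nat_S)
  qed
  have sc: "s i' \<in> carrier P" if "i' \<in> I" for i'
    unfolding s_def using that d c tc by (intro P.M.a_closed P.smult_closed P.M.finsum_closed) auto
  show "sym_extend RS M n e k d \<phi> x \<in> carrier P"
    unfolding ext using sc by (intro P.M.finsum_closed) auto
  assume i: "i \<in> I"
  have cm: "SP.co (smon i') i = (if i = i' then 1 else 0)" if "i' \<in> I" for i'
    using SP.coords_basis[OF that i] by simp
  have ct: "SP.co (t i' j) i = (\<Sum>l\<le>n. if move_index i' j l = i then of_nat (i' j) * c i' * co (\<phi> (e j)) l else 0)"
    if i': "i' \<in> I" "j \<le> n" "i' j > 0" for i' j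
  proof -
    have "SP.co (t i' j) i = of_nat (i' j) * c i' * SP.co (\<Oplus>\<^bsub>P\<^esub>l\<in>{..n}. co (\<phi> (e j)) l \<odot>\<^bsub>P\<^esub> smon (move_index i' j l)) i"
      unfolding t_def sp_move[OF \<phi>[OF i'(2)] i'] using i' m c i
      by (subst SP.coords_smult) (auto simp: add_pow_RS mult_S of_nat_S intro!: P.M.finsum_closed)
    also have "SP.co (\<Oplus>\<^bsub>P\<^esub>l\<in>{..n}. co (\<phi> (e j)) l \<odot>\<^bsub>P\<^esub> smon (move_index i' j l)) i =
        (\<Oplus>\<^bsub>RS\<^esub>l\<in>{..n}. SP.co (co (\<phi> (e j)) l \<odot>\<^bsub>P\<^esub> smon (move_index i' j l)) i)"
      using m i' i by (intro SP.coords_finsum) auto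
    also have "\<dots> = (\<Sum>l\<le>n. SP.co (co (\<phi> (e j)) l \<odot>\<^bsub>P\<^esub> smon (move_index i' j l)) i)"
      using SP.coords_closed[OF m[OF i'] i] by (intro finsum_RS) auto
    also have "\<dots> = (\<Sum>l\<le>n. if move_index i' j l = i then co (\<phi> (e j)) l else 0)"
      using i' i coords_closed[OF \<phi>[OF i'(2)]]
      by (intro sum.cong refl, subst SP.coords_smult) (auto simp: cm move_index_in intro!: mon_closed move_index_in)
    finally show ?thesis by (simp add: sum_distrib_left if_distrib cong: if_cong)
  qed
  have cs: "SP.co (s i') i = (if i' = i then d (c i') else 0) + (\<Sum>j | j \<le> n \<and> i' j > 0. SP.co (t i' j) i)"
    if i': "i' \<in> I" for i'
  proof -
    have "SP.co (s i') i = SP.co (d (c i') \<odot>\<^bsub>P\<^esub> smon i') i + SP.co (\<Oplus>\<^bsub>P\<^esub>j\<in>{j. j \<le> n \<and> i' j > 0}. t i' j) i"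
      unfolding s_def using i i' d c tc
      by (subst SP.coords_add) (auto intro!: P.smult_closed P.M.finsum_closed)
    also have "SP.co (\<Oplus>\<^bsub>P\<^esub>j\<in>{j. j \<le> n \<and> i' j > 0}. t i' j) i = (\<Oplus>\<^bsub>RS\<^esub>j\<in>{j. j \<le> n \<and> i' j > 0}. SP.co (t i' j) i)"
      using tc i' i by (intro SP.coords_finsum) auto
    also have "\<dots> = (\<Sum>j | j \<le> n \<and> i' j > 0. SP.co (t i' j) i)"
      using SP.coords_closed[OF tc[OF i'] i] by (intro finsum_RS) auto
    also have "SP.co (d (c i') \<odot>\<^bsub>P\<^esub> smon i') i = (if i' = i then d (c i') else 0)"
      using i i' d c by (subst SP.coords_smult) (auto simp: cm)
    finally show ?thesis .
  qed
  have "SP.co (sym_extend RS M n e k d \<phi> x) i = (\<Oplus>\<^bsub>RS\<^esub>i'\<in>I. SP.co (s i') i)"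
    unfolding ext using sc i finite_sym_index by (intro SP.coords_finsum) auto
  also have "\<dots> = (\<Sum>i'\<in>I. SP.co (s i') i)"
    using SP.coords_closed[OF sc i] by (intro finsum_RS) auto
  also have "\<dots> = (\<Sum>i'\<in>I. if i' = i then d (c i') else 0) + (\<Sum>i'\<in>I. \<Sum>j | j \<le> n \<and> i' j > 0. SP.co (t i' j) i)"
    using cs by (simp add: sum.distrib)
  also have "(\<Sum>i'\<in>I. if i' = i then d (c i') else 0) = d (c i)"
    using i finite_sym_index by simp
  also have "(\<Sum>i'\<in>I. \<Sum>j | j \<le> n \<and> i' j > 0. SP.co (t i' j) i) =
      (\<Sum>i'\<in>I. \<Sum>j | j \<le> n \<and> i' j > 0. \<Sum>l\<le>n. if move_index i' j l = i then of_nat (i' j) * c i' * co (\<phi> (e j)) l else 0)"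
    using ct by (intro sum.cong) auto
  finally show "SP.co (sym_extend RS M n e k d \<phi> x) i = d (SP.co x i) +
      (\<Sum>i'\<in>I. \<Sum>j | j \<le> n \<and> i' j > 0. \<Sum>l\<le>n.
         if move_index i' j l = i then of_nat (i' j) * SP.co x i' * co (\<phi> (e j)) l else 0)"
    unfolding c_def .
qed

end

section \<open>Null families over a complete ring of integers\<close>

locale valued =
  fixes ord :: "'f::field \<Rightarrow> ereal" and p :: nat
  assumes ord_inf: "ord x = \<infinity> \<longleftrightarrow> x = 0" and ord_minf: "ord x \<noteq> - \<infinity>"
    and ord_mult: "ord (x * y) = ord x + ord y"
    and ord_add: "min (ord x) (ord y) \<le> ord (x + y)"
    and ord_p: "ord (of_nat p) = 1"
begin

text \<open>A bound with a real threshold, which may be negative, as in w(i) - N. It keeps the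
  arithmetic of extended reals out of the estimates.\<close>

definition vb :: "real \<Rightarrow> 'f \<Rightarrow> bool" where "vb b x \<longleftrightarrow> ereal b \<le> ord x"

lemma ord_one [simp]: "ord 1 = 0"
proof -
  have "ord (1::'f) \<noteq> \<infinity>" using ord_inf[of 1] by simp
  then obtain r where r: "ord (1::'f) = ereal r" using ord_minf[of 1] by (cases "ord (1::'f)") auto
  then show ?thesis using ord_mult[of 1 1] by (simp add: zero_ereal_def)
qed

lemma ord_uminus [simp]: "ord (- x) = ord x"
proof -
  have n: "ord (-1::'f) \<noteq> \<infinity>" using ord_inf[of "-1"] by simp
  then obtain r where r: "ord (-1::'f) = ereal r" using ord_minf[of "-1"] by (cases "ord (-1::'f)") auto
  then have "ord (-1::'f) = 0" using ord_mult[of "-1" "-1"] by (simp add: zero_ereal_def)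
  then show ?thesis using ord_mult[of "-1" x] by simp
qed

lemma vb_zero [simp]: "vb b 0"
  using ord_inf[of 0] by (simp add: vb_def)

lemma vb_one [simp]: "vb 0 1"
  by (simp add: vb_def zero_ereal_def[symmetric])

lemma vb_uminus [simp]: "vb b (- x) \<longleftrightarrow> vb b x"
  by (simp add: vb_def)

lemma vb_add: "vb b x \<Longrightarrow> vb b y \<Longrightarrow> vb b (x + y)"
  unfolding vb_def by (rule order.trans[OF _ ord_add]) simp

lemma vb_diff: "vb b x \<Longrightarrow> vb b y \<Longrightarrow> vb b (x - y)"
  using vb_add[of b x "- y"] by simp

lemma vb_minus_commute: "vb b (x - y) \<longleftrightarrow> vb b (y - x)"
  using vb_uminus[of b "x - y"] by simp

lemma vb_trans: "vb b (x - y) \<Longrightarrow> vb b (y - z) \<Longrightarrow> vb b (x - z)"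
  using vb_add[of b "x - y" "y - z"] by simp

lemma vb_diff_iff: "vb b (x - y) \<Longrightarrow> vb b x \<longleftrightarrow> vb b y"
  using vb_add[of b "x - y" y] vb_diff[of b x "x - y"] by auto

lemma vb_sum: "(\<And>i. i \<in> A \<Longrightarrow> vb b (f i)) \<Longrightarrow> vb b (sum f A)"
  by (induction A rule: infinite_finite_induct) (auto intro: vb_add)

lemma vb_mult: "vb a x \<Longrightarrow> vb b y \<Longrightarrow> vb (a + b) (x * y)"
  unfolding vb_def ord_mult plus_ereal.simps(1)[symmetric] by (rule add_mono)

lemma vb_mono: "vb b x \<Longrightarrow> a \<le> b \<Longrightarrow> vb a x"
  unfolding vb_def by (meson ereal_less_eq(3) order.trans)

lemma vb_mult0: "vb 0 x \<Longrightarrow> vb b y \<Longrightarrow> vb b (x * y)" "vb b x \<Longrightarrow> vb 0 y \<Longrightarrow> vb b (x * y)"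
  using vb_mult[of 0 x b y] vb_mult[of b x 0 y] by auto

lemma vb_prod: "(\<And>i. i \<in> A \<Longrightarrow> vb (b i) (f i)) \<Longrightarrow> vb (sum b A) (prod f A)"
  by (induction A rule: infinite_finite_induct) (auto intro: vb_mult)

lemma vb_p: "vb 1 (of_nat p)"
  by (simp add: vb_def ord_p one_ereal_def)

lemma p_neq_0 [simp]: "(of_nat p :: 'f) \<noteq> 0"
  using ord_p ord_inf[of "of_nat p"] by auto

lemma vb_of_nat [simp]: "vb 0 (of_nat m)"
  by (induction m) (auto intro: vb_add)

lemma vb_of_int [simp]: "vb 0 (of_int m)"
  by (cases m) (auto intro: vb_diff)

lemma vb_of_int_dvd:
  assumes "int p dvd m"
  shows "vb 1 (of_int m)"
proof -
  obtain l where "m = int p * l" using assms by blast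
  then show ?thesis using vb_mult0(2)[OF vb_p vb_of_int[of l]] by simp
qed

lemma ord_p_power: "ord (of_nat p ^ s) = ereal (real s)"
  by (induction s) (auto simp: ord_mult ord_p zero_ereal_def one_ereal_def)

lemma vb_divide: "vb b x \<Longrightarrow> ord y = ereal a \<Longrightarrow> vb (b - a) (x / y)"
proof -
  assume x: "vb b x" and y: "ord y = ereal a"
  have y0: "y \<noteq> 0" using y ord_inf[of y] by auto
  have "ord (x / y) + ord y = ord x" using ord_mult[of "x / y" y] y0 by simp
  then have "ereal b \<le> ord (x / y) + ereal a" using x y by (simp add: vb_def)
  then show ?thesis using ord_minf[of "x / y"] unfolding vb_def by (cases "ord (x / y)") auto
qed

lemma vb_p_power_mult: "vb b (of_nat p ^ s * x) \<longleftrightarrow> vb (b - real s) x"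
proof
  assume "vb b (of_nat p ^ s * x)"
  then have "vb (b - real s) (of_nat p ^ s * x / of_nat p ^ s)"
    by (rule vb_divide[OF _ ord_p_power])
  then show "vb (b - real s) x" by simp
next
  assume "vb (b - real s) x"
  moreover have "vb (real s) (of_nat p ^ s)" by (simp add: vb_def ord_p_power)
  ultimately show "vb b (of_nat p ^ s * x)" using vb_mult[of "real s" "of_nat p ^ s" "b - real s" x] by simp
qed

lemma vb_all_zero:
  assumes "\<And>s::nat. vb (real s) x"
  shows "x = 0"
proof -
  have "ereal b \<le> ord x" for b
    using assms[of "nat \<lceil>b\<rceil>"] unfolding vb_def
    by (meson ereal_less_eq(3) order.trans real_nat_ceiling_ge)
  then have "ord x = \<infinity>" by (rule ereal_top)
  then show ?thesis by (simp add: ord_inf)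
qed

lemma vb_all_eq: "(\<And>s::nat. vb (real s) (x - y)) \<Longrightarrow> x = y"
  using vb_all_zero[of "x - y"] by simp

end

text \<open>Completeness is required of a subfield \<open>L\<close> only: an algebraic closure of
  the p-adic numbers is not complete, and all infinite sums are formed inside
  \<open>L\<close>.\<close>

locale complete_valued = valued ord p for ord :: "'f::field \<Rightarrow> ereal" and p +
  fixes L :: "'f set"
  assumes one_L: "1 \<in> L" and diff_L: "x \<in> L \<Longrightarrow> y \<in> L \<Longrightarrow> x - y \<in> L"
    and mult_L: "x \<in> L \<Longrightarrow> y \<in> L \<Longrightarrow> x * y \<in> L"
    and inverse_L: "x \<in> L \<Longrightarrow> inverse x \<in> L"
    and complete_L: "(\<And>i::nat. s i \<in> L) \<Longrightarrow> (\<And>b. \<exists>m. \<forall>i\<ge>m. \<forall>j\<ge>m. vb b (s i - s j)) \<Longrightarrow>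
      \<exists>x\<in>L. \<forall>b. \<exists>m. \<forall>i\<ge>m. vb b (s i - x)"

sublocale complete_valued \<subseteq> L: type_subring L
  by unfold_locales (auto intro: one_L diff_L mult_L)

context complete_valued
begin

lemma of_int_L: "of_int m \<in> L"
  by (cases m) (auto intro!: L.S_closed diff_L)

lemma divide_L: "x \<in> L \<Longrightarrow> y \<in> L \<Longrightarrow> x / y \<in> L"
  by (simp add: divide_inverse inverse_L mult_L)

lemma power_L: "x \<in> L \<Longrightarrow> x ^ m \<in> L"
  by (induction m) (auto intro: one_L mult_L)

lemma prod_L: "(\<And>i. i \<in> A \<Longrightarrow> f i \<in> L) \<Longrightarrow> prod f A \<in> L"
  by (induction A rule: infinite_finite_induct) (auto intro: one_L mult_L)

lemmas L_closed = L.S_closed of_int_L divide_L power_L prod_L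

abbreviation "Oint \<equiv> ring_of_integers ord L"

lemma Oint_iff: "x \<in> Oint \<longleftrightarrow> x \<in> L \<and> vb 0 x"
  by (auto simp: ring_of_integers_def vb_def zero_ereal_def)

lemma type_subring_Oint: "type_subring Oint"
  by unfold_locales (auto simp: Oint_iff one_L intro: L_closed vb_diff vb_mult0)

definition null_family :: "('i \<Rightarrow> 'f) \<Rightarrow> bool" where
  "null_family f \<longleftrightarrow> (\<forall>i. f i \<in> L) \<and> (\<forall>s::nat. finite {i. \<not> vb (real s) (f i)})"

text \<open>The unconditional sum of a null family: every finite set that contains all terms of
  order less than s gives its value modulo p^s. No enumeration of the index set enters.\<close>

definition nsum :: "('i \<Rightarrow> 'f) \<Rightarrow> 'f" where
  "nsum f = (SOME x. x \<in> L \<and> (\<forall>s::nat. \<forall>F. finite F \<and> {i. \<not> vb (real s) (f i)} \<subseteq> F \<longrightarrow> vb (real s) (x - sum f F)))"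

lemma sum_approx:
  assumes "finite F" "finite F'" "{i. \<not> vb b (f i)} \<subseteq> F" "{i. \<not> vb b (f i)} \<subseteq> F'"
  shows "vb b (sum f F - sum f F')"
proof -
  have "sum f F = sum f {i. \<not> vb b (f i)} + sum f (F - {i. \<not> vb b (f i)})"
    using assms by (subst sum.subset_diff) (auto simp: add.commute)
  moreover have "sum f F' = sum f {i. \<not> vb b (f i)} + sum f (F' - {i. \<not> vb b (f i)})"
    using assms by (subst sum.subset_diff) (auto simp: add.commute)
  moreover have "vb b (sum f (F - {i. \<not> vb b (f i)}))" "vb b (sum f (F' - {i. \<not> vb b (f i)}))"
    by (auto intro: vb_sum)
  ultimately show ?thesis using vb_diff by (simp add: add_diff_add)
qed

text \<open>The partial sums over the finite sets of terms of order less than s form a Cauchy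
  sequence in s, because enlarging such a set only adds terms of order at least s. The limit in
  \<open>L\<close> has the required approximations.\<close>

lemma nsum_props:
  assumes "null_family f"
  shows "nsum f \<in> L \<and> (\<forall>s::nat. \<forall>F. finite F \<and> {i. \<not> vb (real s) (f i)} \<subseteq> F \<longrightarrow> vb (real s) (nsum f - sum f F))"
  unfolding nsum_def
proof (rule someI_ex)
  let ?E = "\<lambda>s::nat. {i. \<not> vb (real s) (f i)}"
  have fin: "finite (?E s)" and fL: "f i \<in> L" for s i using assms by (auto simp: null_family_def)
  have mono: "?E s \<subseteq> ?E t" if "s \<le> t" for s t using that by (auto intro: vb_mono)
  have "\<exists>x\<in>L. \<forall>b. \<exists>m. \<forall>i\<ge>m. vb b (sum f (?E i) - x)"
  proof (rule complete_L)
    fix b :: real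
    show "\<exists>m. \<forall>i\<ge>m. \<forall>j\<ge>m. vb b (sum f (?E i) - sum f (?E j))"
    proof (intro exI allI impI)
      fix i j assume ij: "nat \<lceil>b\<rceil> \<le> i" "nat \<lceil>b\<rceil> \<le> j"
      have "vb (real (nat \<lceil>b\<rceil>)) (sum f (?E i) - sum f (?E j))"
        by (rule sum_approx[OF fin fin mono[OF ij(1)] mono[OF ij(2)]])
      then show "vb b (sum f (?E i) - sum f (?E j))" by (rule vb_mono) linarith
    qed
  qed (auto intro: L.sum_S fL)
  then obtain x where x: "x \<in> L" "\<And>b. \<exists>m. \<forall>i\<ge>m. vb b (sum f (?E i) - x)" by auto
  have "vb (real s) (x - sum f F)" if F: "finite F" "?E s \<subseteq> F" for s F
  proof -
    obtain m where m: "\<And>i. i \<ge> m \<Longrightarrow> vb (real s) (sum f (?E i) - x)" using x(2) by blast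
    have "vb (real s) (x - sum f (?E (max m s)))" using m[of "max m s"] vb_minus_commute by simp
    moreover have "vb (real s) (sum f (?E (max m s)) - sum f F)"
      by (rule sum_approx[OF fin F(1) mono F(2)]) simp
    ultimately show ?thesis by (rule vb_trans)
  qed
  then show "\<exists>x. x \<in> L \<and> (\<forall>s::nat. \<forall>F. finite F \<and> ?E s \<subseteq> F \<longrightarrow> vb (real s) (x - sum f F))"
    using x(1) by blast
qed

lemma nsum_L [simp, intro]: "null_family f \<Longrightarrow> nsum f \<in> L"
  using nsum_props by blast

lemma nsum_approx:
  "null_family f \<Longrightarrow> finite F \<Longrightarrow> {i. \<not> vb (real s) (f i)} \<subseteq> F \<Longrightarrow> vb (real s) (nsum f - sum f F)"
  using nsum_props by blast

lemma nsum_eqI: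
  assumes f: "null_family f"
    and "\<And>s::nat. \<exists>F. finite F \<and> {i. \<not> vb (real s) (f i)} \<subseteq> F \<and> vb (real s) (x - sum f F)"
  shows "nsum f = x"
proof (rule vb_all_eq)
  fix s :: nat
  obtain F where F: "finite F" "{i. \<not> vb (real s) (f i)} \<subseteq> F" "vb (real s) (x - sum f F)"
    using assms by blast
  show "vb (real s) (nsum f - x)"
    using nsum_approx[OF f F(1,2)] F(3) vb_trans vb_minus_commute by blast
qed

lemma null_family_add:
  assumes "null_family f" "null_family g"
  shows "null_family (\<lambda>i. f i + g i)"
proof -
  have "{i. \<not> vb (real s) (f i + g i)} \<subseteq> {i. \<not> vb (real s) (f i)} \<union> {i. \<not> vb (real s) (g i)}" for s
    using vb_add by blast
  from finite_subset[OF this] show ?thesis using assms unfolding null_family_def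
    by (auto intro: L_closed)
qed

lemma null_family_bounded:
  assumes "null_family f" "\<And>i. g i \<in> L" "\<And>i. vb 0 (g i)"
  shows "null_family (\<lambda>i. f i * g i)"
proof -
  have "{i. \<not> vb (real s) (f i * g i)} \<subseteq> {i. \<not> vb (real s) (f i)}" for s
    using assms(3) vb_mult0 by blast
  from finite_subset[OF this] show ?thesis using assms unfolding null_family_def
    by (auto intro: L_closed)
qed

lemma nsum_add:
  assumes f: "null_family f" and g: "null_family g"
  shows "nsum (\<lambda>i. f i + g i) = nsum f + nsum g"
proof (rule nsum_eqI[OF null_family_add[OF assms]])
  fix s :: nat
  let ?F = "{i. \<not> vb (real s) (f i)} \<union> {i. \<not> vb (real s) (g i)}"
  have fin: "finite ?F" using assms by (auto simp: null_family_def)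
  have "vb (real s) ((nsum f - sum f ?F) + (nsum g - sum g ?F))"
    using fin by (intro vb_add nsum_approx f g) auto
  then have "vb (real s) (nsum f + nsum g - (\<Sum>i\<in>?F. f i + g i))"
    by (simp add: sum.distrib algebra_simps)
  then show "\<exists>F. finite F \<and> {i. \<not> vb (real s) (f i + g i)} \<subseteq> F \<and> vb (real s) (nsum f + nsum g - (\<Sum>i\<in>F. f i + g i))"
    using fin by (intro exI[of _ ?F]) (auto intro: vb_add)
qed

lemma nsum_cmult:
  assumes f: "null_family f" and c: "c \<in> Oint"
  shows "nsum (\<lambda>i. c * f i) = c * nsum f"
proof (rule nsum_eqI)
  have c': "c \<in> L" "vb 0 c" using c by (auto simp: Oint_iff)
  show "null_family (\<lambda>i. c * f i)"
    using null_family_bounded[OF f, of "\<lambda>_. c"] c' by (simp add: mult.commute)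
  fix s :: nat
  let ?F = "{i. \<not> vb (real s) (f i)}"
  have fin: "finite ?F" using assms by (auto simp: null_family_def)
  have "vb (real s) (c * (nsum f - sum f ?F))"
    using fin c' by (intro vb_mult0 nsum_approx f) auto
  then show "\<exists>F. finite F \<and> {i. \<not> vb (real s) (c * f i)} \<subseteq> F \<and> vb (real s) (c * nsum f - (\<Sum>i\<in>F. c * f i))"
    using fin c' by (intro exI[of _ ?F]) (auto simp: sum_distrib_left algebra_simps intro: vb_mult0)
qed

lemma null_family_finite: "(\<And>i. f i \<in> L) \<Longrightarrow> finite {i. f i \<noteq> 0} \<Longrightarrow> null_family f"
  unfolding null_family_def by (auto elim!: finite_subset[rotated])

lemma nsum_finite:
  assumes "\<And>i. f i \<in> L" "finite F" "\<And>i. i \<notin> F \<Longrightarrow> f i = 0"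
  shows "nsum f = sum f F"
proof (rule nsum_eqI)
  have "{i. f i \<noteq> 0} \<subseteq> F" using assms by auto
  then show "null_family f" using assms finite_subset by (intro null_family_finite) auto
  fix s :: nat
  show "\<exists>F'. finite F' \<and> {i. \<not> vb (real s) (f i)} \<subseteq> F' \<and> vb (real s) (sum f F - sum f F')"
    using assms by (intro exI[of _ F]) (auto intro: ccontr)
qed

lemma nsum_vb:
  assumes f: "null_family f" and b: "\<And>i. vb b (f i)"
  shows "vb b (nsum f)"
proof -
  let ?s = "nat \<lceil>b\<rceil>"
  let ?F = "{i. \<not> vb (real ?s) (f i)}"
  have "finite ?F" using f by (auto simp: null_family_def)
  then have "vb (real ?s) (nsum f - sum f ?F)" by (intro nsum_approx f) auto
  then have "vb b (nsum f - sum f ?F)" by (rule vb_mono) linarith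
  moreover have "vb b (sum f ?F)" using b by (intro vb_sum)
  ultimately show ?thesis using vb_diff_iff by blast
qed

text \<open>The p-adic completion of the free O_q-module on \<open>I\<close>, realised as families
  of integers of \<open>L\<close> that tend to zero. The elements of O, C, H^n and S_k are all
  described by families of this kind.\<close>

definition nfun :: "'i set \<Rightarrow> ('i \<Rightarrow> 'f) set" where
  "nfun I = {f. null_family f \<and> (\<forall>i. vb 0 (f i)) \<and> (\<forall>i. i \<notin> I \<longrightarrow> f i = 0)}"

lemma nfunD:
  assumes "f \<in> nfun I"
  shows "null_family f" "f i \<in> L" "vb 0 (f i)" "i \<notin> I \<Longrightarrow> f i = 0" "f i \<in> Oint"
    "finite {i. \<not> vb (real s) (f i)}"
  using assms by (auto simp: nfun_def null_family_def Oint_iff)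

lemma nfunI:
  assumes "\<And>i. i \<in> I \<Longrightarrow> f i \<in> Oint" "\<And>i. i \<notin> I \<Longrightarrow> f i = 0"
    "\<And>s::nat. finite {i \<in> I. \<not> vb (real s) (f i)}"
  shows "f \<in> nfun I"
proof -
  have a: "f i \<in> L \<and> vb 0 (f i)" for i
    using assms(1,2)[of i] L.zero_S by (cases "i \<in> I") (auto simp: Oint_iff)
  have "{i. \<not> vb (real s) (f i)} = {i \<in> I. \<not> vb (real s) (f i)}" for s
    using assms(2) by (auto intro: ccontr)
  then show ?thesis using a assms(2,3) by (simp add: nfun_def null_family_def)
qed

lemma nfun_zero [simp, intro]: "(\<lambda>_. 0) \<in> nfun I"
  by (auto simp: nfun_def null_family_def L.zero_S)

lemma nfun_add: "f \<in> nfun I \<Longrightarrow> g \<in> nfun I \<Longrightarrow> (\<lambda>i. f i + g i) \<in> nfun I"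
  by (auto simp: nfun_def intro: null_family_add vb_add)

lemma nfun_smult: "c \<in> Oint \<Longrightarrow> f \<in> nfun I \<Longrightarrow> (\<lambda>i. c * f i) \<in> nfun I"
  using null_family_bounded[of f "\<lambda>_. c"]
  by (auto simp: nfun_def Oint_iff mult.commute intro: vb_mult0)

lemma Oint_1 [simp]: "1 \<in> Oint" "0 \<in> Oint" "- 1 \<in> Oint" "of_nat m \<in> Oint" "of_int z \<in> Oint"
  by (auto simp: Oint_iff intro: L_closed)

lemma nfun_uminus: "f \<in> nfun I \<Longrightarrow> (\<lambda>i. - f i) \<in> nfun I"
  using nfun_smult[of "-1" f] by simp

lemma nfun_diff: "f \<in> nfun I \<Longrightarrow> g \<in> nfun I \<Longrightarrow> (\<lambda>i. f i - g i) \<in> nfun I"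
  using nfun_add[of f I "\<lambda>i. - g i"] nfun_uminus[of g I] by simp

lemma nfun_sum: "(\<And>a. a \<in> A \<Longrightarrow> f a \<in> nfun I) \<Longrightarrow> (\<lambda>i. \<Sum>a\<in>A. f a i) \<in> nfun I"
  by (induction A rule: infinite_finite_induct) (auto intro: nfun_add)

lemma nfun_finite:
  assumes "finite F" "\<And>i. i \<in> F \<Longrightarrow> f i \<in> Oint" "\<And>i. i \<notin> F \<Longrightarrow> f i = 0" "F \<subseteq> I"
  shows "f \<in> nfun I"
proof (rule nfunI)
  show "f i \<in> Oint" for i using assms(2,3)[of i] by (cases "i \<in> F") auto
  show "finite {i \<in> I. \<not> vb (real s) (f i)}" for s
    by (rule finite_subset[OF _ assms(1)]) (use assms(3) in \<open>auto intro: ccontr\<close>)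
qed (use assms in auto)

text \<open>Division by p^s lowers every order by exactly s, so the entries of order below t after
  the division had order below t + s before. This is the division step of all successive
  approximations.\<close>

lemma nfun_div_p:
  assumes f: "f \<in> nfun I" and d: "\<And>i. vb (real s) (f i)"
  shows "(\<lambda>i. f i / of_nat p ^ s) \<in> nfun I"
proof (rule nfunI)
  have v: "vb (b - real s) (f i / of_nat p ^ s)" if "vb b (f i)" for i b
    by (rule vb_divide[OF that ord_p_power])
  show "f i / of_nat p ^ s \<in> Oint" for i
    using nfunD(2)[OF f, of i] v[OF d] by (auto simp: Oint_iff intro!: L_closed)
  show "finite {i \<in> I. \<not> vb (real t) (f i / of_nat p ^ s)}" for t
  proof (rule finite_subset)
    show "{i \<in> I. \<not> vb (real t) (f i / of_nat p ^ s)} \<subseteq> {i. \<not> vb (real (t + s)) (f i)}"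
      using v[of "real (t + s)"] by auto
  qed (rule nfunD(6)[OF f])
qed (use nfunD[OF f] in auto)

definition eps :: "'i \<Rightarrow> 'i \<Rightarrow> 'f" where
  "eps i = (\<lambda>j. if j = i then 1 else 0)"

lemma eps_nfun: "i \<in> I \<Longrightarrow> eps i \<in> nfun I"
  by (rule nfun_finite[of "{i}"]) (auto simp: eps_def)

definition nlinear :: "'i set \<Rightarrow> 'j set \<Rightarrow> (('i \<Rightarrow> 'f) \<Rightarrow> 'j \<Rightarrow> 'f) \<Rightarrow> bool" where
  "nlinear I J \<Phi> \<longleftrightarrow> (\<forall>x\<in>nfun I. \<Phi> x \<in> nfun J) \<and>
     (\<forall>x\<in>nfun I. \<forall>y\<in>nfun I. \<forall>j. \<Phi> (\<lambda>i. x i + y i) j = \<Phi> x j + \<Phi> y j) \<and>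
     (\<forall>c\<in>Oint. \<forall>x\<in>nfun I. \<forall>j. \<Phi> (\<lambda>i. c * x i) j = c * \<Phi> x j)"

lemma nlinearI:
  assumes "\<And>x. x \<in> nfun I \<Longrightarrow> \<Phi> x \<in> nfun J"
    "\<And>x y j. x \<in> nfun I \<Longrightarrow> y \<in> nfun I \<Longrightarrow> \<Phi> (\<lambda>i. x i + y i) j = \<Phi> x j + \<Phi> y j"
    "\<And>c x j. c \<in> Oint \<Longrightarrow> x \<in> nfun I \<Longrightarrow> \<Phi> (\<lambda>i. c * x i) j = c * \<Phi> x j"
  shows "nlinear I J \<Phi>"
  using assms by (auto simp: nlinear_def)

lemma nlinearD:
  assumes "nlinear I J \<Phi>"
  shows "x \<in> nfun I \<Longrightarrow> \<Phi> x \<in> nfun J"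
    "x \<in> nfun I \<Longrightarrow> y \<in> nfun I \<Longrightarrow> \<Phi> (\<lambda>i. x i + y i) = (\<lambda>j. \<Phi> x j + \<Phi> y j)"
    "c \<in> Oint \<Longrightarrow> x \<in> nfun I \<Longrightarrow> \<Phi> (\<lambda>i. c * x i) = (\<lambda>j. c * \<Phi> x j)"
  using assms by (auto simp: nlinear_def)

lemma nlinear_zero: "nlinear I J \<Phi> \<Longrightarrow> \<Phi> (\<lambda>_. 0) = (\<lambda>_. 0)"
  using nlinearD(3)[of I J \<Phi> 0 "\<lambda>_. 0"] by simp

lemma nlinear_diff:
  assumes "nlinear I J \<Phi>" "x \<in> nfun I" "y \<in> nfun I"
  shows "\<Phi> (\<lambda>i. x i - y i) = (\<lambda>j. \<Phi> x j - \<Phi> y j)"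
proof -
  have "\<Phi> (\<lambda>i. x i + (- 1) * y i) = (\<lambda>j. \<Phi> x j + \<Phi> (\<lambda>i. (- 1) * y i) j)"
    by (rule nlinearD(2)[OF assms(1,2) nfun_smult[OF _ assms(3)]]) simp
  also have "\<Phi> (\<lambda>i. (- 1) * y i) = (\<lambda>j. (- 1) * \<Phi> y j)"
    by (rule nlinearD(3)[OF assms(1) _ assms(3)]) simp
  finally show ?thesis by simp
qed

lemma nlinear_sum:
  assumes "nlinear I J \<Phi>" "finite A" "\<And>a. a \<in> A \<Longrightarrow> x a \<in> nfun I"
  shows "\<Phi> (\<lambda>i. \<Sum>a\<in>A. x a i) = (\<lambda>j. \<Sum>a\<in>A. \<Phi> (x a) j)"
  using assms(2,3)
proof (induction A rule: finite_induct)
  case (insert a A)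
  have "\<Phi> (\<lambda>i. x a i + (\<Sum>a\<in>A. x a i)) = (\<lambda>j. \<Phi> (x a) j + \<Phi> (\<lambda>i. \<Sum>a\<in>A. x a i) j)"
    using insert by (intro nlinearD(2)[OF assms(1)] nfun_sum) auto
  then show ?case using insert by simp
qed (simp add: nlinear_zero[OF assms(1)])

lemma nlinear_comp: "nlinear I J \<Phi> \<Longrightarrow> nlinear J K \<Psi> \<Longrightarrow> nlinear I K (\<lambda>x. \<Psi> (\<Phi> x))"
  by (rule nlinearI) (simp_all add: nlinearD)

lemma nlinear_plus:
  "nlinear I J \<Phi> \<Longrightarrow> nlinear I J \<Psi> \<Longrightarrow> nlinear I J (\<lambda>x j. \<Phi> x j + \<Psi> x j)"
  by (rule nlinearI) (simp_all add: nlinearD nfun_add algebra_simps)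

lemma nlinear_minus:
  "nlinear I J \<Phi> \<Longrightarrow> nlinear I J \<Psi> \<Longrightarrow> nlinear I J (\<lambda>x j. \<Phi> x j - \<Psi> x j)"
  by (rule nlinearI) (simp_all add: nlinearD nfun_diff algebra_simps)

lemma nlinear_setsum:
  assumes "\<And>a. a \<in> A \<Longrightarrow> nlinear I J (\<Phi> a)"
  shows "nlinear I J (\<lambda>x j. \<Sum>a\<in>A. \<Phi> a x j)"
  using assms
proof (induction A rule: infinite_finite_induct)
  case (insert a A)
  then show ?case using nlinear_plus[of I J "\<Phi> a" "\<lambda>x j. \<Sum>a\<in>A. \<Phi> a x j"] by simp
qed (auto simp: nlinear_def)

lemma finite_part:
  assumes x: "x \<in> nfun I" and F: "finite F"
  shows "(\<lambda>i. if i \<in> F then x i else 0) \<in> nfun I"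
    and "nlinear I J \<Phi> \<Longrightarrow> F \<subseteq> I \<Longrightarrow> \<Phi> (\<lambda>i. if i \<in> F then x i else 0) = (\<lambda>j. \<Sum>i\<in>F. x i * \<Phi> (eps i) j)"
proof -
  have "{i \<in> I. \<not> vb (real s) (if i \<in> F then x i else 0)} \<subseteq> F" for s by auto
  then show "(\<lambda>i. if i \<in> F then x i else 0) \<in> nfun I"
    using nfunD[OF x] F finite_subset by (intro nfunI) auto
  assume \<Phi>: "nlinear I J \<Phi>" and FI: "F \<subseteq> I"
  have "(\<lambda>i. if i \<in> F then x i else 0) = (\<lambda>i. \<Sum>a\<in>F. x a * eps a i)"
    using F by (auto simp: eps_def if_distrib cong: if_cong)
  then have "\<Phi> (\<lambda>i. if i \<in> F then x i else 0) = \<Phi> (\<lambda>i. \<Sum>a\<in>F. x a * eps a i)" by simp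
  also have "\<dots> = (\<lambda>j. \<Sum>a\<in>F. \<Phi> (\<lambda>i. x a * eps a i) j)"
    using F FI nfunD(5)[OF x] by (intro nlinear_sum[OF \<Phi>] nfun_smult eps_nfun) auto
  also have "\<dots> = (\<lambda>j. \<Sum>i\<in>F. x i * \<Phi> (eps i) j)"
    using FI nfunD(5)[OF x] nlinearD(3)[OF \<Phi> _ eps_nfun] by (intro ext sum.cong) auto
  finally show "\<Phi> (\<lambda>i. if i \<in> F then x i else 0) = (\<lambda>j. \<Sum>i\<in>F. x i * \<Phi> (eps i) j)" .
qed

text \<open>Linear maps are automatically continuous for the \<open>p\<close>-adic topology.\<close>

lemma nlinear_vb:
  assumes \<Phi>: "nlinear I J \<Phi>" and x: "x \<in> nfun I" and v: "\<And>i. vb (real s) (x i)"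
  shows "vb (real s) (\<Phi> x j)"
proof -
  define y where "y = (\<lambda>i. x i / of_nat p ^ s)"
  have y: "y \<in> nfun I" unfolding y_def by (rule nfun_div_p[OF x v])
  have "x = (\<lambda>i. of_nat p ^ s * y i)" by (auto simp: y_def)
  moreover have "(of_nat p :: 'f) ^ s \<in> Oint"
    by (auto simp: Oint_iff intro: L_closed vb_mono[of "real s"] simp: vb_def ord_p_power zero_ereal_def)
  ultimately have "\<Phi> x j = of_nat p ^ s * \<Phi> y j" using nlinearD(3)[OF \<Phi> _ y] by simp
  then show ?thesis using nfunD(3)[OF nlinearD(1)[OF \<Phi> y]] by (simp add: vb_p_power_mult)
qed

lemma nlinear_approx:
  assumes \<Phi>: "nlinear I J \<Phi>" and x: "x \<in> nfun I"
    and F: "finite F" "F \<subseteq> I" "{i. \<not> vb (real s) (x i)} \<subseteq> F"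
  shows "vb (real s) (\<Phi> x j - (\<Sum>i\<in>F. x i * \<Phi> (eps i) j))"
proof -
  let ?y = "\<lambda>i. if i \<in> F then x i else 0"
  have y: "?y \<in> nfun I" by (rule finite_part[OF x F(1)])
  have "vb (real s) (\<Phi> (\<lambda>i. x i - ?y i) j)"
    by (rule nlinear_vb[OF \<Phi> nfun_diff[OF x y]]) (use F in auto)
  then show ?thesis
    unfolding nlinear_diff[OF \<Phi> x y] finite_part(2)[OF x F(1) \<Phi> F(2)] .
qed

text \<open>Modulo p^s a null family is a finite combination of unit vectors, and this for every s.
  Identities between operators are therefore checked on monomials only.\<close>

lemma nlinear_ext:
  assumes \<Phi>: "nlinear I J \<Phi>" and \<Psi>: "nlinear I J \<Psi>" and x: "x \<in> nfun I"
    and eq: "\<And>i. i \<in> I \<Longrightarrow> \<Phi> (eps i) = \<Psi> (eps i)"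
  shows "\<Phi> x = \<Psi> x"
proof (intro ext vb_all_eq)
  fix j and s :: nat
  let ?F = "{i. \<not> vb (real s) (x i)}"
  have F: "finite ?F" "?F \<subseteq> I" using nfunD[OF x] by (auto intro: ccontr)
  have "(\<Sum>i\<in>?F. x i * \<Phi> (eps i) j) = (\<Sum>i\<in>?F. x i * \<Psi> (eps i) j)"
    using F eq by (intro sum.cong) auto
  then show "vb (real s) (\<Phi> x j - \<Psi> x j)"
    using nlinear_approx[OF \<Phi> x F order.refl, of j] nlinear_approx[OF \<Psi> x F order.refl, of j]
      vb_trans vb_minus_commute by metis
qed

definition nlin_ext :: "('i \<Rightarrow> 'j \<Rightarrow> 'f) \<Rightarrow> ('i \<Rightarrow> 'f) \<Rightarrow> 'j \<Rightarrow> 'f" where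
  "nlin_ext w x = (\<lambda>j. nsum (\<lambda>i. x i * w i j))"

text \<open>Any assignment of null families to the unit vectors extends: the coefficients
  \<open>x i\<close> tend to zero, so modulo p^s only finitely many \<open>w i\<close> contribute,
  and each of them is itself a null family. No uniformity in \<open>i\<close> is required.\<close>

lemma nlin_ext:
  assumes w: "\<And>i. i \<in> I \<Longrightarrow> w i \<in> nfun J" and w0: "\<And>i. i \<notin> I \<Longrightarrow> w i = (\<lambda>_. 0)"
  shows "nlinear I J (nlin_ext w)" and "i \<in> I \<Longrightarrow> nlin_ext w (eps i) = w i"
proof -
  have w': "w i \<in> nfun J" for i using w w0 by (cases "i \<in> I") auto
  have nf: "null_family (\<lambda>i. x i * w i j)" if "x \<in> nfun I" for x j
    using nfunD[OF that] nfunD[OF w'] by (intro null_family_bounded) auto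
  show "nlinear I J (nlin_ext w)"
  proof (rule nlinearI)
    fix x assume x: "x \<in> nfun I"
    show "nlin_ext w x \<in> nfun J"
    proof (rule nfunI)
      fix j show "nlin_ext w x j \<in> Oint"
        unfolding nlin_ext_def Oint_iff using nfunD[OF x] nfunD[OF w']
        by (intro conjI nsum_L nsum_vb nf x vb_mult0) auto
    next
      fix j assume "j \<notin> J"
      then have "(\<lambda>i. x i * w i j) = (\<lambda>i. 0)" using nfunD(4)[OF w'] by auto
      then show "nlin_ext w x j = 0" using nsum_finite[of "\<lambda>_. 0" "{}"] L.zero_S by (simp add: nlin_ext_def)
    next
      fix s :: nat
      let ?F = "{i. \<not> vb (real s) (x i)}"
      have fin: "finite (\<Union>i\<in>?F. {j. \<not> vb (real s) (w i j)})"
        using nfunD(6)[OF x] nfunD(6)[OF w'] by blast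
      have "vb (real s) (nlin_ext w x j)" if "\<And>i. i \<in> ?F \<Longrightarrow> vb (real s) (w i j)" for j
        unfolding nlin_ext_def
      proof (rule nsum_vb[OF nf[OF x]])
        fix i show "vb (real s) (x i * w i j)"
          using that[of i] nfunD(3)[OF x, of i] nfunD(3)[OF w', of i j] vb_mult0 by (cases "i \<in> ?F") auto
      qed
      then have "{j \<in> J. \<not> vb (real s) (nlin_ext w x j)} \<subseteq> (\<Union>i\<in>?F. {j. \<not> vb (real s) (w i j)})" by blast
      then show "finite {j \<in> J. \<not> vb (real s) (nlin_ext w x j)}" using fin finite_subset by blast
    qed
  next
    fix x y j assume "x \<in> nfun I" "y \<in> nfun I"
    then show "nlin_ext w (\<lambda>i. x i + y i) j = nlin_ext w x j + nlin_ext w y j"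
      by (simp add: nlin_ext_def algebra_simps nsum_add[OF nf nf])
  next
    fix c x j assume "c \<in> Oint" "x \<in> nfun I"
    then show "nlin_ext w (\<lambda>i. c * x i) j = c * nlin_ext w x j"
      by (simp add: nlin_ext_def mult.assoc nsum_cmult[OF nf])
  qed
  show "nlin_ext w (eps i) = w i" if "i \<in> I"
  proof
    fix j
    have "nsum (\<lambda>a. eps i a * w a j) = (\<Sum>a\<in>{i}. eps i a * w a j)"
      using nfunD[OF w'] by (intro nsum_finite) (auto simp: eps_def L.zero_S)
    then show "nlin_ext w (eps i) j = w i j" by (simp add: nlin_ext_def eps_def)
  qed
qed

end

section \<open>Graded maps: invertibility modulo p and its consequences\<close>

context complete_valued
begin

text \<open>\<open>Ns = {}\<close> imposes no condition; thus the statements about the filtration include those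
  without it.\<close>

definition in_level :: "('i \<Rightarrow> nat) \<Rightarrow> real set \<Rightarrow> ('i \<Rightarrow> 'f) \<Rightarrow> bool" where
  "in_level d Ns x \<longleftrightarrow> (\<forall>N\<in>Ns. \<forall>i. vb (real (d i) - N) (x i))"

lemma in_level_zero [simp]: "in_level d Ns (\<lambda>_. 0)"
  by (simp add: in_level_def)

lemma in_level_empty [simp]: "in_level d {} x"
  by (simp add: in_level_def)

lemma in_level_add: "in_level d Ns x \<Longrightarrow> in_level d Ns y \<Longrightarrow> in_level d Ns (\<lambda>i. x i + y i)"
  by (auto simp: in_level_def intro: vb_add)

lemma in_level_diff: "in_level d Ns x \<Longrightarrow> in_level d Ns y \<Longrightarrow> in_level d Ns (\<lambda>i. x i - y i)"
  by (auto simp: in_level_def intro: vb_diff)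

lemma in_level_smult: "c \<in> Oint \<Longrightarrow> in_level d Ns x \<Longrightarrow> in_level d Ns (\<lambda>i. c * x i)"
  by (auto simp: in_level_def Oint_iff intro: vb_mult0)

end

text \<open>A linear map whose part of degree zero is an integer matrix that is invertible modulo \<open>p\<close>;
  terms of negative degree are arbitrary, since they are nilpotent modulo \<open>p\<close> on null families,
  and terms of positive degree \<open>d\<close> are divisible by \<open>p\<^sup>d\<close>.\<close>

locale graded_map = complete_valued ord p L for ord :: "'f::field \<Rightarrow> ereal" and p L +
  fixes I :: "'i set" and J :: "'j set" and dI :: "'i \<Rightarrow> nat" and dJ :: "'j \<Rightarrow> nat"
    and \<Phi> :: "('i \<Rightarrow> 'f) \<Rightarrow> 'j \<Rightarrow> 'f" and T :: "'i \<Rightarrow> 'j \<Rightarrow> int" and U :: "'j \<Rightarrow> 'i \<Rightarrow> int"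
  assumes lin: "nlinear I J \<Phi>"
    and finI: "finite {i \<in> I. dI i = N}" and finJ: "finite {j \<in> J. dJ j = N}"
    and T_hom: "i \<in> I \<Longrightarrow> j \<in> J \<Longrightarrow> dI i \<noteq> dJ j \<Longrightarrow> T i j = 0"
    and main: "i \<in> I \<Longrightarrow> j \<in> J \<Longrightarrow> dI i \<le> dJ j \<Longrightarrow> vb 1 (\<Phi> (eps i) j - of_int (T i j))"
    and bdd: "i \<in> I \<Longrightarrow> j \<in> J \<Longrightarrow> vb (real (dJ j) - real (dI i)) (\<Phi> (eps i) j)"
    and inv1: "j \<in> J \<Longrightarrow> j' \<in> J \<Longrightarrow> dJ j' = dJ j \<Longrightarrow>
      int p dvd (\<Sum>i | i \<in> I \<and> dI i = dJ j. U j i * T i j') - (if j = j' then 1 else 0)"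
    and inv2: "i \<in> I \<Longrightarrow> i' \<in> I \<Longrightarrow> dI i' = dI i \<Longrightarrow>
      int p dvd (\<Sum>j | j \<in> J \<and> dJ j = dI i. T i j * U j i') - (if i = i' then 1 else 0)"
begin

text \<open>Modulo p the value is a finite combination of columns \<open>i\<close> of degree at most
  \<open>N\<close>. For such \<open>i\<close>, and \<open>dJ j\<close> at least \<open>N\<close>,
  the entry agrees modulo p with \<open>T i j\<close>, which vanishes unless the degrees are
  equal.\<close>

lemma top_part:
  assumes x: "x \<in> nfun I" and h: "\<And>i. i \<in> I \<Longrightarrow> dI i > N \<Longrightarrow> vb 1 (x i)" and j: "j \<in> J"
  shows "dJ j = N \<Longrightarrow> vb 1 (\<Phi> x j - (\<Sum>i | i \<in> I \<and> dI i = N. x i * of_int (T i j)))"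
    and "dJ j > N \<Longrightarrow> vb 1 (\<Phi> x j)"
proof -
  define F where "F = {i. \<not> vb (real 1) (x i)} \<union> {i \<in> I. dI i = N}"
  have F: "finite F" "F \<subseteq> I" "{i. \<not> vb (real 1) (x i)} \<subseteq> F"
    using nfunD(4)[OF x] nfunD(6)[OF x, of 1] finI by (auto simp: F_def intro: ccontr)
  have le: "dI i \<le> N" if "i \<in> F" for i
    using that h[of i] F(2) by (force simp: F_def not_less[symmetric])
  have ap: "vb 1 (\<Phi> x j - (\<Sum>i\<in>F. x i * \<Phi> (eps i) j))"
    using nlinear_approx[OF lin x F, of j] by simp
  have "vb 1 ((\<Sum>i\<in>F. x i * \<Phi> (eps i) j) - (\<Sum>i\<in>F. x i * of_int (T i j)))" if "dJ j \<ge> N"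
    unfolding sum_subtractf[symmetric] right_diff_distrib[symmetric]
    using le F(2) main[OF _ j] nfunD(3)[OF x] that by (intro vb_sum vb_mult0(1)) (auto intro: order.trans)
  with ap have 1: "vb 1 (\<Phi> x j - (\<Sum>i\<in>F. x i * of_int (T i j)))" if "dJ j \<ge> N"
    using that vb_trans by blast
  show "vb 1 (\<Phi> x j - (\<Sum>i | i \<in> I \<and> dI i = N. x i * of_int (T i j)))" if N: "dJ j = N"
  proof -
    have TZ: "T i j = 0" if "i \<in> F" "dI i \<noteq> N" for i
      using that F(2) N by (intro T_hom j) auto
    have "(\<Sum>i | i \<in> I \<and> dI i = N. x i * of_int (T i j)) = (\<Sum>i\<in>F. x i * of_int (T i j))"
    proof (rule sum.mono_neutral_left[OF F(1)])
      show "{i. i \<in> I \<and> dI i = N} \<subseteq> F" by (auto simp: F_def)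
      show "\<forall>i\<in>F - {i. i \<in> I \<and> dI i = N}. x i * of_int (T i j) = 0"
      proof
        fix i assume "i \<in> F - {i. i \<in> I \<and> dI i = N}"
        then have "T i j = 0" using TZ[of i] F(2) by blast
        then show "x i * of_int (T i j) = 0" by simp
      qed
    qed
    then show ?thesis using 1 N by simp
  qed
  show "vb 1 (\<Phi> x j)" if N: "dJ j > N"
  proof -
    have "T i j = 0" if "i \<in> F" for i using le[OF that] F(2) that N j by (intro T_hom) auto
    then have "(\<Sum>i\<in>F. x i * of_int (T i j)) = 0" by (intro sum.neutral) auto
    then show ?thesis using 1 N by simp
  qed
qed

text \<open>If \<open>x\<close> is nonzero modulo p, there is a highest degree in which this
  happens, because \<open>x\<close> is a null family. There the lower degrees do not interfere,
  \<open>\<Phi>\<close> acts as \<open>T\<close>, and multiplication by \<open>U\<close> recovers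
  the entries.\<close>

lemma injective_mod_p:
  assumes x: "x \<in> nfun I" and v: "\<And>j. j \<in> J \<Longrightarrow> vb 1 (\<Phi> x j)"
  shows "vb 1 (x i)"
proof (rule ccontr)
  assume "\<not> vb 1 (x i)"
  define E where "E = {i. \<not> vb (real 1) (x i)}"
  have E: "finite E" "i \<in> E" "E \<subseteq> I"
    using nfunD(4)[OF x] nfunD(6)[OF x, of 1] \<open>\<not> vb 1 (x i)\<close> by (auto simp: E_def intro: ccontr)
  define N where "N = Max (dI ` E)"
  have "N \<in> dI ` E" unfolding N_def using E by (intro Max_in) auto
  then obtain a where a: "a \<in> E" "dI a = N" by auto
  have h: "vb 1 (x i)" if "dI i > N" for i
  proof (rule ccontr)
    assume "\<not> vb 1 (x i)"
    then have "dI i \<le> N" unfolding N_def using E by (intro Max_ge) (auto simp: E_def)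
    then show False using that by simp
  qed
  let ?I = "{i. i \<in> I \<and> dI i = N}" and ?J = "{j. j \<in> J \<and> dJ j = N}"
  have 1: "vb 1 (\<Sum>i\<in>?I. x i * of_int (T i j))" if "j \<in> ?J" for j
    
  proof -
    have "vb 1 (\<Phi> x j - (\<Sum>i\<in>?I. x i * of_int (T i j)))"
      using that by (intro top_part(1)[OF x h]) auto
    then show ?thesis using vb_diff_iff v[of j] that by blast
  qed
  have "vb 1 (\<Sum>j\<in>?J. (\<Sum>i\<in>?I. x i * of_int (T i j)) * of_int (U j a))"
    by (rule vb_sum, rule vb_mult0(2)[OF 1]) auto
  also have "(\<Sum>j\<in>?J. (\<Sum>i\<in>?I. x i * of_int (T i j)) * of_int (U j a)) =
      (\<Sum>i\<in>?I. x i * of_int (\<Sum>j\<in>?J. T i j * U j a))"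
    unfolding sum_distrib_right of_int_sum sum_distrib_left by (subst sum.swap) (simp add: mult.assoc)
  finally have 2: "vb 1 (\<Sum>i\<in>?I. x i * of_int (\<Sum>j\<in>?J. T i j * U j a))" .
  have "vb 1 (\<Sum>i\<in>?I. x i * of_int ((\<Sum>j\<in>?J. T i j * U j a) - (if i = a then 1 else 0)))"
  proof (intro vb_sum vb_mult0(1) nfunD(3)[OF x] vb_of_int_dvd)
    fix i assume "i \<in> ?I"
    then show "int p dvd (\<Sum>j\<in>?J. T i j * U j a) - (if i = a then 1 else 0)"
      using inv2[of i a] a E by auto
  qed
  then have "vb 1 ((\<Sum>i\<in>?I. x i * of_int (\<Sum>j\<in>?J. T i j * U j a)) - (\<Sum>i\<in>?I. if i = a then x i else 0))"
    unfolding sum_subtractf[symmetric] by (simp add: algebra_simps if_distrib cong: if_cong)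
  also have "(\<Sum>i\<in>?I. if i = a then x i else 0) = x a"
    using a E(3) finI by (auto simp: subset_iff)
  finally have "vb 1 (x a)" using 2 vb_diff_iff by blast
  then show False using a by (simp add: E_def)
qed

text \<open>A difference z in the kernel is divisible by p, and z / p is again in the kernel; so z
  is divisible by every power of p and vanishes.\<close>

lemma injective:
  assumes x: "x \<in> nfun I" and y: "y \<in> nfun I" and eq: "\<And>j. j \<in> J \<Longrightarrow> \<Phi> x j = \<Phi> y j"
  shows "x = y"
proof -
  define z where "z = (\<lambda>i. x i - y i)"
  have z: "z \<in> nfun I" unfolding z_def by (rule nfun_diff[OF x y])
  have zero: "\<Phi> z j = 0" for j
    using eq[of j] nfunD(4)[OF nlinearD(1)[OF lin z], of j]
    unfolding z_def nlinear_diff[OF lin x y] by (cases "j \<in> J") auto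
  have "vb (real s) (z i)" for s i
  proof -
    have "\<forall>i. vb (real s) (z i)"
    proof (induction s)
      case (Suc s)
      define w where "w = (\<lambda>i. z i / of_nat p ^ s)"
      have w: "w \<in> nfun I" unfolding w_def using Suc by (intro nfun_div_p[OF z]) auto
      have zw: "z = (\<lambda>i. of_nat p ^ s * w i)" by (auto simp: w_def)
      have "(of_nat p :: 'f) ^ s \<in> Oint" using Oint_1(4)[of "p ^ s"] by simp
      then have "\<Phi> z j = of_nat p ^ s * \<Phi> w j" for j
        using nlinearD(3)[OF lin _ w] zw by simp
      then have "\<Phi> w j = 0" for j using zero[of j] by simp
      then have "vb 1 (w i)" for i by (intro injective_mod_p[OF w]) auto
      then show ?case unfolding zw by (auto simp: vb_p_power_mult)
    qed (use nfunD(3)[OF z] in auto)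
    then show ?thesis by blast
  qed
  then have "z i = 0" for i by (rule vb_all_zero)
  then show ?thesis by (auto simp: z_def fun_eq_iff)
qed

text \<open>The bounds compose: order at least \<open>dI i - N\<close> of an entry of
  \<open>x\<close> and order at least \<open>dJ j - dI i\<close> of a matrix entry add up to
  \<open>dJ j - N\<close>. Replacing \<open>x\<close> by a finite part costs only a term within the
  same bound.\<close>

lemma in_level_map:
  assumes x: "x \<in> nfun I" and l: "in_level dI Ns x"
  shows "in_level dJ Ns (\<Phi> x)"
  unfolding in_level_def
proof (intro ballI allI)
  fix N j assume N: "N \<in> Ns"
  show "vb (real (dJ j) - N) (\<Phi> x j)"
  proof (cases "j \<in> J")
    case False
    then show ?thesis using nfunD(4)[OF nlinearD(1)[OF lin x]] by simp
  next
    case True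
    define s where "s = nat \<lceil>real (dJ j) - N\<rceil>"
    define F where "F = {i. \<not> vb (real s) (x i)}"
    have F: "finite F" "F \<subseteq> I" using nfunD[OF x] by (auto simp: F_def intro: ccontr)
    have "vb (real s) (\<Phi> x j - (\<Sum>i\<in>F. x i * \<Phi> (eps i) j))"
      by (rule nlinear_approx[OF lin x F]) (simp add: F_def)
    then have "vb (real (dJ j) - N) (\<Phi> x j - (\<Sum>i\<in>F. x i * \<Phi> (eps i) j))"
      by (rule vb_mono) (simp add: s_def, linarith)
    moreover have "vb (real (dJ j) - N) (\<Sum>i\<in>F. x i * \<Phi> (eps i) j)"
    proof (rule vb_sum)
      fix i assume "i \<in> F"
      then have "vb ((real (dI i) - N) + (real (dJ j) - real (dI i))) (x i * \<Phi> (eps i) j)"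
        using F(2) l N True bdd by (intro vb_mult) (auto simp: in_level_def)
      then show "vb (real (dJ j) - N) (x i * \<Phi> (eps i) j)" by simp
    qed
    ultimately show ?thesis using vb_diff_iff by blast
  qed
qed

text \<open>Descent on the degree from which on \<open>y\<close> vanishes modulo p. The top degree
  is solved by \<open>U\<close>; the solution lives in that degree alone, so it inherits the level,
  and its image vanishes modulo p in all higher degrees.\<close>

lemma surjective_mod_p_aux:
  assumes "y \<in> nfun J" "in_level dJ Ns y" "\<And>j. j \<in> J \<Longrightarrow> dJ j \<ge> N \<Longrightarrow> vb 1 (y j)"
  shows "\<exists>x\<in>nfun I. in_level dI Ns x \<and> (\<forall>j\<in>J. vb 1 (y j - \<Phi> x j))"
  using assms
proof (induction N arbitrary: y)
  case 0
  then show ?case using nlinear_zero[OF lin] by (intro bexI[of _ "\<lambda>_. 0"]) auto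
next
  case (Suc N)
  let ?I = "{i. i \<in> I \<and> dI i = N}" and ?J = "{j. j \<in> J \<and> dJ j = N}"
  define x where "x i = (if i \<in> ?I then \<Sum>j\<in>?J. y j * of_int (U j i) else 0)" for i
  have xO: "(\<Sum>j\<in>?J. y j * of_int (U j i)) \<in> Oint" for i
    using nfunD[OF Suc.prems(1)] by (auto simp: Oint_iff intro!: L_closed vb_sum vb_mult0)
  have x: "x \<in> nfun I"
    using finI[of N] xO by (intro nfun_finite[of ?I]) (auto simp: x_def)
  have lx: "in_level dI Ns x"
    unfolding in_level_def
  proof (intro ballI allI)
    fix N' i assume N': "N' \<in> Ns"
    have "vb (real N - N') (y j)" if "j \<in> ?J" for j
      using Suc.prems(2) N' that by (auto simp: in_level_def)
    then show "vb (real (dI i) - N') (x i)"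
      by (auto simp: x_def intro!: vb_sum vb_mult0(2))
  qed
  define y2 where "y2 = (\<lambda>j. y j - \<Phi> x j)"
  have y2: "y2 \<in> nfun J" "in_level dJ Ns y2"
    unfolding y2_def using Suc.prems lx x nlinearD(1)[OF lin] in_level_map
    by (auto intro!: nfun_diff in_level_diff)
  have hx: "vb 1 (x i)" if "dI i > N" for i using that by (simp add: x_def)
  have "vb 1 (y2 j)" if j: "j \<in> J" "dJ j \<ge> N" for j
  proof (cases "dJ j = N")
    case True
    have eq: "(\<Sum>i\<in>?I. x i * of_int (T i j)) = (\<Sum>j'\<in>?J. y j' * of_int (\<Sum>i\<in>?I. U j' i * T i j))"
      unfolding of_int_sum sum_distrib_left
      by (subst sum.swap) (simp add: x_def sum_distrib_right mult.assoc)
    have "vb 1 (\<Sum>j'\<in>?J. y j' * of_int ((\<Sum>i\<in>?I. U j' i * T i j) - (if j' = j then 1 else 0)))"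
    proof (intro vb_sum vb_mult0(1) nfunD(3)[OF Suc.prems(1)] vb_of_int_dvd)
      fix j' assume "j' \<in> ?J"
      then show "int p dvd (\<Sum>i\<in>?I. U j' i * T i j) - (if j' = j then 1 else 0)"
        using inv1[of j' j] j True by auto
    qed
    then have "vb 1 ((\<Sum>i\<in>?I. x i * of_int (T i j)) - (\<Sum>j'\<in>?J. if j' = j then y j' else 0))"
      unfolding eq sum_subtractf[symmetric] by (simp add: algebra_simps if_distrib cong: if_cong)
    also have "(\<Sum>j'\<in>?J. if j' = j then y j' else 0) = y j"
      using j True finJ by simp
    finally have "vb 1 (\<Phi> x j - y j)"
      using top_part(1)[OF x hx j(1) True] vb_trans by blast
    then show ?thesis by (simp add: y2_def vb_minus_commute)
  next
    case False
    then show ?thesis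
      using Suc.prems(3)[of j] top_part(2)[OF x hx j(1)] j by (auto simp: y2_def intro!: vb_diff)
  qed
  from Suc.IH[OF y2 this] obtain x2 where x2: "x2 \<in> nfun I" "in_level dI Ns x2"
    "\<And>j. j \<in> J \<Longrightarrow> vb 1 (y2 j - \<Phi> x2 j)" by auto
  show ?case
  proof (intro bexI[of _ "\<lambda>i. x i + x2 i"] conjI ballI)
    show "in_level dI Ns (\<lambda>i. x i + x2 i)" using lx x2(2) by (rule in_level_add)
    show "vb 1 (y j - \<Phi> (\<lambda>i. x i + x2 i) j)" if "j \<in> J" for j
      using x2(3)[OF that] nlinearD(2)[OF lin x x2(1)] by (simp add: y2_def algebra_simps)
  qed (rule nfun_add[OF x x2(1)])
qed

text \<open>The remainder is divided by p, which lowers each of its bounds by one. In terms of the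
  level this replaces N by N + 1, whence the shift of \<open>Ns\<close>.\<close>

lemma surjective_mod_p:
  assumes y: "y \<in> nfun J" and l: "in_level dJ Ns y"
  shows "\<exists>x y'. x \<in> nfun I \<and> in_level dI Ns x \<and> y' \<in> nfun J \<and> in_level dJ ((+) 1 ` Ns) y' \<and>
    (\<forall>j. y j = \<Phi> x j + of_nat p * y' j)"
proof -
  define E where "E = {j. \<not> vb (real 1) (y j)}"
  have E: "finite E" using nfunD(6)[OF y, of 1] by (simp add: E_def)
  define N where "N = Suc (Max (insert 0 (dJ ` E)))"
  have "vb 1 (y j)" if "dJ j \<ge> N" for j
  proof (rule ccontr)
    assume "\<not> vb 1 (y j)"
    then have "dJ j \<le> Max (insert 0 (dJ ` E))" using E by (intro Max_ge) (auto simp: E_def)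
    then show False using that by (simp add: N_def)
  qed
  then obtain x where x: "x \<in> nfun I" "in_level dI Ns x" "\<And>j. j \<in> J \<Longrightarrow> vb 1 (y j - \<Phi> x j)"
    using surjective_mod_p_aux[OF y l, of N] by auto
  define z where "z = (\<lambda>j. y j - \<Phi> x j)"
  have z: "z \<in> nfun J" "in_level dJ Ns z"
    unfolding z_def using x y l nlinearD(1)[OF lin] in_level_map by (auto intro!: nfun_diff in_level_diff)
  have vz: "vb (real 1) (z j)" for j
    using x(3)[of j] nfunD(4)[OF z(1), of j] by (cases "j \<in> J") (auto simp: z_def)
  define y' where "y' = (\<lambda>j. z j / of_nat p ^ 1)"
  have zy: "z j = of_nat p ^ 1 * y' j" for j by (simp add: y'_def)
  have "y' \<in> nfun J" unfolding y'_def by (rule nfun_div_p[OF z(1) vz])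
  moreover have "in_level dJ ((+) 1 ` Ns) y'"
    using z(2) unfolding in_level_def zy vb_p_power_mult by (simp add: algebra_simps)
  moreover have "y j = \<Phi> x j + of_nat p * y' j" for j
    using zy[of j] by (simp add: z_def algebra_simps)
  ultimately show ?thesis using x by blast
qed

text \<open>Iterating the solution modulo p gives remainders Y_s and partial solutions Z_s with x =
  Z_0 + p Z_1 + p^2 Z_2 + ... as preimage. Step s has the level N + s, and the factor p^s brings it
  back to N, so the sum keeps the level of \<open>y\<close>.\<close>

lemma surjective:
  assumes y: "y \<in> nfun J" and l: "in_level dJ Ns y"
  shows "\<exists>x\<in>nfun I. in_level dI Ns x \<and> \<Phi> x = y"
proof -
  define P where "P s z \<longleftrightarrow> z \<in> nfun J \<and> in_level dJ ((+) (real s) ` Ns) z" for s :: nat and z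
  define Q where "Q s z z' \<longleftrightarrow> (\<exists>x. x \<in> nfun I \<and> in_level dI ((+) (real s) ` Ns) x \<and>
      (\<forall>j. z j = \<Phi> x j + of_nat p * z' j))" for s :: nat and z z'
  have "\<exists>Y. \<forall>s. (P s (Y s) \<and> (s = 0 \<longrightarrow> Y s = y)) \<and> Q s (Y s) (Y (Suc s))"
  proof (rule dependent_nat_choice)
    fix z and s :: nat assume "P s z \<and> (s = 0 \<longrightarrow> z = y)"
    then have "z \<in> nfun J" "in_level dJ ((+) (real s) ` Ns) z" by (auto simp: P_def)
    from surjective_mod_p[OF this] obtain x y' where xy: "x \<in> nfun I" "in_level dI ((+) (real s) ` Ns) x"
      "y' \<in> nfun J" "in_level dJ ((+) 1 ` (+) (real s) ` Ns) y'" "\<forall>j. z j = \<Phi> x j + of_nat p * y' j"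
      by blast
    have "(+) 1 ` (+) (real s) ` Ns = (+) (real (Suc s)) ` Ns"
      by (simp add: image_image add_ac)
    then show "\<exists>z'. (P (Suc s) z' \<and> (Suc s = 0 \<longrightarrow> z' = y)) \<and> Q s z z'"
      using xy unfolding P_def Q_def by auto
  qed (use y l in \<open>auto simp: P_def\<close>)
  then obtain Y where Y: "\<forall>s. P s (Y s)" "\<forall>s. Q s (Y s) (Y (Suc s))" "Y 0 = y" by blast
  define R where "R s x \<longleftrightarrow> x \<in> nfun I \<and> in_level dI ((+) (real s) ` Ns) x \<and>
      (\<forall>j. Y s j = \<Phi> x j + of_nat p * Y (Suc s) j)" for s :: nat and x
  have "\<forall>s. \<exists>x. R s x" using Y(2) by (simp add: Q_def R_def)
  then have "\<exists>Z. \<forall>s. R s (Z s)" by (rule choice)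
  then obtain Z where Z': "\<forall>s. R s (Z s)" ..
  have Z: "Z s \<in> nfun I" "in_level dI ((+) (real s) ` Ns) (Z s)"
    "Y s j = \<Phi> (Z s) j + of_nat p * Y (Suc s) j" for s j
    using Z' unfolding R_def by blast+
  have pO: "(of_nat p :: 'f) ^ s \<in> Oint" for s using Oint_1(4)[of "p ^ s"] by simp
  have vX: "vb (real s) (of_nat p ^ s * Z s i)" for s i
    using nfunD(3)[OF Z(1)] by (simp add: vb_p_power_mult)
  \<comment> \<open>The bound does not depend on \<open>i\<close>: one partial sum approximates x
    modulo p^s at all entries at once.\<close>
  have large: "{t. \<not> vb (real s) (of_nat p ^ t * Z t i)} \<subseteq> {..<s}" for s i
  proof
    fix t assume "t \<in> {t. \<not> vb (real s) (of_nat p ^ t * Z t i)}"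
    then have "\<not> real s \<le> real t" using vb_mono[OF vX] by blast
    then show "t \<in> {..<s}" by simp
  qed
  have nfam: "null_family (\<lambda>s. of_nat p ^ s * Z s i)" for i
    unfolding null_family_def
  proof (intro conjI allI)
    show "of_nat p ^ s * Z s i \<in> L" for s using nfunD(2)[OF Z(1)] pO by (auto simp: Oint_iff intro: L_closed)
    show "finite {t. \<not> vb (real s) (of_nat p ^ t * Z t i)}" for s :: nat
    proof (rule finite_subset)
      show "{t. \<not> vb (real s) (of_nat p ^ t * Z t i)} \<subseteq> {..<s}" by (rule large)
    qed simp
  qed
  define x where "x i = nsum (\<lambda>s. of_nat p ^ s * Z s i)" for i
  have ap: "vb (real s) (x i - (\<Sum>t<s. of_nat p ^ t * Z t i))" for s i
    unfolding x_def
  proof (rule nsum_approx[OF nfam])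
    show "{t. \<not> vb (real s) (of_nat p ^ t * Z t i)} \<subseteq> {..<s}" by (rule large)
  qed simp
  have part: "(\<lambda>i. \<Sum>t<s. of_nat p ^ t * Z t i) \<in> nfun I" for s
    using pO Z(1) by (intro nfun_sum nfun_smult) auto
  have x: "x \<in> nfun I"
  proof (rule nfunI)
    show "x i \<in> Oint" for i
      unfolding x_def Oint_iff using nfam nfunD(3)[OF Z(1)] pO
      by (intro conjI nsum_L nsum_vb vb_mult0) (auto simp: Oint_iff)
    show "x i = 0" if "i \<notin> I" for i
      unfolding x_def using nfunD(4)[OF Z(1) that] nsum_finite[of "\<lambda>_. 0" "{}"] L.zero_S by simp
    show "finite {i \<in> I. \<not> vb (real s) (x i)}" for s
    proof (rule finite_subset)
      show "{i \<in> I. \<not> vb (real s) (x i)} \<subseteq> {i. \<not> vb (real s) (\<Sum>t<s. of_nat p ^ t * Z t i)}"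
        using vb_diff_iff[OF ap] by auto
    qed (rule nfunD(6)[OF part])
  qed
  have lx: "in_level dI Ns x"
    unfolding in_level_def
  proof (intro ballI allI)
    fix N i assume N: "N \<in> Ns"
    show "vb (real (dI i) - N) (x i)"
      unfolding x_def
    proof (rule nsum_vb[OF nfam])
      fix s
      have "vb (real (dI i) - (real s + N)) (Z s i)" using Z(2)[of s] N by (auto simp: in_level_def)
      moreover have "real (dI i) - (real s + N) = real (dI i) - N - real s" by simp
      ultimately show "vb (real (dI i) - N) (of_nat p ^ s * Z s i)"
        by (simp only: vb_p_power_mult)
    qed
  qed
  \<comment> \<open>The recursion for the remainders, unrolled s times.\<close>
  have yY: "y j = (\<Sum>t<s. of_nat p ^ t * \<Phi> (Z t) j) + of_nat p ^ s * Y s j" for s j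
  proof (induction s)
    case (Suc s)
    then show ?case by (simp add: Z(3)[of s j] algebra_simps)
  qed (simp add: Y(3))
  have "\<Phi> x = y"
  proof (intro ext vb_all_eq)
    fix j and s :: nat
    let ?z = "\<lambda>i. \<Sum>t<s. of_nat p ^ t * Z t i"
    have "vb (real s) (\<Phi> (\<lambda>i. x i - ?z i) j)"
      by (rule nlinear_vb[OF lin nfun_diff[OF x part] ap])
    then have "vb (real s) (\<Phi> x j - \<Phi> ?z j)" by (simp add: nlinear_diff[OF lin x part])
    have "\<Phi> ?z = (\<lambda>j. \<Sum>t<s. of_nat p ^ t * \<Phi> (Z t) j)"
      using pO Z(1) by (subst nlinear_sum[OF lin]) (auto simp: nlinearD(3)[OF lin] intro!: nfun_smult)
    have "vb (real s) (of_nat p ^ s * Y s j)"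
      using Y(1) nfunD(3)[of "Y s" J] by (simp add: P_def vb_p_power_mult)
    have "vb (real s) ((\<Phi> x j - \<Phi> ?z j) - of_nat p ^ s * Y s j)"
      by (rule vb_diff) fact+
    moreover have "y j = \<Phi> ?z j + of_nat p ^ s * Y s j"
      unfolding \<open>\<Phi> ?z = _\<close> by (rule yY)
    ultimately show "vb (real s) (\<Phi> x j - y j)" by (simp add: algebra_simps)
  qed
  then show ?thesis using x lx by blast
qed

lemma bijective: "y \<in> nfun J \<Longrightarrow> \<exists>!x. x \<in> nfun I \<and> \<Phi> x = y"
  using surjective[of y "{}"] injective by auto

definition inv_map :: "('j \<Rightarrow> 'f) \<Rightarrow> 'i \<Rightarrow> 'f" where
  "inv_map y = (THE x. x \<in> nfun I \<and> \<Phi> x = y)"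

lemma inv_map:
  assumes "y \<in> nfun J"
  shows "inv_map y \<in> nfun I" "\<Phi> (inv_map y) = y"
  using theI'[OF bijective[OF assms]] by (auto simp: inv_map_def)

lemma inv_map_eqI: "x \<in> nfun I \<Longrightarrow> inv_map (\<Phi> x) = x"
  using inv_map[OF nlinearD(1)[OF lin]] injective by simp

lemma inv_map_level: "y \<in> nfun J \<Longrightarrow> in_level dJ Ns y \<Longrightarrow> in_level dI Ns (inv_map y)"
  using surjective[of y Ns] inv_map_eqI by metis

lemma nlinear_inv_map: "nlinear J I inv_map"
proof (rule nlinearI)
  fix x y j assume *: "x \<in> nfun J" "y \<in> nfun J"
  have "(\<lambda>i. x i + y i) = \<Phi> (\<lambda>i. inv_map x i + inv_map y i)"
    using * by (simp add: nlinearD(2)[OF lin] inv_map)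
  then show "inv_map (\<lambda>i. x i + y i) j = inv_map x j + inv_map y j"
    using inv_map_eqI[OF nfun_add[OF inv_map(1)[OF *(1)] inv_map(1)[OF *(2)]]] by simp
next
  fix c x j assume *: "c \<in> Oint" "x \<in> nfun J"
  have "(\<lambda>i. c * x i) = \<Phi> (\<lambda>i. c * inv_map x i)"
    using * by (simp add: nlinearD(3)[OF lin] inv_map)
  then show "inv_map (\<lambda>i. c * x i) j = c * inv_map x j"
    using inv_map_eqI[OF nfun_smult[OF *(1) inv_map(1)[OF *(2)]]] by simp
qed (rule inv_map(1))

end

section \<open>The cohomology of the Kloosterman family in toric coordinates\<close>

text \<open>In the coordinates \<open>X\<^sub>0 = \<gamma> t / (x\<^sub>1 \<cdots> x\<^sub>n)\<close>, \<open>X\<^sub>l = \<gamma> x\<^sub>l\<close> the module \<open>\<C>\<close> is the Tate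
  algebra in \<open>X\<^sub>0,\<dots>,X\<^sub>n\<close>, and \<open>D\<^bsub>t,l\<^esub> = \<delta>\<^sub>l - \<delta>\<^sub>0\<close>, \<open>\<partial> = \<delta>\<^sub>0\<close> with commuting operators
  \<open>\<delta>\<^sub>l = X\<^sub>l d/dX\<^sub>l + \<Sum>\<^sub>j c\<^sub>j X\<^sub>l\<^bsup>p^j\<^esup>\<close>.\<close>

definition embed :: "('a \<Rightarrow> 'b) \<Rightarrow> ('a \<Rightarrow> 'f::zero) \<Rightarrow> 'b \<Rightarrow> 'f" where
  "embed \<phi> a v = (if v \<in> range \<phi> then a (inv_into UNIV \<phi> v) else 0)"

lemma embed_apply: "inj \<phi> \<Longrightarrow> embed \<phi> a (\<phi> i) = a i"
  by (simp add: embed_def)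

lemma (in complete_valued) nlinear_embed:
  assumes \<phi>: "inj \<phi>" "range \<phi> \<subseteq> J"
  shows "nlinear UNIV J (embed \<phi>)" and "embed \<phi> (eps i) = eps (\<phi> i)"
proof -
  have cl: "embed \<phi> x \<in> nfun J" if x: "x \<in> nfun UNIV" for x
  proof (rule nfunI)
    show "embed \<phi> x v \<in> Oint" for v using nfunD(5)[OF x] by (simp add: embed_def)
    show "embed \<phi> x v = 0" if "v \<notin> J" for v using \<phi>(2) that by (auto simp: embed_def)
    show "finite {v \<in> J. \<not> vb (real s) (embed \<phi> x v)}" for s
    proof (rule finite_subset)
      show "{v \<in> J. \<not> vb (real s) (embed \<phi> x v)} \<subseteq> \<phi> ` {i. \<not> vb (real s) (x i)}"
        using \<phi>(1) by (auto simp: embed_def split: if_splits)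
    qed (use nfunD(6)[OF x] in auto)
  qed
  show "nlinear UNIV J (embed \<phi>)"
    by (rule nlinearI[OF cl]) (auto simp: embed_def)
  show "embed \<phi> (eps i) = eps (\<phi> i)"
    using \<phi>(1) by (auto simp: embed_def eps_def fun_eq_iff inj_def)
qed

definition expo :: "nat \<Rightarrow> (nat \<Rightarrow> nat) set" where
  "expo n = {v. \<forall>l>n. v l = 0}"

definition tdeg :: "nat \<Rightarrow> (nat \<Rightarrow> nat) \<Rightarrow> nat" where
  "tdeg n v = (\<Sum>l\<le>n. v l)"

lemma finite_expo: "finite {v \<in> expo n. tdeg n v \<le> N}"
proof (rule finite_subset)
  show "{v \<in> expo n. tdeg n v \<le> N} \<subseteq> {i. \<forall>j. (j \<in> {..n} \<longrightarrow> i j \<in> {..N}) \<and> (j \<notin> {..n} \<longrightarrow> i j = 0)}"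
  proof (intro subsetI CollectI allI conjI impI)
    fix v j assume "v \<in> {v \<in> expo n. tdeg n v \<le> N}" and "j \<in> {..n}"
    then have v: "tdeg n v \<le> N" and j: "j \<le> n" by auto
    have "v j \<le> tdeg n v" unfolding tdeg_def using j by (intro member_le_sum) auto
    then show "v j \<in> {..N}" using v by simp
  next
    fix v j assume "v \<in> {v \<in> expo n. tdeg n v \<le> N}" "j \<notin> {..n}"
    then show "v j = 0" by (simp add: expo_def)
  qed
  show "finite {i. \<forall>j. (j \<in> {..n} \<longrightarrow> i j \<in> {..N}) \<and> (j \<notin> {..n} \<longrightarrow> i j = (0::nat))}"
    by (rule finite_set_of_finite_funs) auto
qed

lemma finite_expo_eq: "finite {v \<in> expo n. tdeg n v = N}"
  by (rule finite_subset[OF _ finite_expo[of n N]]) auto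

lemma tdeg_upd: "l \<le> n \<Longrightarrow> tdeg n (v(l := m)) + v l = tdeg n v + m"
  unfolding tdeg_def by (subst (1 2) sum.remove[of _ l]) auto

lemma expo_upd: "l \<le> n \<Longrightarrow> v \<in> expo n \<Longrightarrow> v(l := m) \<in> expo n"
  by (auto simp: expo_def)

text \<open>The last assumption is the analytic input about \<gamma>;
  \<open>gamma_part_estimate\<close> supplies it from the vanishing of the series.\<close>

locale kloosterman = complete_valued ord p L for ord :: "'f::field \<Rightarrow> ereal" and p L +
  fixes n :: nat and \<gamma> :: 'f
  assumes p2: "p \<ge> 2" and n1: "n \<ge> 1" and \<gamma>_L: "\<gamma> \<in> L" and \<gamma>_neq_0 [simp]: "\<gamma> \<noteq> 0"
    and gamma_part_bound: "vb (real (p ^ j) - 1) (of_nat (p ^ j) * gamma_part p \<gamma> j / \<gamma> ^ (p ^ j))"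
begin

text \<open>In x_l dH/dx_l the term p^j \<gamma>_j x_l^(p^j) equals c_j X_l^(p^j), because X_l =
  \<gamma> x_l.\<close>

definition c :: "nat \<Rightarrow> 'f" where
  "c j = of_nat (p ^ j) * gamma_part p \<gamma> j / \<gamma> ^ (p ^ j)"

lemma c_0 [simp]: "c 0 = 1"
  by (simp add: c_def gamma_part_def)

lemma c_bound: "vb (real (p ^ j) - 1) (c j)"
  using gamma_part_bound by (simp add: c_def)

lemma c_L: "c j \<in> L"
  unfolding c_def gamma_part_def by (intro L_closed \<gamma>_L)

lemma p_power_gt: "j < p ^ j"
proof -
  have "j < 2 ^ j" by (rule less_exp)
  also have "\<dots> \<le> p ^ j" using p2 by (rule power_mono) simp
  finally show ?thesis .
qed

lemma p_power_pos: "p ^ j \<ge> 1"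
  using p_power_gt[of j] by linarith

lemma c_vb0: "vb 0 (c j)"
  by (rule vb_mono[OF c_bound]) (use p_power_pos[of j] in \<open>simp add: of_nat_power[symmetric] del: of_nat_power\<close>)

lemma c_vb1: "j > 0 \<Longrightarrow> vb 1 (c j)"
proof (rule vb_mono[OF c_bound])
  assume "j > 0"
  have "(2::nat) = 2 ^ (1::nat)" by simp
  also have "\<dots> \<le> (2::nat) ^ j" using \<open>j > 0\<close> by (intro power_increasing) auto
  also have "\<dots> \<le> p ^ j" using p2 by (rule power_mono) simp
  finally have "2 \<le> p ^ j" .
  then show "1 \<le> real (p ^ j) - 1" by linarith
qed

abbreviation "E \<equiv> expo n"
abbreviation "dg \<equiv> tdeg n"

lemma finite_powers: "finite {j. p ^ j \<le> m}"
  by (rule finite_subset[of _ "{..m}"]) (use p_power_gt in \<open>auto intro: order.trans less_imp_le\<close>)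

definition delta :: "nat \<Rightarrow> ((nat \<Rightarrow> nat) \<Rightarrow> 'f) \<Rightarrow> (nat \<Rightarrow> nat) \<Rightarrow> 'f" where
  "delta l a v = of_nat (v l) * a v + (\<Sum>j | p ^ j \<le> v l. c j * a (v(l := v l - p ^ j)))"

text \<open>The number of terms grows with the exponent, but for p^j > s the coefficient c_j is
  already divisible by p^s. Modulo p^s there remain only finitely many shifts of the finite set of
  coefficients of order below s.\<close>

lemma nlinear_delta:
  assumes l: "l \<le> n"
  shows "nlinear E E (delta l)"
proof (rule nlinearI)
  fix x assume x: "x \<in> nfun E"
  show "delta l x \<in> nfun E"
  proof (rule nfunI)
    fix v show "delta l x v \<in> Oint"
      unfolding delta_def Oint_iff using nfunD[OF x] c_L c_vb0
      by (auto intro!: L_closed vb_add vb_sum vb_mult0)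
  next
    fix v assume v: "v \<notin> E"
    have "v(l := m) \<notin> E" for m using v l by (auto simp: expo_def)
    then show "delta l x v = 0" using v nfunD(4)[OF x] by (simp add: delta_def)
  next
    fix s :: nat
    define Bs where "Bs = {v. \<not> vb (real s) (x v)}"
    define up where "up j v = v(l := v l + p ^ j)" for j and v :: "nat \<Rightarrow> nat"
    have fin: "finite (Bs \<union> (\<Union>j\<in>{j. p ^ j \<le> s}. up j ` Bs))"
      using finite_powers nfunD(6)[OF x] by (simp add: Bs_def)
    have "vb (real s) (delta l x v)"
      if nv: "v \<notin> Bs \<union> (\<Union>j\<in>{j. p ^ j \<le> s}. up j ` Bs)" for v
      unfolding delta_def
    proof (rule vb_add)
      have "vb (real s) (x v)" using nv by (simp add: Bs_def)
      then show "vb (real s) (of_nat (v l) * x v)" by (rule vb_mult0(1)[OF vb_of_nat])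
      show "vb (real s) (\<Sum>j | p ^ j \<le> v l. c j * x (v(l := v l - p ^ j)))"
      proof (rule vb_sum)
        fix j assume j: "j \<in> {j. p ^ j \<le> v l}"
        show "vb (real s) (c j * x (v(l := v l - p ^ j)))"
        proof (cases "p ^ j \<le> s")
          case True
          have "v = up j (v(l := v l - p ^ j))" using j by (auto simp: up_def)
          then have "v(l := v l - p ^ j) \<notin> Bs" using nv True by blast
          then show ?thesis using vb_mult0(1)[OF c_vb0] by (simp add: Bs_def)
        next
          case False
          then have "real s \<le> real (p ^ j) - 1" by linarith
          then show ?thesis using vb_mult0(2)[OF vb_mono[OF c_bound] nfunD(3)[OF x]] by blast
        qed
      qed
    qed
    then have "{v \<in> E. \<not> vb (real s) (delta l x v)} \<subseteq> Bs \<union> (\<Union>j\<in>{j. p ^ j \<le> s}. up j ` Bs)" by blast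
    then show "finite {v \<in> E. \<not> vb (real s) (delta l x v)}" using fin finite_subset by blast
  qed
qed (simp_all add: delta_def algebra_simps sum.distrib sum_distrib_left)

text \<open>The coefficient of \<open>X\<^sup>w\<close> in \<open>\<delta>\<^sup>i 1\<close>, in one variable.\<close>

fun kap :: "nat \<Rightarrow> nat \<Rightarrow> 'f" where
  "kap 0 w = (if w = 0 then 1 else 0)"
| "kap (Suc i) w = of_nat w * kap i w + (\<Sum>j | p ^ j \<le> w. c j * kap i (w - p ^ j))"

lemma kap_L: "kap i w \<in> L"
  by (induction i arbitrary: w) (auto intro!: L_closed c_L)

lemma kap_vb0: "vb 0 (kap i w)"
  by (induction i arbitrary: w) (auto intro!: vb_add vb_sum vb_mult0 c_vb0)

text \<open>The term X^(p^j) raises the degree by p^j and brings the order p^j - 1, so each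
  application of \<delta> loses at most one unit against the degree.\<close>

lemma kap_bound: "vb (real w - real i) (kap i w)"
proof (induction i arbitrary: w)
  case (Suc i)
  have "vb (real w - real (Suc i)) (of_nat w * kap i w)"
    by (rule vb_mult0(1)[OF vb_of_nat vb_mono[OF Suc]]) simp
  moreover have "vb (real w - real (Suc i)) (c j * kap i (w - p ^ j))" if "p ^ j \<le> w" for j
  proof (rule vb_mono[OF vb_mult[OF c_bound Suc]])
    show "real w - real (Suc i) \<le> real (p ^ j) - 1 + (real (w - p ^ j) - real i)"
      unfolding of_nat_diff[OF that] by simp
  qed
  ultimately show ?case by (auto intro!: vb_add vb_sum)
qed auto

text \<open>Multiplication by X, the term j = 0 with c_0 = 1, reproduces the previous diagonal
  entry. The Euler term meets \<open>kap i (Suc i)\<close>, divisible by p according to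
  \<open>kap_bound\<close>, and for j > 0 the coefficient c_j is divisible by p.\<close>

lemma kap_diag: "vb 1 (kap i i - 1)"
proof (induction i)
  case (Suc i)
  have A: "finite {j. p ^ j \<le> Suc i}" by (rule finite_powers)
  have B: "0 \<in> {j. p ^ j \<le> Suc i}" by simp
  have "kap (Suc i) (Suc i) - 1 = of_nat (Suc i) * kap i (Suc i) + (kap i i - 1) +
      (\<Sum>j\<in>{j. p ^ j \<le> Suc i} - {0}. c j * kap i (Suc i - p ^ j))"
    unfolding kap.simps(2) sum.remove[OF A B] by simp
  moreover have "vb 1 (of_nat (Suc i) * kap i (Suc i))"
    using kap_bound[of "Suc i" i] by (intro vb_mult0(1)[OF vb_of_nat]) simp
  moreover have "vb 1 (\<Sum>j\<in>{j. p ^ j \<le> Suc i} - {0}. c j * kap i (Suc i - p ^ j))"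
    by (intro vb_sum vb_mult0(2) c_vb1 kap_vb0) auto
  ultimately show ?case using Suc by (simp only:) (intro vb_add)
qed auto

text \<open>The coefficient of X^w in \<delta>_0^(v_0) ... \<delta>_n^(v_n) 1. It is a product over
  the variables since \<delta>_l involves X_l alone.\<close>

definition dpow :: "(nat \<Rightarrow> nat) \<Rightarrow> (nat \<Rightarrow> nat) \<Rightarrow> 'f" where
  "dpow v w = (if v \<in> E \<and> w \<in> E then \<Prod>l\<le>n. kap (v l) (w l) else 0)"

lemma dpow_bound:
  assumes "v \<in> E"
  shows "vb (real (dg w) - real (dg v)) (dpow v w)"
proof (cases "w \<in> E")
  case True
  have "vb (\<Sum>l\<le>n. real (w l) - real (v l)) (\<Prod>l\<le>n. kap (v l) (w l))"
    by (intro vb_prod kap_bound)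
  then show ?thesis using assms True by (simp add: dpow_def tdeg_def sum_subtractf)
qed (simp add: dpow_def)

lemma dpow_nfun: "dpow v \<in> nfun E"
proof (cases "v \<in> E")
  case True
  show ?thesis
  proof (rule nfunI)
    show "dpow v w \<in> Oint" for w
      using vb_prod[of "{..n}" "\<lambda>_. 0" "\<lambda>l. kap (v l) (w l)"] kap_vb0
      by (auto simp: dpow_def Oint_iff intro!: L_closed kap_L)
    show "finite {w \<in> E. \<not> vb (real s) (dpow v w)}" for s
    proof (rule finite_subset[OF _ finite_expo[of n "dg v + s"]], safe)
      fix w assume w: "\<not> vb (real s) (dpow v w)"
      have "\<not> real s \<le> real (dg w) - real (dg v)" using vb_mono[OF dpow_bound[OF True]] w by blast
      then show "dg w \<le> dg v + s" by linarith
    qed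
  qed (auto simp: dpow_def)
qed (simp add: dpow_def[abs_def])

lemma dpow_main:
  assumes v: "v \<in> E" and w: "w \<in> E" and le: "dg v \<le> dg w"
  shows "vb 1 (dpow v w - (if v = w then 1 else 0))"
proof (cases "v = w")
  case True
  have "vb 1 ((\<Prod>l\<in>A. kap (w l) (w l)) - 1)" if "finite A" for A
    using that
  proof (induction A rule: finite_induct)
    case (insert a A)
    have "(\<Prod>l\<in>insert a A. kap (w l) (w l)) - 1 =
        kap (w a) (w a) * ((\<Prod>l\<in>A. kap (w l) (w l)) - 1) + (kap (w a) (w a) - 1)"
      using insert by (simp add: algebra_simps)
    then show ?case using insert.IH kap_diag kap_vb0 by (simp only:) (intro vb_add vb_mult0(1))
  qed auto
  then show ?thesis using True v by (simp add: dpow_def)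
next
  case False
  \<comment> \<open>Otherwise w is at most v entrywise, and the degrees force equality. For such an
    l the factor \<open>kap (v l) (w l)\<close> is divisible by p.\<close>
  have "\<exists>l\<le>n. v l < w l"
  proof (rule ccontr)
    assume "\<not> (\<exists>l\<le>n. v l < w l)"
    then have le': "\<And>l. l \<le> n \<Longrightarrow> w l \<le> v l" by (auto simp: not_less)
    have "(\<Sum>l\<le>n. w l) = (\<Sum>l\<le>n. v l)"
      using le le' by (intro antisym[OF sum_mono]) (auto simp: tdeg_def)
    then have eq: "w l = v l" if "l \<le> n" for l
      by (rule sum_mono_inv) (use le' that in auto)
    have "w l = v l" for l
      using eq[of l] v w by (cases "l \<le> n") (simp_all add: expo_def)
    then have "w = v" by blast
    then show False using False by simp
  qed
  then obtain l where l: "l \<le> n" "v l < w l" by blast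
  have "(\<Prod>l\<le>n. kap (v l) (w l)) = kap (v l) (w l) * (\<Prod>m\<in>{..n} - {l}. kap (v m) (w m))"
    using l by (intro prod.remove) auto
  moreover have "vb 1 (kap (v l) (w l))" by (rule vb_mono[OF kap_bound]) (use l in simp)
  moreover have "vb 0 (\<Prod>m\<in>{..n} - {l}. kap (v m) (w m))"
    using vb_prod[of "{..n} - {l}" "\<lambda>_. 0" "\<lambda>m. kap (v m) (w m)"] kap_vb0 by simp
  ultimately show ?thesis using False v w vb_mult0(2) by (simp add: dpow_def)
qed

lemma delta_dpow:
  assumes v: "v \<in> E" and l: "l \<le> n"
  shows "delta l (dpow v) = dpow (v(l := Suc (v l)))"
proof
  fix w
  show "delta l (dpow v) w = dpow (v(l := Suc (v l))) w"
  proof (cases "w \<in> E")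
    case False
    then have "w(l := m) \<notin> E" for m using l by (auto simp: expo_def)
    then show ?thesis using False by (simp add: delta_def dpow_def)
  next
    case True
    define P where "P = (\<Prod>m\<in>{..n} - {l}. kap (v m) (w m))"
    have 1: "dpow v (w(l := x)) = kap (v l) x * P" for x
      using True v l expo_upd[OF l True] unfolding dpow_def P_def
      by (subst prod.remove[of _ l]) (auto intro!: prod.cong)
    have 2: "dpow (v(l := Suc (v l))) w = kap (Suc (v l)) (w l) * P"
      using True l expo_upd[OF l v] unfolding dpow_def P_def
      by (subst prod.remove[of _ l]) (auto intro!: prod.cong)
    have 3: "dpow v w = kap (v l) (w l) * P" using 1[of "w l"] by simp
    show ?thesis
      unfolding delta_def 1 2 3 kap.simps(2) by (simp add: algebra_simps sum_distrib_left)
  qed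
qed

text \<open>The map X^v |-> \<delta>^v 1. It carries multiplication by X_l to \<delta>_l, so the
  images of the operators \<delta>_l - \<delta>_0 correspond to the ideal generated by the X_l -
  X_0.\<close>

definition Xi :: "((nat \<Rightarrow> nat) \<Rightarrow> 'f) \<Rightarrow> (nat \<Rightarrow> nat) \<Rightarrow> 'f" where
  "Xi = nlin_ext dpow"

lemma nlinear_Xi: "nlinear E E Xi"
  unfolding Xi_def by (rule nlin_ext(1)[OF dpow_nfun]) (auto simp: dpow_def[abs_def])

lemma Xi_eps: "v \<in> E \<Longrightarrow> Xi (eps v) = dpow v"
  unfolding Xi_def by (rule nlin_ext(2)[OF dpow_nfun, of E]) (auto simp: dpow_def[abs_def])

end

lemma sum_delta_delta:
  "finite A \<Longrightarrow> i \<in> A \<Longrightarrow> (\<Sum>j\<in>A. (if i = j then 1 else 0) * (if j = k then 1 else (0::int))) = (if i = k then 1 else 0)"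
  by (simp add: if_distrib[of "\<lambda>x. x * _"] cong: if_cong)

text \<open>By \<open>dpow_main\<close> the map is the identity modulo p up to lower degrees; hence
  the identity matrices for \<open>T\<close> and \<open>U\<close>.\<close>

sublocale kloosterman \<subseteq> Xi: graded_map ord p L E E dg dg Xi
  "\<lambda>i j. if i = j then 1 else 0" "\<lambda>i j. if i = j then 1 else 0"
proof (unfold_locales, goal_cases)
  case 1 show ?case by (rule nlinear_Xi)
next
  case (4 i j) then show ?case using dpow_main[of i j] by (cases "i = j") (simp_all add: Xi_eps)
next
  case 5 then show ?case using dpow_bound by (simp add: Xi_eps)
next
  case (6 j j') then show ?case using sum_delta_delta[OF finite_expo_eq[of n "dg j"], of j j'] by simp
qed (auto simp: finite_expo_eq)

section \<open>The quotient by the X_l - X_0: series in one variable\<close>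

context kloosterman
begin

definition shift :: "nat \<Rightarrow> ((nat \<Rightarrow> nat) \<Rightarrow> 'f) \<Rightarrow> (nat \<Rightarrow> nat) \<Rightarrow> 'f" where
  "shift l g v = (if v l > 0 then g (v(l := v l - 1)) else 0)"

lemma shift_eps:
  shows "shift l (eps v) = eps (v(l := Suc (v l)))"
proof
  fix u
  show "shift l (eps v) u = eps (v(l := Suc (v l))) u"
  proof (cases "u l")
    case 0
    then have "u \<noteq> v(l := Suc (v l))" by auto
    then show ?thesis using 0 by (simp add: shift_def eps_def)
  next
    case (Suc m)
    then have "u(l := m) = v \<longleftrightarrow> u = v(l := Suc (v l))" by (auto simp: fun_eq_iff split: if_splits)
    then show ?thesis using Suc by (simp add: shift_def eps_def)
  qed
qed

lemma nlinear_shift: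
  assumes l: "l \<le> n"
  shows "nlinear E E (shift l)"
proof (rule nlinearI)
  fix x assume x: "x \<in> nfun E"
  show "shift l x \<in> nfun E"
  proof (rule nfunI)
    show "shift l x v \<in> Oint" for v using nfunD(5)[OF x] by (simp add: shift_def)
    show "shift l x v = 0" if "v \<notin> E" for v
    proof -
      have "v(l := m) \<notin> E" for m using that l by (auto simp: expo_def)
      then show ?thesis using nfunD(4)[OF x] by (simp add: shift_def)
    qed
    show "finite {v \<in> E. \<not> vb (real s) (shift l x v)}" for s
    proof (rule finite_subset)
      show "{v \<in> E. \<not> vb (real s) (shift l x v)} \<subseteq> (\<lambda>v. v(l := Suc (v l))) ` {v. \<not> vb (real s) (x v)}"
      proof
        fix v assume "v \<in> {v \<in> E. \<not> vb (real s) (shift l x v)}"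
        then have "v l > 0" "\<not> vb (real s) (x (v(l := v l - 1)))" by (auto simp: shift_def split: if_splits)
        moreover have "v = (v(l := v l - 1))(l := Suc ((v(l := v l - 1)) l))" using \<open>v l > 0\<close> by auto
        ultimately show "v \<in> (\<lambda>v. v(l := Suc (v l))) ` {v. \<not> vb (real s) (x v)}" by blast
      qed
    qed (use nfunD(6)[OF x] in auto)
  qed
qed (simp_all add: shift_def)

lemma delta_Xi:
  assumes l: "l \<le> n" and g: "g \<in> nfun E"
  shows "delta l (Xi g) = Xi (shift l g)"
proof (rule nlinear_ext[OF nlinear_comp[OF nlinear_Xi nlinear_delta[OF l]]
      nlinear_comp[OF nlinear_shift[OF l] nlinear_Xi] g])
  fix v assume v: "v \<in> E"
  show "delta l (Xi (eps v)) = Xi (shift l (eps v))"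
    using v l expo_upd[OF l v] by (simp add: Xi_eps shift_eps delta_dpow)
qed

text \<open>Substitution of one variable Y for all X_l; the value at N is the coefficient of
  Y^N.\<close>

definition total :: "((nat \<Rightarrow> nat) \<Rightarrow> 'f) \<Rightarrow> nat \<Rightarrow> 'f" where
  "total g N = (\<Sum>v | v \<in> E \<and> dg v = N. g v)"

lemma nlinear_total: "nlinear E UNIV total"
proof (rule nlinearI)
  fix x assume x: "x \<in> nfun E"
  show "total x \<in> nfun UNIV"
  proof (rule nfunI)
    show "total x N \<in> Oint" for N
      using nfunD[OF x] by (auto simp: total_def Oint_iff intro!: L_closed vb_sum)
    show "finite {N \<in> UNIV. \<not> vb (real s) (total x N)}" for s
    proof (rule finite_subset)
      show "{N \<in> UNIV. \<not> vb (real s) (total x N)} \<subseteq> dg ` {v. \<not> vb (real s) (x v)}"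
      proof
        fix N assume "N \<in> {N \<in> UNIV. \<not> vb (real s) (total x N)}"
        then have "\<not> vb (real s) (\<Sum>v | v \<in> E \<and> dg v = N. x v)" by (simp add: total_def)
        then have "\<exists>v\<in>{v. v \<in> E \<and> dg v = N}. \<not> vb (real s) (x v)"
          using vb_sum[of "{v. v \<in> E \<and> dg v = N}" "real s" x] by blast
        then obtain v where "dg v = N" "\<not> vb (real s) (x v)" by blast
        then show "N \<in> dg ` {v. \<not> vb (real s) (x v)}" by blast
      qed
    qed (use nfunD(6)[OF x] in auto)
  qed auto
qed (simp_all add: total_def sum.distrib sum_distrib_left)

lemma total_eps:
  assumes v: "v \<in> E"
  shows "total (eps v) = eps (dg v)"
proof
  fix N show "total (eps v) N = eps (dg v) N"
    unfolding total_def eps_def using finite_expo_eq[of n N] v by auto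
qed

lemma total_shift:
  assumes l: "l \<le> n" and m: "m \<le> n" and g: "g \<in> nfun E"
  shows "total (shift l g) = total (shift m g)"
proof (rule nlinear_ext[OF nlinear_comp[OF nlinear_shift[OF l] nlinear_total]
      nlinear_comp[OF nlinear_shift[OF m] nlinear_total] g])
  fix v assume v: "v \<in> E"
  have "dg (v(l := Suc (v l))) = dg (v(m := Suc (v m)))"
    using tdeg_upd[OF l, of v "Suc (v l)"] tdeg_upd[OF m, of v "Suc (v m)"] by simp
  then show "total (shift l (eps v)) = total (shift m (eps v))"
    using v expo_upd[OF l v] expo_upd[OF m v] by (simp add: shift_eps total_eps)
qed

text \<open>Undoes \<open>Xi\<close> and then identifies the variables. Its kernel turns out to be
  \<open>DE\<close>, so it describes classes in H^n by sequences.\<close>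

definition Psi :: "((nat \<Rightarrow> nat) \<Rightarrow> 'f) \<Rightarrow> nat \<Rightarrow> 'f" where
  "Psi f = total (Xi.inv_map f)"

lemma nlinear_Psi: "nlinear E UNIV Psi"
  unfolding Psi_def by (rule nlinear_comp[OF Xi.nlinear_inv_map nlinear_total])

lemma inv_delta:
  assumes l: "l \<le> n" and f: "f \<in> nfun E"
  shows "Xi.inv_map (delta l f) = shift l (Xi.inv_map f)"
proof -
  have g: "Xi.inv_map f \<in> nfun E" using Xi.inv_map(1)[OF f] .
  have "delta l f = Xi (shift l (Xi.inv_map f))"
    using delta_Xi[OF l g] Xi.inv_map(2)[OF f] by simp
  then show ?thesis using Xi.inv_map_eqI nlinearD(1)[OF nlinear_shift[OF l] g] by simp
qed

definition DE :: "((nat \<Rightarrow> nat) \<Rightarrow> 'f) set" where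
  "DE = {(\<lambda>v. \<Sum>l=1..n. delta l (h l) v - delta 0 (h l) v) | h. \<forall>l\<in>{1..n}. h l \<in> nfun E}"

lemma Psi_DE:
  assumes "f \<in> DE"
  shows "Psi f = (\<lambda>_. 0)"
proof -
  obtain h where h: "\<And>l. l \<in> {1..n} \<Longrightarrow> h l \<in> nfun E"
    and f: "f = (\<lambda>v. \<Sum>l=1..n. delta l (h l) v - delta 0 (h l) v)"
    using assms unfolding DE_def by blast
  have d: "delta l (h l) \<in> nfun E" "delta 0 (h l) \<in> nfun E" if "l \<in> {1..n}" for l
    using nlinearD(1)[OF nlinear_delta] h that by auto
  have "Psi f = (\<lambda>N. \<Sum>l=1..n. Psi (\<lambda>v. delta l (h l) v - delta 0 (h l) v) N)"
    unfolding f by (rule nlinear_sum[OF nlinear_Psi]) (simp, intro nfun_diff d)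
  also have "\<dots> = (\<lambda>N. \<Sum>l=1..n. 0)"
  proof (intro ext sum.cong refl)
    fix N l assume l: "l \<in> {1..n}"
    have "Psi (\<lambda>v. delta l (h l) v - delta 0 (h l) v) N = Psi (delta l (h l)) N - Psi (delta 0 (h l)) N"
      using nlinear_diff[OF nlinear_Psi d[OF l]] by simp
    also have "\<dots> = 0"
      unfolding Psi_def using l h[OF l] total_shift[of l 0] Xi.inv_map(1) by (simp add: inv_delta)
    finally show "Psi (\<lambda>v. delta l (h l) v - delta 0 (h l) v) N = 0" .
  qed
  finally show ?thesis by simp
qed

definition at0 :: "nat \<Rightarrow> nat \<Rightarrow> nat" where
  "at0 N = (\<lambda>l. if l = 0 then N else 0)"

lemma at0: "inj at0" "range at0 \<subseteq> E"
  by (auto simp: at0_def expo_def inj_def fun_eq_iff)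

text \<open>Each step moves one factor X_a with a > 0 to X_0, by X_a X^u = X_0 X^u + (X_a - X_0)
  X^u. After v_1 + ... + v_n steps only a power of X_0 of the same degree is left.\<close>

lemma telescope:
  assumes "v \<in> E"
  shows "\<exists>h. (\<forall>l. h l \<in> nfun E) \<and>
    (\<forall>w. eps v w = eps (at0 (dg v)) w + (\<Sum>l=1..n. shift l (h l) w - shift 0 (h l) w))"
  using assms
proof (induction "\<Sum>l=1..n. v l" arbitrary: v)
  case 0
  have "v = at0 (dg v)"
  proof
    fix l
    have d: "dg v = v 0 + (\<Sum>l=1..n. v l)"
      by (simp add: tdeg_def sum.atMost_shift sum.atLeast_Suc_atMost_Suc_shift[symmetric] atLeast0LessThan[symmetric]
          sum.atLeast1_atMost_eq lessThan_atLeast0)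
    show "v l = at0 (dg v) l"
      using 0 d by (cases "l = 0"; cases "l \<le> n") (auto simp: at0_def expo_def)
  qed
  then show ?case
    by (intro exI[of _ "\<lambda>_ _. 0"]) (simp add: shift_def)
next
  case (Suc k)
  have "\<exists>a\<in>{1..n}. v a > 0"
  proof (rule ccontr)
    assume "\<not> (\<exists>a\<in>{1..n}. v a > 0)"
    then have "(\<Sum>l=1..n. v l) = 0" by (intro sum.neutral) (simp add: Bex_def)
    then show False using Suc.hyps(2) by linarith
  qed
  then obtain a where a: "a \<in> {1..n}" "v a > 0" by blast
  define u where "u = v(a := v a - 1)"
  define v' where "v' = u(0 := Suc (u 0))"
  have uE: "u \<in> E" and v'E: "v' \<in> E" using Suc.prems a by (auto simp: u_def v'_def expo_def)
  have vu: "v = u(a := Suc (u a))" using a by (auto simp: u_def)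
  have "dg v' = dg v"
    using tdeg_upd[of a n v "v a - 1"] tdeg_upd[of 0 n u "Suc (u 0)"] a by (auto simp: u_def v'_def)
  moreover have "k = (\<Sum>l=1..n. v' l)"
  proof -
    have "(\<Sum>l=1..n. v l) = v a + (\<Sum>l\<in>{1..n}-{a}. v l)" using a by (intro sum.remove) auto
    moreover have "(\<Sum>l=1..n. v' l) = v' a + (\<Sum>l\<in>{1..n}-{a}. v' l)" using a by (intro sum.remove) auto
    moreover have "(\<Sum>l\<in>{1..n}-{a}. v' l) = (\<Sum>l\<in>{1..n}-{a}. v l)"
      by (intro sum.cong) (auto simp: v'_def u_def)
    ultimately show ?thesis using Suc.hyps(2) a by (simp add: v'_def u_def)
  qed
  ultimately obtain h where h: "\<forall>l. h l \<in> nfun E"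
    "\<forall>w. eps v' w = eps (at0 (dg v)) w + (\<Sum>l=1..n. shift l (h l) w - shift 0 (h l) w)"
    using Suc.hyps(1)[OF _ v'E] by auto
  define h' where "h' l = (if l = a then (\<lambda>w. h a w + eps u w) else h l)" for l
  have "h' l \<in> nfun E" for l
    using h(1) uE by (auto simp: h'_def intro: nfun_add eps_nfun)
  moreover have "eps v w = eps (at0 (dg v)) w + (\<Sum>l=1..n. shift l (h' l) w - shift 0 (h' l) w)" for w
  proof -
    have "(\<Sum>l=1..n. shift l (h' l) w - shift 0 (h' l) w) =
        (\<Sum>l=1..n. (shift l (h l) w - shift 0 (h l) w) + (if l = a then shift a (eps u) w - shift 0 (eps u) w else 0))"
      by (intro sum.cong) (auto simp: h'_def shift_def)
    also have "\<dots> = (\<Sum>l=1..n. shift l (h l) w - shift 0 (h l) w) + (eps v w - eps v' w)"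
      using a by (simp add: sum.distrib shift_eps vu v'_def)
    finally show ?thesis using h(2) by simp
  qed
  ultimately show ?case by blast
qed

text \<open>The multipliers found for monomials are extended to null families by
  \<open>nlin_ext\<close>. Every g is then a series in X_0 with the coefficients
  \<open>total g\<close> plus multiples of the X_l - X_0. If \<open>total g\<close> vanishes,
  \<open>Xi\<close> turns the rest into values of the operators \<delta>_l - \<delta>_0.\<close>

lemma Psi_kernel:
  assumes f: "f \<in> nfun E" and 0: "Psi f = (\<lambda>_. 0)"
  shows "f \<in> DE"
proof -
  have "\<forall>v. \<exists>h. v \<in> E \<longrightarrow> (\<forall>l. h l \<in> nfun E) \<and>
    (\<forall>w. eps v w = eps (at0 (dg v)) w + (\<Sum>l=1..n. shift l (h l) w - shift 0 (h l) w))"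
    using telescope by blast
  then have "\<exists>H. \<forall>v. v \<in> E \<longrightarrow> (\<forall>l. H v l \<in> nfun E) \<and>
    (\<forall>w. eps v w = eps (at0 (dg v)) w + (\<Sum>l=1..n. shift l (H v l) w - shift 0 (H v l) w))"
    by (rule choice)
  then obtain H where H: "\<And>v l. v \<in> E \<Longrightarrow> H v l \<in> nfun E"
    "\<And>v w. v \<in> E \<Longrightarrow> eps v w = eps (at0 (dg v)) w + (\<Sum>l=1..n. shift l (H v l) w - shift 0 (H v l) w)"
    by blast
  define M where "M l = nlin_ext (\<lambda>v. if v \<in> E then H v l else (\<lambda>_. 0))" for l
  have M: "nlinear E E (M l)" "v \<in> E \<Longrightarrow> M l (eps v) = H v l" for l v
    unfolding M_def using nlin_ext[of E "\<lambda>v. if v \<in> E then H v l else (\<lambda>_. 0)" E] H(1) by auto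
  have lin: "nlinear E E (\<lambda>g w. embed at0 (total g) w + (\<Sum>l=1..n. shift l (M l g) w - shift 0 (M l g) w))"
    using nlinear_embed(1)[OF at0]
    by (intro nlinear_plus nlinear_setsum nlinear_minus nlinear_comp[OF nlinear_total]
        nlinear_comp[OF M(1) nlinear_shift]) auto
  define g where "g = Xi.inv_map f"
  have g: "g \<in> nfun E" "Xi g = f" using Xi.inv_map[OF f] by (auto simp: g_def)
  have "(\<lambda>x. x) g = (\<lambda>w. embed at0 (total g) w + (\<Sum>l=1..n. shift l (M l g) w - shift 0 (M l g) w))"
  proof (rule nlinear_ext[OF _ lin g(1)])
    show "nlinear E E (\<lambda>x. x)" by (auto simp: nlinear_def)
    fix v assume v: "v \<in> E"
    show "eps v = (\<lambda>w. embed at0 (total (eps v)) w + (\<Sum>l=1..n. shift l (M l (eps v)) w - shift 0 (M l (eps v)) w))"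
      using H(2)[OF v] by (intro ext) (simp add: total_eps[OF v] nlinear_embed(2)[OF at0] M(2)[OF v])
  qed
  moreover have "total g = (\<lambda>_. 0)" using 0 by (simp add: Psi_def g_def)
  ultimately have "g = (\<lambda>w. \<Sum>l=1..n. shift l (M l g) w - shift 0 (M l g) w)"
    by (simp add: embed_def)
  then have "f = Xi (\<lambda>w. \<Sum>l=1..n. shift l (M l g) w - shift 0 (M l g) w)" using g(2) by simp
  also have "\<dots> = (\<lambda>w. \<Sum>l=1..n. Xi (\<lambda>w. shift l (M l g) w - shift 0 (M l g) w) w)"
    using g(1) by (intro nlinear_sum[OF nlinear_Xi] nfun_diff nlinearD(1)[OF nlinear_shift] nlinearD(1)[OF M(1)]) auto
  also have "\<dots> = (\<lambda>w. \<Sum>l=1..n. delta l (Xi (M l g)) w - delta 0 (Xi (M l g)) w)"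
  proof (intro ext sum.cong refl)
    fix w l assume l: "l \<in> {1..n}"
    have Mg: "M l g \<in> nfun E" by (rule nlinearD(1)[OF M(1) g(1)])
    have "Xi (\<lambda>w. shift l (M l g) w - shift 0 (M l g) w) = (\<lambda>w. Xi (shift l (M l g)) w - Xi (shift 0 (M l g)) w)"
      using l by (intro nlinear_diff[OF nlinear_Xi] nlinearD(1)[OF nlinear_shift] Mg) auto
    then show "Xi (\<lambda>w. shift l (M l g) w - shift 0 (M l g) w) w = delta l (Xi (M l g)) w - delta 0 (Xi (M l g)) w"
      using l Mg by (simp add: delta_Xi)
  qed
  finally show ?thesis
    using nlinearD(1)[OF nlinear_Xi nlinearD(1)[OF M(1) g(1)]] unfolding DE_def
    by (intro CollectI exI[of _ "\<lambda>l. Xi (M l g)"]) simp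
qed

text \<open>The exponent vector of \<open>\<tau>\<^sup>r X\<^sub>1 \<cdots> X\<^sub>j\<close>, where \<open>N = (n + 1) r + j\<close> and \<open>\<tau> = X\<^sub>0 \<cdots> X\<^sub>n\<close>.\<close>

definition bvec :: "nat \<Rightarrow> nat \<Rightarrow> nat" where
  "bvec N = (\<lambda>l. if l \<le> n then N div (n + 1) + (if 1 \<le> l \<and> l \<le> N mod (n + 1) then 1 else 0) else 0)"

lemma bvec_E: "bvec N \<in> E"
  by (simp add: bvec_def expo_def)

lemma tdeg_bvec: "dg (bvec N) = N"
proof -
  define m where "m = N mod (n + 1)"
  have le: "m \<le> n" using mod_less_divisor[of "n + 1" N] by (simp add: m_def)
  have "dg (bvec N) = (\<Sum>l\<le>n. N div (n + 1) + (if 1 \<le> l \<and> l \<le> m then 1 else 0))"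
    by (simp add: tdeg_def bvec_def m_def)
  also have "\<dots> = (n + 1) * (N div (n + 1)) + (\<Sum>l\<le>n. if 1 \<le> l \<and> l \<le> m then 1 else 0)"
    by (simp add: sum.distrib)
  also have "(\<Sum>l\<le>n. if 1 \<le> l \<and> l \<le> m then 1 else 0) = card {l\<in>{..n}. 1 \<le> l \<and> l \<le> m}"
    by (simp add: sum.If_cases Int_def)
  also have "{l\<in>{..n}. 1 \<le> l \<and> l \<le> m} = {1..m}" using le by auto
  finally show ?thesis by (simp add: m_def del: div_mult_self1 mult_Suc)
qed

lemma bvec: "inj bvec" "range bvec \<subseteq> E"
proof -
  show "inj bvec" by (rule inj_on_inverseI[of _ dg]) (simp add: tdeg_bvec)
qed (use bvec_E in auto)

abbreviation iota :: "(nat \<Rightarrow> 'f) \<Rightarrow> (nat \<Rightarrow> nat) \<Rightarrow> 'f" where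
  "iota \<equiv> embed bvec"

lemma nlinear_iota: "nlinear UNIV E iota"
  by (rule nlinear_embed(1)[OF bvec])

lemma iota_eps: "iota (eps N) = eps (bvec N)"
  by (rule nlinear_embed(2)[OF bvec])

lemma Psi_level:
  assumes f: "f \<in> nfun E" and l: "in_level dg Ns f"
  shows "in_level id Ns (Psi f)"
proof -
  have "in_level dg Ns (Xi.inv_map f)" by (rule Xi.inv_map_level[OF f l])
  then show ?thesis by (auto simp: in_level_def Psi_def total_def intro!: vb_sum)
qed

lemma eps_level: "in_level d {real (d v)} (eps v)"
  by (auto simp: in_level_def eps_def)

lemma Psi_eps_bound:
  assumes v: "v \<in> E"
  shows "vb (real N - real (dg v)) (Psi (eps v) N)"
  using Psi_level[OF eps_nfun[OF v] eps_level[of dg v]] by (simp add: in_level_def)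

text \<open>The preimage g of X^v under \<open>Xi\<close> has level \<open>dg v\<close>, hence is
  divisible by p above that degree; in that degree it agrees with X^v modulo p because
  \<open>Xi\<close> acts there as the identity. Summing g over the degree gives 1 modulo p.\<close>

lemma Psi_eps_main:
  assumes v: "v \<in> E" and N: "dg v \<le> N"
  shows "vb 1 (Psi (eps v) N - (if N = dg v then 1 else 0))"
proof (cases "N = dg v")
  case False
  then show ?thesis using vb_mono[OF Psi_eps_bound[OF v], of 1 N] N by simp
next
  case True
  define g where "g = Xi.inv_map (eps v)"
  have g: "g \<in> nfun E" "Xi g = eps v" "in_level dg {real (dg v)} g"
    using Xi.inv_map[OF eps_nfun[OF v]] Xi.inv_map_level[OF eps_nfun[OF v] eps_level[of dg v]]
    by (auto simp: g_def)
  have h: "vb 1 (g w)" if "dg w > N" for w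
  proof -
    have "vb (real (dg w) - real (dg v)) (g w)" using g(3) by (simp add: in_level_def)
    then show ?thesis by (rule vb_mono) (use that True in linarith)
  qed
  have "vb 1 (eps v w - g w)" if w: "w \<in> {w. w \<in> E \<and> dg w = N}" for w
  proof -
    have "vb 1 (Xi g w - (\<Sum>i | i \<in> E \<and> dg i = N. g i * of_int (if i = w then 1 else 0)))"
      using w by (intro Xi.top_part(1)[OF g(1) h]) auto
    also have "(\<Sum>i | i \<in> E \<and> dg i = N. g i * of_int (if i = w then 1 else 0)) = (\<Sum>i | i \<in> E \<and> dg i = N. if i = w then g i else 0)"
      by (intro sum.cong) auto
    also have "\<dots> = g w" using w finite_expo_eq[of n N] by simp
    finally show ?thesis by (simp add: g(2))
  qed
  then have "vb 1 (\<Sum>w | w \<in> E \<and> dg w = N. eps v w - g w)" by (intro vb_sum)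
  then have "vb 1 (total (eps v) N - total g N)" by (simp add: total_def sum_subtractf)
  moreover have "total (eps v) N = 1" unfolding total_eps[OF v] using True by (simp add: eps_def)
  moreover have "Psi (eps v) N = total g N" by (simp add: Psi_def g_def)
  ultimately show ?thesis using True vb_minus_commute[of 1 1 "total g N"] by simp
qed

end

text \<open>There is exactly one representative \<open>bvec N\<close> in each degree N, and
  \<open>Psi\<close> maps it to Y^N modulo p up to lower degrees. Hence every series in Y is the
  image of a unique null combination of the representatives.\<close>

sublocale kloosterman \<subseteq> PI: graded_map ord p L UNIV UNIV id id "\<lambda>a. Psi (iota a)"
  "\<lambda>i j. if i = j then 1 else 0" "\<lambda>i j. if i = j then 1 else 0"
proof (unfold_locales, goal_cases)
  case 1 show ?case by (rule nlinear_comp[OF nlinear_iota nlinear_Psi])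
next
  case (4 i j) then show ?case
    using Psi_eps_main[OF bvec_E[of i], of j] by (cases "i = j") (simp_all add: iota_eps tdeg_bvec)
next
  case (5 i j) then show ?case using Psi_eps_bound[OF bvec_E[of i], of j] by (simp add: iota_eps tdeg_bvec)
next
  case (6 j j') then show ?case using sum_delta_delta[of "{j}" j j'] by simp
qed auto

context kloosterman
begin

text \<open>The coordinates of the class of \<open>f\<close> with respect to the monomials X^v with
  v = \<open>bvec N\<close>.\<close>

definition hcoord :: "((nat \<Rightarrow> nat) \<Rightarrow> 'f) \<Rightarrow> nat \<Rightarrow> 'f" where
  "hcoord f = PI.inv_map (Psi f)"

lemma nlinear_hcoord: "nlinear E UNIV hcoord"
  unfolding hcoord_def by (rule nlinear_comp[OF nlinear_Psi PI.nlinear_inv_map])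

lemma hcoord_diff:
  assumes f: "f \<in> nfun E"
  shows "(\<lambda>v. f v - iota (hcoord f) v) \<in> DE"
proof -
  have h: "hcoord f \<in> nfun UNIV" by (rule nlinearD(1)[OF nlinear_hcoord f])
  have i: "iota (hcoord f) \<in> nfun E" by (rule nlinearD(1)[OF nlinear_iota h])
  have "Psi (iota (hcoord f)) = Psi f"
    unfolding hcoord_def by (rule PI.inv_map(2)[OF nlinearD(1)[OF nlinear_Psi f]])
  then have "Psi (\<lambda>v. f v - iota (hcoord f) v) = (\<lambda>_. 0)"
    using nlinear_diff[OF nlinear_Psi f i] by simp
  then show ?thesis by (rule Psi_kernel[OF nfun_diff[OF f i]])
qed

lemma hcoord_unique:
  assumes f: "f \<in> nfun E" and a: "a \<in> nfun UNIV" and d: "(\<lambda>v. f v - iota a v) \<in> DE"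
  shows "a = hcoord f"
proof -
  have i: "iota a \<in> nfun E" by (rule nlinearD(1)[OF nlinear_iota a])
  have "Psi f = Psi (iota a)"
    using Psi_DE[OF d] nlinear_diff[OF nlinear_Psi f i] by (simp add: fun_eq_iff)
  then show ?thesis using PI.inv_map_eqI[OF a] by (simp add: hcoord_def)
qed

lemma hcoord_level:
  assumes f: "f \<in> nfun E" and l: "in_level dg Ns f"
  shows "in_level id Ns (hcoord f)"
  unfolding hcoord_def
  by (rule PI.inv_map_level[OF nlinearD(1)[OF nlinear_Psi f] Psi_level[OF f l]])

lemma hcoord_bvec: "hcoord (eps (bvec N)) = eps N"
  using PI.inv_map_eqI[OF eps_nfun[of N UNIV]] by (simp add: hcoord_def iota_eps)

end

section \<open>Series in t and x as null families of coefficients in X_0, ..., X_n\<close>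

context kloosterman
begin

text \<open>A limit along the natural numbers is a condition on cofinite sets; in this form it makes
  sense for any index set and agrees with \<open>null_family\<close>.\<close>

lemma lim_ord_iff:
  "((\<lambda>r::nat. ord (a r)) \<longlongrightarrow> \<infinity>) sequentially \<longleftrightarrow> (\<forall>s::nat. finite {r. \<not> vb (real s) (a r)})"
  unfolding tendsto_PInfty cofinite_eq_sequentially[symmetric] eventually_cofinite
proof safe
  fix s :: nat assume *: "\<forall>b. finite {x. \<not> ereal b < ord (a x)}"
  show "finite {r. \<not> vb (real s) (a r)}"
    by (rule finite_subset[OF _ *[rule_format, of "real s"]]) (auto simp: vb_def)
next
  fix b assume *: "\<forall>s::nat. finite {r. \<not> vb (real s) (a r)}"
  show "finite {x. \<not> ereal b < ord (a x)}"
  proof (rule finite_subset[OF _ *[rule_format, of "Suc (nat \<lceil>b\<rceil>)"]], safe)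
    fix x assume "vb (real (Suc (nat \<lceil>b\<rceil>))) (a x)" "\<not> ereal b < ord (a x)"
    moreover have "b < real (Suc (nat \<lceil>b\<rceil>))" by linarith
    ultimately show False unfolding vb_def
      by (meson ereal_less_eq(3) less_ereal.simps(1) order_less_le_trans)
  qed
qed

abbreviation "OS \<equiv> O_set ord Oint n \<gamma>"
abbreviation "CS \<equiv> C_set ord Oint n \<gamma>"

text \<open>The coefficient a(r) in the expansion of an element of O in powers of \<gamma>^(n+1) t,
  which is the product X_0 ... X_n.\<close>

definition ncoef :: "'f fps \<Rightarrow> nat \<Rightarrow> 'f" where
  "ncoef f r = fps_nth f r / \<gamma> ^ (r * (n + 1))"

lemma O_set_iff: "f \<in> OS \<longleftrightarrow> ncoef f \<in> nfun UNIV"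
proof
  assume "f \<in> OS"
  then obtain a where a: "\<forall>r. a r \<in> Oint \<and> fps_nth f r = a r * \<gamma> ^ (r * (n + 1))"
    "((\<lambda>r. ord (a r)) \<longlongrightarrow> \<infinity>) sequentially"
    unfolding O_set_def by blast
  have "ncoef f = a" using a(1) by (auto simp: ncoef_def)
  then show "ncoef f \<in> nfun UNIV" using a unfolding lim_ord_iff by (intro nfunI) auto
next
  assume *: "ncoef f \<in> nfun UNIV"
  show "f \<in> OS"
    unfolding O_set_def lim_ord_iff
    by (rule CollectI, rule exI[of _ "ncoef f"]) (use nfunD[OF *] in \<open>auto simp: ncoef_def\<close>)
qed

lemma ncoef_nth: "fps_nth f r = ncoef f r * \<gamma> ^ (r * (n + 1))"
  by (simp add: ncoef_def)

lemma ncoef_simps [simp]: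
  "ncoef 0 r = 0" "ncoef (f + g) r = ncoef f r + ncoef g r" "ncoef (f - g) r = ncoef f r - ncoef g r"
  "ncoef (- f) r = - ncoef f r" "ncoef (fps_const a * f) r = a * ncoef f r"
  by (auto simp: ncoef_def diff_divide_distrib add_divide_distrib)

lemma ncoef_1: "ncoef 1 = eps 0"
  by (auto simp: ncoef_def eps_def fun_eq_iff)

lemma ncoef_mult: "ncoef (f * g) r = (\<Sum>i\<le>r. ncoef f i * ncoef g (r - i))"
proof -
  have "ncoef (f * g) r = (\<Sum>i\<le>r. fps_nth f i * fps_nth g (r - i)) / \<gamma> ^ (r * (n + 1))"
    by (simp add: ncoef_def fps_mult_nth atLeast0AtMost)
  also have "\<dots> = (\<Sum>i\<le>r. ncoef f i * ncoef g (r - i))"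
    unfolding sum_divide_distrib
  proof (intro sum.cong refl)
    fix i assume "i \<in> {..r}"
    then have "\<gamma> ^ (r * (n + 1)) = \<gamma> ^ (i * (n + 1)) * \<gamma> ^ ((r - i) * (n + 1))"
      by (simp add: power_add[symmetric] add_mult_distrib[symmetric] del: mult_Suc_right add_mult_distrib)
    then show "fps_nth f i * fps_nth g (r - i) / \<gamma> ^ (r * (n + 1)) = ncoef f i * ncoef g (r - i)"
      by (simp add: ncoef_def)
  qed
  finally show ?thesis .
qed

lemma O_set_mult: "f \<in> OS \<Longrightarrow> g \<in> OS \<Longrightarrow> f * g \<in> OS"
  unfolding O_set_iff
proof (rule nfunI)
  assume f: "ncoef f \<in> nfun UNIV" and g: "ncoef g \<in> nfun UNIV"
  show "ncoef (f * g) r \<in> Oint" for r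
    unfolding ncoef_mult Oint_iff using nfunD[OF f] nfunD[OF g]
    by (auto intro!: L_closed vb_sum vb_mult0)
  show "finite {r \<in> UNIV. \<not> vb (real s) (ncoef (f * g) r)}" for s
  proof (rule finite_subset)
    let ?A = "{r. \<not> vb (real s) (ncoef f r)}" and ?B = "{r. \<not> vb (real s) (ncoef g r)}"
    show "{r \<in> UNIV. \<not> vb (real s) (ncoef (f * g) r)} \<subseteq> (\<lambda>(a, b). a + b) ` (?A \<times> ?B)"
    proof
      fix r assume "r \<in> {r \<in> UNIV. \<not> vb (real s) (ncoef (f * g) r)}"
      then have "\<not> vb (real s) (\<Sum>i\<le>r. ncoef f i * ncoef g (r - i))" by (simp add: ncoef_mult)
      then obtain i where i: "i \<le> r" "\<not> vb (real s) (ncoef f i * ncoef g (r - i))"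
        using vb_sum[of "{..r}" "real s" "\<lambda>i. ncoef f i * ncoef g (r - i)"] by blast
      then have "i \<in> ?A" "r - i \<in> ?B"
        using vb_mult0(1)[of "ncoef f i" "real s" "ncoef g (r - i)"]
          vb_mult0(2)[of "real s" "ncoef f i" "ncoef g (r - i)"] nfunD(3)[OF f] nfunD(3)[OF g] by auto
      then show "r \<in> (\<lambda>(a, b). a + b) ` (?A \<times> ?B)"
        using i(1) by (intro image_eqI[of _ _ "(i, r - i)"]) auto
    qed
    show "finite ((\<lambda>(a, b). a + b) ` (?A \<times> ?B))"
      using nfunD(6)[OF f] nfunD(6)[OF g] by (intro finite_imageI finite_cartesian_product)
  qed
qed auto

lemma type_subring_O: "type_subring OS"
proof
  show "1 \<in> OS" unfolding O_set_iff ncoef_1 by (rule eps_nfun) simp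
  show "x - y \<in> OS" if "x \<in> OS" "y \<in> OS" for x y
    using that nfun_diff unfolding O_set_iff by (simp add: ncoef_simps(3)[abs_def])
qed (rule O_set_mult)

text \<open>The condition r \<ge> m(u) for u in Z^n, that is, t^r x^u is up to a scalar a monomial
  in X_0, ..., X_n.\<close>

definition valid :: "(nat \<Rightarrow> int) \<Rightarrow> nat \<Rightarrow> bool" where
  "valid u r \<longleftrightarrow> u \<in> exponents n \<and> (\<forall>l\<in>{1..n}. 0 \<le> u l + int r)"

text \<open>X^v = \<gamma>^(dg v) t^(v_0) x^u with u_l = v_l - v_0. Conversely \<open>vof\<close>
  reads v off from u and the exponent r = v_0 of t.\<close>

definition uof :: "(nat \<Rightarrow> nat) \<Rightarrow> nat \<Rightarrow> int" where
  "uof v = (\<lambda>l. if l \<in> {1..n} then int (v l) - int (v 0) else 0)"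

definition vof :: "(nat \<Rightarrow> int) \<Rightarrow> nat \<Rightarrow> nat \<Rightarrow> nat" where
  "vof u r = (\<lambda>l. if l = 0 then r else if l \<le> n then nat (u l + int r) else 0)"

lemma valid_iff: "valid u r \<longleftrightarrow> u \<in> exponents n \<and> m_exp n u \<le> r"
proof -
  have "m_exp n u \<le> r \<longleftrightarrow> (\<forall>l\<in>{1..n}. 0 \<le> u l + int r)"
    unfolding m_exp_def nat_le_iff by (subst Max_le_iff) auto
  then show ?thesis by (simp add: valid_def)
qed

lemma vof_0 [simp]: "vof u r 0 = r"
  by (simp add: vof_def)

lemma vof_E: "vof u r \<in> E"
  by (simp add: vof_def expo_def)

lemma uof_exponents: "uof v \<in> exponents n"
  by (simp add: uof_def exponents_def)

lemma valid_uof: "valid (uof v) (v 0)"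
  using uof_exponents[of v] by (simp add: valid_def uof_def)

lemma vof_uof: "v \<in> E \<Longrightarrow> vof (uof v) (v 0) = v"
  by (auto simp: vof_def uof_def expo_def fun_eq_iff)

lemma uof_vof: "valid u r \<Longrightarrow> uof (vof u r) = u"
  by (auto simp: vof_def uof_def valid_def exponents_def fun_eq_iff)

lemma sum_split0: "(\<Sum>l\<le>n. f l) = f 0 + (\<Sum>l=1..n. f l)" for f :: "nat \<Rightarrow> 'a::comm_monoid_add"
  by (simp add: atLeast0AtMost[symmetric] sum.atLeast_Suc_atMost)

lemma int_tdeg_vof:
  assumes "valid u r"
  shows "int (dg (vof u r)) = (\<Sum>l=1..n. u l) + int ((n + 1) * r)"
proof -
  have "int (dg (vof u r)) = int r + (\<Sum>l=1..n. int (vof u r l))"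
    by (simp add: tdeg_def sum_split0)
  also have "(\<Sum>l=1..n. int (vof u r l)) = (\<Sum>l=1..n. u l + int r)"
    using assms by (intro sum.cong) (auto simp: vof_def valid_def)
  finally show ?thesis by (simp add: sum.distrib algebra_simps)
qed

text \<open>Reconciles the two normalisations: \<gamma>^(w(u)) from the definition of C and
  \<gamma>^((n+1) s) for t^s in O multiply to \<gamma>^(dg v) when s = r - m(u).\<close>

lemma tdeg_vof:
  assumes "valid u r"
  shows "dg (vof u r) = w_exp n u + (n + 1) * (r - m_exp n u)"
proof -
  have v: "valid u (m_exp n u)" using assms by (simp add: valid_iff)
  have le: "m_exp n u \<le> r" using assms by (simp add: valid_iff)
  have w: "int (w_exp n u) = (\<Sum>l=1..n. u l) + int ((n + 1) * m_exp n u)"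
    using int_tdeg_vof[OF v] unfolding w_exp_def by linarith
  obtain k where k: "r = m_exp n u + k" using le le_iff_add by blast
  have "int (dg (vof u r)) = int (w_exp n u) + int ((n + 1) * (r - m_exp n u))"
    unfolding int_tdeg_vof[OF assms] w by (simp add: k algebra_simps)
  then show ?thesis by linarith
qed

definition cfun :: "'f series \<Rightarrow> (nat \<Rightarrow> nat) \<Rightarrow> 'f" where
  "cfun f v = (if v \<in> E then fps_nth (f (uof v)) (v 0) / \<gamma> ^ dg v else 0)"

definition fser :: "((nat \<Rightarrow> nat) \<Rightarrow> 'f) \<Rightarrow> 'f series" where
  "fser a u = Abs_fps (\<lambda>r. if valid u r then a (vof u r) * \<gamma> ^ dg (vof u r) else 0)"

lemma cfun_vof: "valid u r \<Longrightarrow> fps_nth (f u) r = cfun f (vof u r) * \<gamma> ^ dg (vof u r)"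
  by (simp add: cfun_def vof_E uof_vof)

lemma cfun_fser: "(\<And>v. v \<notin> E \<Longrightarrow> a v = 0) \<Longrightarrow> cfun (fser a) = a"
  by (auto simp: cfun_def fser_def valid_uof vof_uof fun_eq_iff)

lemma finite_w_exp: "finite {u \<in> exponents n. w_exp n u < W}"
proof (rule finite_subset)
  show "{u \<in> exponents n. w_exp n u < W} \<subseteq> uof ` {v \<in> E. dg v \<le> W}"
  proof
    fix u assume u: "u \<in> {u \<in> exponents n. w_exp n u < W}"
    have v: "valid u (m_exp n u)" using u by (simp add: valid_iff)
    show "u \<in> uof ` {v \<in> E. dg v \<le> W}"
      using uof_vof[OF v] tdeg_vof[OF v] vof_E u
      by (intro image_eqI[of _ _ "vof u (m_exp n u)"]) auto
  qed
qed (intro finite_imageI finite_expo)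

text \<open>Only finitely many u have w(u) below a given bound. Therefore the two convergence
  conditions, that each \<xi>(u) has coefficients tending to zero and that \<xi>(u) itself tends to
  zero in the norm, amount to one: the coefficients of the X^v form a null family.\<close>

lemma C_set_iff: "f \<in> CS \<longleftrightarrow> (\<forall>u r. \<not> valid u r \<longrightarrow> fps_nth (f u) r = 0) \<and> cfun f \<in> nfun E"
proof
  assume "f \<in> CS"
  then obtain \<xi> where 0: "\<And>u. u \<notin> exponents n \<Longrightarrow> f u = 0"
    and \<xi>: "\<And>u. u \<in> exponents n \<Longrightarrow> \<xi> u \<in> OS"
      "\<And>u. u \<in> exponents n \<Longrightarrow> f u = \<xi> u * fps_const (\<gamma> ^ w_exp n u) * fps_X ^ m_exp n u"
    and lim: "\<And>b::real. \<exists>W. \<forall>u\<in>exponents n. W \<le> w_exp n u \<longrightarrow> ereal b \<le> O_ord ord n \<gamma> (\<xi> u)"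
    unfolding C_set_def by blast
  have nth: "fps_nth (f u) r = (if r < m_exp n u then 0 else fps_nth (\<xi> u) (r - m_exp n u) * \<gamma> ^ w_exp n u)"
    if "u \<in> exponents n" for u r
    unfolding \<xi>(2)[OF that] by (simp add: fps_X_power_mult_right_nth)
  have cf: "cfun f v = ncoef (\<xi> (uof v)) (v 0 - m_exp n (uof v))" if v: "v \<in> E" for v
  proof -
    let ?u = "uof v" and ?m = "m_exp n (uof v)"
    have le: "?m \<le> v 0" using valid_uof by (simp add: valid_iff)
    have d: "dg v = w_exp n ?u + (v 0 - ?m) * (n + 1)"
      using tdeg_vof[OF valid_uof[of v]] by (simp add: vof_uof[OF v] mult.commute)
    have "cfun f v = fps_nth (\<xi> ?u) (v 0 - ?m) * \<gamma> ^ w_exp n ?u / \<gamma> ^ dg v"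
      using v le by (simp add: cfun_def nth[OF uof_exponents])
    also have "\<dots> = ncoef (\<xi> ?u) (v 0 - ?m)"
      unfolding d power_add ncoef_def by simp
    finally show ?thesis .
  qed
  show "(\<forall>u r. \<not> valid u r \<longrightarrow> fps_nth (f u) r = 0) \<and> cfun f \<in> nfun E"
  proof (intro conjI allI impI)
    fix u r assume nv: "\<not> valid u r"
    show "fps_nth (f u) r = 0"
      using nv nth[of u r] 0[of u] by (cases "u \<in> exponents n") (auto simp: valid_iff)
  next
    show "cfun f \<in> nfun E"
    proof (rule nfunI)
      show "cfun f v \<in> Oint" if "v \<in> E" for v
        using nfunD(5)[OF \<xi>(1)[OF uof_exponents, unfolded O_set_iff]] cf[OF that] by simp
      show "cfun f v = 0" if "v \<notin> E" for v using that by (simp add: cfun_def)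
      fix s :: nat
      obtain W where W: "\<And>u. u \<in> exponents n \<Longrightarrow> W \<le> w_exp n u \<Longrightarrow> ereal (real s) \<le> O_ord ord n \<gamma> (\<xi> u)"
        using lim[of "real s"] by blast
      let ?B = "\<lambda>u. {r. \<not> vb (real s) (ncoef (\<xi> u) r)}"
      let ?D = "{u \<in> exponents n. w_exp n u < W}"
      \<comment> \<open>Exponents u with w(u) at least W are settled by the norm; each of the
        finitely many others contributes finitely many r.\<close>
      have "{v \<in> E. \<not> vb (real s) (cfun f v)} \<subseteq> (\<Union>u\<in>?D. (\<lambda>r. vof u (r + m_exp n u)) ` ?B u)"
      proof
        fix v assume "v \<in> {v \<in> E. \<not> vb (real s) (cfun f v)}"
        then have v: "v \<in> E" and nv: "\<not> vb (real s) (cfun f v)" by auto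
        let ?u = "uof v"
        have nb: "v 0 - m_exp n ?u \<in> ?B ?u" using nv cf[OF v] by simp
        have "O_ord ord n \<gamma> (\<xi> ?u) \<le> ord (ncoef (\<xi> ?u) (v 0 - m_exp n ?u))"
          unfolding O_ord_def ncoef_def by (rule INF_lower) simp
        then have "\<not> ereal (real s) \<le> O_ord ord n \<gamma> (\<xi> ?u)"
          using nb order.trans unfolding vb_def by blast
        then have "?u \<in> ?D" using W[OF uof_exponents[of v]] uof_exponents[of v] by force
        moreover have "v = vof ?u ((v 0 - m_exp n ?u) + m_exp n ?u)"
          using vof_uof[OF v] valid_uof[of v] by (simp add: valid_iff)
        ultimately show "v \<in> (\<Union>u\<in>?D. (\<lambda>r. vof u (r + m_exp n u)) ` ?B u)" using nb by blast
      qed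
      moreover have "finite (\<Union>u\<in>?D. (\<lambda>r. vof u (r + m_exp n u)) ` ?B u)"
        using finite_w_exp nfunD(6)[OF \<xi>(1)[unfolded O_set_iff]] by (intro finite_UN_I finite_imageI) auto
      ultimately show "finite {v \<in> E. \<not> vb (real s) (cfun f v)}" by (rule finite_subset)
    qed
  qed
next
  assume *: "(\<forall>u r. \<not> valid u r \<longrightarrow> fps_nth (f u) r = 0) \<and> cfun f \<in> nfun E"
  then have a: "cfun f \<in> nfun E" and nv: "\<And>u r. \<not> valid u r \<Longrightarrow> fps_nth (f u) r = 0" by auto
  define \<xi> where "\<xi> u = Abs_fps (\<lambda>r. cfun f (vof u (r + m_exp n u)) * \<gamma> ^ (r * (n + 1)))" for u
  have nc: "ncoef (\<xi> u) = (\<lambda>r. cfun f (vof u (r + m_exp n u)))" for u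
    by (auto simp: ncoef_def \<xi>_def)
  have \<xi>O: "\<xi> u \<in> OS" if "u \<in> exponents n" for u
    unfolding O_set_iff nc
  proof (rule nfunI)
    show "cfun f (vof u (r + m_exp n u)) \<in> Oint" for r by (rule nfunD(5)[OF a])
    show "finite {r \<in> UNIV. \<not> vb (real s) (cfun f (vof u (r + m_exp n u)))}" for s
    proof (rule finite_subset)
      show "{r \<in> UNIV. \<not> vb (real s) (cfun f (vof u (r + m_exp n u)))} \<subseteq>
          (\<lambda>v. v 0 - m_exp n u) ` {v. \<not> vb (real s) (cfun f v)}"
        by (auto intro!: image_eqI[of _ _ "vof u (_ + m_exp n u)"])
    qed (use nfunD(6)[OF a] in auto)
  qed auto
  have eq: "f u = \<xi> u * fps_const (\<gamma> ^ w_exp n u) * fps_X ^ m_exp n u" if u: "u \<in> exponents n" for u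
  proof (rule fps_ext)
    fix r
    show "fps_nth (f u) r = fps_nth (\<xi> u * fps_const (\<gamma> ^ w_exp n u) * fps_X ^ m_exp n u) r"
    proof (cases "m_exp n u \<le> r")
      case True
      then have v: "valid u r" using u by (simp add: valid_iff)
      have "\<gamma> ^ dg (vof u r) = \<gamma> ^ ((r - m_exp n u) * (n + 1)) * \<gamma> ^ w_exp n u"
        unfolding tdeg_vof[OF v] power_add[symmetric] by (simp add: algebra_simps)
      then show ?thesis
        using True cfun_vof[OF v, of f] by (simp add: fps_X_power_mult_right_nth \<xi>_def)
    next
      case False
      then show ?thesis using nv[of u r] by (simp add: valid_iff fps_X_power_mult_right_nth)
    qed
  qed
  have f0: "f u = 0" if "u \<notin> exponents n" for u
    using nv[of u] that by (intro fps_ext) (simp add: valid_iff)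
  have "\<exists>W. \<forall>u\<in>exponents n. W \<le> w_exp n u \<longrightarrow> ereal b \<le> O_ord ord n \<gamma> (\<xi> u)" for b :: real
  proof -
    define s where "s = nat \<lceil>b\<rceil>"
    \<comment> \<open>Beyond every degree in which some coefficient has order below s. This suffices
      because the degree of t^r x^u is at least w(u).\<close>
    define W where "W = Suc (Max (insert 0 (dg ` {v. \<not> vb (real s) (cfun f v)})))"
    have fin: "finite {v. \<not> vb (real s) (cfun f v)}" by (rule nfunD(6)[OF a])
    have good: "vb b (cfun f v)" if "W \<le> dg v" for v
    proof -
      have "vb (real s) (cfun f v)"
      proof (rule ccontr)
        assume "\<not> vb (real s) (cfun f v)"
        then have "dg v \<le> Max (insert 0 (dg ` {v. \<not> vb (real s) (cfun f v)}))"
          using fin by (intro Max_ge) auto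
        then show False using that by (simp add: W_def)
      qed
      then show ?thesis by (rule vb_mono) (simp add: s_def real_nat_ceiling_ge)
    qed
    show ?thesis
    proof (intro exI[of _ W] ballI impI)
      fix u assume u: "u \<in> exponents n" "W \<le> w_exp n u"
      show "ereal b \<le> O_ord ord n \<gamma> (\<xi> u)"
        unfolding O_ord_def
      proof (rule INF_greatest)
        fix r
        have v: "valid u (r + m_exp n u)" using u(1) by (simp add: valid_iff)
        have "W \<le> dg (vof u (r + m_exp n u))" using u(2) tdeg_vof[OF v] by simp
        from good[OF this] show "ereal b \<le> ord (fps_nth (\<xi> u) r / \<gamma> ^ (r * (n + 1)))"
          unfolding ncoef_def[symmetric] nc vb_def .
      qed
    qed
  qed
  then show "f \<in> CS" unfolding C_set_def using \<xi>O eq f0 by blast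
qed

lemma cfun_nfun: "f \<in> CS \<Longrightarrow> cfun f \<in> nfun E"
  by (simp add: C_set_iff)

lemma C_set_nth:
  assumes "f \<in> CS"
  shows "fps_nth (f u) r = (if valid u r then cfun f (vof u r) * \<gamma> ^ dg (vof u r) else 0)"
  using assms cfun_vof[of u r f] by (simp add: C_set_iff)

lemma fser_cfun: "f \<in> CS \<Longrightarrow> fser (cfun f) = f"
  by (auto simp: fser_def fun_eq_iff fps_eq_iff C_set_nth)

lemma cfun_fser': "a \<in> nfun E \<Longrightarrow> cfun (fser a) = a"
  using nfunD(4)[of a E] by (intro cfun_fser)

lemma fser_C: "a \<in> nfun E \<Longrightarrow> fser a \<in> CS"
  by (simp add: C_set_iff cfun_fser') (simp add: fser_def)

lemma cfun_inj: "f \<in> CS \<Longrightarrow> g \<in> CS \<Longrightarrow> cfun f = cfun g \<Longrightarrow> f = g"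
  using fser_cfun by metis

lemma cfun_simps:
  "cfun (\<lambda>u. f u + g u) = (\<lambda>v. cfun f v + cfun g v)"
  "cfun (\<lambda>u. f u - g u) = (\<lambda>v. cfun f v - cfun g v)"
  "cfun (\<lambda>u. - f u) = (\<lambda>v. - cfun f v)" "cfun (\<lambda>u. 0) = (\<lambda>v. 0)"
  "cfun (\<lambda>u. \<Sum>i\<in>A. h i u) = (\<lambda>v. \<Sum>i\<in>A. cfun (h i) v)"
  by (auto simp: cfun_def fun_eq_iff add_divide_distrib diff_divide_distrib fps_sum_nth sum_divide_distrib)

lemma C_set_add: "f \<in> CS \<Longrightarrow> g \<in> CS \<Longrightarrow> (\<lambda>u. f u + g u) \<in> CS"
  by (simp add: C_set_iff cfun_simps nfun_add)

lemma C_set_minus: "f \<in> CS \<Longrightarrow> g \<in> CS \<Longrightarrow> (\<lambda>u. f u - g u) \<in> CS"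
  by (simp add: C_set_iff cfun_simps nfun_diff)

lemma C_set_uminus: "f \<in> CS \<Longrightarrow> (\<lambda>u. - f u) \<in> CS"
  by (simp add: C_set_iff cfun_simps nfun_uminus)

lemma C_set_zero: "(\<lambda>u. 0) \<in> CS"
  by (simp add: C_set_iff cfun_simps)

lemma C_set_sum: "(\<And>i. i \<in> A \<Longrightarrow> h i \<in> CS) \<Longrightarrow> (\<lambda>u. \<Sum>i\<in>A. h i u) \<in> CS"
  by (induction A rule: infinite_finite_induct) (auto intro: C_set_add C_set_zero)

text \<open>Multiplication by the series with coefficients b_s in \<tau> = X_0 ... X_n =
  \<gamma>^(n+1) t; the power \<tau>^s divides X^v exactly when s \<le> v_l for all l.\<close>

definition tmul :: "(nat \<Rightarrow> 'f) \<Rightarrow> ((nat \<Rightarrow> nat) \<Rightarrow> 'f) \<Rightarrow> (nat \<Rightarrow> nat) \<Rightarrow> 'f" where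
  "tmul b a v = (if v \<in> E then \<Sum>s\<in>{s. \<forall>l\<le>n. s \<le> v l}. b s * a (\<lambda>l. v l - s) else 0)"

lemma finite_below: "finite {s. \<forall>l\<le>n. s \<le> v l}" for v :: "nat \<Rightarrow> nat"
  by (rule finite_subset[of _ "{..v 0}"]) auto

lemma cfun_smult:
  assumes f: "f \<in> CS"
  shows "cfun (\<lambda>u. b * f u) = tmul (ncoef b) (cfun f)"
proof
  fix v
  show "cfun (\<lambda>u. b * f u) v = tmul (ncoef b) (cfun f) v"
  proof (cases "v \<in> E")
    case False
    then show ?thesis by (simp add: cfun_def tmul_def)
  next
    case True
    have "cfun (\<lambda>u. b * f u) v = (\<Sum>s\<le>v 0. fps_nth b s * fps_nth (f (uof v)) (v 0 - s)) / \<gamma> ^ dg v"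
      using True by (simp add: cfun_def fps_mult_nth atLeast0AtMost)
    \<comment> \<open>For each dropped s some v_l with l \<ge> 1 is smaller than s, so the monomial
      t^(v_0 - s) x^u does not occur in \<open>f\<close>.\<close>
    also have "(\<Sum>s\<le>v 0. fps_nth b s * fps_nth (f (uof v)) (v 0 - s)) =
        (\<Sum>s\<in>{s. \<forall>l\<le>n. s \<le> v l}. fps_nth b s * fps_nth (f (uof v)) (v 0 - s))"
    proof (rule sum.mono_neutral_right)
      show "\<forall>s\<in>{..v 0} - {s. \<forall>l\<le>n. s \<le> v l}. fps_nth b s * fps_nth (f (uof v)) (v 0 - s) = 0"
      proof
        fix s assume "s \<in> {..v 0} - {s. \<forall>l\<le>n. s \<le> v l}"
        then obtain l where l: "s \<le> v 0" "l \<le> n" "v l < s" by (auto simp: not_le)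
        then have "l \<in> {1..n}" by (cases l) auto
        moreover have "uof v l + int (v 0 - s) < 0" using l \<open>l \<in> {1..n}\<close> by (simp add: uof_def)
        ultimately have "\<not> valid (uof v) (v 0 - s)" by (force simp: valid_def)
        then show "fps_nth b s * fps_nth (f (uof v)) (v 0 - s) = 0" using C_set_nth[OF f] by simp
      qed
    qed auto
    also have "\<dots> / \<gamma> ^ dg v = tmul (ncoef b) (cfun f) v"
      unfolding tmul_def if_P[OF True] sum_divide_distrib
    proof (intro sum.cong refl)
      fix s assume s: "s \<in> {s. \<forall>l\<le>n. s \<le> v l}"
      have vu: "valid (uof v) (v 0 - s)"
        using s uof_exponents[of v] by (auto simp: valid_def uof_def)
      have vv: "vof (uof v) (v 0 - s) = (\<lambda>l. v l - s)"
        using True s by (auto simp: vof_def uof_def expo_def fun_eq_iff)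
      have "dg v = (\<Sum>l\<le>n. (v l - s) + s)"
        unfolding tdeg_def using s by (intro sum.cong) auto
      then have d: "dg v = dg (\<lambda>l. v l - s) + s * (n + 1)"
        by (simp add: tdeg_def sum.distrib)
      show "fps_nth b s * fps_nth (f (uof v)) (v 0 - s) / \<gamma> ^ dg v = ncoef b s * cfun f (\<lambda>l. v l - s)"
        unfolding cfun_vof[OF vu, of f] vv d power_add ncoef_def by simp
    qed
    finally show ?thesis .
  qed
qed

end

section \<open>The connection and the operators D_{t,l} in the variables X_0, ..., X_n\<close>

context kloosterman
begin

text \<open>\<open>ev l N\<close> and \<open>ov N\<close> are the exponents in x of the monomials of
  K(t^N, x^N), namely of x_l^N and of t^N / (x_1 ... x_n)^N.\<close>

definition ev :: "nat \<Rightarrow> nat \<Rightarrow> nat \<Rightarrow> int" where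
  "ev l N = (\<lambda>j. if j = l then int N else 0)"

definition ov :: "nat \<Rightarrow> nat \<Rightarrow> int" where
  "ov N = (\<lambda>j. if j \<in> {1..n} then - int N else 0)"

lemma ev_eq_iff: "N > 0 \<Longrightarrow> ev l N = ev l' N' \<longleftrightarrow> l = l' \<and> N = N'"
  by (auto simp: ev_def fun_eq_iff split: if_splits)

lemma ov_eq_iff: "ov N = ov N' \<longleftrightarrow> N = N'"
proof
  assume "ov N = ov N'"
  then have "ov N 1 = ov N' 1" by simp
  then show "N = N'" using n1 by (simp add: ov_def)
qed simp

lemma ev_neq_ov: "N > 0 \<Longrightarrow> l \<in> {1..n} \<Longrightarrow> ev l N \<noteq> ov N'"
proof
  assume "N > 0" "l \<in> {1..n}" "ev l N = ov N'"
  then have "ev l N l = ov N' l" by simp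
  then show False using \<open>N > 0\<close> \<open>l \<in> {1..n}\<close> by (simp add: ev_def ov_def)
qed

lemma p_power_eq_iff: "p ^ i = p ^ j \<longleftrightarrow> i = j"
  using p2 by (simp add: power_inject_exp)

lemma p_power_pos': "0 < p ^ j"
  using p_power_pos[of j] by linarith

lemma K_pow_eq:
  "K_pow n N v = (\<Sum>l=1..n. if v = ev l N then 1 else 0) + (if v = ov N then fps_X ^ N else (0 :: 'f fps))"
  by (simp add: K_pow_def monom_x_def ev_def ov_def)

lemma K_pow_ev: "l \<in> {1..n} \<Longrightarrow> K_pow n (p ^ i) (ev l (p ^ j)) = (if i = j then 1 else (0 :: 'f fps))"
proof -
  assume l: "l \<in> {1..n}"
  have "(\<Sum>l'=1..n. if ev l (p ^ j) = ev l' (p ^ i) then 1 else (0 :: 'f fps)) =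
      (\<Sum>l'=1..n. if l' = l then (if i = j then 1 else 0) else 0)"
    by (intro sum.cong refl) (auto simp: ev_eq_iff[OF p_power_pos'] p_power_eq_iff)
  then show ?thesis using l ev_neq_ov[OF p_power_pos' l] by (simp add: K_pow_eq)
qed

lemma K_pow_ov: "K_pow n (p ^ i) (ov (p ^ j)) = (if i = j then fps_X ^ (p ^ i) else (0 :: 'f fps))"
proof -
  have "(\<Sum>l'=1..n. if ov (p ^ j) = ev l' (p ^ i) then 1 else (0 :: 'f fps)) = 0"
    using ev_neq_ov[OF p_power_pos'] by (intro sum.neutral) (metis (full_types))
  then show ?thesis by (auto simp: K_pow_eq ov_eq_iff p_power_eq_iff)
qed

lemma K_pow_other:
  assumes "\<And>l. l \<in> {1..n} \<Longrightarrow> v \<noteq> ev l N" "v \<noteq> ov N"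
  shows "K_pow n N v = (0 :: 'f fps)"
  using assms by (auto simp: K_pow_eq intro!: sum.neutral)

abbreviation "HH \<equiv> H_series p n \<gamma>"

lemma HH_ev: "l \<in> {1..n} \<Longrightarrow> HH (ev l (p ^ j)) = fps_const (gamma_part p \<gamma> j)"
  unfolding H_series_def by (subst Sum_any.expand_superset[of "{j}"]) (auto simp: K_pow_ev)

lemma HH_ov: "HH (ov (p ^ j)) = fps_const (gamma_part p \<gamma> j) * fps_X ^ (p ^ j)"
  unfolding H_series_def by (subst Sum_any.expand_superset[of "{j}"]) (auto simp: K_pow_ov)

lemma HH_other:
  assumes "\<And>l j. l \<in> {1..n} \<Longrightarrow> v \<noteq> ev l (p ^ j)" "\<And>j. v \<noteq> ov (p ^ j)"
  shows "HH v = 0"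
proof -
  have "K_pow n (p ^ i) v = (0 :: 'f fps)" for i
    by (rule K_pow_other) (use assms in blast)+
  then show ?thesis by (simp add: H_series_def)
qed

text \<open>Reduces a convolution with H at a fixed monomial to the finitely many terms of H that
  can contribute; \<open>Sum_any_ev_ov\<close> does the same when two kinds of terms occur.\<close>

lemma Sum_any_ov:
  fixes F :: "(nat \<Rightarrow> int) \<Rightarrow> 'f"
  assumes B: "finite B" and 0: "\<And>v. (\<And>j. j \<in> B \<Longrightarrow> v \<noteq> ov (p ^ j)) \<Longrightarrow> F v = 0"
  shows "Sum_any F = (\<Sum>j\<in>B. F (ov (p ^ j)))"
proof -
  have "Sum_any F = sum F ((\<lambda>j. ov (p ^ j)) ` B)"
    using B 0 by (intro Sum_any.expand_superset) auto
  also have "\<dots> = (\<Sum>j\<in>B. F (ov (p ^ j)))"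
    by (subst sum.reindex) (auto simp: inj_on_def ov_eq_iff p_power_eq_iff)
  finally show ?thesis .
qed

lemma Sum_any_ev_ov:
  fixes F :: "(nat \<Rightarrow> int) \<Rightarrow> 'f"
  assumes l: "l \<in> {1..n}" and A: "finite A" and B: "finite B"
    and 0: "\<And>v. (\<And>j. j \<in> A \<Longrightarrow> v \<noteq> ev l (p ^ j)) \<Longrightarrow> (\<And>j. j \<in> B \<Longrightarrow> v \<noteq> ov (p ^ j)) \<Longrightarrow> F v = 0"
  shows "Sum_any F = (\<Sum>j\<in>A. F (ev l (p ^ j))) + (\<Sum>j\<in>B. F (ov (p ^ j)))"
proof -
  have "Sum_any F = sum F ((\<lambda>j. ev l (p ^ j)) ` A \<union> (\<lambda>j. ov (p ^ j)) ` B)"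
    using A B 0 by (intro Sum_any.expand_superset) auto
  also have "\<dots> = sum F ((\<lambda>j. ev l (p ^ j)) ` A) + sum F ((\<lambda>j. ov (p ^ j)) ` B)"
    using A B ev_neq_ov[OF p_power_pos' l] by (intro sum.union_disjoint) auto
  also have "sum F ((\<lambda>j. ev l (p ^ j)) ` A) = (\<Sum>j\<in>A. F (ev l (p ^ j)))"
    by (subst sum.reindex) (auto simp: inj_on_def ev_eq_iff[OF p_power_pos'] p_power_eq_iff)
  also have "sum F ((\<lambda>j. ov (p ^ j)) ` B) = (\<Sum>j\<in>B. F (ov (p ^ j)))"
    by (subst sum.reindex) (auto simp: inj_on_def ov_eq_iff p_power_eq_iff)
  finally show ?thesis .
qed

lemma valid_ev:
  assumes l: "l \<in> {1..n}"
  shows "valid (\<lambda>i. u i - ev l N i) r \<longleftrightarrow> valid u r \<and> N \<le> vof u r l"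
proof -
  have "(\<lambda>i. u i - ev l N i) \<in> exponents n \<longleftrightarrow> u \<in> exponents n"
    using l by (auto simp: exponents_def ev_def)
  moreover have "(\<forall>i\<in>{1..n}. 0 \<le> u i - ev l N i + int r) \<longleftrightarrow> (\<forall>i\<in>{1..n}. 0 \<le> u i + int r) \<and> int N \<le> u l + int r"
  proof safe
    fix i assume h: "\<forall>i\<in>{1..n}. 0 \<le> u i - ev l N i + int r" and i: "i \<in> {1..n}"
    from h i have "0 \<le> u i - ev l N i + int r" by blast
    then show "0 \<le> u i + int r" by (simp add: ev_def split: if_splits)
  next
    assume h: "\<forall>i\<in>{1..n}. 0 \<le> u i - ev l N i + int r"
    with l have "0 \<le> u l - ev l N l + int r" by blast
    then show "int N \<le> u l + int r" by (simp add: ev_def)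
  next
    fix i assume "\<forall>i\<in>{1..n}. 0 \<le> u i + int r" "int N \<le> u l + int r" "i \<in> {1..n}"
    then show "0 \<le> u i - ev l N i + int r" by (auto simp: ev_def)
  qed
  moreover have "N \<le> vof u r l \<longleftrightarrow> int N \<le> u l + int r" if "0 \<le> u l + int r"
    using l that by (auto simp: vof_def)
  ultimately show ?thesis unfolding valid_def using l by auto
qed

lemma vof_ev:
  assumes l: "l \<in> {1..n}" and v: "valid u r" "N \<le> vof u r l"
  shows "vof (\<lambda>i. u i - ev l N i) r = (vof u r)(l := vof u r l - N)"
  using assms by (auto simp: vof_def ev_def fun_eq_iff valid_def)

lemma valid_ov:
  assumes N: "N \<le> r"
  shows "valid (\<lambda>i. u i - ov N i) (r - N) \<longleftrightarrow> valid u r"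
proof -
  have "(\<lambda>i. u i - ov N i) \<in> exponents n \<longleftrightarrow> u \<in> exponents n"
    by (auto simp: exponents_def ov_def)
  then show ?thesis using N by (auto simp: valid_def ov_def)
qed

lemma vof_ov:
  assumes N: "N \<le> r"
  shows "vof (\<lambda>i. u i - ov N i) (r - N) = (vof u r)(0 := r - N)"
  using assms by (auto simp: vof_def ov_def fun_eq_iff)

lemma C_set_ev:
  assumes f: "f \<in> CS" and l: "l \<in> {1..n}" and N: "N \<le> vof u r l" and v: "valid u r"
  shows "fps_nth (f (\<lambda>i. u i - ev l N i)) r * \<gamma> ^ N = cfun f ((vof u r)(l := vof u r l - N)) * \<gamma> ^ dg (vof u r)"
proof -
  have "dg ((vof u r)(l := vof u r l - N)) + N = dg (vof u r)"
    using tdeg_upd[of l n "vof u r" "vof u r l - N"] l N by simp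
  then show ?thesis
    using C_set_nth[OF f, of "\<lambda>i. u i - ev l N i" r] valid_ev[OF l, of u N r] v N vof_ev[OF l v N]
    by (simp add: power_add[symmetric] mult.assoc)
qed

lemma C_set_ov:
  assumes f: "f \<in> CS" and N: "N \<le> r" and v: "valid u r"
  shows "fps_nth (f (\<lambda>i. u i - ov N i)) (r - N) * \<gamma> ^ N = cfun f ((vof u r)(0 := vof u r 0 - N)) * \<gamma> ^ dg (vof u r)"
proof -
  have "dg ((vof u r)(0 := r - N)) + N = dg (vof u r)"
    using tdeg_upd[of 0 n "vof u r" "r - N"] N by simp
  then show ?thesis
    using C_set_nth[OF f, of "\<lambda>i. u i - ov N i" "r - N"] valid_ov[OF N, of u] v vof_ov[OF N, of u]
    by (simp add: power_add[symmetric] mult.assoc)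
qed

lemma fps_X_power_const_nth:
  "fps_nth (fps_const a * fps_X ^ N * g) r = (if r < N then 0 else a * fps_nth g (r - N))" for g :: "'f fps"
  by (simp add: mult.assoc fps_X_power_mult_nth)

lemma theta_nth: "fps_nth (theta f) r = of_nat r * fps_nth f r" for f :: "'f fps"
  by (cases r) (simp_all add: theta_def)

text \<open>Of the terms of H only those at \<open>ov (p ^ j)\<close> depend on t, and t d/dt
  multiplies them by p^j. The change of degree supplies \<gamma>^(p^j), which turns p^j \<gamma>_j
  into c_j, and r is the exponent of X_0; so the result is \<delta>_0.\<close>

lemma del_op_nth:
  assumes f: "f \<in> CS"
  shows "fps_nth (del_op p n \<gamma> f u) r = (if valid u r then delta 0 (cfun f) (vof u r) * \<gamma> ^ dg (vof u r) else 0)"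
proof -
  define F where "F v = fps_nth (theta (HH v) * f (\<lambda>i. u i - v i)) r" for v
  have Fov: "F (ov (p ^ j)) = (if r < p ^ j then 0 else
      of_nat (p ^ j) * gamma_part p \<gamma> j * fps_nth (f (\<lambda>i. u i - ov (p ^ j) i)) (r - p ^ j))" for j
  proof -
    have "theta (HH (ov (p ^ j))) = fps_const (of_nat (p ^ j) * gamma_part p \<gamma> j) * fps_X ^ (p ^ j)"
    proof (rule fps_ext)
      fix m
      show "fps_nth (theta (HH (ov (p ^ j)))) m =
          fps_nth (fps_const (of_nat (p ^ j) * gamma_part p \<gamma> j) * fps_X ^ (p ^ j)) m"
        unfolding theta_nth HH_ov fps_mult_left_const_nth fps_X_power_nth
        by (cases "m = p ^ j") simp_all
    qed
    then show ?thesis by (simp add: F_def fps_X_power_const_nth)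
  qed
  have Fev: "F (ev l (p ^ j)) = 0" if "l \<in> {1..n}" for l j
    unfolding F_def HH_ev[OF that] by (simp add: theta_def)
  have "Sum_any F = (\<Sum>j | p ^ j \<le> r. F (ov (p ^ j)))"
  proof (rule Sum_any_ov[OF finite_powers])
    fix v assume h: "\<And>j. j \<in> {j. p ^ j \<le> r} \<Longrightarrow> v \<noteq> ov (p ^ j)"
    consider l j where "l \<in> {1..n}" "v = ev l (p ^ j)" | j where "v = ov (p ^ j)"
      | "\<And>l j. l \<in> {1..n} \<Longrightarrow> v \<noteq> ev l (p ^ j)" "\<And>j. v \<noteq> ov (p ^ j)" by blast
    then show "F v = 0"
    proof cases
      case 2
      then have "\<not> p ^ j \<le> r" using h[of j] by auto
      then show ?thesis using 2 by (simp add: Fov not_le)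
    next
      case 3
      then have "HH v = 0" by (intro HH_other) blast+
      then show ?thesis by (simp add: F_def theta_def)
    qed (use Fev in auto)
  qed
  also have "\<dots> = (\<Sum>j | p ^ j \<le> r. c j * (fps_nth (f (\<lambda>i. u i - ov (p ^ j) i)) (r - p ^ j) * \<gamma> ^ (p ^ j)))"
    by (intro sum.cong refl) (simp add: Fov c_def)
  finally have S: "Sum_any F = \<dots>" .
  have "fps_nth (del_op p n \<gamma> f u) r = of_nat r * fps_nth (f u) r + Sum_any F"
    by (cases r) (simp_all add: del_op_def series_mult_def theta_def F_def)
  also have "\<dots> = (if valid u r then delta 0 (cfun f) (vof u r) * \<gamma> ^ dg (vof u r) else 0)"
  proof (cases "valid u r")
    case True
    have "(\<Sum>j | p ^ j \<le> r. c j * (fps_nth (f (\<lambda>i. u i - ov (p ^ j) i)) (r - p ^ j) * \<gamma> ^ (p ^ j))) =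
        (\<Sum>j | p ^ j \<le> r. c j * cfun f ((vof u r)(0 := r - p ^ j))) * \<gamma> ^ dg (vof u r)"
      unfolding sum_distrib_right using C_set_ov[OF f _ True] by (intro sum.cong refl) (simp add: mult.assoc)
    then show ?thesis
      unfolding S using True cfun_vof[OF True, of f] by (simp add: delta_def algebra_simps)
  next
    case False
    then have "Sum_any F = 0"
      unfolding S using valid_ov[of _ r u] C_set_nth[OF f] by (intro sum.neutral) simp
    then show ?thesis using False C_set_nth[OF f, of u r] by simp
  qed
  finally show ?thesis .
qed

text \<open>The terms at \<open>ev l\<close> carry the factor p^j and those at \<open>ov\<close> the
  factor -p^j, which give the sums in \<delta>_l and in -\<delta>_0. The Euler terms match because
  u_l = v_l - v_0.\<close>

lemma D_op_nth:
  assumes f: "f \<in> CS" and l: "l \<in> {1..n}"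
  shows "fps_nth (D_op p n \<gamma> l f u) r =
    (if valid u r then (delta l (cfun f) (vof u r) - delta 0 (cfun f) (vof u r)) * \<gamma> ^ dg (vof u r) else 0)"
proof -
  define F where "F v = fps_nth (theta_x l HH v * f (\<lambda>i. u i - v i)) r" for v
  have ofi: "fps_nth (of_int z * g) r = of_int z * fps_nth g r" for z and g :: "'f fps" and r
    by (simp add: fps_of_int[symmetric])
  have Fov: "F (ov (p ^ j)) = (if r < p ^ j then 0 else
      - (of_nat (p ^ j) * gamma_part p \<gamma> j * fps_nth (f (\<lambda>i. u i - ov (p ^ j) i)) (r - p ^ j)))" for j
  proof -
    have "F (ov (p ^ j)) = of_int (ov (p ^ j) l) * fps_nth (HH (ov (p ^ j)) * f (\<lambda>i. u i - ov (p ^ j) i)) r"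
      by (simp add: F_def theta_x_def mult.assoc ofi)
    also have "\<dots> = - of_nat (p ^ j) * fps_nth (HH (ov (p ^ j)) * f (\<lambda>i. u i - ov (p ^ j) i)) r"
      using l by (simp add: ov_def)
    finally show ?thesis by (simp add: HH_ov fps_X_power_const_nth)
  qed
  have Fev: "F (ev l' (p ^ j)) = (if l' = l then of_nat (p ^ j) * gamma_part p \<gamma> j * fps_nth (f (\<lambda>i. u i - ev l (p ^ j) i)) r else 0)"
    if "l' \<in> {1..n}" for l' j
  proof -
    have "F (ev l' (p ^ j)) = of_int (ev l' (p ^ j) l) * fps_nth (HH (ev l' (p ^ j)) * f (\<lambda>i. u i - ev l' (p ^ j) i)) r"
      by (simp add: F_def theta_x_def mult.assoc ofi)
    then show ?thesis using that by (simp add: HH_ev) (simp add: ev_def)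
  qed
  \<comment> \<open>Such a term would need a monomial of \<open>f\<close> with a negative exponent
    of X_l.\<close>
  have Fev0: "F (ev l (p ^ j)) = 0" if "\<not> p ^ j \<le> vof u r l" for j
    using valid_ev[OF l, of u "p ^ j" r] C_set_nth[OF f, of "\<lambda>i. u i - ev l (p ^ j) i" r] that l by (simp add: Fev)
  have "Sum_any F = (\<Sum>j | p ^ j \<le> vof u r l. F (ev l (p ^ j))) + (\<Sum>j | p ^ j \<le> r. F (ov (p ^ j)))"
  proof (rule Sum_any_ev_ov[OF l finite_powers finite_powers])
    fix v assume h: "\<And>j. j \<in> {j. p ^ j \<le> vof u r l} \<Longrightarrow> v \<noteq> ev l (p ^ j)"
      "\<And>j. j \<in> {j. p ^ j \<le> r} \<Longrightarrow> v \<noteq> ov (p ^ j)"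
    consider l' j where "l' \<in> {1..n}" "v = ev l' (p ^ j)" | j where "v = ov (p ^ j)"
      | "\<And>l j. l \<in> {1..n} \<Longrightarrow> v \<noteq> ev l (p ^ j)" "\<And>j. v \<noteq> ov (p ^ j)" by blast
    then show "F v = 0"
    proof cases
      case 1
      then show ?thesis using h(1)[of j] Fev0[of j] by (cases "l' = l") (auto simp: Fev)
    next
      case 2
      then have "\<not> p ^ j \<le> r" using h(2)[of j] by auto
      then show ?thesis using 2 by (simp add: Fov not_le)
    next
      case 3
      then have "HH v = 0" by (intro HH_other) blast+
      then show ?thesis by (simp add: F_def theta_x_def)
    qed
  qed
  also have "\<dots> = (\<Sum>j | p ^ j \<le> vof u r l. c j * (fps_nth (f (\<lambda>i. u i - ev l (p ^ j) i)) r * \<gamma> ^ (p ^ j)))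
      - (\<Sum>j | p ^ j \<le> r. c j * (fps_nth (f (\<lambda>i. u i - ov (p ^ j) i)) (r - p ^ j) * \<gamma> ^ (p ^ j)))"
    unfolding diff_conv_add_uminus sum_negf[symmetric] using l
    by (intro arg_cong2[where f = "(+)"] sum.cong refl) (simp_all add: Fov Fev c_def)
  finally have S: "Sum_any F = \<dots>" .
  have "fps_nth (D_op p n \<gamma> l f u) r = of_int (u l) * fps_nth (f u) r + Sum_any F"
    by (simp add: D_op_def series_mult_def theta_x_def F_def ofi)
  also have "\<dots> = (if valid u r then (delta l (cfun f) (vof u r) - delta 0 (cfun f) (vof u r)) * \<gamma> ^ dg (vof u r) else 0)"
  proof (cases "valid u r")
    case True
    have 1: "(\<Sum>j | p ^ j \<le> r. c j * (fps_nth (f (\<lambda>i. u i - ov (p ^ j) i)) (r - p ^ j) * \<gamma> ^ (p ^ j))) =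
        (\<Sum>j | p ^ j \<le> r. c j * cfun f ((vof u r)(0 := r - p ^ j))) * \<gamma> ^ dg (vof u r)"
      unfolding sum_distrib_right using C_set_ov[OF f _ True] by (intro sum.cong refl) (simp add: mult.assoc)
    have 2: "(\<Sum>j | p ^ j \<le> vof u r l. c j * (fps_nth (f (\<lambda>i. u i - ev l (p ^ j) i)) r * \<gamma> ^ (p ^ j))) =
        (\<Sum>j | p ^ j \<le> vof u r l. c j * cfun f ((vof u r)(l := vof u r l - p ^ j))) * \<gamma> ^ dg (vof u r)"
      unfolding sum_distrib_right using C_set_ev[OF f l _ True] by (intro sum.cong refl) (simp add: mult.assoc)
    have ul: "of_int (u l) = (of_nat (vof u r l) - of_nat r :: 'f)"
    proof -
      have "u l = int (vof u r l) - int r" using True l by (auto simp: valid_def vof_def)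
      then show ?thesis by simp
    qed
    show ?thesis
      unfolding S 1 2 ul using True cfun_vof[OF True, of f] by (simp add: delta_def algebra_simps)
  next
    case False
    have "(\<Sum>j | p ^ j \<le> vof u r l. c j * (fps_nth (f (\<lambda>i. u i - ev l (p ^ j) i)) r * \<gamma> ^ (p ^ j))) = 0"
      using valid_ev[OF l, of u _ r] False C_set_nth[OF f] by (intro sum.neutral) simp
    moreover have "(\<Sum>j | p ^ j \<le> r. c j * (fps_nth (f (\<lambda>i. u i - ov (p ^ j) i)) (r - p ^ j) * \<gamma> ^ (p ^ j))) = 0"
      using valid_ov[of _ r u] False C_set_nth[OF f] by (intro sum.neutral) simp
    ultimately show ?thesis unfolding S using False C_set_nth[OF f, of u r] by simp
  qed
  finally show ?thesis .
qed

lemma del_op_eq: "f \<in> CS \<Longrightarrow> del_op p n \<gamma> f = fser (delta 0 (cfun f))"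
  by (auto simp: fser_def fun_eq_iff fps_eq_iff del_op_nth)

lemma D_op_eq: "f \<in> CS \<Longrightarrow> l \<in> {1..n} \<Longrightarrow> D_op p n \<gamma> l f = fser (\<lambda>v. delta l (cfun f) v - delta 0 (cfun f) v)"
  by (auto simp: fser_def fun_eq_iff fps_eq_iff D_op_nth)

lemma delta_closed: "l \<le> n \<Longrightarrow> a \<in> nfun E \<Longrightarrow> delta l a \<in> nfun E"
  using nlinearD(1)[OF nlinear_delta] by blast

lemma del_op_C: "f \<in> CS \<Longrightarrow> del_op p n \<gamma> f \<in> CS" "f \<in> CS \<Longrightarrow> cfun (del_op p n \<gamma> f) = delta 0 (cfun f)"
  using delta_closed[of 0 "cfun f"] cfun_nfun[of f] by (auto simp: del_op_eq fser_C cfun_fser')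

lemma D_op_C:
  assumes "f \<in> CS" "l \<in> {1..n}"
  shows "D_op p n \<gamma> l f \<in> CS" "cfun (D_op p n \<gamma> l f) = (\<lambda>v. delta l (cfun f) v - delta 0 (cfun f) v)"
proof -
  have "(\<lambda>v. delta l (cfun f) v - delta 0 (cfun f) v) \<in> nfun E"
    using assms by (intro nfun_diff delta_closed cfun_nfun) auto
  then show "D_op p n \<gamma> l f \<in> CS" "cfun (D_op p n \<gamma> l f) = (\<lambda>v. delta l (cfun f) v - delta 0 (cfun f) v)"
    unfolding D_op_eq[OF assms] by (auto simp: fser_C cfun_fser')
qed

lemma DC_iff: "f \<in> DC ord Oint p n \<gamma> \<longleftrightarrow> f \<in> CS \<and> cfun f \<in> DE"
proof
  assume "f \<in> DC ord Oint p n \<gamma>"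
  then obtain h where h: "\<And>l. l \<in> {1..n} \<Longrightarrow> h l \<in> CS" and f: "f = (\<lambda>u. \<Sum>l=1..n. D_op p n \<gamma> l (h l) u)"
    unfolding DC_def by blast
  have "f \<in> CS" unfolding f using D_op_C(1) h by (intro C_set_sum) auto
  moreover have "cfun f = (\<lambda>v. \<Sum>l=1..n. delta l (cfun (h l)) v - delta 0 (cfun (h l)) v)"
    unfolding f cfun_simps using D_op_C(2) h by (intro ext sum.cong) auto
  ultimately show "f \<in> CS \<and> cfun f \<in> DE"
    unfolding DE_def using h cfun_nfun by (intro conjI CollectI exI[of _ "\<lambda>l. cfun (h l)"]) auto
next
  assume f: "f \<in> CS \<and> cfun f \<in> DE"
  then obtain h where h: "\<And>l. l \<in> {1..n} \<Longrightarrow> h l \<in> nfun E"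
    and e: "cfun f = (\<lambda>v. \<Sum>l=1..n. delta l (h l) v - delta 0 (h l) v)"
    unfolding DE_def by blast
  have C: "(\<lambda>u. \<Sum>l=1..n. D_op p n \<gamma> l (fser (h l)) u) \<in> CS"
    using D_op_C(1) fser_C h by (intro C_set_sum) auto
  have "cfun (\<lambda>u. \<Sum>l=1..n. D_op p n \<gamma> l (fser (h l)) u) = cfun f"
    unfolding e cfun_simps using D_op_C(2) fser_C h cfun_fser' by (intro ext sum.cong) auto
  then have "f = (\<lambda>u. \<Sum>l=1..n. D_op p n \<gamma> l (fser (h l)) u)"
    using cfun_inj C f by metis
  then show "f \<in> DC ord Oint p n \<gamma>"
    unfolding DC_def using h fser_C by (intro CollectI exI[of _ "\<lambda>l. fser (h l)"]) auto
qed

lemma tmul_nfun: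
  assumes b: "b \<in> nfun UNIV" and a: "a \<in> nfun E"
  shows "tmul b a \<in> nfun E"
proof (rule nfunI)
  show "tmul b a v \<in> Oint" for v
    using nfunD[OF a] nfunD[OF b] by (auto simp: tmul_def Oint_iff L.zero_S intro!: L_closed vb_sum vb_mult0)
  show "tmul b a v = 0" if "v \<notin> E" for v using that by (simp add: tmul_def)
  show "finite {v \<in> E. \<not> vb (real s) (tmul b a v)}" for s
  proof (rule finite_subset)
    let ?A = "{r. \<not> vb (real s) (b r)}" and ?B = "{v. \<not> vb (real s) (a v)}"
    let ?g = "\<lambda>(r, v) l. if l \<le> n then v l + r else 0"
    show "{v \<in> E. \<not> vb (real s) (tmul b a v)} \<subseteq> ?g ` (?A \<times> ?B)"
    proof
      fix v assume "v \<in> {v \<in> E. \<not> vb (real s) (tmul b a v)}"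
      then have v: "v \<in> E" and nv: "\<not> vb (real s) (\<Sum>r\<in>{r. \<forall>l\<le>n. r \<le> v l}. b r * a (\<lambda>l. v l - r))"
        by (auto simp: tmul_def)
      then obtain r where r: "\<forall>l\<le>n. r \<le> v l" "\<not> vb (real s) (b r * a (\<lambda>l. v l - r))"
        using vb_sum[of "{r. \<forall>l\<le>n. r \<le> v l}" "real s" "\<lambda>r. b r * a (\<lambda>l. v l - r)"] by blast
      have "r \<in> ?A" using vb_mult0(2)[OF _ nfunD(3)[OF a]] r(2) by blast
      moreover have "(\<lambda>l. v l - r) \<in> ?B" using vb_mult0(1)[OF nfunD(3)[OF b]] r(2) by blast
      moreover have "v = ?g (r, \<lambda>l. v l - r)" using r(1) v by (auto simp: expo_def fun_eq_iff)
      ultimately show "v \<in> ?g ` (?A \<times> ?B)" by blast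
    qed
    show "finite (?g ` (?A \<times> ?B))"
      using nfunD(6)[OF a] nfunD(6)[OF b] by (intro finite_imageI finite_cartesian_product)
  qed
qed

lemma C_set_smult: "b \<in> OS \<Longrightarrow> f \<in> CS \<Longrightarrow> (\<lambda>u. b * f u) \<in> CS"
proof -
  assume b: "b \<in> OS" and f: "f \<in> CS"
  have 0: "fps_nth (b * f u) r = 0" if nv: "\<not> valid u r" for u r
  proof -
    have "\<not> valid u (r - i)" for i
      using nv by (force simp: valid_def)
    then show ?thesis using C_set_nth[OF f, of u] by (simp add: fps_mult_nth)
  qed
  have "tmul (ncoef b) (cfun f) \<in> nfun E"
    using b f by (intro tmul_nfun cfun_nfun) (simp add: O_set_iff)
  then show ?thesis using 0 by (simp add: C_set_iff cfun_smult[OF f])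
qed

text \<open>The Leibniz rule \<delta>_l(\<tau>^s a) = \<tau>^s \<delta>_l a + s \<tau>^s a. The
  extra term does not depend on l, so it cancels in \<delta>_l - \<delta>_0, which therefore
  commutes with \<tau>.\<close>

lemma tmul_delta:
  assumes l: "l \<le> n" and v: "v \<in> E"
  shows "delta l (tmul b a) v = tmul b (delta l a) v +
    (\<Sum>s\<in>{s. \<forall>l\<le>n. s \<le> v l}. of_nat s * (b s * a (\<lambda>l. v l - s)))"
proof -
  let ?S = "{s. \<forall>l\<le>n. s \<le> v l}"
  let ?g = "\<lambda>j s. c j * (b s * a ((\<lambda>i. v i - s)(l := v l - s - p ^ j)))"
  have 1: "c j * tmul b a (v(l := v l - p ^ j)) = (\<Sum>s\<in>{s \<in> ?S. p ^ j \<le> v l - s}. ?g j s)"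
    if j: "p ^ j \<le> v l" for j
  proof -
    have "{s. \<forall>i\<le>n. s \<le> (v(l := v l - p ^ j)) i} = {s \<in> ?S. p ^ j \<le> v l - s}"
    proof (rule Set.set_eqI)
      fix s
      have "(\<forall>i\<le>n. s \<le> (v(l := v l - p ^ j)) i) \<longleftrightarrow> (\<forall>i\<le>n. i \<noteq> l \<longrightarrow> s \<le> v i) \<and> s \<le> v l - p ^ j"
        using l by auto
      moreover have "(\<forall>i\<le>n. s \<le> v i) \<longleftrightarrow> (\<forall>i\<le>n. i \<noteq> l \<longrightarrow> s \<le> v i) \<and> s \<le> v l"
        using l by auto
      moreover have "s \<le> v l - p ^ j \<longleftrightarrow> s \<le> v l \<and> p ^ j \<le> v l - s" using j by arith
      ultimately show "s \<in> {s. \<forall>i\<le>n. s \<le> (v(l := v l - p ^ j)) i} \<longleftrightarrow> s \<in> {s \<in> ?S. p ^ j \<le> v l - s}"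
        by blast
    qed
    moreover have "(\<lambda>i. (v(l := v l - p ^ j)) i - s) = (\<lambda>i. v i - s)(l := v l - s - p ^ j)" for s
      by (auto simp: fun_eq_iff)
    ultimately show ?thesis
      using expo_upd[OF l v] by (simp add: tmul_def sum_distrib_left)
  qed
  have 2: "delta l a (\<lambda>i. v i - s) = (of_nat (v l) - of_nat s) * a (\<lambda>i. v i - s) +
      (\<Sum>j\<in>{j \<in> {j. p ^ j \<le> v l}. p ^ j \<le> v l - s}. c j * a ((\<lambda>i. v i - s)(l := v l - s - p ^ j)))" if "s \<in> ?S" for s
  proof -
    have "{j. p ^ j \<le> v l - s} = {j \<in> {j. p ^ j \<le> v l}. p ^ j \<le> v l - s}" by auto
    moreover have "s \<le> v l" using that l by auto
    ultimately show ?thesis by (simp add: delta_def of_nat_diff)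
  qed
  have "(\<Sum>j | p ^ j \<le> v l. c j * tmul b a (v(l := v l - p ^ j))) =
      (\<Sum>j | p ^ j \<le> v l. \<Sum>s\<in>{s \<in> ?S. p ^ j \<le> v l - s}. ?g j s)"
    using 1 by (intro sum.cong) auto
  \<comment> \<open>The pairs (j, s) are those with p^j + s \<le> v_l; they may be summed in either
    order.\<close>
  also have "\<dots> = (\<Sum>s\<in>?S. \<Sum>j\<in>{j \<in> {j. p ^ j \<le> v l}. p ^ j \<le> v l - s}. ?g j s)"
    by (rule sum.swap_restrict[OF finite_powers finite_below])
  finally have "delta l (tmul b a) v = of_nat (v l) * (\<Sum>s\<in>?S. b s * a (\<lambda>l. v l - s)) + \<dots>"
    using v by (simp add: delta_def tmul_def)
  also have "\<dots> = (\<Sum>s\<in>?S. b s * delta l a (\<lambda>i. v i - s) + of_nat s * (b s * a (\<lambda>l. v l - s)))"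
    unfolding sum_distrib_left sum.distrib[symmetric]
  proof (intro sum.cong refl)
    fix s assume s: "s \<in> ?S"
    show "of_nat (v l) * (b s * a (\<lambda>l. v l - s)) + (\<Sum>j\<in>{j \<in> {j. p ^ j \<le> v l}. p ^ j \<le> v l - s}. ?g j s) =
        b s * delta l a (\<lambda>i. v i - s) + of_nat s * (b s * a (\<lambda>l. v l - s))"
      unfolding 2[OF s] by (simp add: algebra_simps sum_distrib_left)
  qed
  finally show ?thesis using v by (simp add: tmul_def sum.distrib)
qed

lemma DC_smult:
  assumes b: "b \<in> OS" and f: "f \<in> DC ord Oint p n \<gamma>"
  shows "(\<lambda>u. b * f u) \<in> DC ord Oint p n \<gamma>"
proof -
  obtain h where h: "\<And>l. l \<in> {1..n} \<Longrightarrow> h l \<in> nfun E"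
    and e: "cfun f = (\<lambda>v. \<Sum>l=1..n. delta l (h l) v - delta 0 (h l) v)" and fC: "f \<in> CS"
    using f unfolding DC_iff DE_def by blast
  have nb: "ncoef b \<in> nfun UNIV" using b by (simp add: O_set_iff)
  have "tmul (ncoef b) (cfun f) = (\<lambda>v. \<Sum>l=1..n. delta l (tmul (ncoef b) (h l)) v - delta 0 (tmul (ncoef b) (h l)) v)"
  proof
    fix v
    show "tmul (ncoef b) (cfun f) v = (\<Sum>l=1..n. delta l (tmul (ncoef b) (h l)) v - delta 0 (tmul (ncoef b) (h l)) v)"
    proof (cases "v \<in> E")
      case False
      have "delta l (tmul (ncoef b) (h l')) v = 0" if "l \<le> n" "l' \<in> {1..n}" for l l'
        using nfunD(4)[OF delta_closed[OF that(1) tmul_nfun[OF nb h[OF that(2)]]] False] .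
      then show ?thesis using False by (simp add: tmul_def)
    next
      case True
      have "(\<Sum>l=1..n. delta l (tmul (ncoef b) (h l)) v - delta 0 (tmul (ncoef b) (h l)) v) =
          (\<Sum>l=1..n. tmul (ncoef b) (delta l (h l)) v - tmul (ncoef b) (delta 0 (h l)) v)"
        using True by (intro sum.cong refl) (simp add: tmul_delta)
      also have "\<dots> = (\<Sum>l=1..n. \<Sum>s\<in>{s. \<forall>i\<le>n. s \<le> v i}. ncoef b s *
          (delta l (h l) (\<lambda>i. v i - s) - delta 0 (h l) (\<lambda>i. v i - s)))"
        using True by (simp add: tmul_def sum_subtractf right_diff_distrib)
      also have "\<dots> = (\<Sum>s\<in>{s. \<forall>i\<le>n. s \<le> v i}. \<Sum>l=1..n. ncoef b s *
          (delta l (h l) (\<lambda>i. v i - s) - delta 0 (h l) (\<lambda>i. v i - s)))"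
        by (rule sum.swap)
      also have "\<dots> = tmul (ncoef b) (cfun f) v"
        unfolding tmul_def if_P[OF True] e sum_distrib_left[symmetric] ..
      finally show ?thesis by (rule sym)
    qed
  qed
  then have "tmul (ncoef b) (cfun f) \<in> DE"
    unfolding DE_def using tmul_nfun[OF nb h] by (intro CollectI exI[of _ "\<lambda>l. tmul (ncoef b) (h l)"]) auto
  then show ?thesis using C_set_smult[OF b fC] by (simp add: DC_iff cfun_smult[OF fC])
qed

end

section \<open>The module H^n: its basis, coordinates and connection\<close>

sublocale kloosterman \<subseteq> OS: type_subring OS
  by (rule type_subring_O)

context kloosterman
begin

abbreviation "OR \<equiv> O_ring ord Oint n \<gamma>"
abbreviation "CM \<equiv> C_module ord Oint n \<gamma>"
abbreviation "DD \<equiv> DC ord Oint p n \<gamma>"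
abbreviation "HM \<equiv> Hn ord Oint p n \<gamma>"
abbreviation "hb \<equiv> Hn_basis ord Oint p n \<gamma>"

lemma O_ring_eq: "OR = (ring_of_type_algebra :: 'f fps ring)\<lparr>carrier := OS\<rparr>"
  by (simp add: O_ring_def)

lemma C_module_simps [simp]:
  "carrier CM = CS" "add CM = (\<lambda>f g u. f u + g u)" "zero CM = (\<lambda>_. 0)" "module.smult CM = (\<lambda>c f u. c * f u)"
  by (auto simp: C_module_def)

lemma module_C: "module OR CM"
  unfolding O_ring_eq
proof (rule moduleI)
  show "abelian_group CM"
  proof (rule abelian_groupI)
    fix f assume "f \<in> carrier CM"
    then have "(\<lambda>u. - f u) \<in> carrier CM" by (simp add: C_set_uminus)
    then show "\<exists>g\<in>carrier CM. g \<oplus>\<^bsub>CM\<^esub> f = \<zero>\<^bsub>CM\<^esub>" by (rule rev_bexI) simp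
  qed (auto simp: add_ac C_set_add C_set_zero)
qed (auto simp: OS.cring_RS C_set_smult algebra_simps)

lemma C_minus:
  assumes "f \<in> CS" "g \<in> CS"
  shows "f \<ominus>\<^bsub>CM\<^esub> g = (\<lambda>u. f u - g u)"
proof -
  interpret C: module OR CM by (rule module_C)
  have "\<ominus>\<^bsub>CM\<^esub> g = (\<lambda>u. - g u)"
    using assms by (intro C.M.minus_equality) (auto simp: C_set_uminus)
  then show ?thesis by (simp add: a_minus_def)
qed

lemma C_finsum:
  assumes "finite A" "\<And>a. a \<in> A \<Longrightarrow> f a \<in> CS"
  shows "finsum CM f A = (\<lambda>u. \<Sum>a\<in>A. f a u)"
proof -
  interpret C: module OR CM by (rule module_C)
  show ?thesis using assms
  proof (induction A rule: finite_induct)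
    case (insert a A)
    then have "finsum CM f (insert a A) = f a \<oplus>\<^bsub>CM\<^esub> finsum CM f A"
      by (intro C.M.finsum_insert) auto
    then show ?case using insert by simp
  qed simp
qed

lemma Psi_DE_iff: "a \<in> nfun E \<Longrightarrow> a \<in> DE \<longleftrightarrow> Psi a = (\<lambda>_. 0)"
  using Psi_DE Psi_kernel by blast

text \<open>Additivity comes from the description of the image as the kernel of \<open>Psi\<close>,
  closure under scalars from \<open>DC_smult\<close>, and negation is the scalar -1.\<close>

lemma submodule_DC: "submodule DD OR CM"
proof -
  interpret C: module OR CM by (rule module_C)
  have eq: "f \<in> DD \<longleftrightarrow> f \<in> CS \<and> Psi (cfun f) = (\<lambda>_. 0)" for f
    unfolding DC_iff using Psi_DE_iff[OF cfun_nfun] by blast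
  show ?thesis
  proof (rule C.submoduleI)
    fix f g assume *: "f \<in> DD" "g \<in> DD"
    then have "Psi (cfun (\<lambda>u. f u + g u)) = (\<lambda>_. 0)"
      unfolding eq cfun_simps using nlinearD(2)[OF nlinear_Psi, of "cfun f" "cfun g"] cfun_nfun by simp
    then show "f \<oplus>\<^bsub>CM\<^esub> g \<in> DD" using * by (simp add: eq C_set_add)
  next
    fix f assume *: "f \<in> DD"
    have "\<ominus>\<^bsub>CM\<^esub> f = \<zero>\<^bsub>CM\<^esub> \<ominus>\<^bsub>CM\<^esub> f" using * by (simp add: eq C.M.minus_eq)
    also have "\<dots> = (\<lambda>u. - f u)" using * C_minus[OF C_set_zero, of f] by (simp add: eq)
    also have "\<dots> = (\<lambda>u. (-1) * f u)" by simp
    also have "\<dots> \<in> DD" using * OS.uminus_S[OF OS.one_S] by (intro DC_smult)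
    finally show "\<ominus>\<^bsub>CM\<^esub> f \<in> DD" .
  next
    fix b f assume "b \<in> carrier OR" "f \<in> DD"
    then show "b \<odot>\<^bsub>CM\<^esub> f \<in> DD" by (simp add: O_ring_eq DC_smult)
  qed (auto simp: eq C_set_zero cfun_simps nlinear_zero[OF nlinear_Psi])
qed

lemma quot_mod_C: "quot_mod OR CM DD"
  by (simp add: quot_mod_def quot_mod_axioms_def module_C submodule_DC)

definition bC :: "nat \<Rightarrow> 'f series" where
  "bC j = monom_x (fps_const (\<gamma> ^ j)) (\<lambda>l. if l \<in> {1..j} then 1 else 0)"

lemma hb_eq: "hb j = DD +>\<^bsub>CM\<^esub> bC j"
  by (simp add: Hn_basis_def bC_def)

lemma Hn_eq: "HM = quot_module CM DD"
  by (simp add: Hn_def)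

text \<open>For j \<le> n the series \<gamma>^j x_1 ... x_j is X_1 ... X_j, and
  \<open>bvec j\<close> is the exponent vector of the latter.\<close>

lemma bC:
  assumes j: "j \<le> n"
  shows "bC j \<in> CS" "cfun (bC j) = eps (bvec j)"
proof -
  have b: "bvec j = (\<lambda>l. if l \<in> {1..j} then 1 else 0)"
    using j by (auto simp: bvec_def fun_eq_iff)
  have u: "uof (bvec j) = (\<lambda>l. if l \<in> {1..j} then 1 else 0)"
    using j unfolding b uof_def by (auto simp: fun_eq_iff)
  have cf: "cfun (bC j) = eps (bvec j)"
  proof
    fix v
    show "cfun (bC j) v = eps (bvec j) v"
    proof (cases "v \<in> E \<and> uof v = uof (bvec j) \<and> v 0 = 0")
      case True
      then have "v = bvec j"
        using vof_uof[of v] vof_uof[OF bvec_E[of j]] b by simp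
      moreover have "bvec j 0 = 0" using b by simp
      then have "cfun (bC j) (bvec j) = 1"
        using bvec_E[of j] by (simp add: cfun_def bC_def monom_x_def u tdeg_bvec)
      ultimately show ?thesis by (simp add: eps_def)
    next
      case False
      then have "cfun (bC j) v = 0" by (auto simp: cfun_def bC_def monom_x_def u)
      moreover have "v \<noteq> bvec j" using False bvec_E[of j] b by auto
      ultimately show ?thesis by (simp add: eps_def)
    qed
  qed
  show "cfun (bC j) = eps (bvec j)" by (rule cf)
  have "fps_nth (bC j w) r = 0" if "\<not> valid w r" for w r
  proof (rule ccontr)
    assume "fps_nth (bC j w) r \<noteq> 0"
    then have "w = uof (bvec j)" "r = 0" by (auto simp: bC_def monom_x_def u split: if_splits)
    then have "valid w r" using valid_uof[of "bvec j"] b by simp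
    then show False using that by simp
  qed
  then show "bC j \<in> CS" using eps_nfun[OF bvec_E] by (simp add: C_set_iff cf)
qed

text \<open>Interleaves n + 1 elements of O into one sequence: the coefficient of \<tau>^r in entry
  j goes to position (n + 1) r + j, which is the degree of \<tau>^r X_1 ... X_j. The map
  \<open>dec\<close> separates them again.\<close>

definition enc :: "(nat \<Rightarrow> 'f fps) \<Rightarrow> nat \<Rightarrow> 'f" where
  "enc x N = ncoef (x (N mod (n + 1))) (N div (n + 1))"

definition dec :: "(nat \<Rightarrow> 'f) \<Rightarrow> nat \<Rightarrow> 'f fps" where
  "dec a j = Abs_fps (\<lambda>r. a ((n + 1) * r + j) * \<gamma> ^ (r * (n + 1)))"

lemma ncoef_dec: "ncoef (dec a j) r = a ((n + 1) * r + j)"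
  by (simp add: ncoef_def dec_def)

lemma enc_dec: "enc (dec a) = a"
  by (auto simp: enc_def ncoef_dec fun_eq_iff simp del: mult_Suc)

lemma enc_restrict: "enc (restrict x {..n}) = enc x"
proof
  fix N
  have "N mod (n + 1) \<in> {..n}" using mod_less_divisor[of "n + 1" N] by simp
  then show "enc (restrict x {..n}) N = enc x N" by (simp add: enc_def)
qed

lemma enc_apply: "j \<le> n \<Longrightarrow> enc x ((n + 1) * r + j) = ncoef (x j) r"
  by (simp add: enc_def del: mult_Suc)

lemma ncoef_inj: "ncoef f = ncoef g \<Longrightarrow> f = g"
  by (intro fps_ext) (simp add: ncoef_nth)

lemma dec_O: "a \<in> nfun UNIV \<Longrightarrow> dec a j \<in> OS"
  unfolding O_set_iff
proof (rule nfunI)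
  assume a: "a \<in> nfun UNIV"
  show "ncoef (dec a j) r \<in> Oint" for r using nfunD(5)[OF a] by (simp add: ncoef_dec)
  show "finite {r \<in> UNIV. \<not> vb (real s) (ncoef (dec a j) r)}" for s
  proof -
    have "inj (\<lambda>r. (n + 1) * r + j)"
    proof (rule injI)
      fix x y assume "(n + 1) * x + j = (n + 1) * y + j"
      then have "(n + 1) * x = (n + 1) * y" by (simp only: add_right_cancel)
      then show "x = y" by (simp only: mult_cancel1) simp
    qed
    then have "finite ((\<lambda>r. (n + 1) * r + j) -` {N. \<not> vb (real s) (a N)})"
      using nfunD(6)[OF a] by (intro finite_vimageI)
    then show ?thesis by (simp add: ncoef_dec vimage_def)
  qed
qed auto

lemma enc_nfun:
  assumes x: "\<And>j. j \<le> n \<Longrightarrow> x j \<in> OS"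
  shows "enc x \<in> nfun UNIV"
proof (rule nfunI)
  have le: "N mod (n + 1) \<le> n" for N using mod_less_divisor[of "n + 1" N] by simp
  have xN: "ncoef (x (N mod (n + 1))) \<in> nfun UNIV" for N using x[OF le] by (simp add: O_set_iff)
  show "enc x N \<in> Oint" for N unfolding enc_def by (rule nfunD(5)[OF xN])
  show "finite {N \<in> UNIV. \<not> vb (real s) (enc x N)}" for s
  proof (rule finite_subset)
    show "{N \<in> UNIV. \<not> vb (real s) (enc x N)} \<subseteq>
      (\<Union>j\<in>{..n}. (\<lambda>r. (n + 1) * r + j) ` {r. \<not> vb (real s) (ncoef (x j) r)})"
    proof
      fix N assume "N \<in> {N \<in> UNIV. \<not> vb (real s) (enc x N)}"
      then have "N div (n + 1) \<in> {r. \<not> vb (real s) (ncoef (x (N mod (n + 1))) r)}" by (simp add: enc_def)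
      moreover have "N = (n + 1) * (N div (n + 1)) + N mod (n + 1)" by (rule mult_div_mod_eq[symmetric])
      ultimately show "N \<in> (\<Union>j\<in>{..n}. (\<lambda>r. (n + 1) * r + j) ` {r. \<not> vb (real s) (ncoef (x j) r)})"
        using le by blast
    qed
    show "finite (\<Union>j\<in>{..n}. (\<lambda>r. (n + 1) * r + j) ` {r. \<not> vb (real s) (ncoef (x j) r)})"
      using x by (intro finite_UN_I finite_imageI) (auto simp: O_set_iff intro: nfunD(6))
  qed
qed auto

lemma bvec_apply: "l \<le> n \<Longrightarrow> bvec ((n + 1) * r + j) l = r + (if 1 \<le> l \<and> l \<le> j then 1 else 0)" if "j \<le> n" for j
  using that by (simp add: bvec_def del: mult_Suc)

text \<open>The monomial \<tau>^r X_1 ... X_j has the exponent vector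
  \<open>bvec ((n + 1) * r + j)\<close>, so in an O-combination of the basis no two terms meet, and
  its coefficients are the interleaved ones.\<close>

lemma cfun_lincomb:
  assumes x: "\<And>j. j \<le> n \<Longrightarrow> x j \<in> OS"
  shows "cfun (\<lambda>u. \<Sum>j\<le>n. x j * bC j u) = iota (enc x)"
proof
  fix v
  have "cfun (\<lambda>u. \<Sum>j\<le>n. x j * bC j u) v = (\<Sum>j\<le>n. tmul (ncoef (x j)) (eps (bvec j)) v)"
    unfolding cfun_simps using bC by (intro sum.cong refl) (simp add: cfun_smult)
  also have "\<dots> = iota (enc x) v"
  proof (cases "v \<in> E")
    case False
    then show ?thesis using bvec(2) by (auto simp: tmul_def embed_def intro!: sum.neutral)
  next
    case vE: True
    have shifted: "(\<lambda>l. v l - s) = bvec j \<longleftrightarrow> v = bvec ((n + 1) * s + j)"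
      if "j \<le> n" "\<forall>l\<le>n. s \<le> v l" for s j
    proof
      assume h: "(\<lambda>l. v l - s) = bvec j"
      show "v = bvec ((n + 1) * s + j)"
      proof
        fix l
        have "v l - s = bvec j l" using fun_cong[OF h] .
        then show "v l = bvec ((n + 1) * s + j) l"
          using that vE bvec_apply[of j l s] bvec_apply[of j l 0] bvec_E[of "(n + 1) * s + j"]
          by (cases "l \<le> n") (auto simp: expo_def)
      qed
    next
      assume h: "v = bvec ((n + 1) * s + j)"
      show "(\<lambda>l. v l - s) = bvec j"
      proof
        fix l show "v l - s = bvec j l"
          unfolding h using that(1) bvec_apply[of j l s] bvec_apply[of j l 0] bvec_E[of "(n + 1) * s + j"] bvec_E[of j]
          by (cases "l \<le> n") (auto simp: expo_def)
      qed
    qed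
    show ?thesis
    proof (cases "v \<in> range bvec")
      case False
      have "tmul (ncoef (x j)) (eps (bvec j)) v = 0" if "j \<le> n" for j
        unfolding tmul_def if_P[OF vE]
      proof (rule sum.neutral, rule ballI)
        fix s assume "s \<in> {s. \<forall>l\<le>n. s \<le> v l}"
        then have "(\<lambda>l. v l - s) \<noteq> bvec j" using shifted[OF that, of s] False by auto
        then show "ncoef (x j) s * eps (bvec j) (\<lambda>l. v l - s) = 0" by (simp add: eps_def)
      qed
      then show ?thesis using False by (simp add: embed_def)
    next
      case True
      then obtain N where N: "v = bvec N" by blast
      define r where "r = N div (n + 1)"
      define i where "i = N mod (n + 1)"
      have i: "i \<le> n" using mod_less_divisor[of "n + 1" N] by (simp add: i_def)
      have Nri: "N = (n + 1) * r + i" unfolding r_def i_def by (rule mult_div_mod_eq[symmetric])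
      have rB: "r \<in> {s. \<forall>l\<le>n. s \<le> v l}" unfolding N Nri using bvec_apply[OF i] by simp
      have "tmul (ncoef (x j)) (eps (bvec j)) v = (if j = i then ncoef (x i) r else 0)" if j: "j \<le> n" for j
      proof -
        have "tmul (ncoef (x j)) (eps (bvec j)) v =
            (\<Sum>s\<in>{s. \<forall>l\<le>n. s \<le> v l}. if s = r then (if j = i then ncoef (x i) r else 0) else 0)"
          unfolding tmul_def if_P[OF vE]
        proof (intro sum.cong refl)
          fix s assume s: "s \<in> {s. \<forall>l\<le>n. s \<le> v l}"
          have "(\<lambda>l. v l - s) = bvec j \<longleftrightarrow> bvec N = bvec ((n + 1) * s + j)"
            using shifted[OF j, of s] s N by simp
          also have "\<dots> \<longleftrightarrow> N = (n + 1) * s + j" using inj_eq[OF bvec(1)] .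
          also have "\<dots> \<longleftrightarrow> s = r \<and> j = i"
          proof
            assume "N = (n + 1) * s + j"
            then show "s = r \<and> j = i" using j by (simp add: r_def i_def del: mult_Suc)
          qed (use Nri in simp)
          finally show "ncoef (x j) s * eps (bvec j) (\<lambda>l. v l - s) = (if s = r then (if j = i then ncoef (x i) r else 0) else 0)"
            by (auto simp: eps_def)
        qed
        also have "\<dots> = (if j = i then ncoef (x i) r else 0)"
          using finite_below[of v] rB by simp
        finally show ?thesis .
      qed
      then have "(\<Sum>j\<le>n. tmul (ncoef (x j)) (eps (bvec j)) v) = (\<Sum>j\<le>n. if j = i then ncoef (x i) r else 0)"
        by (intro sum.cong) auto
      also have "\<dots> = ncoef (x i) r" using i by simp
      also have "\<dots> = iota (enc x) v" unfolding N embed_apply[OF bvec(1)] Nri enc_apply[OF i] ..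
      finally show ?thesis .
    qed
  qed
  finally show "cfun (\<lambda>u. \<Sum>j\<le>n. x j * bC j u) v = iota (enc x) v" .
qed

lemma lincomb_C:
  assumes x: "\<And>j. j \<le> n \<Longrightarrow> x j \<in> OS"
  shows "(\<lambda>u. \<Sum>j\<le>n. x j * bC j u) \<in> CS" "(\<Oplus>\<^bsub>CM\<^esub>j\<in>{..n}. x j \<odot>\<^bsub>CM\<^esub> bC j) = (\<lambda>u. \<Sum>j\<le>n. x j * bC j u)"
proof -
  show "(\<lambda>u. \<Sum>j\<le>n. x j * bC j u) \<in> CS" using bC(1) x by (intro C_set_sum C_set_smult) auto
  show "(\<Oplus>\<^bsub>CM\<^esub>j\<in>{..n}. x j \<odot>\<^bsub>CM\<^esub> bC j) = (\<lambda>u. \<Sum>j\<le>n. x j * bC j u)"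
    using C_finsum[of "{..n}" "\<lambda>j. x j \<odot>\<^bsub>CM\<^esub> bC j"] bC(1) x C_set_smult by simp
qed

lemma lincomb_DC_iff:
  assumes f: "f \<in> CS" and x: "\<And>j. j \<le> n \<Longrightarrow> x j \<in> OS"
  shows "f \<ominus>\<^bsub>CM\<^esub> (\<Oplus>\<^bsub>CM\<^esub>j\<in>{..n}. x j \<odot>\<^bsub>CM\<^esub> bC j) \<in> DD \<longleftrightarrow> enc x = hcoord (cfun f)"
proof -
  have d: "f \<ominus>\<^bsub>CM\<^esub> (\<Oplus>\<^bsub>CM\<^esub>j\<in>{..n}. x j \<odot>\<^bsub>CM\<^esub> bC j) = (\<lambda>u. f u - (\<Sum>j\<le>n. x j * bC j u))"
  proof -
    have l: "(\<Oplus>\<^bsub>CM\<^esub>j\<in>{..n}. x j \<odot>\<^bsub>CM\<^esub> bC j) = (\<lambda>u. \<Sum>j\<le>n. x j * bC j u)"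
      by (rule lincomb_C(2)) (rule x)
    show ?thesis unfolding l by (rule C_minus[OF f lincomb_C(1)]) (rule x)
  qed
  have "(\<lambda>u. f u - (\<Sum>j\<le>n. x j * bC j u)) \<in> DD \<longleftrightarrow> (\<lambda>v. cfun f v - iota (enc x) v) \<in> DE"
    unfolding DC_iff using C_set_minus[OF f lincomb_C(1)[of x, OF x]]
    by (simp add: cfun_simps(2) cfun_lincomb[of x, OF x])
  also have "\<dots> \<longleftrightarrow> enc x = hcoord (cfun f)"
    using hcoord_unique[OF cfun_nfun[OF f] enc_nfun[of x, OF x]] hcoord_diff[OF cfun_nfun[OF f]] by auto
  finally show ?thesis unfolding d .
qed

text \<open>Existence and uniqueness of \<open>hcoord\<close>, regrouped by the residue of the
  degree modulo n + 1: the coefficients with residue j form the O-coordinate at e_j.\<close>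

theorem Hn_free: "free_with_basis OR HM {..n} hb"
proof -
  interpret QC: quot_mod OR CM DD by (rule quot_mod_C)
  have "free_with_basis OR HM {..n} (\<lambda>j. DD +>\<^bsub>CM\<^esub> bC j)"
    unfolding Hn_eq
  proof (subst QC.quot_free_iff)
    show "\<forall>f\<in>carrier CM. \<exists>!x. x \<in> {..n} \<rightarrow>\<^sub>E carrier OR \<and> f \<ominus>\<^bsub>CM\<^esub> (\<Oplus>\<^bsub>CM\<^esub>j\<in>{..n}. x j \<odot>\<^bsub>CM\<^esub> bC j) \<in> DD"
    proof
      fix f assume "f \<in> carrier CM"
      then have f: "f \<in> CS" by simp
      let ?a = "hcoord (cfun f)"
      have a: "?a \<in> nfun UNIV" by (rule nlinearD(1)[OF nlinear_hcoord cfun_nfun[OF f]])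
      show "\<exists>!x. x \<in> {..n} \<rightarrow>\<^sub>E carrier OR \<and> f \<ominus>\<^bsub>CM\<^esub> (\<Oplus>\<^bsub>CM\<^esub>j\<in>{..n}. x j \<odot>\<^bsub>CM\<^esub> bC j) \<in> DD"
      proof (rule ex1I[of _ "restrict (dec ?a) {..n}"], intro conjI)
        show "restrict (dec ?a) {..n} \<in> {..n} \<rightarrow>\<^sub>E carrier OR" using dec_O[OF a] by (simp add: O_ring_eq)
        have "restrict (dec ?a) {..n} j \<in> OS" if "j \<le> n" for j using dec_O[OF a] that by simp
        from lincomb_DC_iff[of f "restrict (dec ?a) {..n}", OF f this]
        show "f \<ominus>\<^bsub>CM\<^esub> (\<Oplus>\<^bsub>CM\<^esub>j\<in>{..n}. restrict (dec ?a) {..n} j \<odot>\<^bsub>CM\<^esub> bC j) \<in> DD"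
          by (simp add: enc_restrict enc_dec)
      next
        fix x assume x: "x \<in> {..n} \<rightarrow>\<^sub>E carrier OR \<and> f \<ominus>\<^bsub>CM\<^esub> (\<Oplus>\<^bsub>CM\<^esub>j\<in>{..n}. x j \<odot>\<^bsub>CM\<^esub> bC j) \<in> DD"
        have xO: "x j \<in> OS" if "j \<le> n" for j using x that by (auto simp: O_ring_eq)
        have e: "enc x = ?a" using lincomb_DC_iff[OF f, of x, OF xO] x by simp
        show "x = restrict (dec ?a) {..n}"
        proof
          fix j
          show "x j = restrict (dec ?a) {..n} j"
          proof (cases "j \<le> n")
            case True
            have "ncoef (x j) = ncoef (dec ?a j)"
              using enc_apply[OF True, of x] by (auto simp: ncoef_dec e[symmetric] simp del: mult_Suc)
            then show ?thesis using True ncoef_inj by simp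
          next
            case False
            then show ?thesis using x by (auto simp: PiE_def extensional_def)
          qed
        qed
      qed
    qed
  qed (use bC in auto)
  moreover have "hb = (\<lambda>j. DD +>\<^bsub>CM\<^esub> bC j)" by (rule ext) (rule hb_eq)
  ultimately show ?thesis by simp
qed

lemma Hn_coords:
  assumes f: "f \<in> CS" and j: "j \<le> n"
  shows "ncoef (coords OR HM {..n} hb (DD +>\<^bsub>CM\<^esub> f) j) r = hcoord (cfun f) ((n + 1) * r + j)"
proof -
  interpret QC: quot_mod OR CM DD by (rule quot_mod_C)
  interpret H: free_mod OR HM "{..n}" hb by (rule free_modI[OF Hn_free])
  let ?x = "H.co (DD +>\<^bsub>CM\<^esub> f)"
  have c: "DD +>\<^bsub>CM\<^esub> f \<in> carrier HM" using f by (simp add: Hn_eq QC.quot_carrier)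
  have xO: "?x j \<in> OS" if "j \<le> n" for j using H.coords_closed[OF c, of j] that by (simp add: O_ring_eq)
  have lin: "(\<Oplus>\<^bsub>QC.Q\<^esub>j\<in>{..n}. ?x j \<odot>\<^bsub>QC.Q\<^esub> (DD +>\<^bsub>CM\<^esub> bC j)) = DD +>\<^bsub>CM\<^esub> (\<Oplus>\<^bsub>CM\<^esub>j\<in>{..n}. ?x j \<odot>\<^bsub>CM\<^esub> bC j)"
    using xO bC by (intro QC.quot_lincomb) (auto simp: O_ring_eq)
  have "DD +>\<^bsub>CM\<^esub> f = (\<Oplus>\<^bsub>HM\<^esub>j\<in>{..n}. ?x j \<odot>\<^bsub>HM\<^esub> (DD +>\<^bsub>CM\<^esub> bC j))"
    using H.coords_sum[OF c] by (simp add: hb_eq)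
  also have "\<dots> = DD +>\<^bsub>CM\<^esub> (\<Oplus>\<^bsub>CM\<^esub>j\<in>{..n}. ?x j \<odot>\<^bsub>CM\<^esub> bC j)"
    by (rule lin[folded Hn_eq])
  finally have "f \<ominus>\<^bsub>CM\<^esub> (\<Oplus>\<^bsub>CM\<^esub>j\<in>{..n}. ?x j \<odot>\<^bsub>CM\<^esub> bC j) \<in> DD"
    using QC.quot_eq_iff f lincomb_C[of ?x, OF xO] by simp
  then have "enc ?x = hcoord (cfun f)" using lincomb_DC_iff[OF f, of ?x, OF xO] by simp
  then show ?thesis using enc_apply[OF j, of ?x r] by simp
qed

lemma total_shift_Suc:
  assumes l: "l \<le> n" and g: "g \<in> nfun E"
  shows "total (shift l g) = embed Suc (total g)"
proof (rule nlinear_ext[OF nlinear_comp[OF nlinear_shift[OF l] nlinear_total] nlinear_comp[OF nlinear_total nlinear_embed(1)] g])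
  fix v assume v: "v \<in> E"
  have "dg (v(l := Suc (v l))) = Suc (dg v)" using tdeg_upd[OF l, of v "Suc (v l)"] by simp
  then show "total (shift l (eps v)) = embed Suc (total (eps v))"
    using expo_upd[OF l v] unfolding shift_eps total_eps[OF v]
    by (simp add: total_eps nlinear_embed(2)[of Suc UNIV])
qed auto

text \<open>\<open>Psi\<close> turns every \<delta>_l into multiplication by the single variable.
  Thus \<partial> acts on H^n as this multiplication, and within a class \<delta>_0 f may be
  replaced by any \<delta>_l f.\<close>

lemma Psi_delta_Suc:
  assumes "l \<le> n" "f \<in> nfun E"
  shows "Psi (delta l f) = embed Suc (Psi f)"
  unfolding Psi_def inv_delta[OF assms] by (rule total_shift_Suc[OF assms(1) Xi.inv_map(1)[OF assms(2)]])

text \<open>The class of \<delta>_0 g depends only on \<open>Psi\<close> of g, by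
  \<open>Psi_delta_Suc\<close>; so the connection respects the image of the D_{t,l}.\<close>

lemma Hn_del_coset:
  assumes f: "f \<in> CS"
  shows "Hn_del ord Oint p n \<gamma> (DD +>\<^bsub>CM\<^esub> f) = DD +>\<^bsub>CM\<^esub> del_op p n \<gamma> f"
proof -
  interpret QC: quot_mod OR CM DD by (rule quot_mod_C)
  have "del_op p n \<gamma> g \<ominus>\<^bsub>CM\<^esub> del_op p n \<gamma> h \<in> DD"
    if g: "g \<in> CS" and h: "h \<in> CS" and d: "g \<ominus>\<^bsub>CM\<^esub> h \<in> DD" for g h
  proof -
    have gh: "cfun g \<in> nfun E" "cfun h \<in> nfun E" using g h cfun_nfun by auto
    have "(\<lambda>v. cfun g v - cfun h v) \<in> DE" using d by (simp add: C_minus[OF g h] DC_iff cfun_simps)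
    then have "Psi (cfun g) = Psi (cfun h)"
      using Psi_DE nlinear_diff[OF nlinear_Psi gh] by (force simp: fun_eq_iff)
    then have "Psi (delta 0 (cfun g)) = Psi (delta 0 (cfun h))"
      using gh by (simp add: Psi_delta_Suc)
    then have "Psi (\<lambda>v. delta 0 (cfun g) v - delta 0 (cfun h) v) = (\<lambda>_. 0)"
      using nlinear_diff[OF nlinear_Psi delta_closed delta_closed, of 0 "cfun g" 0 "cfun h"] gh by simp
    then have "(\<lambda>v. delta 0 (cfun g) v - delta 0 (cfun h) v) \<in> DE"
      using gh by (intro Psi_kernel nfun_diff delta_closed) auto
    then show ?thesis
      using del_op_C[OF g] del_op_C[OF h] by (simp add: C_minus DC_iff cfun_simps C_set_minus)
  qed
  then show ?thesis
    unfolding Hn_del_def induced_map_def using del_op_C(1) f by (intro QC.induced_eq) auto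
qed

definition gcoef :: "nat \<Rightarrow> nat \<Rightarrow> 'f" where
  "gcoef j = hcoord (delta 0 (eps (bvec j)))"

lemma Hn_del_basis:
  assumes j: "j \<le> n"
  shows "Hn_del ord Oint p n \<gamma> (hb j) \<in> carrier HM"
    and "l \<le> n \<Longrightarrow> ncoef (coords OR HM {..n} hb (Hn_del ord Oint p n \<gamma> (hb j)) l) r = gcoef j ((n + 1) * r + l)"
proof -
  interpret QC: quot_mod OR CM DD by (rule quot_mod_C)
  have e: "Hn_del ord Oint p n \<gamma> (hb j) = DD +>\<^bsub>CM\<^esub> del_op p n \<gamma> (bC j)"
    unfolding hb_eq by (rule Hn_del_coset[OF bC(1)[OF j]])
  show "Hn_del ord Oint p n \<gamma> (hb j) \<in> carrier HM"
    unfolding e Hn_eq QC.quot_carrier using del_op_C(1)[OF bC(1)[OF j]] by simp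
  show "ncoef (coords OR HM {..n} hb (Hn_del ord Oint p n \<gamma> (hb j)) l) r = gcoef j ((n + 1) * r + l)" if "l \<le> n"
    unfolding e Hn_coords[OF del_op_C(1)[OF bC(1)[OF j]] that] gcoef_def
    by (simp add: del_op_C(2)[OF bC(1)[OF j]] bC(2)[OF j])
qed

text \<open>Position j + 1 stands for e_(j+1), or for \<tau> e_0 when j = n. So modulo p the
  connection on H^n is the map \<open>G_bar\<close>, with \<tau> in the role of t.\<close>

lemma gcoef_props:
  assumes j: "j \<le> n"
  shows "gcoef j \<in> nfun UNIV" "vb (real N - real (j + 1)) (gcoef j N)"
    "vb 1 (gcoef j N - (if N = j + 1 then 1 else 0))"
proof -
  \<comment> \<open>The variable X_s does not divide X_1 ... X_j, so the Euler term of \<delta>_s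
    vanishes, and X_s X_1 ... X_j is exactly the representative of degree j + 1; for j = n it is
    \<tau>.\<close>
  define s where "s = (if j = n then 0 else j + 1)"
  have s: "s \<le> n" using j by (auto simp: s_def)
  have bs: "bvec j s = 0" and bup: "(bvec j)(s := Suc (bvec j s)) = bvec (j + 1)"
  proof -
    show 0: "bvec j s = 0" using j by (auto simp: s_def bvec_def)
    show "(bvec j)(s := Suc (bvec j s)) = bvec (j + 1)"
      using j n1 unfolding 0 by (auto simp: s_def bvec_def fun_eq_iff)
  qed
  have eN: "eps (bvec j) \<in> nfun E" by (rule eps_nfun[OF bvec_E])
  define q where "q = delta s (eps (bvec j))"
  have q: "q \<in> nfun E" unfolding q_def by (rule delta_closed[OF s eN])
  have gq: "gcoef j = hcoord q"
    unfolding gcoef_def q_def hcoord_def using s eN by (simp add: Psi_delta_Suc)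
  show "gcoef j \<in> nfun UNIV" unfolding gq by (rule nlinearD(1)[OF nlinear_hcoord q])
  have first: "of_nat (v s) * eps (bvec j) v = (0 :: 'f)" for v
    using bs by (cases "v = bvec j") (auto simp: eps_def)
  have "in_level dg {real (j + 1)} q"
    unfolding in_level_def
  proof (safe)
    fix v
    have "vb (real (dg v) - real (j + 1)) (c i * eps (bvec j) (v(s := v s - p ^ i)))" if i: "p ^ i \<le> v s" for i
    proof (cases "v(s := v s - p ^ i) = bvec j")
      case True
      have "dg v = j + p ^ i"
        using tdeg_upd[OF s, of v "v s - p ^ i"] i True tdeg_bvec[of j] by simp
      then have e: "real (dg v) - real (j + 1) = real (p ^ i) - 1" by simp
      show ?thesis unfolding e True using c_bound[of i] by (simp add: eps_def)
    qed (simp add: eps_def)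
    then show "vb (real (dg v) - real (j + 1)) (q v)"
      unfolding q_def delta_def first by (auto intro!: vb_add vb_sum)
  qed
  from hcoord_level[OF q this] show "vb (real N - real (j + 1)) (gcoef j N)"
    unfolding gq in_level_def by simp
  have m: "vb 1 (q v - eps (bvec (j + 1)) v)" for v
  proof -
    have sh: "(if 1 \<le> v s then eps (bvec j) (v(s := v s - 1)) else 0) = eps (bvec (j + 1)) v"
      using fun_cong[OF shift_eps[of s "bvec j"], of v] unfolding bup shift_def by auto
    have sp: "(\<Sum>i | p ^ i \<le> v s. c i * eps (bvec j) (v(s := v s - p ^ i))) =
        (if 1 \<le> v s then eps (bvec j) (v(s := v s - 1)) else 0) +
        (\<Sum>i\<in>{i. p ^ i \<le> v s} - {0}. c i * eps (bvec j) (v(s := v s - p ^ i)))"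
    proof (cases "1 \<le> v s")
      case True
      then have "0 \<in> {i. p ^ i \<le> v s}" by simp
      from sum.remove[OF finite_powers this, of "\<lambda>i. c i * eps (bvec j) (v(s := v s - p ^ i))"]
      show ?thesis using True by simp
    next
      case False
      then have "\<not> p ^ i \<le> v s" for i using p_power_pos[of i] by linarith
      then show ?thesis using False by simp
    qed
    have "q v - eps (bvec (j + 1)) v = (\<Sum>i\<in>{i. p ^ i \<le> v s} - {0}. c i * eps (bvec j) (v(s := v s - p ^ i)))"
      unfolding q_def delta_def first sp sh by simp
    also have "vb 1 \<dots>"
      by (intro vb_sum vb_mult0(2) c_vb1) (auto simp: eps_def)
    finally show ?thesis .
  qed
  \<comment> \<open>Linear maps preserve divisibility by p, so the congruence between monomials
    passes to their coordinates.\<close>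
  have "vb (real 1) (hcoord (\<lambda>v. q v - eps (bvec (j + 1)) v) N)"
    using m by (intro nlinear_vb[OF nlinear_hcoord] nfun_diff q eps_nfun bvec_E) simp
  then show "vb 1 (gcoef j N - (if N = j + 1 then 1 else 0))"
    unfolding nlinear_diff[OF nlinear_hcoord q eps_nfun[OF bvec_E]] hcoord_bvec gq by (simp add: eps_def)
qed

end

section \<open>Finite extensions of the \<open>p\<close>-adic numbers are complete\<close>

context valued
begin

definition cauchy :: "(nat \<Rightarrow> 'f) \<Rightarrow> bool" where
  "cauchy s \<longleftrightarrow> (\<forall>b. \<exists>m. \<forall>i\<ge>m. \<forall>j\<ge>m. vb b (s i - s j))"

definition limit :: "(nat \<Rightarrow> 'f) \<Rightarrow> 'f \<Rightarrow> bool" where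
  "limit s x \<longleftrightarrow> (\<forall>b. \<exists>m. \<forall>i\<ge>m. vb b (s i - x))"

definition complete_set :: "'f set \<Rightarrow> bool" where
  "complete_set W \<longleftrightarrow> (\<forall>s. (\<forall>i. s i \<in> W) \<longrightarrow> cauchy s \<longrightarrow> (\<exists>x\<in>W. limit s x))"

lemma limit_add:
  assumes "limit s x" "limit t y"
  shows "limit (\<lambda>i. s i + t i) (x + y)"
  unfolding limit_def
proof
  fix b
  obtain m m' where m: "\<And>i. i \<ge> m \<Longrightarrow> vb b (s i - x)" "\<And>i. i \<ge> m' \<Longrightarrow> vb b (t i - y)"
    using assms unfolding limit_def by blast
  show "\<exists>m. \<forall>i\<ge>m. vb b (s i + t i - (x + y))"
  proof (intro exI allI impI)
    fix i assume "max m m' \<le> i"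
    then have "vb b ((s i - x) + (t i - y))" by (intro vb_add m) auto
    then show "vb b (s i + t i - (x + y))" by (simp add: algebra_simps)
  qed
qed

lemma vb_exists: "\<exists>b. vb b x"
proof (cases "ord x")
  case (real r)
  then show ?thesis by (intro exI[of _ r]) (simp add: vb_def)
qed (use ord_minf[of x] in \<open>auto simp: vb_def\<close>)

lemma limit_cmult:
  assumes "limit s x"
  shows "limit (\<lambda>i. s i * b) (x * b)"
  unfolding limit_def
proof
  fix B
  obtain a where a: "vb a b" using vb_exists by blast
  obtain m where m: "\<And>i. i \<ge> m \<Longrightarrow> vb (B - a) (s i - x)" using assms unfolding limit_def by blast
  have "vb B (s i * b - x * b)" if "i \<ge> m" for i
    using vb_mult[OF m[OF that] a] by (simp add: algebra_simps)
  then show "\<exists>m. \<forall>i\<ge>m. vb B (s i * b - x * b)" by blast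
qed

lemma cauchy_diff_cmult:
  assumes "cauchy s" "cauchy k"
  shows "cauchy (\<lambda>i. s i - k i * b)"
  unfolding cauchy_def
proof
  fix B
  obtain a where a: "vb a b" using vb_exists by blast
  obtain m m' where m: "\<And>i j. i \<ge> m \<Longrightarrow> j \<ge> m \<Longrightarrow> vb B (s i - s j)"
    "\<And>i j. i \<ge> m' \<Longrightarrow> j \<ge> m' \<Longrightarrow> vb (B - a) (k i - k j)"
    using assms unfolding cauchy_def by metis
  show "\<exists>m. \<forall>i\<ge>m. \<forall>j\<ge>m. vb B (s i - k i * b - (s j - k j * b))"
  proof (intro exI allI impI)
    fix i j assume ij: "max m m' \<le> i" "max m m' \<le> j"
    have "vb B ((k i - k j) * b)" using vb_mult[OF m(2) a, of i j] ij by simp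
    then have "vb B ((s i - s j) - (k i - k j) * b)" using ij by (intro vb_diff m) auto
    then show "vb B (s i - k i * b - (s j - k j * b))" by (simp add: algebra_simps)
  qed
qed

text \<open>A point b outside the complete space W has positive distance from it. Hence the order of
  k b + w bounds the order of k up to a constant, and a Cauchy sequence in K b + W has Cauchy
  components.\<close>

lemma complete_line_extension:
  assumes K: "complete_set K" "\<And>x y. x \<in> K \<Longrightarrow> y \<in> K \<Longrightarrow> x - y \<in> K" "\<And>x. x \<in> K \<Longrightarrow> inverse x \<in> K"
    and W: "complete_set W" "\<And>x y. x \<in> W \<Longrightarrow> y \<in> W \<Longrightarrow> x - y \<in> W" "\<And>k x. k \<in> K \<Longrightarrow> x \<in> W \<Longrightarrow> k * x \<in> W"
    and b: "b \<notin> W"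
  shows "complete_set {k * b + w | k w. k \<in> K \<and> w \<in> W}"
proof -
  have "\<exists>c. \<forall>w\<in>W. \<not> vb c (b - w)"
  proof (rule ccontr)
    assume "\<not> (\<exists>c. \<forall>w\<in>W. \<not> vb c (b - w))"
    then have "\<forall>m::nat. \<exists>w. w \<in> W \<and> vb (real m) (b - w)" by blast
    then have "\<exists>w. \<forall>m::nat. w m \<in> W \<and> vb (real m) (b - w m)" by (rule choice)
    then obtain w where w: "\<And>m::nat. w m \<in> W" "\<And>m. vb (real m) (b - w m)" by blast
    have wb: "vb B (b - w i)" if "nat \<lceil>B\<rceil> \<le> i" for B i
      by (rule vb_mono[OF w(2)]) (use that in linarith)
    have "cauchy w"
      unfolding cauchy_def
    proof (intro allI exI impI)
      fix B :: real and i j assume ij: "nat \<lceil>B\<rceil> \<le> i" "nat \<lceil>B\<rceil> \<le> j"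
      show "vb B (w i - w j)" using vb_diff[OF wb[OF ij(2)] wb[OF ij(1)]] by simp
    qed
    then obtain x where x: "x \<in> W" "limit w x" using W(1) w(1) unfolding complete_set_def by blast
    have "vb (real s) (b - x)" for s
    proof -
      obtain m where m: "\<And>i. i \<ge> m \<Longrightarrow> vb (real s) (w i - x)" using x(2) unfolding limit_def by blast
      have "vb (real s) ((b - w (max m s)) + (w (max m s) - x))"
        by (intro vb_add m vb_mono[OF w(2)]) auto
      then show ?thesis by simp
    qed
    then have "b = x" by (rule vb_all_eq)
    then show False using x(1) b by simp
  qed
  then obtain c where c: "\<And>w. w \<in> W \<Longrightarrow> \<not> vb c (b - w)" by blast
  have bound: "vb (B - c) k" if k: "k \<in> K" and w: "w \<in> W" and v: "vb B (k * b + w)" for k w B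
  proof (cases "k = 0")
    case False
    have "inverse k * w \<in> W" by (rule W(3)[OF K(3)[OF k] w])
    \<comment> \<open>Closure is assumed for differences only; x - x - x stands for -x.\<close>
    then have "inverse k * w - inverse k * w - inverse k * w \<in> W" by (intro W(2))
    then have nv: "\<not> vb c (b + inverse k * w)" using c by fastforce
    have "ord k \<noteq> \<infinity>" using False ord_inf[of k] by simp
    then obtain r where r: "ord k = ereal r" using ord_minf[of k] by (cases "ord k") auto
    have "k * b + w = k * (b + inverse k * w)" using False by (simp add: algebra_simps)
    then have "vb (B - r) (b + inverse k * w)"
      using vb_divide[OF v r] False by simp
    then have "\<not> c \<le> B - r" using nv vb_mono by blast
    then show ?thesis using r by (simp add: vb_def)
  qed simp
  show ?thesis
    unfolding complete_set_def
  proof (intro allI impI)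
    fix s assume "\<forall>i. s i \<in> {k * b + w | k w. k \<in> K \<and> w \<in> W}" and s: "cauchy s"
    then have "\<forall>i. \<exists>kw. s i = fst kw * b + snd kw \<and> fst kw \<in> K \<and> snd kw \<in> W" by force
    then have "\<exists>kw. \<forall>i. s i = fst (kw i) * b + snd (kw i) \<and> fst (kw i) \<in> K \<and> snd (kw i) \<in> W" by (rule choice)
    then obtain kw where kw: "\<And>i. s i = fst (kw i) * b + snd (kw i)" "\<And>i. fst (kw i) \<in> K" "\<And>i. snd (kw i) \<in> W"
      by blast
    define k w where "k i = fst (kw i)" and "w i = snd (kw i)" for i
    have kw: "s i = k i * b + w i" "k i \<in> K" "w i \<in> W" for i using kw by (auto simp: k_def w_def)
    have "cauchy k"
      unfolding cauchy_def
    proof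
      fix B
      obtain m where m: "\<And>i j. i \<ge> m \<Longrightarrow> j \<ge> m \<Longrightarrow> vb (B + c) (s i - s j)" using s unfolding cauchy_def by blast
      have "vb B (k i - k j)" if "i \<ge> m" "j \<ge> m" for i j
      proof -
        have "vb (B + c) ((k i - k j) * b + (w i - w j))" using m[OF that] kw(1) by (simp add: algebra_simps)
        from bound[OF K(2)[OF kw(2) kw(2)] W(2)[OF kw(3) kw(3)] this] show ?thesis by simp
      qed
      then show "\<exists>m. \<forall>i\<ge>m. \<forall>j\<ge>m. vb B (k i - k j)" by blast
    qed
    then obtain k' where k': "k' \<in> K" "limit k k'" using K(1) kw(2) unfolding complete_set_def by blast
    have "w = (\<lambda>i. s i - k i * b)" using kw(1) by auto
    then have "cauchy w" using cauchy_diff_cmult[OF s \<open>cauchy k\<close>] by simp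
    then obtain w' where w': "w' \<in> W" "limit w w'" using W(1) kw(3) unfolding complete_set_def by blast
    have "s = (\<lambda>i. k i * b + w i)" by (rule ext) (rule kw(1))
    then have "limit s (k' * b + w')"
      using limit_add[OF limit_cmult[OF k'(2), of b] w'(2)] by simp
    then show "\<exists>x\<in>{k * b + w | k w. k \<in> K \<and> w \<in> W}. limit s x" using k'(1) w'(1) by blast
  qed
qed

end

abbreviation tr :: "'f::field ring" where "tr \<equiv> ring_of_type_algebra"

lemma tr_simps [simp]:
  "carrier (tr :: 'f::field ring) = UNIV" "add (tr :: 'f ring) = (+)" "monoid.mult (tr :: 'f ring) = (*)"
  "zero (tr :: 'f ring) = 0" "one (tr :: 'f ring) = 1"
  by (auto simp: ring_of_type_algebra_def)

interpretation tr: domain "tr :: 'f::field ring"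
  by (rule field.axioms(1)[OF field_from_type_algebra])

lemma tr_a_inv: "\<ominus>\<^bsub>tr\<^esub> x = - (x :: 'f::field)"
  using tr.minus_equality[of "- x" x] by simp

lemma tr_m_inv: "x \<noteq> 0 \<Longrightarrow> inv\<^bsub>tr\<^esub> x = inverse (x :: 'f::field)"
  by (rule tr.inv_unique'[symmetric]) simp_all

lemma subfield_tr:
  assumes "subfield K (tr :: 'f::field ring)"
  shows "1 \<in> K" "x \<in> K \<Longrightarrow> y \<in> K \<Longrightarrow> x - y \<in> K" "x \<in> K \<Longrightarrow> y \<in> K \<Longrightarrow> x * y \<in> K" "x \<in> K \<Longrightarrow> inverse x \<in> K"
    "x \<in> K \<Longrightarrow> y \<in> K \<Longrightarrow> x + y \<in> K" "0 \<in> K"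
proof -
  note r = subringE[OF subfieldE(1)[OF assms]]
  show "1 \<in> K" "0 \<in> K" "x \<in> K \<Longrightarrow> y \<in> K \<Longrightarrow> x * y \<in> K" "x \<in> K \<Longrightarrow> y \<in> K \<Longrightarrow> x + y \<in> K"
    using r(2,3) r(6)[of x y] r(7)[of x y] by simp_all
  have "- x \<in> K" if "x \<in> K" for x using r(5)[OF that] by (simp add: tr_a_inv)
  then show "x \<in> K \<Longrightarrow> y \<in> K \<Longrightarrow> x - y \<in> K" using r(7)[of x "- y"] by simp
  show "x \<in> K \<Longrightarrow> inverse x \<in> K"
    using tr.subfield_m_inv(1)[OF assms, of x] \<open>0 \<in> K\<close> by (cases "x = 0") (auto simp: tr_m_inv)
qed

lemma line_extension_tr:
  "ring.line_extension tr K b W = {k * b + w | k w. k \<in> K \<and> w \<in> (W :: 'f::field set)}"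
  by (auto simp: tr.line_extension_mem_iff) blast+

text \<open>Induction along the construction of a finite-dimensional space by adding one line at a
  time; closure under differences and scalars is carried along because the next step requires
  it.\<close>

lemma (in valued) complete_dimension:
  assumes K: "complete_set K" "subfield K (tr :: 'f ring)" and d: "ring.dimension tr m K W"
  shows "complete_set W \<and> (\<forall>x y. x \<in> W \<longrightarrow> y \<in> W \<longrightarrow> x - y \<in> W) \<and> (\<forall>k x. k \<in> K \<longrightarrow> x \<in> W \<longrightarrow> k * x \<in> W)"
  using d K
proof (induction rule: tr.dimension.induct)
  case (zero_dim K)
  have "limit s 0" if "\<forall>i. s i = 0" for s using that by (simp add: limit_def)
  then show ?case by (auto simp: complete_set_def)
next
  case (Suc_dim v W n K)
  note sf = subfield_tr[OF Suc_dim.prems(2)]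
  show ?case
    unfolding line_extension_tr
  proof (intro conjI allI impI)
    show "complete_set {k * v + w |k w. k \<in> K \<and> w \<in> W}"
      using Suc_dim.IH[OF Suc_dim.prems] Suc_dim.hyps Suc_dim.prems sf by (intro complete_line_extension) auto
  next
    fix x y assume "x \<in> {k * v + w |k w. k \<in> K \<and> w \<in> W}" "y \<in> {k * v + w |k w. k \<in> K \<and> w \<in> W}"
    then obtain k w k' w' where "x = k * v + w" "y = k' * v + w'" "k \<in> K" "w \<in> W" "k' \<in> K" "w' \<in> W" by auto
    then show "x - y \<in> {k * v + w |k w. k \<in> K \<and> w \<in> W}"
      using Suc_dim.IH[OF Suc_dim.prems] sf(2)
      by (intro CollectI exI[of _ "k - k'"] exI[of _ "w - w'"]) (auto simp: algebra_simps)
  next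
    fix a x assume "a \<in> K" "x \<in> {k * v + w |k w. k \<in> K \<and> w \<in> W}"
    then obtain k w where "x = k * v + w" "k \<in> K" "w \<in> W" by auto
    then show "a * x \<in> {k * v + w |k w. k \<in> K \<and> w \<in> W}"
      using Suc_dim.IH[OF Suc_dim.prems] sf(3) \<open>a \<in> K\<close>
      by (intro CollectI exI[of _ "a * k"] exI[of _ "a * w"]) (auto simp: algebra_simps)
  qed
qed

section \<open>The p-adic coefficient field and the order of the partial sums of the series for
  \<gamma>\<close>

lemma valued_padic:
  assumes "padic_closure p ord"
  shows "valued ord p"
  using assms unfolding padic_closure_def valued_def by blast

lemma complete_range_to_ac:
  assumes "padic_closure p (ord :: 'k::field_char_0 alg_closure \<Rightarrow> ereal)"
  shows "valued.complete_set ord (range to_ac)"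
proof -
  interpret valued ord p by (rule valued_padic[OF assms])
  have compl: "(\<forall>b::real. \<exists>m. \<forall>i\<ge>m. \<forall>j\<ge>m. ereal b \<le> ord (to_ac (s i - s j))) \<longrightarrow>
        (\<exists>x. ((\<lambda>i. ord (to_ac (s i - x))) \<longlongrightarrow> \<infinity>) sequentially)" for s :: "nat \<Rightarrow> 'k"
    using assms unfolding padic_closure_def by blast
  show ?thesis
    unfolding complete_set_def
  proof (intro allI impI)
    fix s :: "nat \<Rightarrow> 'k alg_closure" assume "\<forall>i. s i \<in> range to_ac" and c: "cauchy s"
    then have s: "s i = to_ac (of_ac (s i))" for i by (simp add: to_ac_of_ac)
    define t where "t i = of_ac (s i)" for i
    have st: "s = (\<lambda>i. to_ac (t i))" using s by (auto simp: t_def)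
    have "\<forall>b::real. \<exists>m. \<forall>i\<ge>m. \<forall>j\<ge>m. ereal b \<le> ord (to_ac (t i - t j))"
      using c unfolding st cauchy_def vb_def by simp
    then obtain x where x: "((\<lambda>i. ord (to_ac (t i - x))) \<longlongrightarrow> \<infinity>) sequentially" using compl by blast
    have "limit s (to_ac x)"
      unfolding limit_def
    proof
      fix b
      have "eventually (\<lambda>i. ereal b < ord (to_ac (t i - x))) sequentially"
        using x unfolding tendsto_PInfty by blast
      then obtain m where "\<And>i. i \<ge> m \<Longrightarrow> ereal b < ord (to_ac (t i - x))"
        unfolding eventually_sequentially by blast
      then show "\<exists>m. \<forall>i\<ge>m. vb b (s i - to_ac x)"
        unfolding st vb_def by (intro exI[of _ m]) (auto simp: less_imp_le)
    qed
    then show "\<exists>x\<in>range to_ac. limit s x" by blast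
  qed
qed

text \<open>Evaluation in \<open>univ_poly\<close> reads a coefficient list from the leading
  coefficient on, whereas \<open>Poly\<close> starts with the constant one; hence
  \<open>rev\<close>.\<close>

lemma eval_tr: "ring.eval tr xs x = poly (Poly (rev xs)) (x :: 'f::field)"
proof (induction xs)
  case (Cons a xs)
  have pw: "x [^]\<^bsub>tr\<^esub> (m::nat) = x ^ m" for m
    by (induction m) (auto simp: mult.commute)
  show ?case using Cons by (simp add: pw Poly_append poly_monom algebra_simps)
qed simp

lemma algebraic_range_to_ac: "(ring.algebraic tr over (range to_ac)) (x :: 'k::field alg_closure)"
proof -
  obtain P :: "'k poly" where P: "P \<noteq> 0" "poly (map_poly to_ac P) x = 0"
    by (rule alg_closure_algebraic)
  define xs where "xs = rev (coeffs (map_poly to_ac P))"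
  have nz: "map_poly to_ac P \<noteq> 0" using P(1) by (simp add: map_poly_eq_0_iff)
  then have ne: "xs \<noteq> []" by (simp add: xs_def)
  have "set xs \<subseteq> range to_ac" by (auto simp: xs_def set_coeffs_map_poly)
  moreover have "hd xs \<noteq> 0"
    using nz by (simp add: xs_def hd_rev last_coeffs_eq_coeff_degree)
  ultimately have "xs \<in> carrier (univ_poly tr (range to_ac))"
    by (simp add: univ_poly_def polynomial_def)
  moreover have "ring.eval tr xs x = \<zero>\<^bsub>tr\<^esub>" using P(2) by (simp add: eval_tr xs_def)
  ultimately show ?thesis using ne by (intro tr.algebraicI)
qed

text \<open>As \<rho> is algebraic, the field generated by it over Q_q is the simple extension, and
  by multiplicativity of degrees it has finite dimension over the p-adic numbers. Finite-dimensional
  spaces over the complete base field are complete.\<close>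

lemma complete_valued_extension:
  fixes ord :: "'k::field_char_0 alg_closure \<Rightarrow> ereal"
  assumes po: "padic_closure p ord" and ur: "unramified_extension ord a Qq"
  shows "complete_valued ord p (generate_field tr (insert \<rho> Qq))"
proof -
  interpret valued ord p by (rule valued_padic[OF po])
  have Q: "subfield Qq tr" "range to_ac \<subseteq> Qq" "ring.dimension tr a (range to_ac) Qq"
    using ur by (auto simp: unramified_extension_def)
  have K: "subfield (range to_ac) (tr :: 'k alg_closure ring)"
  proof (rule field.subfieldI'[OF field_from_type_algebra])
    show "subring (range to_ac) (tr :: 'k alg_closure ring)"
      by (rule tr.subringI)
        (auto simp: tr_a_inv to_ac_minus[symmetric] to_ac_add[symmetric] to_ac_mult[symmetric] to_ac_1[symmetric] simp del: to_ac_minus to_ac_add to_ac_mult to_ac_1)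
    fix k :: "'k alg_closure" assume k: "k \<in> range to_ac - {\<zero>\<^bsub>tr\<^esub>}"
    then show "inv\<^bsub>tr\<^esub> k \<in> range to_ac"
      by (auto simp: tr_m_inv to_ac_inverse[symmetric] simp del: to_ac_inverse)
  qed
  have "(ring.algebraic tr over (range to_ac)) \<rho>" by (rule algebraic_range_to_ac)
  then have alg: "(ring.algebraic tr over Qq) \<rho>"
    using tr.algebraic_mono[OF Q(2)] by simp
  define L where "L = ring.simple_extension tr Qq \<rho>"
  have L: "subfield L tr" unfolding L_def using tr.simple_extension_is_subfield[OF Q(1)] alg by simp
  have rc: "\<rho> \<in> carrier tr" by simp
  note dim = tr.telescopic_base[OF K Q(1) Q(3) tr.dimension_simple_extension[OF Q(1) rc alg]]
  from complete_dimension[OF complete_range_to_ac[OF po] K dim] have cL: "complete_set L"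
    unfolding L_def by blast
  have gen: "generate_field tr (insert \<rho> Qq) = L"
  proof
    show "generate_field tr (insert \<rho> Qq) \<subseteq> L"
      using tr.simple_extension_mem[OF subfieldE(1)[OF Q(1)], of \<rho>] tr.simple_extension_incl[of Qq \<rho>]
      by (intro field.generate_field_min_subfield1[OF field_from_type_algebra _ L]) (auto simp: L_def)
    have sg: "subfield (generate_field tr (insert \<rho> Qq)) (tr :: 'k alg_closure ring)"
      by (rule field.generate_field_is_subfield[OF field_from_type_algebra]) simp
    show "L \<subseteq> generate_field tr (insert \<rho> Qq)"
    proof
      fix x assume "x \<in> L"
      then show "x \<in> generate_field tr (insert \<rho> Qq)"
        unfolding L_def
      proof (induction rule: tr.simple_extension.induct)
        case (lin k1 k2)
        have "\<rho> \<in> generate_field tr (insert \<rho> Qq)" "k2 \<in> generate_field tr (insert \<rho> Qq)"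
          using lin.hyps by (auto intro: generate_field.incl)
        then show ?case using lin.IH subfield_tr[OF sg] by simp
      qed (use subfield_tr[OF sg] in simp)
    qed
  qed
  show ?thesis
    unfolding gen
  proof unfold_locales
    fix s assume *: "\<And>i::nat. s i \<in> L" "\<And>b. \<exists>m. \<forall>i\<ge>m. \<forall>j\<ge>m. vb b (s i - s j)"
    then have "cauchy s" by (simp add: cauchy_def)
    then show "\<exists>x\<in>L. \<forall>b. \<exists>m. \<forall>i\<ge>m. vb b (s i - x)"
      using cL *(1) unfolding complete_set_def limit_def by blast
  qed (use subfield_tr[OF L] in auto)
qed

text \<open>The partial sums tend to zero, so \<gamma>_j is minus the tail from j + 1 on. Its terms
  have the orders e(i) = p^i/(p-1) - i, nondecreasing in i, hence \<gamma>_j has order at least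
  e(j+1), and j + e(j+1) - p^j/(p-1) = p^j - 1.\<close>

lemma gamma_part_estimate:
  fixes ord :: "'f::field \<Rightarrow> ereal"
  assumes "valued ord p" and p: "p \<ge> 2"
    and lim: "((\<lambda>i. ord (gamma_part p \<gamma> i)) \<longlongrightarrow> \<infinity>) sequentially"
    and g: "ord \<gamma> = ereal (1 / (real p - 1))"
  shows "valued.vb ord (real (p ^ j) - 1) (of_nat (p ^ j) * gamma_part p \<gamma> j / \<gamma> ^ (p ^ j))"
proof -
  interpret valued ord p by fact
  have og: "ord (\<gamma> ^ m) = ereal (real m / (real p - 1))" for m
    by (induction m) (auto simp: ord_mult g zero_ereal_def add_divide_distrib)
  define e where "e i = real (p ^ i) / (real p - 1) - real i" for i
  have tm: "vb (e i) (\<gamma> ^ (p ^ i) / of_nat (p ^ i))" for i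
    unfolding e_def of_nat_power
    by (rule vb_divide[OF _ ord_p_power]) (simp add: vb_def og)
  have step: "e i \<le> e (Suc i)" for i
  proof -
    have p1: "real p - 1 > 0" using p by simp
    have "e (Suc i) - e i = real (p ^ i) * (real p - 1) / (real p - 1) - 1"
      by (simp add: e_def diff_divide_distrib algebra_simps)
    also have "\<dots> = real (p ^ i) - 1" using p1 by simp
    also have "\<dots> \<ge> 0" using p by (simp add: one_le_power)
    finally show ?thesis by simp
  qed
  have mono: "e i \<le> e i'" if "i \<le> i'" for i i'
    using that step by (rule lift_Suc_mono_le[of e, rotated])
  have "eventually (\<lambda>i. ereal (e (Suc j)) < ord (gamma_part p \<gamma> i)) sequentially"
    using lim unfolding tendsto_PInfty by blast
  then obtain m where m: "\<And>i. i \<ge> m \<Longrightarrow> vb (e (Suc j)) (gamma_part p \<gamma> i)"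
    unfolding eventually_sequentially vb_def by (auto intro: less_imp_le)
  define M where "M = max m j"
  \<comment> \<open>Finitely many terms of the tail suffice, since the partial sum at M already has
    order at least e(j+1).\<close>
  have "gamma_part p \<gamma> M = gamma_part p \<gamma> j + (\<Sum>i\<in>{Suc j..M}. \<gamma> ^ (p ^ i) / of_nat (p ^ i))"
  proof -
    have "{..M} = {..j} \<union> {Suc j..M}" by (auto simp: M_def)
    then show ?thesis unfolding gamma_part_def by (simp add: sum.union_disjoint)
  qed
  moreover have "vb (e (Suc j)) (\<Sum>i\<in>{Suc j..M}. \<gamma> ^ (p ^ i) / of_nat (p ^ i))"
    by (intro vb_sum vb_mono[OF tm] mono) auto
  moreover have "vb (e (Suc j)) (gamma_part p \<gamma> M)" by (rule m) (simp add: M_def)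
  ultimately have "vb (e (Suc j)) (gamma_part p \<gamma> j)"
    using vb_diff by (metis add_diff_cancel_right')
  then have "vb (real j + e (Suc j)) (of_nat (p ^ j) * gamma_part p \<gamma> j)"
    unfolding of_nat_power vb_p_power_mult by simp
  then have "vb (real j + e (Suc j) - real (p ^ j) / (real p - 1)) (of_nat (p ^ j) * gamma_part p \<gamma> j / \<gamma> ^ (p ^ j))"
    by (rule vb_divide[OF _ og])
  moreover have "real j + e (Suc j) - real (p ^ j) / (real p - 1) = real (p ^ j) - 1"
  proof -
    have p1: "real p - 1 > 0" using p by simp
    have "real (p ^ Suc j) / (real p - 1) - real (p ^ j) / (real p - 1) = real (p ^ j) * (real p - 1) / (real p - 1)"
      by (simp add: diff_divide_distrib algebra_simps)
    also have "\<dots> = real (p ^ j)" using p1 by simp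
    finally show ?thesis by (simp add: e_def)
  qed
  ultimately show ?thesis by simp
qed

section \<open>The reduction modulo \<open>p\<close>\<close>

lemma restrict_scalars_simps [simp]:
  "carrier (restrict_scalars \<iota> M) = carrier M" "add (restrict_scalars \<iota> M) = add M"
  "zero (restrict_scalars \<iota> M) = zero M" "module.smult (restrict_scalars \<iota> M) = (\<lambda>c. module.smult M (\<iota> c))"
  by (auto simp: restrict_scalars_def)

lemma restrict_scalars_cong:
  "finsum (restrict_scalars \<iota> M) f A = finsum M f A" "(restrict_scalars \<iota> M) = M' \<Longrightarrow> a_r_coset M' = a_r_coset M"
proof -
  show "finsum (restrict_scalars \<iota> M) f A = finsum M f A" by (rule finsum_record_cong) simp_all
  show "(restrict_scalars \<iota> M) = M' \<Longrightarrow> a_r_coset M' = a_r_coset M"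
    by (auto simp: a_r_coset_def r_coset_def restrict_scalars_def fun_eq_iff)
qed

lemma restrict_scalars_minus: "x \<ominus>\<^bsub>restrict_scalars \<iota> M\<^esub> y = x \<ominus>\<^bsub>M\<^esub> y"
  by (simp add: a_minus_def a_inv_def restrict_scalars_def m_inv_def)

locale scalar_map = A: type_subring A + S: type_subring S
  for A :: "'a::comm_ring_1 set" and S :: "'r::comm_ring_1 set" and \<iota> :: "'a \<Rightarrow> 'r" +
  assumes \<iota>_closed: "x \<in> A \<Longrightarrow> \<iota> x \<in> S" and \<iota>_1: "\<iota> 1 = 1"
    and \<iota>_add: "\<iota> (x + y) = \<iota> x + \<iota> y" and \<iota>_mult: "\<iota> (x * y) = \<iota> x * \<iota> y"
begin

lemma module_restrict_scalars:
  assumes "module S.RS M"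
  shows "module A.RS (restrict_scalars \<iota> M)"
proof -
  interpret M: module S.RS M by fact
  show ?thesis
  proof (rule moduleI)
    show "abelian_group (restrict_scalars \<iota> M)"
    proof (rule abelian_groupI)
      fix x assume "x \<in> carrier (restrict_scalars \<iota> M)"
      then show "\<exists>y\<in>carrier (restrict_scalars \<iota> M). y \<oplus>\<^bsub>restrict_scalars \<iota> M\<^esub> x = \<zero>\<^bsub>restrict_scalars \<iota> M\<^esub>"
        by (auto intro!: bexI[of _ "\<ominus>\<^bsub>M\<^esub> x"] simp: M.M.l_neg)
    qed (auto simp: M.M.a_ac)
  next
    fix x assume "x \<in> carrier (restrict_scalars \<iota> M)"
    then show "\<one>\<^bsub>A.RS\<^esub> \<odot>\<^bsub>restrict_scalars \<iota> M\<^esub> x = x" using M.smult_one[of x] by (simp add: \<iota>_1)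
  next
    fix a x y assume "a \<in> carrier A.RS" "x \<in> carrier (restrict_scalars \<iota> M)" "y \<in> carrier (restrict_scalars \<iota> M)"
    then show "a \<odot>\<^bsub>restrict_scalars \<iota> M\<^esub> (x \<oplus>\<^bsub>restrict_scalars \<iota> M\<^esub> y) =
        a \<odot>\<^bsub>restrict_scalars \<iota> M\<^esub> x \<oplus>\<^bsub>restrict_scalars \<iota> M\<^esub> a \<odot>\<^bsub>restrict_scalars \<iota> M\<^esub> y"
      using M.smult_r_distr[of "\<iota> a" x y] by (simp add: \<iota>_closed)
  next
    fix a b x assume "a \<in> carrier A.RS" "b \<in> carrier A.RS" "x \<in> carrier (restrict_scalars \<iota> M)"
    then show "(a \<oplus>\<^bsub>A.RS\<^esub> b) \<odot>\<^bsub>restrict_scalars \<iota> M\<^esub> x =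
        a \<odot>\<^bsub>restrict_scalars \<iota> M\<^esub> x \<oplus>\<^bsub>restrict_scalars \<iota> M\<^esub> b \<odot>\<^bsub>restrict_scalars \<iota> M\<^esub> x"
      and "(a \<otimes>\<^bsub>A.RS\<^esub> b) \<odot>\<^bsub>restrict_scalars \<iota> M\<^esub> x =
        a \<odot>\<^bsub>restrict_scalars \<iota> M\<^esub> (b \<odot>\<^bsub>restrict_scalars \<iota> M\<^esub> x)"
      using M.smult_l_distr[of "\<iota> a" "\<iota> b" x] M.smult_assoc1[of "\<iota> a" "\<iota> b" x] by (simp_all add: \<iota>_closed \<iota>_add \<iota>_mult)
  next
    fix a x assume "a \<in> carrier A.RS" "x \<in> carrier (restrict_scalars \<iota> M)"
    then show "a \<odot>\<^bsub>restrict_scalars \<iota> M\<^esub> x \<in> carrier (restrict_scalars \<iota> M)"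
      using M.smult_closed[of "\<iota> a" x] by (simp add: \<iota>_closed)
  qed (rule A.cring_RS)
qed

text \<open>The connection on S_k is linear only over the constants O_q, so its image is a submodule
  only after restriction of scalars. The quotient by \<open>nabla_bar\<close> is likewise formed
  over the constants F_q.\<close>

lemma submodule_image:
  assumes "module S.RS M" and f: "\<And>x. x \<in> carrier M \<Longrightarrow> f x \<in> carrier M"
    and fa: "\<And>x y. x \<in> carrier M \<Longrightarrow> y \<in> carrier M \<Longrightarrow> f (x \<oplus>\<^bsub>M\<^esub> y) = f x \<oplus>\<^bsub>M\<^esub> f y"
    and fm: "\<And>a x. a \<in> A \<Longrightarrow> x \<in> carrier M \<Longrightarrow> f (\<iota> a \<odot>\<^bsub>M\<^esub> x) = \<iota> a \<odot>\<^bsub>M\<^esub> f x"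
  shows "submodule (f ` carrier M) A.RS (restrict_scalars \<iota> M)"
proof -
  interpret M: module S.RS M by fact
  interpret R: module A.RS "restrict_scalars \<iota> M" by (rule module_restrict_scalars[OF assms(1)])
  have smult: "\<iota> a \<odot>\<^bsub>M\<^esub> y \<in> f ` carrier M" if a: "a \<in> A" and y: "y \<in> f ` carrier M" for a y
  proof -
    obtain x where x: "x \<in> carrier M" "y = f x" using y by auto
    then have "\<iota> a \<odot>\<^bsub>M\<^esub> y = f (\<iota> a \<odot>\<^bsub>M\<^esub> x)" using fm a by simp
    moreover have "\<iota> a \<odot>\<^bsub>M\<^esub> x \<in> carrier M" using x a M.smult_closed[of "\<iota> a" x] by (simp add: \<iota>_closed)
    ultimately show ?thesis by blast
  qed
  have fc: "f ` carrier M \<subseteq> carrier M" using f by auto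
  have z: "\<iota> 0 = 0" using \<iota>_add[of 0 0] by simp
  show ?thesis
  proof (rule R.submoduleI)
    have "f \<zero>\<^bsub>M\<^esub> \<in> f ` carrier M" by simp
    from smult[OF A.zero_S this] show "\<zero>\<^bsub>restrict_scalars \<iota> M\<^esub> \<in> f ` carrier M"
      using M.smult_l_null[OF f[OF M.M.zero_closed]] by (simp add: z)
  next
    fix a assume a: "a \<in> f ` carrier M"
    have ac: "a \<in> carrier M" using a fc by blast
    have "\<ominus>\<^bsub>restrict_scalars \<iota> M\<^esub> a = (\<ominus>\<^bsub>A.RS\<^esub> 1) \<odot>\<^bsub>restrict_scalars \<iota> M\<^esub> a"
      using R.smult_l_minus[of 1 a] R.smult_one[of a] ac A.one_S by simp
    also have "\<dots> \<in> f ` carrier M"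
      using smult[OF _ a, of "- 1"] A.uminus_S[OF A.one_S] by (simp add: A.a_inv_RS A.one_S)
    finally show "\<ominus>\<^bsub>restrict_scalars \<iota> M\<^esub> a \<in> f ` carrier M" .
  next
    fix a b assume "a \<in> f ` carrier M" "b \<in> f ` carrier M"
    then obtain x y where "x \<in> carrier M" "y \<in> carrier M" "a = f x" "b = f y" by blast
    then show "a \<oplus>\<^bsub>restrict_scalars \<iota> M\<^esub> b \<in> f ` carrier M"
      using fa[of x y] M.M.a_closed[of x y] by (metis imageI restrict_scalars_simps(2))
  qed (use fc smult in auto)
qed

end

text \<open>The degree of t^r e^i in which e_j has degree j and t has degree n + 1; with this choice
  G raises the degree by exactly one.\<close>

definition ix_deg :: "nat \<Rightarrow> (nat \<Rightarrow> nat) \<times> nat \<Rightarrow> nat" where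
  "ix_deg n a = index_weight n (fst a) + (n + 1) * snd a"

definition next_ix :: "nat \<Rightarrow> nat \<Rightarrow> nat" where
  "next_ix n j = (if j < n then j + 1 else 0)"

text \<open>The matrix of \<open>\<nabla>\<close> in the bases \<open>t\<^sup>r e\<^sup>i\<close>, which are indexed by the pairs \<open>(i, r)\<close>.\<close>

definition conn_mat :: "nat \<Rightarrow> (nat \<Rightarrow> nat) \<times> nat \<Rightarrow> (nat \<Rightarrow> nat) \<times> nat \<Rightarrow> int" where
  "conn_mat n a b = (\<Sum>j | j \<le> n \<and> fst a j > 0.
     if move_index (fst a) j (next_ix n j) = fst b \<and> snd b = snd a + (if j = n then 1 else 0)
     then int (fst a j) else 0)"

lemma next_ix_le: "j \<le> n \<Longrightarrow> next_ix n j \<le> n"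
  by (simp add: next_ix_def)

lemma index_weight_move:
  assumes "j \<le> n" "i j > 0" "l \<le> n"
  shows "index_weight n (move_index i j l) + j = index_weight n i + l"
  using move_index_sum[of j n i l "\<lambda>a. a", OF assms] by (simp add: index_weight_def)

text \<open>Passing from e_j to e_(j+1) adds one to the weight; passing from e_n to t e_0 subtracts
  n and adds n + 1 for t.\<close>

lemma conn_mat_hom:
  assumes "Suc (ix_deg n a) \<noteq> ix_deg n b"
  shows "conn_mat n a b = 0"
  unfolding conn_mat_def
proof (rule sum.neutral, rule ballI)
  fix j assume j: "j \<in> {j. j \<le> n \<and> fst a j > 0}"
  have "Suc (ix_deg n a) = ix_deg n b"
    if h: "move_index (fst a) j (next_ix n j) = fst b" "snd b = snd a + (if j = n then 1 else 0)"
  proof -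
    have "index_weight n (fst b) + j = index_weight n (fst a) + next_ix n j"
      unfolding h(1)[symmetric] using j by (intro index_weight_move next_ix_le) auto
    then show ?thesis using j h(2) by (cases "j = n") (auto simp: ix_deg_def next_ix_def)
  qed
  then show "(if move_index (fst a) j (next_ix n j) = fst b \<and> snd b = snd a + (if j = n then 1 else 0)
     then int (fst a j) else 0) = 0" using assms by auto
qed

lemma conn_mat_snd: "conn_mat n a b \<noteq> 0 \<Longrightarrow> snd a \<le> snd b"
proof (rule ccontr)
  assume "\<not> snd a \<le> snd b"
  then have "conn_mat n a b = 0" unfolding conn_mat_def by (intro sum.neutral) auto
  moreover assume "conn_mat n a b \<noteq> 0"
  ultimately show False by simp
qed

lemma finite_ix: "finite {a \<in> sym_index n k \<times> UNIV. ix_deg n a = N}"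
proof (rule finite_subset)
  show "{a \<in> sym_index n k \<times> UNIV. ix_deg n a = N} \<subseteq> sym_index n k \<times> {..N}"
    by (auto simp: ix_deg_def)
  show "finite (sym_index n k \<times> {..N})" by (intro finite_cartesian_product finite_sym_index) auto
qed

lemma rta_UNIV: "(ring_of_type_algebra :: 'r::comm_ring_1 ring)\<lparr>carrier := UNIV\<rparr> = ring_of_type_algebra"
  by (simp add: ring_of_type_algebra_def)

lemma type_subring_UNIV: "type_subring (UNIV :: 'r::comm_ring_1 set)"
  by unfold_locales auto

lemma M_bar_coords:
  "free_mod (ring_of_type_algebra :: 'q::field poly ring) (M_bar n) {..n} e_bar"
  "f \<in> carrier (M_bar n) \<Longrightarrow> j \<le> n \<Longrightarrow> coords (ring_of_type_algebra :: 'q::field poly ring) (M_bar n) {..n} e_bar f j = f j"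
proof -
  interpret U: type_subring "UNIV :: 'q poly set" by (rule type_subring_UNIV)
  have M: "M_bar n = free_module U.RS {0..n}" by (simp add: M_bar_def rta_UNIV)
  have lc: "(\<Oplus>\<^bsub>M_bar n\<^esub>i\<in>{..n}. c i \<odot>\<^bsub>M_bar n\<^esub> e_bar i) = (\<lambda>x. if x \<le> n then c x else 0)"
    for c :: "nat \<Rightarrow> 'q poly"
  proof -
    have e: "(e_bar i :: nat \<Rightarrow> 'q poly) \<in> carrier (M_bar n)" if "i \<le> n" for i
      using U.unit_vec_closed[of i "{0..n}"] that unfolding M_bar_def e_bar_def rta_UNIV by simp
    interpret Mm: module U.RS "M_bar n" unfolding M by (rule U.module_free_module)
    have "(\<Oplus>\<^bsub>M_bar n\<^esub>i\<in>{..n}. c i \<odot>\<^bsub>M_bar n\<^esub> e_bar i) = (\<lambda>x. \<Sum>i\<le>n. (c i \<odot>\<^bsub>M_bar n\<^esub> e_bar i) x)"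
      using U.free_module_finsum[of "{..n}" "\<lambda>i. c i \<odot>\<^bsub>M_bar n\<^esub> e_bar i" "{0..n}"] e Mm.smult_closed unfolding M by simp
    also have "\<dots> = (\<lambda>x. \<Sum>i\<le>n. if i = x then c i else 0)"
      by (intro ext sum.cong) (auto simp: M e_bar_def U.unit_vec_RS[unfolded rta_UNIV])
    finally show ?thesis by auto
  qed
  have car: "f \<in> carrier (M_bar n) \<longleftrightarrow> (\<forall>x>n. f x = 0)" for f :: "nat \<Rightarrow> 'q poly"
  proof
    assume h: "\<forall>x>n. f x = 0"
    then have "{x. f x \<noteq> 0} \<subseteq> {..n}" by (force simp: not_le[symmetric])
    then show "f \<in> carrier (M_bar n)"
      using h finite_subset unfolding M U.carrier_free_module by auto
  qed (auto simp: M U.carrier_free_module)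
  have fw: "free_with_basis (ring_of_type_algebra :: 'q poly ring) (M_bar n) {..n} e_bar"
    unfolding free_with_basis_def
  proof (intro conjI ballI)
    show "module ring_of_type_algebra (M_bar n :: ('q poly, nat \<Rightarrow> 'q poly) module)"
      using U.module_free_module[of "{0..n}"] by (simp add: M_bar_def rta_UNIV)
    show "e_bar \<in> {..n} \<rightarrow> carrier (M_bar n :: ('q poly, nat \<Rightarrow> 'q poly) module)"
      by (auto simp: car e_bar_def unit_vec_def ring_of_type_algebra_def)
    fix f :: "nat \<Rightarrow> 'q poly" assume f: "f \<in> carrier (M_bar n)"
    show "\<exists>!c. c \<in> {..n} \<rightarrow>\<^sub>E carrier ring_of_type_algebra \<and> f = (\<Oplus>\<^bsub>M_bar n\<^esub>i\<in>{..n}. c i \<odot>\<^bsub>M_bar n\<^esub> e_bar i)"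
    proof (rule ex1I[of _ "restrict f {..n}"])
      show "restrict f {..n} \<in> {..n} \<rightarrow>\<^sub>E carrier ring_of_type_algebra \<and>
          f = (\<Oplus>\<^bsub>M_bar n\<^esub>i\<in>{..n}. restrict f {..n} i \<odot>\<^bsub>M_bar n\<^esub> e_bar i)"
        unfolding lc using f by (auto simp: car fun_eq_iff ring_of_type_algebra_def)
      fix c assume "c \<in> {..n} \<rightarrow>\<^sub>E carrier ring_of_type_algebra \<and> f = (\<Oplus>\<^bsub>M_bar n\<^esub>i\<in>{..n}. c i \<odot>\<^bsub>M_bar n\<^esub> e_bar i)"
      then show "c = restrict f {..n}" unfolding lc by (auto simp: fun_eq_iff PiE_def extensional_def)
    qed
  qed simp
  then show fm: "free_mod (ring_of_type_algebra :: 'q poly ring) (M_bar n) {..n} e_bar" by (rule free_modI)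
  interpret fm: free_mod "ring_of_type_algebra :: 'q poly ring" "M_bar n" "{..n}" e_bar by (rule fm)
  show "coords (ring_of_type_algebra :: 'q poly ring) (M_bar n) {..n} e_bar f j = f j"
    if f: "f \<in> carrier (M_bar n)" and j: "j \<le> n"
  proof -
    have "f j = (\<Oplus>\<^bsub>M_bar n\<^esub>i\<in>{..n}. fm.co f i \<odot>\<^bsub>M_bar n\<^esub> e_bar i) j" using fm.coords_sum[OF f] by simp
    then show ?thesis unfolding lc using j by simp
  qed
qed

lemma G_bar_e_bar:
  assumes "j \<le> n"
  shows "G_bar n (e_bar j) = (\<lambda>l. if l = next_ix n j then (if j = n then [:0, 1:] else 1) else (0 :: 'q::field poly))"
  using assms by (auto simp: G_bar_def e_bar_def unit_vec_def next_ix_def ring_of_type_algebra_def fun_eq_iff)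

lemma G_bar_closed: "j \<le> n \<Longrightarrow> G_bar n (e_bar j) \<in> carrier (M_bar n :: ('q::field poly, nat \<Rightarrow> 'q poly) module)"
  unfolding M_bar_def free_module_def
  by (auto simp: G_bar_e_bar next_ix_def ring_of_type_algebra_def)

locale reduction =
  fixes n k :: nat and qt :: "'q::field itself"
begin

sublocale SB: sym_mod "UNIV :: 'q poly set" "M_bar n" n e_bar k
  using M_bar_coords(1)[where ?'q = 'q] type_subring_UNIV[where ?'r = "'q poly"]
  by (simp add: sym_mod_def rta_UNIV)

abbreviation "Sb \<equiv> S_bar n k :: ('q poly, ((nat \<Rightarrow> 'q poly) multiset \<Rightarrow> 'q poly) set) module"
abbreviation "nab \<equiv> nabla_bar n k :: ((nat \<Rightarrow> 'q poly) multiset \<Rightarrow> 'q poly) set \<Rightarrow> _"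
abbreviation "I \<equiv> sym_index n k"

lemma Sb_eq: "Sb = SB.P"
  by (simp add: S_bar_def rta_UNIV)

lemma nab_eq: "nab = sym_extend SB.RS (M_bar n) n e_bar k (\<lambda>_. 0) (G_bar n)"
  by (simp add: nabla_bar_def rta_UNIV)

lemma nab_closed: "x \<in> carrier Sb \<Longrightarrow> nab x \<in> carrier Sb"
  unfolding Sb_eq nab_eq using G_bar_closed by (intro SB.sym_extend_coords) auto

lemma nab_coords:
  assumes x: "x \<in> carrier Sb" and i: "i \<in> I"
  shows "SB.SP.co (nab x) i = (\<Sum>i'\<in>I. \<Sum>j | j \<le> n \<and> i' j > 0.
    if move_index i' j (next_ix n j) = i then of_nat (i' j) * SB.SP.co x i' * (if j = n then [:0, 1:] else 1) else 0)"
proof -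
  have "SB.SP.co (nab x) i = 0 + (\<Sum>i'\<in>I. \<Sum>j | j \<le> n \<and> i' j > 0. \<Sum>l\<le>n.
         if move_index i' j l = i then of_nat (i' j) * SB.SP.co x i' * coords SB.RS (M_bar n) {..n} e_bar (G_bar n (e_bar j)) l else 0)"
    unfolding nab_eq using G_bar_closed x i unfolding Sb_eq by (intro SB.sym_extend_coords(2)) auto
  also have "\<dots> = (\<Sum>i'\<in>I. \<Sum>j | j \<le> n \<and> i' j > 0.
    if move_index i' j (next_ix n j) = i then of_nat (i' j) * SB.SP.co x i' * (if j = n then [:0, 1:] else 1) else 0)"
    unfolding add_0
  proof (intro sum.cong refl)
    fix i' :: "nat \<Rightarrow> nat" and j assume j: "j \<in> {j. j \<le> n \<and> i' j > 0}"
    have "(\<Sum>l\<le>n. if move_index i' j l = i then of_nat (i' j) * SB.SP.co x i' * coords SB.RS (M_bar n) {..n} e_bar (G_bar n (e_bar j)) l else 0) =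
      (\<Sum>l\<le>n. if l = next_ix n j then (if move_index i' j (next_ix n j) = i then of_nat (i' j) * SB.SP.co x i' * (if j = n then [:0, 1:] else 1) else 0) else 0)"
    proof (intro sum.cong refl)
      fix l assume l: "l \<in> {..n}"
      have "coords SB.RS (M_bar n) {..n} e_bar (G_bar n (e_bar j)) l = G_bar n (e_bar j) l"
        unfolding rta_UNIV using j l G_bar_closed by (intro M_bar_coords(2)) auto
      also have "\<dots> = (if l = next_ix n j then (if j = n then [:0, 1:] else 1) else 0)"
        using j by (simp add: G_bar_e_bar)
      finally have cg: "coords SB.RS (M_bar n) {..n} e_bar (G_bar n (e_bar j)) l =
          (if l = next_ix n j then (if j = n then [:0, 1:] else 1) else 0)" .
      then show "(if move_index i' j l = i then of_nat (i' j) * SB.SP.co x i' * coords SB.RS (M_bar n) {..n} e_bar (G_bar n (e_bar j)) l else 0) =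
        (if l = next_ix n j then (if move_index i' j (next_ix n j) = i then of_nat (i' j) * SB.SP.co x i' * (if j = n then [:0, 1:] else 1) else 0) else 0)"
        unfolding cg by simp
    qed
    also have "\<dots> = (if move_index i' j (next_ix n j) = i then of_nat (i' j) * SB.SP.co x i' * (if j = n then [:0, 1:] else 1) else 0)"
      using next_ix_le[of j n] j by (subst sum.delta) auto
    finally show "(\<Sum>l\<le>n. if move_index i' j l = i then of_nat (i' j) * SB.SP.co x i' * coords SB.RS (M_bar n) {..n} e_bar (G_bar n (e_bar j)) l else 0) =
      (if move_index i' j (next_ix n j) = i then of_nat (i' j) * SB.SP.co x i' * (if j = n then [:0, 1:] else 1) else 0)" .
  qed
  finally show ?thesis .
qed

text \<open>Rewrites \<open>nabla_bar\<close> by the integer matrix \<open>conn_mat\<close>, with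
  the sources grouped by degree. A source with a higher power of t than the target, or of the wrong
  degree, has matrix entry zero, so the sum over one degree equals the sum over all powers of t up
  to r.\<close>

lemma nab_coeff:
  assumes x: "x \<in> carrier Sb" and i: "i \<in> I"
  shows "coeff (SB.SP.co (nab x) i) r =
    (\<Sum>a | a \<in> I \<times> UNIV \<and> Suc (ix_deg n a) = ix_deg n (i, r). coeff (SB.SP.co x (fst a)) (snd a) * of_int (conn_mat n a (i, r)))"
proof -
  let ?D = "{a. a \<in> I \<times> UNIV \<and> Suc (ix_deg n a) = ix_deg n (i, r)}"
  let ?f = "\<lambda>a. coeff (SB.SP.co x (fst a)) (snd a) * of_int (conn_mat n a (i, r))"
  have fin: "finite (I \<times> {..r})" by (intro finite_cartesian_product finite_sym_index) auto
  have finD: "finite ?D"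
    using finite_ix[of n k "ix_deg n (i, r) - 1"] by (rule rev_finite_subset) auto
  have big: "?f a = 0" if "a \<in> ?D - ?D \<inter> I \<times> {..r}" for a
  proof -
    have "\<not> snd a \<le> snd (i, r)" using that by (auto simp: mem_Times_iff)
    then have "conn_mat n a (i, r) = 0" using conn_mat_snd by blast
    then show ?thesis by simp
  qed
  have "sum ?f ?D = sum ?f (?D \<inter> I \<times> {..r})"
    by (rule sum.mono_neutral_right[OF finD]) (use big in auto)
  also have "\<dots> = sum ?f (I \<times> {..r})"
  proof (rule sum.mono_neutral_left[OF fin])
    show "\<forall>a\<in>I \<times> {..r} - ?D \<inter> I \<times> {..r}. ?f a = 0"
    proof
      fix a assume "a \<in> I \<times> {..r} - ?D \<inter> I \<times> {..r}"
      then have "Suc (ix_deg n a) \<noteq> ix_deg n (i, r)" by auto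
      from conn_mat_hom[OF this] show "?f a = 0" by simp
    qed
  qed auto
  also have "\<dots> = (\<Sum>i'\<in>I. \<Sum>r'\<le>r. ?f (i', r'))"
    by (simp add: sum.cartesian_product case_prod_unfold)
  also have "\<dots> = coeff (SB.SP.co (nab x) i) r"
    unfolding nab_coords[OF x i] coeff_sum
  proof (rule sum.cong[OF refl])
    fix i' assume "i' \<in> I"
    let ?c = "SB.SP.co x i'"
    have "(\<Sum>r'\<le>r. ?f (i', r')) = (\<Sum>r'\<le>r. \<Sum>j | j \<le> n \<and> i' j > 0.
        if move_index i' j (next_ix n j) = i \<and> r = r' + (if j = n then 1 else 0) then coeff ?c r' * of_nat (i' j) else 0)"
      unfolding conn_mat_def of_int_sum sum_distrib_left by (intro sum.cong refl) auto
    also have "\<dots> = (\<Sum>j | j \<le> n \<and> i' j > 0. \<Sum>r'\<le>r.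
        if move_index i' j (next_ix n j) = i \<and> r = r' + (if j = n then 1 else 0) then coeff ?c r' * of_nat (i' j) else 0)"
      by (rule sum.swap)
    also have "\<dots> = (\<Sum>j | j \<le> n \<and> i' j > 0. coeff (if move_index i' j (next_ix n j) = i
        then of_nat (i' j) * ?c * (if j = n then [:0, 1:] else 1) else 0) r)"
    proof (intro sum.cong refl)
      fix j
      have cn: "coeff (of_nat N * ?c) m = of_nat N * coeff ?c m" for N m
        by (simp add: of_nat_poly)
      show "(\<Sum>r'\<le>r. if move_index i' j (next_ix n j) = i \<and> r = r' + (if j = n then 1 else 0) then coeff ?c r' * of_nat (i' j) else 0) =
        coeff (if move_index i' j (next_ix n j) = i then of_nat (i' j) * ?c * (if j = n then [:0, 1:] else 1) else 0) r"
      proof (cases "move_index i' j (next_ix n j) = i")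
        case True
        show ?thesis
        proof (cases "j = n")
          case False
          then show ?thesis using True by (simp add: cn mult.commute)
        next
          case jn: True
          have "(\<Sum>r'\<le>r. if r = r' + 1 then coeff ?c r' * of_nat (i' j) else 0) =
              (\<Sum>r'\<le>r. if r' = r - 1 then (if r = 0 then 0 else coeff ?c (r - 1) * of_nat (i' j)) else 0)"
            by (intro sum.cong) auto
          then show ?thesis using True jn by (cases r) (simp_all add: cn mult.commute)
        qed
      qed simp
    qed
    finally show "(\<Sum>r'\<le>r. ?f (i', r')) = (\<Sum>j | j \<le> n \<and> i' j > 0. coeff (if move_index i' j (next_ix n j) = i
        then of_nat (i' j) * ?c * (if j = n then [:0, 1:] else 1) else 0) r)" .
  qed
  finally show ?thesis by simp
qed

end

lemma (in abelian_group) minus_eq_iff_add: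
  assumes "x \<in> carrier G" "y \<in> carrier G" "z \<in> carrier G"
  shows "x \<ominus> z = y \<longleftrightarrow> x = y \<oplus> z"
proof
  assume "x \<ominus> z = y"
  then have "y \<oplus> z = x \<ominus> z \<oplus> z" by simp
  then show "x = y \<oplus> z" using assms by (simp add: minus_eq a_assoc l_neg)
next
  assume "x = y \<oplus> z"
  then show "x \<ominus> z = y" using assms by (simp add: minus_eq a_assoc r_neg)
qed

section \<open>Finite fields: the prime field, inverses modulo p, and counting of vectors\<close>

text \<open>Translation by 1 permutes the field, so summing x + 1 over it shows that the number of
  elements, a power of p, is zero in the field.\<close>

lemma CHAR_finite_field:
  assumes "prime p" "card (UNIV :: 'q::finite_field set) = p ^ a"
  shows "CHAR('q) = p"
proof -
  have "(\<Sum>x\<in>UNIV. x + 1) = (\<Sum>x\<in>UNIV. x :: 'q)"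
    by (rule sum.reindex_bij_witness[of _ "\<lambda>x. x - 1" "\<lambda>x. x + 1"]) auto
  then have "of_nat (card (UNIV :: 'q set)) = (0 :: 'q)" by (simp add: sum.distrib)
  then have "CHAR('q) dvd p ^ a" unfolding assms(2) of_nat_eq_0_iff_char_dvd .
  moreover have "prime CHAR('q)" by simp
  ultimately show ?thesis using assms(1) by (metis prime_dvd_power primes_dvd_imp_eq)
qed

text \<open>With p the characteristic, the polynomial X^p - X has at most p roots, and the prime
  field already provides p of them.\<close>

lemma frobenius_fixed_prime_field:
  fixes z :: "'q::finite_field"
  assumes "z ^ CHAR('q) = z"
  obtains m :: nat where "z = of_nat m"
proof -
  let ?p = "CHAR('q)"
  let ?f = "monom 1 ?p - monom 1 1 :: 'q poly"
  have p: "prime ?p" by simp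
  then have p1: "?p > 1" by (rule prime_gt_1_nat)
  have "coeff ?f ?p = 1" using p1 by simp
  then have f0: "?f \<noteq> 0" by (metis coeff_0 zero_neq_one)
  have deg: "degree ?f \<le> ?p" using p1
    by (intro degree_diff_le) (auto intro!: degree_monom_le order.trans[OF degree_monom_le])
  have roots: "poly ?f x = 0 \<longleftrightarrow> x ^ ?p = x" for x by (simp add: poly_monom)
  have inj: "inj_on (of_nat :: nat \<Rightarrow> 'q) {..<?p}"
  proof (rule linorder_inj_onI')
    fix i j assume ij: "i \<in> {..<?p}" "j \<in> {..<?p}" "i < j"
    then have "\<not> ?p dvd j - i" by (auto dest: dvd_imp_le)
    then show "of_nat i \<noteq> (of_nat j :: 'q)" using of_nat_eq_iff_char_dvd[OF ij(3), where ?'a = 'q] by simp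
  qed
  have pow: "(of_nat m :: 'q) ^ ?p = of_nat m" for m
    by (induction m) (use p p1 freshmans_dream[where ?'a = 'q] in \<open>auto simp: power_0_left\<close>)
  have sub: "of_nat ` {..<?p} \<subseteq> {x. poly ?f x = 0}" unfolding roots using pow by auto
  have "card {x. poly ?f x = 0} \<le> ?p" using card_poly_roots_bound[OF f0] deg by simp
  also have "\<dots> = card ((of_nat :: nat \<Rightarrow> 'q) ` {..<?p})" using card_image[OF inj] by simp
  finally have "of_nat ` {..<?p} = {x. poly ?f x = 0}" using sub by (intro card_seteq) auto
  then have "z \<in> of_nat ` {..<?p}" using assms roots by simp
  then show ?thesis using that by auto
qed

text \<open>The solutions of \<open>z T = \<delta>\<^sub>j\<close> are unique, hence fixed by the Frobenius map and therefore
  in the prime field.\<close>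

lemma integer_inverse_mod_p:
  fixes T :: "'i \<Rightarrow> 'j \<Rightarrow> int" and qt :: "'q::finite_field itself"
  assumes fin: "finite A" "finite B"
    and surj: "\<And>y :: 'j \<Rightarrow> 'q. \<exists>z. \<forall>b\<in>B. (\<Sum>i\<in>A. z i * of_int (T i b)) = y b"
    and inj: "\<And>z :: 'i \<Rightarrow> 'q. (\<And>b. b \<in> B \<Longrightarrow> (\<Sum>i\<in>A. z i * of_int (T i b)) = 0) \<Longrightarrow> \<forall>i\<in>A. z i = 0"
  shows "\<exists>U. (\<forall>j\<in>B. \<forall>j'\<in>B. int CHAR('q) dvd (\<Sum>i\<in>A. U j i * T i j') - (if j = j' then 1 else 0)) \<and>
    (\<forall>i\<in>A. \<forall>i'\<in>A. int CHAR('q) dvd (\<Sum>j\<in>B. T i j * U j i') - (if i = i' then 1 else 0))"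
proof -
  let ?p = "CHAR('q)"
  have p: "prime ?p" by simp
  have p0: "?p > 0" by simp
  have Tp: "(of_int m :: 'q) ^ ?p = of_int m" for m :: int
  proof -
    have n: "(of_nat m :: 'q) ^ ?p = of_nat m" for m
      by (induction m) (use p p0 freshmans_dream[where ?'a = 'q] in \<open>auto simp: power_0_left\<close>)
    define m' where "m' = nat (m mod int ?p)"
    have "int m' = m mod int ?p" using p0 by (simp add: m'_def)
    then have "int ?p dvd m - int m'" by (simp add: mod_eq_dvd_iff[symmetric])
    then have "of_int (m - int m') = (0 :: 'q)" by (simp only: of_int_eq_0_iff_char_dvd)
    then have "(of_int m :: 'q) = of_nat m'" by simp
    then show ?thesis using n by simp
  qed
  have "\<exists>u :: 'i \<Rightarrow> int. \<forall>b\<in>B. (\<Sum>i\<in>A. of_int (u i) * of_int (T i b)) = (if j = b then 1 else 0 :: 'q)" for j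
  proof -
    obtain z :: "'i \<Rightarrow> 'q" where z: "\<And>b. b \<in> B \<Longrightarrow> (\<Sum>i\<in>A. z i * of_int (T i b)) = (if j = b then 1 else 0)"
      using surj[of "\<lambda>b. if j = b then 1 else 0"] by auto
    \<comment> \<open>The p-th power of the system has the same integer matrix and the same
      right-hand side of zeros and ones, so z^p - z solves the homogeneous system.\<close>
    have "(\<Sum>i\<in>A. (z i ^ ?p - z i) * of_int (T i b)) = 0" if b: "b \<in> B" for b
    proof -
      have "(\<Sum>i\<in>A. z i ^ ?p * of_int (T i b)) = (\<Sum>i\<in>A. z i * of_int (T i b)) ^ ?p"
        using p by (simp add: freshmans_dream_sum power_mult_distrib Tp)
      also have "\<dots> = (\<Sum>i\<in>A. z i * of_int (T i b))" using p0 by (simp add: z[OF b])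
      finally show ?thesis by (simp add: left_diff_distrib sum_subtractf)
    qed
    then have "\<forall>i\<in>A. z i ^ ?p - z i = 0" by (rule inj)
    then have "\<exists>m :: nat. z i = of_nat m" if "i \<in> A" for i
      using frobenius_fixed_prime_field[of "z i"] that by (metis eq_iff_diff_eq_0)
    then obtain u :: "'i \<Rightarrow> nat" where u: "\<And>i. i \<in> A \<Longrightarrow> z i = of_nat (u i)" by metis
    show ?thesis by (rule exI[of _ "\<lambda>i. int (u i)"]) (use z u in simp)
  qed
  then obtain U :: "'j \<Rightarrow> 'i \<Rightarrow> int" where
    U: "\<And>j b. b \<in> B \<Longrightarrow> (\<Sum>i\<in>A. of_int (U j i) * of_int (T i b)) = (if j = b then 1 else 0 :: 'q)"
    by metis
  have "int ?p dvd (\<Sum>i\<in>A. U j i * T i j') - (if j = j' then 1 else 0)" if "j \<in> B" "j' \<in> B" for j j'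
  proof -
    have "of_int ((\<Sum>i\<in>A. U j i * T i j') - (if j = j' then 1 else 0)) = (0 :: 'q)"
      using U[OF that(2), of j] by (simp add: of_int_sum)
    then show ?thesis by (simp only: of_int_eq_0_iff_char_dvd)
  qed
  moreover have "int ?p dvd (\<Sum>j\<in>B. T i j * U j i') - (if i = i' then 1 else 0)" if i: "i \<in> A" "i' \<in> A" for i i'
  proof -
    \<comment> \<open>As U T = 1, a row w of T U - 1 satisfies w T = T U T - T = 0 in that row, and
      injectivity gives w = 0.\<close>
    define w :: "'i \<Rightarrow> 'q" where "w i' = (\<Sum>j\<in>B. of_int (T i j) * of_int (U j i')) - (if i = i' then 1 else 0)" for i'
    have "(\<Sum>i'\<in>A. w i' * of_int (T i' b)) = 0" if b: "b \<in> B" for b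
    proof -
      have "(\<Sum>i'\<in>A. w i' * of_int (T i' b)) =
          (\<Sum>i'\<in>A. \<Sum>j\<in>B. of_int (T i j) * (of_int (U j i') * of_int (T i' b))) - (\<Sum>i'\<in>A. if i = i' then of_int (T i' b) else 0)"
        unfolding w_def left_diff_distrib sum_subtractf sum_distrib_right
        by (intro arg_cong2[of _ _ _ _ minus] sum.cong) (auto simp: mult.assoc)
      also have "(\<Sum>i'\<in>A. \<Sum>j\<in>B. of_int (T i j) * (of_int (U j i') * of_int (T i' b))) =
          (\<Sum>j\<in>B. of_int (T i j) * (\<Sum>i'\<in>A. of_int (U j i') * (of_int (T i' b) :: 'q)))"
        by (subst sum.swap) (simp add: sum_distrib_left)
      also have "\<dots> = (\<Sum>j\<in>B. if j = b then of_int (T i j) else 0)"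
        by (intro sum.cong) (auto simp: U[OF b])
      finally show ?thesis using fin i b by simp
    qed
    then have "w i' = 0" using inj i by blast
    then have "of_int ((\<Sum>j\<in>B. T i j * U j i') - (if i = i' then 1 else 0)) = (0 :: 'q)"
      by (simp add: w_def of_int_sum)
    then show ?thesis by (simp only: of_int_eq_0_iff_char_dvd)
  qed
  ultimately show ?thesis by (intro exI[of _ U] conjI ballI)
qed

text \<open>Over a field with q elements the vectors indexed by A number q^|A|. Dimensions are
  therefore compared by counting: a surjection of finite sets gives the inequality, and it is
  injective when the numbers agree.\<close>

lemma surjective_card_eq_injective:
  fixes T :: "'i \<Rightarrow> 'j \<Rightarrow> 'q::finite_field"
  assumes fin: "finite A" "finite B"
    and surj: "\<And>y :: 'j \<Rightarrow> 'q. \<exists>z. \<forall>b\<in>B. (\<Sum>i\<in>A. z i * T i b) = y b"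
  shows "card B \<le> card A"
    and "(\<And>z. (\<And>b. b \<in> B \<Longrightarrow> (\<Sum>i\<in>A. z i * T i b) = 0) \<Longrightarrow> \<forall>i\<in>A. z i = 0) \<Longrightarrow> card A \<le> card B"
    and "card A = card B \<Longrightarrow> (\<And>b. b \<in> B \<Longrightarrow> (\<Sum>i\<in>A. z i * T i b) = 0) \<Longrightarrow> \<forall>i\<in>A. z i = 0"
proof -
  define F where "F z = restrict (\<lambda>b. \<Sum>i\<in>A. z i * T i b) B" for z :: "'i \<Rightarrow> 'q"
  let ?V = "A \<rightarrow>\<^sub>E (UNIV :: 'q set)" and ?W = "B \<rightarrow>\<^sub>E (UNIV :: 'q set)"
  have Fr: "F (restrict z A) = F z" for z by (auto simp: F_def cong: restrict_cong)
  have im: "F ` ?V = ?W"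
  proof
    show "?W \<subseteq> F ` ?V"
    proof
      fix y assume y: "y \<in> ?W"
      obtain z where "\<forall>b\<in>B. (\<Sum>i\<in>A. z i * T i b) = y b" using surj by blast
      then have "F (restrict z A) = y" unfolding Fr unfolding F_def using y
        by (auto simp: fun_eq_iff PiE_def extensional_def)
      moreover have "restrict z A \<in> ?V" by auto
      ultimately show "y \<in> F ` ?V" by blast
    qed
  qed (auto simp: F_def)
  have finV: "finite ?V" using fin by (intro finite_PiE) auto
  let ?q = "card (UNIV :: 'q set)"
  have "card {0 :: 'q, 1} \<le> ?q" by (rule card_mono) auto
  then have q: "?q > 1" by simp
  have "?q ^ card B \<le> ?q ^ card A"
    using card_image_le[OF finV, of F] fin unfolding im by (simp add: card_funcsetE)
  then show "card B \<le> card A" using q by simp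
  show "card A \<le> card B" if inj: "\<And>z. (\<And>b. b \<in> B \<Longrightarrow> (\<Sum>i\<in>A. z i * T i b) = 0) \<Longrightarrow> \<forall>i\<in>A. z i = 0"
  proof -
    have "inj_on F ?V"
    proof (rule inj_onI)
      fix x y assume xy: "x \<in> ?V" "y \<in> ?V" "F x = F y"
      have "(\<Sum>i\<in>A. (x i - y i) * T i b) = 0" if "b \<in> B" for b
        using fun_cong[OF xy(3), of b] that by (simp add: F_def left_diff_distrib sum_subtractf)
      then have "\<forall>i\<in>A. x i - y i = 0" by (rule inj)
      then show "x = y" using xy by (intro PiE_ext[of x A "\<lambda>_. UNIV" y]) auto
    qed
    then have "card ?V = card ?W" using card_image im by metis
    then have "?q ^ card A = ?q ^ card B" using fin by (simp add: card_funcsetE)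
    then show ?thesis using q by simp
  qed
  assume c: "card A = card B" and z: "\<And>b. b \<in> B \<Longrightarrow> (\<Sum>i\<in>A. z i * T i b) = 0"
  have "inj_on F ?V" using finV fin c by (intro eq_card_imp_inj_on) (simp_all add: im card_funcsetE)
  moreover have "F (restrict z A) = F (restrict (\<lambda>_. 0) A)"
    unfolding Fr unfolding F_def using z by (auto cong: restrict_cong)
  ultimately have "restrict z A = restrict (\<lambda>_. 0) A" by (auto simp: inj_on_def)
  then show "\<forall>i\<in>A. z i = 0" by (auto simp: fun_eq_iff split: if_splits)
qed

lemma finite_index_weight_le:
  assumes "i \<in> sym_index n k"
  shows "index_weight n i \<le> n * k"
proof -
  have "index_weight n i \<le> (\<Sum>j\<le>n. n * i j)"
    unfolding index_weight_def by (intro sum_mono mult_right_mono) auto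
  also have "\<dots> = n * k" using assms by (simp add: sym_index_def sum_distrib_left[symmetric])
  finally show ?thesis .
qed

lemma card_sym_index: "card (sym_index n k) = (n + k) choose n"
proof -
  have "bij_betw (\<lambda>i. map i [0..<Suc n]) (sym_index n k) {l. length l = Suc n \<and> sum_list l = k}"
  proof (rule bij_betw_byWitness[of _ "\<lambda>l j. if j \<le> n then l ! j else 0"])
    show "\<forall>i\<in>sym_index n k. (\<lambda>j. if j \<le> n then map i [0..<Suc n] ! j else 0) = i"
      by (auto simp: sym_index_def fun_eq_iff nth_append simp del: upt_Suc)
    show "\<forall>l\<in>{l. length l = Suc n \<and> sum_list l = k}. map (\<lambda>j. if j \<le> n then l ! j else 0) [0..<Suc n] = l"
      by (auto intro!: nth_equalityI simp del: upt_Suc)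
    show "(\<lambda>i. map i [0..<Suc n]) ` sym_index n k \<subseteq> {l. length l = Suc n \<and> sum_list l = k}"
      by (auto simp: sym_index_def interv_sum_list_conv_sum_set_nat atLeast0LessThan lessThan_Suc_atMost simp del: upt_Suc)
    show "(\<lambda>l j. if j \<le> n then l ! j else 0) ` {l. length l = Suc n \<and> sum_list l = k} \<subseteq> sym_index n k"
      by (auto simp: sym_index_def sum_list_sum_nth atLeast0LessThan lessThan_Suc_atMost)
  qed
  then have "card (sym_index n k) = (k + Suc n - 1) choose k"
    by (simp add: bij_betw_same_card card_length_sum_list)
  then show ?thesis using binomial_symmetric[of n "n + k"] by (simp add: add.commute)
qed

section \<open>The homogeneous pieces of \<nabla> together with B_k\<close>

text \<open>Indices of the source of (\<eta>, c) |-> \<nabla> \<eta> + sum of c_i e^i: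
  \<open>Inl\<close> for \<eta> and \<open>Inr\<close> for c. The degree on the \<open>Inl\<close>
  side is raised by one so that the map preserves degrees.\<close>

definition src_deg :: "nat \<Rightarrow> (nat \<Rightarrow> nat) \<times> nat + (nat \<Rightarrow> nat) \<Rightarrow> nat" where
  "src_deg n s = (case s of Inl a \<Rightarrow> Suc (ix_deg n a) | Inr i \<Rightarrow> index_weight n i)"

definition src_mat :: "nat \<Rightarrow> (nat \<Rightarrow> nat) \<times> nat + (nat \<Rightarrow> nat) \<Rightarrow> (nat \<Rightarrow> nat) \<times> nat \<Rightarrow> int" where
  "src_mat n s b = (case s of Inl a \<Rightarrow> conn_mat n a b | Inr i \<Rightarrow> if b = (i, 0) then 1 else 0)"

lemma src_simps [simp]:
  "src_deg n (Inl a) = Suc (ix_deg n a)" "src_deg n (Inr i) = index_weight n i"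
  "src_mat n (Inl a) b = conn_mat n a b" "src_mat n (Inr i) b = (if b = (i, 0) then 1 else 0)"
  by (simp_all add: src_deg_def src_mat_def)

locale reduction_basis = reduction n k qt for n k and qt :: "'q::finite_field itself" +
  fixes B :: "(nat \<Rightarrow> nat) set" and p a :: nat
  assumes reduced_basis: "reduced_basis_set qt n k B"
    and p: "prime p" and card_q: "card (UNIV :: 'q set) = p ^ a"
begin

abbreviation "src N \<equiv> {s \<in> (I \<times> UNIV) <+> B. src_deg n s = N}"
abbreviation "tgt N \<equiv> {b \<in> I \<times> UNIV. ix_deg n b = N}"

lemma B_sub: "B \<subseteq> I"
  using reduced_basis by (simp add: reduced_basis_set_def Let_def)

lemma finite_B: "finite B"
  using B_sub finite_sym_index finite_subset by blast

lemma src_eq: "src N = {a \<in> I \<times> UNIV. Suc (ix_deg n a) = N} <+> {i \<in> B. index_weight n i = N}"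
  by auto

lemma finite_src1: "finite {a \<in> I \<times> UNIV. Suc (ix_deg n a) = N}"
  by (rule finite_subset[OF _ finite_ix[of n k "N - 1"]]) auto

lemma finite_src: "finite (src N)"
  unfolding src_eq using finite_src1 finite_B by (intro finite_Plus) auto

lemma sum_src:
  "(\<Sum>s\<in>src N. z s * of_int (src_mat n s b)) =
    (\<Sum>a | a \<in> I \<times> UNIV \<and> Suc (ix_deg n a) = N. z (Inl a) * of_int (conn_mat n a b)) +
    (\<Sum>i | i \<in> B \<and> index_weight n i = N. if b = (i, 0) then z (Inr i) else (0 :: 'r::comm_ring_1))"
  unfolding src_eq using finite_src1 finite_B
  by (subst sum.Plus) (auto intro!: arg_cong2[of _ _ _ _ "(+)"] sum.cong)

definition elt :: "nat \<Rightarrow> ((nat \<Rightarrow> nat) \<times> nat \<Rightarrow> 'q) \<Rightarrow> ((nat \<Rightarrow> 'q poly) multiset \<Rightarrow> 'q poly) set" where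
  "elt N f = (\<Oplus>\<^bsub>SB.P\<^esub>i\<in>I. (\<Sum>r | ix_deg n (i, r) = N. monom (f (i, r)) r) \<odot>\<^bsub>SB.P\<^esub> SB.smon i)"

lemma elt_closed: "elt N f \<in> carrier Sb"
  unfolding elt_def Sb_eq by (intro SB.SP.lincomb_closed) simp

lemma elt_coeff:
  assumes "i \<in> I"
  shows "coeff (SB.SP.co (elt N f) i) r = (if ix_deg n (i, r) = N then f (i, r) else 0)"
proof -
  have "finite {r. ix_deg n (i, r) = N}"
    by (rule finite_subset[of _ "{..N}"]) (auto simp: ix_deg_def)
  moreover have "SB.SP.co (elt N f) i = (\<Sum>r | ix_deg n (i, r) = N. monom (f (i, r)) r)"
    unfolding elt_def using assms by (intro SB.SP.coords_lincomb) auto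
  ultimately show ?thesis by (simp add: coeff_sum sum.delta)
qed

lemma smult_const_closed: "i \<in> I \<Longrightarrow> [:c:] \<odot>\<^bsub>SB.P\<^esub> SB.smon i \<in> carrier SB.P"
  using SB.SP.basis_closed by simp

lemma nab_linear:
  assumes "x \<in> carrier Sb" "y \<in> carrier Sb"
  shows "nab (x \<oplus>\<^bsub>SB.P\<^esub> y) = nab x \<oplus>\<^bsub>SB.P\<^esub> nab y" and "nab ([:c:] \<odot>\<^bsub>SB.P\<^esub> x) = [:c:] \<odot>\<^bsub>SB.P\<^esub> nab x"
proof -
  have c: "x \<in> carrier SB.P" "y \<in> carrier SB.P" using assms by (simp_all add: Sb_eq)
  have n: "nab x \<in> carrier SB.P" "nab y \<in> carrier SB.P" using assms nab_closed by (simp_all add: Sb_eq)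
  have s: "x \<oplus>\<^bsub>SB.P\<^esub> y \<in> carrier Sb" "[:c:] \<odot>\<^bsub>SB.P\<^esub> x \<in> carrier Sb"
    using c SB.P.smult_closed[of "[:c:]" x] by (simp_all add: Sb_eq)
  have nc: "nab (x \<oplus>\<^bsub>SB.P\<^esub> y) \<in> carrier SB.P" "nab ([:c:] \<odot>\<^bsub>SB.P\<^esub> x) \<in> carrier SB.P"
    using nab_closed[OF s(1)] nab_closed[OF s(2)] by (simp_all only: Sb_eq)
  show "nab (x \<oplus>\<^bsub>SB.P\<^esub> y) = nab x \<oplus>\<^bsub>SB.P\<^esub> nab y"
  proof (rule SB.SP.coords_inj)
    fix i assume i: "i \<in> I"
    show "SB.SP.co (nab (x \<oplus>\<^bsub>SB.P\<^esub> y)) i = SB.SP.co (nab x \<oplus>\<^bsub>SB.P\<^esub> nab y) i"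
    proof (rule poly_eqI)
      fix r
      have "coeff (SB.SP.co (nab (x \<oplus>\<^bsub>SB.P\<^esub> y)) i) r =
        (\<Sum>a | a \<in> I \<times> UNIV \<and> Suc (ix_deg n a) = ix_deg n (i, r).
          coeff (SB.SP.co x (fst a) + SB.SP.co y (fst a)) (snd a) * of_int (conn_mat n a (i, r)))"
        unfolding nab_coeff[OF s(1) i] using c by (intro sum.cong) (auto simp: SB.SP.coords_add)
      then show "coeff (SB.SP.co (nab (x \<oplus>\<^bsub>SB.P\<^esub> y)) i) r = coeff (SB.SP.co (nab x \<oplus>\<^bsub>SB.P\<^esub> nab y) i) r"
        using n i assms by (simp add: SB.SP.coords_add nab_coeff sum.distrib distrib_right)
    qed
  qed (use nc n in simp_all)
  have n2: "[:c:] \<odot>\<^bsub>SB.P\<^esub> nab x \<in> carrier SB.P" using n SB.P.smult_closed[of "[:c:]"] by simp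
  show "nab ([:c:] \<odot>\<^bsub>SB.P\<^esub> x) = [:c:] \<odot>\<^bsub>SB.P\<^esub> nab x"
  proof (rule SB.SP.coords_inj)
    fix i assume i: "i \<in> I"
    show "SB.SP.co (nab ([:c:] \<odot>\<^bsub>SB.P\<^esub> x)) i = SB.SP.co ([:c:] \<odot>\<^bsub>SB.P\<^esub> nab x) i"
    proof (rule poly_eqI)
      fix r
      have "coeff (SB.SP.co (nab ([:c:] \<odot>\<^bsub>SB.P\<^esub> x)) i) r =
        (\<Sum>a | a \<in> I \<times> UNIV \<and> Suc (ix_deg n a) = ix_deg n (i, r).
          c * (coeff (SB.SP.co x (fst a)) (snd a) * of_int (conn_mat n a (i, r))))"
        unfolding nab_coeff[OF s(2) i] using c by (intro sum.cong) (auto simp: SB.SP.coords_smult)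
      then show "coeff (SB.SP.co (nab ([:c:] \<odot>\<^bsub>SB.P\<^esub> x)) i) r = coeff (SB.SP.co ([:c:] \<odot>\<^bsub>SB.P\<^esub> nab x) i) r"
        using n i assms by (simp add: SB.SP.coords_smult nab_coeff sum_distrib_left)
    qed
  qed (use nc n2 in simp_all)
qed

text \<open>Comparing the coefficients of all t^r e^i turns the equation into scalar equations, each
  of which involves only the sources of one degree.\<close>

lemma decomposition_iff:
  assumes x: "x \<in> carrier Sb" and y: "y \<in> carrier Sb"
  shows "x \<ominus>\<^bsub>SB.P\<^esub> (\<Oplus>\<^bsub>SB.P\<^esub>i\<in>B. [:c i:] \<odot>\<^bsub>SB.P\<^esub> SB.smon i) = nab y \<longleftrightarrow>
    (\<forall>b\<in>I \<times> UNIV. coeff (SB.SP.co x (fst b)) (snd b) =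
      (\<Sum>a | a \<in> I \<times> UNIV \<and> Suc (ix_deg n a) = ix_deg n b. coeff (SB.SP.co y (fst a)) (snd a) * of_int (conn_mat n a b)) +
      (\<Sum>i\<in>B. if b = (i, 0) then c i else 0))"
proof -
  let ?L = "\<Oplus>\<^bsub>SB.P\<^esub>i\<in>B. [:c i:] \<odot>\<^bsub>SB.P\<^esub> SB.smon i"
  have t: "[:c i:] \<odot>\<^bsub>SB.P\<^esub> SB.smon i \<in> carrier SB.P" if "i \<in> B" for i
    using that B_sub smult_const_closed by blast
  then have L: "?L \<in> carrier SB.P" by (intro SB.P.M.finsum_closed) auto
  have Lc: "SB.SP.co ?L i = (\<Sum>i'\<in>B. if i = i' then [:c i':] else 0)" if i: "i \<in> I" for i
  proof -
    have "SB.SP.co ?L i = (\<Sum>i'\<in>B. SB.SP.co ([:c i':] \<odot>\<^bsub>SB.P\<^esub> SB.smon i') i)"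
      using SB.SP.coords_finsum[OF finite_B t i] by (simp add: SB.finsum_RS finite_B)
    also have "\<dots> = (\<Sum>i'\<in>B. if i = i' then [:c i':] else 0)"
      using B_sub i by (intro sum.cong refl) (subst SB.SP.coords_smult, auto simp: SB.SP.coords_basis)
    finally show ?thesis .
  qed
  have Lr: "coeff (SB.SP.co ?L i) r = (\<Sum>i'\<in>B. if (i, r) = (i', 0) then c i' else 0)" if i: "i \<in> I" for i r
    unfolding Lc[OF i] coeff_sum by (intro sum.cong refl) (auto simp: coeff_pCons split: nat.split)
  have xy: "x \<in> carrier SB.P" "nab y \<in> carrier SB.P" using x y nab_closed by (simp_all add: Sb_eq)
  have "x \<ominus>\<^bsub>SB.P\<^esub> ?L = nab y \<longleftrightarrow> x = nab y \<oplus>\<^bsub>SB.P\<^esub> ?L"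
    using SB.P.M.minus_eq_iff_add[OF xy L] .
  also have "\<dots> \<longleftrightarrow> (\<forall>i\<in>I. SB.SP.co x i = SB.SP.co (nab y \<oplus>\<^bsub>SB.P\<^esub> ?L) i)"
    using xy L SB.SP.coords_inj[of x "nab y \<oplus>\<^bsub>SB.P\<^esub> ?L"] by auto
  also have "\<dots> \<longleftrightarrow> (\<forall>i\<in>I. \<forall>r. coeff (SB.SP.co x i) r = coeff (SB.SP.co (nab y) i) r + coeff (SB.SP.co ?L i) r)"
    using xy L by (simp add: SB.SP.coords_add poly_eq_iff)
  also have "\<dots> \<longleftrightarrow> (\<forall>i\<in>I. \<forall>r. coeff (SB.SP.co x i) r =
      (\<Sum>a | a \<in> I \<times> UNIV \<and> Suc (ix_deg n a) = ix_deg n (i, r). coeff (SB.SP.co y (fst a)) (snd a) * of_int (conn_mat n a (i, r))) +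
      (\<Sum>i'\<in>B. if (i, r) = (i', 0) then c i' else 0))"
    by (simp only: Lr nab_coeff[OF y] cong: ball_cong)
  finally show ?thesis by auto
qed

lemma unique_decomposition:
  assumes x: "x \<in> carrier Sb"
  shows "\<exists>!c. c \<in> B \<rightarrow>\<^sub>E UNIV \<and> (\<exists>y\<in>carrier Sb. x \<ominus>\<^bsub>SB.P\<^esub> (\<Oplus>\<^bsub>SB.P\<^esub>i\<in>B. [:c i:] \<odot>\<^bsub>SB.P\<^esub> SB.smon i) = nab y)"
proof -
  let ?S = "restrict_scalars (\<lambda>c::'q. [:c:]) SB.P"
  let ?N = "nab ` carrier SB.P"
  interpret sm: scalar_map "UNIV :: 'q set" "UNIV :: 'q poly set" "\<lambda>c. [:c:]"
    by (intro scalar_map.intro type_subring_UNIV) (unfold_locales, auto simp: one_pCons)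
  have "submodule ?N sm.A.RS ?S"
    using nab_linear nab_closed by (intro sm.submodule_image SB.P.module_axioms) (auto simp: Sb_eq)
  then have N: "submodule ?N ring_of_type_algebra ?S" by (simp only: rta_UNIV)
  have "module sm.A.RS ?S" by (rule sm.module_restrict_scalars[OF SB.P.module_axioms])
  then interpret q: quot_mod ring_of_type_algebra ?S ?N
    using N by (simp add: quot_mod_def quot_mod_axioms_def rta_UNIV)
  have "free_with_basis ring_of_type_algebra q.Q B (\<lambda>i. ?N +>\<^bsub>?S\<^esub> SB.smon i)"
    using reduced_basis by (simp add: reduced_basis_set_def Let_def Sb_eq rta_UNIV)
  moreover have "SB.smon i \<in> carrier ?S" if "i \<in> B" for i using that B_sub SB.SP.basis_closed by auto
  ultimately have "\<forall>x\<in>carrier ?S. \<exists>!c. c \<in> B \<rightarrow>\<^sub>E carrier ring_of_type_algebra \<and>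
      x \<ominus>\<^bsub>?S\<^esub> (\<Oplus>\<^bsub>?S\<^esub>i\<in>B. c i \<odot>\<^bsub>?S\<^esub> SB.smon i) \<in> ?N"
    using q.quot_free_iff[OF finite_B, of SB.smon] by blast
  then have "\<exists>!c. c \<in> B \<rightarrow>\<^sub>E UNIV \<and> x \<ominus>\<^bsub>SB.P\<^esub> (\<Oplus>\<^bsub>SB.P\<^esub>i\<in>B. [:c i:] \<odot>\<^bsub>SB.P\<^esub> SB.smon i) \<in> ?N"
    using x unfolding restrict_scalars_minus restrict_scalars_cong(1) restrict_scalars_simps Sb_eq
    by (simp add: ring_of_type_algebra_def)
  then show ?thesis unfolding image_iff by (simp only: Sb_eq)
qed

lemma decomposition_unique:
  assumes x: "x \<in> carrier Sb" and c: "c \<in> B \<rightarrow>\<^sub>E UNIV" "d \<in> B \<rightarrow>\<^sub>E UNIV" and y: "y \<in> carrier Sb" "y' \<in> carrier Sb"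
    and eq: "x \<ominus>\<^bsub>SB.P\<^esub> (\<Oplus>\<^bsub>SB.P\<^esub>i\<in>B. [:c i:] \<odot>\<^bsub>SB.P\<^esub> SB.smon i) = nab y"
      "x \<ominus>\<^bsub>SB.P\<^esub> (\<Oplus>\<^bsub>SB.P\<^esub>i\<in>B. [:d i:] \<odot>\<^bsub>SB.P\<^esub> SB.smon i) = nab y'"
  shows "c = d"
proof -
  let ?R = "\<lambda>c. c \<in> B \<rightarrow>\<^sub>E UNIV \<and> (\<exists>y\<in>carrier Sb. x \<ominus>\<^bsub>SB.P\<^esub> (\<Oplus>\<^bsub>SB.P\<^esub>i\<in>B. [:c i:] \<odot>\<^bsub>SB.P\<^esub> SB.smon i) = nab y)"
  have "?R c" by (intro conjI c bexI[of _ y] eq y)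
  moreover have "?R d" by (intro conjI c bexI[of _ y'] eq y)
  ultimately show ?thesis using unique_decomposition[OF x] by (elim ex1E) (rule trans[OF _ sym], blast+)
qed

lemma sum_B_homogeneous:
  assumes "ix_deg n b = N"
  shows "(\<Sum>i | i \<in> B \<and> index_weight n i = N. if b = (i, 0) then c i else 0) = (\<Sum>i\<in>B. if b = (i, 0) then c i else (0 :: 'r::comm_ring_1))"
  using assms finite_B by (intro sum.mono_neutral_left) (auto simp: ix_deg_def)

text \<open>The homogeneous element with coefficients \<open>y\<close> is decomposed by the basis
  property; its equations at indices of degree N see only the sources of degree N.\<close>

lemma src_surj:
  fixes y :: "(nat \<Rightarrow> nat) \<times> nat \<Rightarrow> 'q"
  shows "\<exists>z. \<forall>b\<in>tgt N. (\<Sum>s\<in>src N. z s * of_int (src_mat n s b)) = y b"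
proof -
  obtain c x where x: "x \<in> carrier Sb"
    and e: "elt N y \<ominus>\<^bsub>SB.P\<^esub> (\<Oplus>\<^bsub>SB.P\<^esub>i\<in>B. [:c i:] \<odot>\<^bsub>SB.P\<^esub> SB.smon i) = nab x"
    using unique_decomposition[OF elt_closed] by blast
  let ?z = "case_sum (\<lambda>a. coeff (SB.SP.co x (fst a)) (snd a)) c"
  have "(\<Sum>s\<in>src N. ?z s * of_int (src_mat n s b)) = y b" if b: "b \<in> tgt N" for b
  proof -
    have "coeff (SB.SP.co (elt N y) (fst b)) (snd b) = (\<Sum>s\<in>src N. ?z s * of_int (src_mat n s b))"
      using e[unfolded decomposition_iff[OF elt_closed x], rule_format, of b] b
      unfolding sum_src by (simp add: sum_B_homogeneous cong: if_cong)
    moreover have "coeff (SB.SP.co (elt N y) (fst b)) (snd b) = y b"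
      using b elt_coeff[of "fst b" N y "snd b"] by auto
    ultimately show ?thesis by simp
  qed
  then show ?thesis by blast
qed

text \<open>Uniqueness of the coordinates at B, applied to zero and its trivial decomposition. It
  says nothing about the \<open>Inl\<close> part, since B is a basis of the quotient by the image of
  \<nabla>, in which the kernel of \<nabla> is invisible.\<close>

lemma src_Inr_zero:
  fixes z :: "_ \<Rightarrow> 'q"
  assumes z: "\<And>b. b \<in> tgt N \<Longrightarrow> (\<Sum>s\<in>src N. z s * of_int (src_mat n s b)) = 0"
    and i: "i \<in> B" "index_weight n i = N"
  shows "z (Inr i) = 0"
proof -
  let ?c = "restrict (\<lambda>i. if index_weight n i = N then z (Inr i) else 0) B"
  let ?d = "restrict (\<lambda>i. 0 :: 'q) B"
  \<comment> \<open>For N = 0 there are no sources of type \<open>Inl\<close>, but N - 1 is then 0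
    as well; the coefficients are therefore set to zero.\<close>
  let ?x = "elt (N - 1) (\<lambda>a. if N = 0 then 0 else z (Inl a))"
  have z0: "coeff (SB.SP.co \<zero>\<^bsub>SB.P\<^esub> i) r = 0" if "i \<in> I" for i r
    using SB.SP.coords_zero[OF that] by simp
  have zc: "\<zero>\<^bsub>SB.P\<^esub> \<in> carrier Sb" using SB.P.M.zero_closed by (simp add: Sb_eq)
  have "\<zero>\<^bsub>SB.P\<^esub> \<ominus>\<^bsub>SB.P\<^esub> (\<Oplus>\<^bsub>SB.P\<^esub>i\<in>B. [:?c i:] \<odot>\<^bsub>SB.P\<^esub> SB.smon i) = nab ?x"
    unfolding decomposition_iff[OF zc elt_closed]
  proof
    fix b assume b: "b \<in> I \<times> (UNIV :: nat set)"
    have 1: "(\<Sum>a | a \<in> I \<times> UNIV \<and> Suc (ix_deg n a) = ix_deg n b. coeff (SB.SP.co ?x (fst a)) (snd a) * of_int (conn_mat n a b)) =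
       (if ix_deg n b = N then \<Sum>a | a \<in> I \<times> UNIV \<and> Suc (ix_deg n a) = N. z (Inl a) * of_int (conn_mat n a b) else 0)"
    proof (cases "ix_deg n b = N")
      case True
      then show ?thesis by (auto intro!: sum.cong simp: elt_coeff)
    next
      case False
      then show ?thesis by (auto intro!: sum.neutral simp: elt_coeff)
    qed
    have 2: "(\<Sum>i\<in>B. if b = (i, 0) then ?c i else 0) =
       (if ix_deg n b = N then \<Sum>i\<in>B. if b = (i, 0) then z (Inr i) else 0 else 0)"
    proof (cases "ix_deg n b = N")
      case True
      have "(\<Sum>i\<in>B. if b = (i, 0) then ?c i else 0) = (\<Sum>i\<in>B. if b = (i, 0) then z (Inr i) else 0)"
      proof (rule sum.cong[OF refl])
        fix i assume "i \<in> B"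
        moreover have "index_weight n i = N" if "b = (i, 0)" using True that by (simp add: ix_deg_def)
        ultimately show "(if b = (i, 0) then ?c i else 0) = (if b = (i, 0) then z (Inr i) else 0)" by simp
      qed
      then show ?thesis using True by simp
    next
      case False
      then show ?thesis by (auto intro!: sum.neutral simp: ix_deg_def)
    qed
    show "coeff (SB.SP.co \<zero>\<^bsub>SB.P\<^esub> (fst b)) (snd b) =
      (\<Sum>a | a \<in> I \<times> UNIV \<and> Suc (ix_deg n a) = ix_deg n b. coeff (SB.SP.co ?x (fst a)) (snd a) * of_int (conn_mat n a b)) +
      (\<Sum>i\<in>B. if b = (i, 0) then ?c i else 0)"
    proof (cases "ix_deg n b = N")
      case True
      then show ?thesis using b z0[of "fst b" "snd b"] z[of b] unfolding 1 2 sum_src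
        by (simp add: sum_B_homogeneous mem_Times_iff)
    next
      case False
      then show ?thesis unfolding 1 2 using b z0[of "fst b" "snd b"] by (simp add: mem_Times_iff)
    qed
  qed
  moreover have "\<zero>\<^bsub>SB.P\<^esub> \<ominus>\<^bsub>SB.P\<^esub> (\<Oplus>\<^bsub>SB.P\<^esub>i\<in>B. [:?d i:] \<odot>\<^bsub>SB.P\<^esub> SB.smon i) = nab \<zero>\<^bsub>SB.P\<^esub>"
    unfolding decomposition_iff[OF zc zc]
  proof
    fix b assume b: "b \<in> I \<times> (UNIV :: nat set)"
    have s1: "(\<Sum>a | a \<in> I \<times> UNIV \<and> Suc (ix_deg n a) = ix_deg n b. coeff (SB.SP.co \<zero>\<^bsub>SB.P\<^esub> (fst a)) (snd a) * of_int (conn_mat n a b)) = 0"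
      by (rule sum.neutral) (auto simp: z0)
    have s2: "(\<Sum>i\<in>B. if b = (i, 0) then ?d i else 0) = 0" by (rule sum.neutral) auto
    show "coeff (SB.SP.co \<zero>\<^bsub>SB.P\<^esub> (fst b)) (snd b) =
      (\<Sum>a | a \<in> I \<times> UNIV \<and> Suc (ix_deg n a) = ix_deg n b. coeff (SB.SP.co \<zero>\<^bsub>SB.P\<^esub> (fst a)) (snd a) * of_int (conn_mat n a b)) +
      (\<Sum>i\<in>B. if b = (i, 0) then ?d i else 0)"
      unfolding s1 s2 using z0[of "fst b" "snd b"] b by (simp add: mem_Times_iff)
  qed
  ultimately have "?c = ?d"
    using zc by (intro decomposition_unique[OF zc _ _ elt_closed zc]) simp_all
  from fun_cong[OF this, of i] show ?thesis using i by simp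
qed

lemma card_src: "card (src (Suc N)) = card (tgt N) + card {i \<in> B. index_weight n i = Suc N}"
  "card (src 0) = card {i \<in> B. index_weight n i = 0}"
  unfolding src_eq using finite_ix[of n k N] finite_B by (simp_all add: card_Plus)

lemma weight_B: "i \<in> B \<Longrightarrow> index_weight n i \<le> n * k"
  using B_sub finite_index_weight_le by blast

lemma card_tgt_le: "card (tgt N) \<le> card (src N)"
  by (rule surjective_card_eq_injective(1)[OF finite_src finite_ix src_surj])

text \<open>No element of B has weight above n k, so beyond this degree the source consists of
  pieces of the symmetric power alone.\<close>

lemma card_src_large:
  assumes "n * k \<le> N"
  shows "card (src (Suc N)) = card (tgt N)"
proof -
  have "{i \<in> B. index_weight n i = Suc N} = {}" using weight_B assms by fastforce
  then show ?thesis unfolding card_src by (simp only: card.empty add_0_right)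
qed

lemma card_tgt_shift: "card (tgt N) \<le> card (tgt (N + (n + 1)))"
  by (rule card_inj_on_le[of "\<lambda>b. (fst b, snd b + 1)", OF _ _ finite_ix]) (auto simp: inj_on_def ix_deg_def)

lemma card_tgt_antimono: "n * k \<le> N \<Longrightarrow> card (tgt (N + m)) \<le> card (tgt N)"
proof (induction m)
  case (Suc m)
  then show ?case using card_tgt_le[of "Suc (N + m)"] card_src_large[of "N + m"] by simp
qed simp

text \<open>Surjectivity makes the sizes of the pieces nonincreasing from degree n k on, while
  multiplication by t embeds the piece of degree N into that of degree N + n + 1. Hence the sizes
  are constant.\<close>

lemma card_tgt_const: "n * k \<le> N \<Longrightarrow> card (tgt (Suc N)) = card (tgt N)"
  using card_tgt_shift[of N] card_tgt_antimono[of "Suc N" n] card_tgt_antimono[of N 1] by simp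

text \<open>Source and target have equal size here, so surjectivity entails injectivity.\<close>

lemma src_inj_large:
  fixes z :: "_ \<Rightarrow> 'q"
  assumes "n * k < N" and z: "\<And>b. b \<in> tgt N \<Longrightarrow> (\<Sum>s\<in>src N. z s * of_int (src_mat n s b)) = 0"
  shows "\<forall>s\<in>src N. z s = 0"
proof -
  obtain N' where N: "N = Suc N'" "n * k \<le> N'" using assms(1) by (cases N) auto
  have "card (src N) = card (tgt N)" unfolding N(1) using N(2) by (simp only: card_src_large card_tgt_const)
  from surjective_card_eq_injective(3)[OF finite_src finite_ix src_surj this z] show ?thesis .
qed

lemma conn_mat_shift: "conn_mat n (i, r + m) (i', s + m) = conn_mat n (i, r) (i', s)"
  unfolding conn_mat_def fst_conv snd_conv by simp

text \<open>For small degrees multiply by a power of \<open>t\<close>.\<close>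

lemma src_inj:
  fixes z :: "_ \<Rightarrow> 'q"
  assumes z: "\<And>b. b \<in> tgt N \<Longrightarrow> (\<Sum>s\<in>src N. z s * of_int (src_mat n s b)) = 0"
  shows "\<forall>s\<in>src N. z s = 0"
proof -
  define m where "m = n * k + 1"
  define N' where "N' = N + (n + 1) * m"
  have "m \<le> (n + 1) * m" by simp
  then have N': "n * k < N'" unfolding N'_def m_def by linarith
  \<comment> \<open>The vector z multiplied by t^m, with the part at B dropped; that part of z
    vanishes by \<open>src_Inr_zero\<close>. The exponent m brings the degree above n k.\<close>
  define z' :: "(nat \<Rightarrow> nat) \<times> nat + (nat \<Rightarrow> nat) \<Rightarrow> 'q" where "z' s = (case s of Inl a \<Rightarrow> if m \<le> snd a then z (Inl (fst a, snd a - m)) else 0 | Inr i \<Rightarrow> 0)" for s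
  have z1: "z (Inr i) = 0" if "i \<in> B" "index_weight n i = N" for i
    using src_Inr_zero[OF z that] .
  have z2: "(\<Sum>a | a \<in> I \<times> UNIV \<and> Suc (ix_deg n a) = N. z (Inl a) * of_int (conn_mat n a b)) = 0" if "b \<in> tgt N" for b
  proof -
    have "(\<Sum>i | i \<in> B \<and> index_weight n i = N. if b = (i, 0) then z (Inr i) else 0) = 0"
      by (rule sum.neutral) (use z1 in auto)
    then show ?thesis using z[OF that] unfolding sum_src by simp
  qed
  have "(\<Sum>s\<in>src N'. z' s * of_int (src_mat n s b)) = 0" if b: "b \<in> tgt N'" for b
  proof -
    have zr: "(\<Sum>i | i \<in> B \<and> index_weight n i = N'. if b = (i, 0) then z' (Inr i) else 0) = 0"
      by (rule sum.neutral) (simp add: z'_def)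
    have "(\<Sum>a | a \<in> I \<times> UNIV \<and> Suc (ix_deg n a) = N'. z' (Inl a) * of_int (conn_mat n a b)) = 0"
    proof (cases "m \<le> snd b")
      case False
      have "z' (Inl a) * of_int (conn_mat n a b) = 0" for a
      proof (cases "m \<le> snd a")
        case True
        then have "\<not> snd a \<le> snd b" using False by simp
        then have "conn_mat n a b = 0" using conn_mat_snd by blast
        then show ?thesis by simp
      qed (simp add: z'_def)
      then show ?thesis by (intro sum.neutral) simp
    next
      case True
      define b' where "b' = (fst b, snd b - m)"
      obtain r where rm: "snd b = r + m" using True le_add_diff_inverse2 by metis
      have b': "b' \<in> tgt N" "b = (fst b', snd b' + m)" using b
        by (auto simp: b'_def ix_deg_def N'_def rm algebra_simps prod_eq_iff)
      let ?sh = "\<lambda>a :: (nat \<Rightarrow> nat) \<times> nat. (fst a, snd a + m)"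
      have sub: "?sh ` {a \<in> I \<times> UNIV. Suc (ix_deg n a) = N} \<subseteq> {a \<in> I \<times> UNIV. Suc (ix_deg n a) = N'}"
        by (auto simp: ix_deg_def N'_def algebra_simps)
      have "(\<Sum>a | a \<in> I \<times> UNIV \<and> Suc (ix_deg n a) = N'. z' (Inl a) * of_int (conn_mat n a b)) =
          (\<Sum>a\<in>?sh ` {a \<in> I \<times> UNIV. Suc (ix_deg n a) = N}. z' (Inl a) * of_int (conn_mat n a b))"
      proof (rule sum.mono_neutral_right[OF finite_src1 sub], rule ballI)
        fix a assume a: "a \<in> {a \<in> I \<times> UNIV. Suc (ix_deg n a) = N'} - ?sh ` {a \<in> I \<times> UNIV. Suc (ix_deg n a) = N}"
        have "\<not> m \<le> snd a"
        proof
          assume m: "m \<le> snd a"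
          then obtain r where rm: "snd a = r + m" using le_add_diff_inverse2 by metis
          then have "a = ?sh (fst a, r)" by (simp add: prod_eq_iff)
          moreover have "(fst a, r) \<in> {a \<in> I \<times> UNIV. Suc (ix_deg n a) = N}"
            using a by (auto simp: ix_deg_def N'_def rm algebra_simps)
          ultimately show False using a by blast
        qed
        then show "z' (Inl a) * of_int (conn_mat n a b) = 0" by (simp add: z'_def)
      qed
      also have "\<dots> = (\<Sum>a | a \<in> I \<times> UNIV \<and> Suc (ix_deg n a) = N. z' (Inl (?sh a)) * of_int (conn_mat n (?sh a) b))"
        by (subst sum.reindex) (auto simp: inj_on_def)
      also have "\<dots> = (\<Sum>a | a \<in> I \<times> UNIV \<and> Suc (ix_deg n a) = N. z (Inl a) * of_int (conn_mat n a b'))"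
        unfolding b'(2) using conn_mat_shift[of _ _ m "fst b'" "snd b'"] by (intro sum.cong refl) (auto simp: z'_def)
      also have "\<dots> = 0" using z2 b' by simp
      finally show ?thesis .
    qed
    then show ?thesis unfolding sum_src zr by simp
  qed
  from src_inj_large[OF N' this] have zz: "\<forall>s\<in>src N'. z' s = 0" .
  show ?thesis
  proof
    fix s assume s: "s \<in> src N"
    show "z s = 0"
    proof (cases s)
      case (Inl a)
      then have "Inl (fst a, snd a + m) \<in> src N'" using s by (auto simp: ix_deg_def N'_def algebra_simps)
      then have "z' (Inl (fst a, snd a + m)) = 0" using zz by blast
      then show ?thesis using Inl by (simp add: z'_def)
    next
      case (Inr i)
      then show ?thesis using s z1 by auto
    qed
  qed
qed

text \<open>An inverse modulo p is chosen in each degree, and the choices are glued: row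
  \<open>j\<close> uses the one belonging to its own degree.\<close>

lemma integer_inverse:
  obtains U :: "(nat \<Rightarrow> nat) \<times> nat \<Rightarrow> (nat \<Rightarrow> nat) \<times> nat + (nat \<Rightarrow> nat) \<Rightarrow> int" where
    "\<And>N j j'. j \<in> tgt N \<Longrightarrow> j' \<in> tgt N \<Longrightarrow> int p dvd (\<Sum>s\<in>src N. U j s * src_mat n s j') - (if j = j' then 1 else 0)"
    "\<And>N s s'. s \<in> src N \<Longrightarrow> s' \<in> src N \<Longrightarrow> int p dvd (\<Sum>j\<in>tgt N. src_mat n s j * U j s') - (if s = s' then 1 else 0)"
proof -
  define R :: "nat \<Rightarrow> ((nat \<Rightarrow> nat) \<times> nat \<Rightarrow> (nat \<Rightarrow> nat) \<times> nat + (nat \<Rightarrow> nat) \<Rightarrow> int) \<Rightarrow> bool" where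
    "R N U \<longleftrightarrow> (\<forall>j\<in>tgt N. \<forall>j'\<in>tgt N. int p dvd (\<Sum>s\<in>src N. U j s * src_mat n s j') - (if j = j' then 1 else 0)) \<and>
      (\<forall>s\<in>src N. \<forall>s'\<in>src N. int p dvd (\<Sum>j\<in>tgt N. src_mat n s j * U j s') - (if s = s' then 1 else 0))" for N U
  have "\<exists>U. R N U" for N
    using integer_inverse_mod_p[OF finite_src[of N] finite_ix[of n k N] src_surj[where N = N] src_inj[where N = N]]
    unfolding CHAR_finite_field[OF p card_q] R_def .
  then obtain U where U: "\<And>N. R N (U N)" by metis
  show ?thesis
  proof (rule that[of "\<lambda>j. U (ix_deg n j) j"])
    show "int p dvd (\<Sum>s\<in>src N. U (ix_deg n j) j s * src_mat n s j') - (if j = j' then 1 else 0)"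
      if "j \<in> tgt N" "j' \<in> tgt N" for N j j'
    proof -
      have "ix_deg n j = N" using that(1) by simp
      then show ?thesis using U[of N, unfolded R_def, THEN conjunct1, rule_format, OF that] by simp
    qed
    show "int p dvd (\<Sum>j\<in>tgt N. src_mat n s j * U (ix_deg n j) j s') - (if s = s' then 1 else 0)"
      if "s \<in> src N" "s' \<in> src N" for N s s'
    proof -
      have "(\<Sum>j\<in>tgt N. src_mat n s j * U (ix_deg n j) j s') = (\<Sum>j\<in>tgt N. src_mat n s j * U N j s')"
        by (rule sum.cong[OF refl]) simp
      then show ?thesis using U[of N, unfolded R_def, THEN conjunct2, rule_format, OF that] by simp
    qed
  qed
qed

text \<open>Bijectivity makes the piece of degree N + 1 as large as the piece of degree N together
  with the elements of B of weight N + 1; induction adds these up.\<close>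

lemma card_tgt: "card (tgt N) = card {i \<in> B. index_weight n i \<le> N}"
proof (induction N)
  case 0
  have "card (tgt 0) = card (src 0)"
    using card_tgt_le surjective_card_eq_injective(2)[OF finite_src finite_ix src_surj src_inj] by (rule antisym)
  then show ?case by (simp add: card_src)
next
  case (Suc N)
  have "card (tgt (Suc N)) = card (src (Suc N))"
    using card_tgt_le surjective_card_eq_injective(2)[OF finite_src finite_ix src_surj src_inj] by (rule antisym)
  also have "\<dots> = card {i \<in> B. index_weight n i \<le> N} + card {i \<in> B. index_weight n i = Suc N}"
    by (simp only: card_src Suc)
  also have "\<dots> = card ({i \<in> B. index_weight n i \<le> N} \<union> {i \<in> B. index_weight n i = Suc N})"
    using finite_B by (subst card_Un_disjoint) auto
  also have "{i \<in> B. index_weight n i \<le> N} \<union> {i \<in> B. index_weight n i = Suc N} = {i \<in> B. index_weight n i \<le> Suc N}"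
    by auto
  finally show ?case .
qed

text \<open>Every \<open>i \<in> I\<close> has a unique multiple \<open>t\<^sup>r e\<^sup>i\<close> with degree in \<open>{nk..nk+n}\<close>.\<close>

lemma card_B: "(n + 1) * card B = (n + k) choose n"
proof -
  \<comment> \<open>All weights in B are at most n k, so from this degree on the count includes the
    whole of B.\<close>
  have B: "card (tgt (n * k + m)) = card B" for m
  proof -
    have "{i \<in> B. index_weight n i \<le> n * k + m} = B" using weight_B by (auto intro: trans_le_add1)
    then show ?thesis by (simp add: card_tgt)
  qed
  let ?A = "{b \<in> I \<times> UNIV. ix_deg n b \<in> (\<lambda>m. n * k + m) ` {..n}}"
  have A: "?A = (\<Union>m\<in>{..n}. tgt (n * k + m))" by auto
  have "card ?A = (\<Sum>m\<le>n. card (tgt (n * k + m)))"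
    unfolding A by (rule card_UN_disjoint) (auto simp: finite_ix)
  then have 1: "card ?A = (n + 1) * card B" by (simp add: B)
  have "bij_betw fst ?A I"
  \<comment> \<open>The second component is the largest r with w(i) + (n + 1) r \<le> n k +
    n.\<close>
  proof (rule bij_betwI[where g = "\<lambda>i. (i, (n * k + n - index_weight n i) div (n + 1))"])
    have div: "n * k \<le> w + (n + 1) * ((n * k + n - w) div (n + 1)) \<and> w + (n + 1) * ((n * k + n - w) div (n + 1)) \<le> n * k + n"
      if "w \<le> n * k" for w
    proof -
      define d where "d = n * k + n - w"
      have "(n + 1) * (d div (n + 1)) + d mod (n + 1) = d" by (rule mult_div_mod_eq)
      moreover have "d mod (n + 1) < n + 1" by simp
      ultimately show ?thesis unfolding d_def[symmetric] using that d_def by linarith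
    qed
    show "(\<lambda>i. (i, (n * k + n - index_weight n i) div (n + 1))) \<in> I \<rightarrow> ?A"
    proof
      fix i assume i: "i \<in> I"
      let ?d = "ix_deg n (i, (n * k + n - index_weight n i) div (n + 1))"
      have "n * k \<le> ?d \<and> ?d \<le> n * k + n"
        using div[OF finite_index_weight_le[OF i]] by (simp add: ix_deg_def)
      then show "(i, (n * k + n - index_weight n i) div (n + 1)) \<in> ?A"
        using i by (auto intro!: image_eqI[of _ _ "?d - n * k"])
    qed
    show "(fst b, (n * k + n - index_weight n (fst b)) div (n + 1)) = b" if b: "b \<in> ?A" for b
    proof -
      obtain i r where ir: "b = (i, r)" by (cases b)
      have "n * k \<le> index_weight n i + (n + 1) * r" "index_weight n i + (n + 1) * r \<le> n * k + n"
        using b ir by (auto simp: ix_deg_def)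
      then have "(n + 1) * r \<le> n * k + n - index_weight n i" "n * k + n - index_weight n i < (n + 1) * r + (n + 1)"
        by linarith+
      then have "(n * k + n - index_weight n i) div (n + 1) = r"
        by (intro div_nat_eqI) (simp_all add: algebra_simps)
      then show ?thesis using ir by simp
    qed
  qed auto
  then have "card ?A = card I" by (rule bij_betw_same_card)
  then show ?thesis using 1 by (simp add: card_sym_index)
qed

end

text \<open>Position (n + 1) d + l of an interleaved sequence is that of \<tau>^d e_l. Position j +
  1 therefore belongs to e_(j+1), or to \<tau> e_0 when j = n.\<close>

lemma next_ix_iff:
  assumes "l \<le> n" "j \<le> n"
  shows "(n + 1) * d + l = j + 1 \<longleftrightarrow> l = next_ix n j \<and> d = (if j = n then 1 else 0)"
proof
  assume e: "(n + 1) * d + l = j + 1"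
  have "d \<le> 1"
  proof (rule ccontr)
    assume "\<not> d \<le> 1"
    then have "(n + 1) * 2 \<le> (n + 1) * d" by (intro mult_left_mono) auto
    then show False using e assms by simp
  qed
  then have "d = 0 \<or> d = 1" by auto
  then show "l = next_ix n j \<and> d = (if j = n then 1 else 0)"
    using e assms by (auto simp: next_ix_def)
qed (use assms in \<open>auto simp: next_ix_def split: if_splits\<close>)

section \<open>The connection on S_k in coordinates\<close>

context kloosterman
begin

lemma ncoef_of_nat: "ncoef (of_nat m * f) r = of_nat m * ncoef f r"
  by (simp flip: fps_of_nat)

lemma ncoef_theta: "ncoef (theta f) r = of_nat r * ncoef f r"
  by (simp add: ncoef_def theta_nth)

lemma theta_O: "f \<in> OS \<Longrightarrow> theta f \<in> OS"
proof -
  assume "f \<in> OS"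
  then have f: "ncoef f \<in> nfun UNIV" by (simp add: O_set_iff)
  have v: "vb b (of_nat r * ncoef f r)" if "vb b (ncoef f r)" for r b
    using that by (rule vb_mult0(1)[OF vb_of_nat])
  have "(\<lambda>r. of_nat r * ncoef f r) \<in> nfun UNIV"
  proof (rule nfunI)
    show "of_nat i * ncoef f i \<in> Oint" for i
      using type_subring.mult_S[OF type_subring_Oint Oint_1(4) nfunD(5)[OF f]] .
    show "finite {i \<in> UNIV. \<not> vb (real s) (of_nat i * ncoef f i)}" for s
      by (rule finite_subset[OF _ nfunD(6)[OF f, of s]]) (use v in auto)
  qed simp
  then show ?thesis unfolding O_set_iff by (simp add: ncoef_theta[abs_def])
qed

lemma const_O: "a \<in> Oint \<Longrightarrow> fps_const a \<in> OS"
proof -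
  assume a: "a \<in> Oint"
  have "ncoef (fps_const a) = (\<lambda>r. a * eps 0 r)"
    using ncoef_simps(5)[of a 1] by (auto simp: ncoef_1)
  then show ?thesis unfolding O_set_iff using nfun_smult[OF a eps_nfun[of 0 UNIV]] by simp
qed

end

locale kloosterman_sym = kloosterman ord p L n \<gamma>
  for ord :: "'f::field \<Rightarrow> ereal" and p L n \<gamma> +
  fixes k :: nat

sublocale kloosterman_sym \<subseteq> SK: sym_mod OS HM n hb k
  using Hn_free OS.type_subring_axioms unfolding O_ring_eq
  by (intro sym_mod.intro free_modI)

sublocale kloosterman_sym \<subseteq> sm: scalar_map Oint OS fps_const
  by (intro scalar_map.intro type_subring_Oint OS.type_subring_axioms)
    (unfold_locales, auto simp: const_O)

context kloosterman_sym
begin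

abbreviation "I \<equiv> sym_index n k"
abbreviation "J \<equiv> I \<times> (UNIV :: nat set)"
abbreviation "SM \<equiv> SK.P"
abbreviation "del \<equiv> Sk_del ord Oint p n \<gamma> k"

lemma Sk_eq: "Sk ord Oint p n \<gamma> k = SM"
  by (simp add: Sk_def O_ring_eq)

lemma Sk_basis_eq: "Sk_basis ord Oint p n \<gamma> k = SK.smon"
  by (simp add: Sk_basis_def O_ring_eq)

lemma del_eq: "del = sym_extend OS.RS HM n hb k theta (Hn_del ord Oint p n \<gamma>)"
  by (simp add: Sk_del_def O_ring_eq)

lemma del_closed: "\<eta> \<in> carrier SM \<Longrightarrow> del \<eta> \<in> carrier SM"
  unfolding del_eq by (intro SK.sym_extend_coords(1) theta_O Hn_del_basis(1))

text \<open>The coefficient of \<tau>^r e^i, where \<open>b\<close> is the pair (i, r); on null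
  families \<open>ser\<close> provides the inverse.\<close>

definition cf :: "('f series set multiset \<Rightarrow> 'f fps) set \<Rightarrow> (nat \<Rightarrow> nat) \<times> nat \<Rightarrow> 'f" where
  "cf \<eta> b = (if fst b \<in> I then ncoef (SK.SP.co \<eta> (fst b)) (snd b) else 0)"

definition ser :: "((nat \<Rightarrow> nat) \<times> nat \<Rightarrow> 'f) \<Rightarrow> ('f series set multiset \<Rightarrow> 'f fps) set" where
  "ser x = (\<Oplus>\<^bsub>SM\<^esub>i\<in>I. Abs_fps (\<lambda>r. x (i, r) * \<gamma> ^ (r * (n + 1))) \<odot>\<^bsub>SM\<^esub> SK.smon i)"

lemma co_O: "\<eta> \<in> carrier SM \<Longrightarrow> i \<in> I \<Longrightarrow> SK.SP.co \<eta> i \<in> OS"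
  using SK.SP.coords_closed by simp

lemma cf_nfun:
  assumes \<eta>: "\<eta> \<in> carrier SM"
  shows "cf \<eta> \<in> nfun J"
proof (rule nfunI)
  have n: "ncoef (SK.SP.co \<eta> i) \<in> nfun UNIV" if "i \<in> I" for i
    using co_O[OF \<eta> that] by (simp add: O_set_iff)
  show "b \<in> J \<Longrightarrow> cf \<eta> b \<in> Oint" for b using nfunD(5)[OF n] by (auto simp: cf_def)
  show "b \<notin> J \<Longrightarrow> cf \<eta> b = 0" for b by (simp add: cf_def mem_Times_iff)
  fix s :: nat
  have "{b \<in> J. \<not> vb (real s) (cf \<eta> b)} = (SIGMA i:I. {r. \<not> vb (real s) (ncoef (SK.SP.co \<eta> i) r)})"
    by (auto simp: cf_def)
  then show "finite {b \<in> J. \<not> vb (real s) (cf \<eta> b)}"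
    using nfunD(6)[OF n] finite_sym_index by simp
qed

lemma ser:
  assumes x: "x \<in> nfun J"
  shows "ser x \<in> carrier SM" "cf (ser x) = x"
proof -
  let ?f = "\<lambda>i. Abs_fps (\<lambda>r. x (i, r) * \<gamma> ^ (r * (n + 1)))"
  have nc: "ncoef (?f i) = (\<lambda>r. x (i, r))" for i by (simp add: ncoef_def fun_eq_iff)
  have O: "?f i \<in> OS" for i unfolding O_set_iff nc
  proof (rule nfunI)
    show "x (i, r) \<in> Oint" for r using nfunD(5)[OF x] .
    show "finite {r \<in> UNIV. \<not> vb (real s) (x (i, r))}" for s
      using finite_vimageI[OF nfunD(6)[OF x, of s], of "Pair i"] by (simp add: inj_on_def vimage_def)
  qed simp
  then show "ser x \<in> carrier SM" unfolding ser_def by (intro SK.SP.lincomb_closed) simp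
  have "SK.SP.co (ser x) i = ?f i" if "i \<in> I" for i
    unfolding ser_def using O that by (intro SK.SP.coords_lincomb) auto
  then show "cf (ser x) = x" using nc nfunD(4)[OF x] by (auto simp: cf_def fun_eq_iff)
qed

lemma cf_inj:
  assumes "\<eta> \<in> carrier SM" "\<eta>' \<in> carrier SM" "cf \<eta> = cf \<eta>'"
  shows "\<eta> = \<eta>'"
proof (rule SK.SP.coords_inj[OF assms(1,2)])
  fix i assume "i \<in> I"
  then have "ncoef (SK.SP.co \<eta> i) r = ncoef (SK.SP.co \<eta>' i) r" for r
    using fun_cong[OF assms(3), of "(i, r)"] by (simp add: cf_def)
  then show "SK.SP.co \<eta> i = SK.SP.co \<eta>' i" by (intro ncoef_inj ext)
qed

lemma cf_add: "\<eta> \<in> carrier SM \<Longrightarrow> \<eta>' \<in> carrier SM \<Longrightarrow> cf (\<eta> \<oplus>\<^bsub>SM\<^esub> \<eta>') = (\<lambda>b. cf \<eta> b + cf \<eta>' b)"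
  by (auto simp: cf_def SK.SP.coords_add)

lemma cf_smult: "a \<in> Oint \<Longrightarrow> \<eta> \<in> carrier SM \<Longrightarrow> cf (fps_const a \<odot>\<^bsub>SM\<^esub> \<eta>) = (\<lambda>b. a * cf \<eta> b)"
  by (auto simp: cf_def SK.SP.coords_smult const_O)

lemma cf_zero: "cf \<zero>\<^bsub>SM\<^esub> = (\<lambda>b. 0)"
  by (auto simp: cf_def SK.SP.coords_zero)

lemma cf_monom:
  assumes i: "i \<in> I" and a: "a \<in> OS"
  shows "cf (a \<odot>\<^bsub>SM\<^esub> SK.smon i) b = (if fst b = i then ncoef a (snd b) else 0)"
  using assms by (auto simp: cf_def SK.SP.coords_smult SK.SP.coords_basis)

text \<open>The connection in these coordinates: t d/dt multiplies the coefficient of \<tau>^r by r,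
  and the coordinates \<open>gcoef j\<close> of \<partial> e_j enter through a Cauchy product in
  \<tau>.\<close>

definition dmap :: "((nat \<Rightarrow> nat) \<times> nat \<Rightarrow> 'f) \<Rightarrow> (nat \<Rightarrow> nat) \<times> nat \<Rightarrow> 'f" where
  "dmap x b = (if fst b \<in> I then of_nat (snd b) * x b +
     (\<Sum>i\<in>I. \<Sum>j | j \<le> n \<and> i j > 0. \<Sum>l\<le>n. if move_index i j l = fst b
        then of_nat (i j) * (\<Sum>r\<le>snd b. x (i, r) * gcoef j ((n + 1) * (snd b - r) + l)) else 0) else 0)"

lemma cf_del:
  assumes \<eta>: "\<eta> \<in> carrier SM"
  shows "cf (del \<eta>) = dmap (cf \<eta>)"
proof
  fix b
  show "cf (del \<eta>) b = dmap (cf \<eta>) b"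
  proof (cases "fst b \<in> I")
    case True
    obtain i r where b: "b = (i, r)" by (cases b)
    have i: "i \<in> I" using True b by simp
    have ns: "ncoef (sum f A) r = (\<Sum>a\<in>A. ncoef (f a) r)" for f :: "'x \<Rightarrow> 'f fps" and A
      by (simp add: ncoef_def fps_sum_nth sum_divide_distrib)
    have ni: "ncoef (if P then f else 0) r = (if P then ncoef f r else 0)" for P f by simp
    have co: "SK.SP.co (del \<eta>) i = theta (SK.SP.co \<eta> i) +
      (\<Sum>i'\<in>I. \<Sum>j | j \<le> n \<and> i' j > 0. \<Sum>l\<le>n. if move_index i' j l = i then
        of_nat (i' j) * SK.SP.co \<eta> i' * SK.co (Hn_del ord Oint p n \<gamma> (hb j)) l else 0)"
      unfolding del_eq by (rule SK.sym_extend_coords(2)[where d = theta and \<phi> = "Hn_del ord Oint p n \<gamma>", OF theta_O Hn_del_basis(1) \<eta> i])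
    have "cf (del \<eta>) b = ncoef (SK.SP.co (del \<eta>) i) r" using i by (simp add: cf_def b)
    also have "\<dots> = of_nat r * ncoef (SK.SP.co \<eta> i) r +
      (\<Sum>i'\<in>I. \<Sum>j | j \<le> n \<and> i' j > 0. \<Sum>l\<le>n. if move_index i' j l = i then
        ncoef (of_nat (i' j) * SK.SP.co \<eta> i' * SK.co (Hn_del ord Oint p n \<gamma> (hb j)) l) r else 0)"
      unfolding co ncoef_simps ncoef_theta ns ni ..
    also have "(\<Sum>i'\<in>I. \<Sum>j | j \<le> n \<and> i' j > 0. \<Sum>l\<le>n. if move_index i' j l = i then
        ncoef (of_nat (i' j) * SK.SP.co \<eta> i' * SK.co (Hn_del ord Oint p n \<gamma> (hb j)) l) r else 0) =
      (\<Sum>i'\<in>I. \<Sum>j | j \<le> n \<and> i' j > 0. \<Sum>l\<le>n. if move_index i' j l = i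
        then of_nat (i' j) * (\<Sum>r'\<le>r. cf \<eta> (i', r') * gcoef j ((n + 1) * (r - r') + l)) else 0)"
    proof (rule sum.cong[OF refl], rule sum.cong[OF refl], rule sum.cong[OF refl])
      fix i' j l assume i': "i' \<in> I" and j: "j \<in> {j. j \<le> n \<and> i' j > 0}" and l: "l \<in> {..n}"
      have "ncoef (SK.co (Hn_del ord Oint p n \<gamma> (hb j)) l) r' = gcoef j ((n + 1) * r' + l)" for r'
        using Hn_del_basis(2)[of j l r'] j l by (simp only: O_ring_eq mem_Collect_eq atMost_iff)
      then have "ncoef (of_nat (i' j) * SK.SP.co \<eta> i' * SK.co (Hn_del ord Oint p n \<gamma> (hb j)) l) r =
          of_nat (i' j) * (\<Sum>r'\<le>r. cf \<eta> (i', r') * gcoef j ((n + 1) * (r - r') + l))"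
        unfolding mult.assoc ncoef_of_nat unfolding ncoef_mult using i' by (simp only: cf_def fst_conv snd_conv if_True)
      then show "(if move_index i' j l = i then ncoef (of_nat (i' j) * SK.SP.co \<eta> i' * SK.co (Hn_del ord Oint p n \<gamma> (hb j)) l) r else 0) =
        (if move_index i' j l = i then of_nat (i' j) * (\<Sum>r'\<le>r. cf \<eta> (i', r') * gcoef j ((n + 1) * (r - r') + l)) else 0)"
        by simp
    qed
    finally have "cf (del \<eta>) b = of_nat r * cf \<eta> (i, r) + (\<Sum>i'\<in>I. \<Sum>j | j \<le> n \<and> i' j > 0. \<Sum>l\<le>n. if move_index i' j l = i
        then of_nat (i' j) * (\<Sum>r'\<le>r. cf \<eta> (i', r') * gcoef j ((n + 1) * (r - r') + l)) else 0)"
      unfolding cf_def[of \<eta> "(i, r)"] fst_conv snd_conv if_P[OF i] .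
    then show ?thesis unfolding dmap_def b fst_conv snd_conv if_P[OF i] .
  qed (simp add: cf_def dmap_def)
qed

text \<open>That null families go to null families is read off from the connection on S_k itself,
  through \<open>ser\<close> and \<open>cf\<close>; only linearity is computed.\<close>

lemma dmap_nlinear: "nlinear J J dmap"
proof (rule nlinearI)
  show "dmap x \<in> nfun J" if "x \<in> nfun J" for x
    using cf_nfun[OF del_closed[OF ser(1)[OF that]]] cf_del[OF ser(1)[OF that]] ser(2)[OF that] by simp
  show "dmap (\<lambda>i. x i + y i) b = dmap x b + dmap y b" for x y b
  proof -
    have e: "(if P then of_nat m * (\<Sum>r\<le>s. (x (i, r) + y (i, r)) * g r) else 0) =
      (if P then of_nat m * (\<Sum>r\<le>s. x (i, r) * g r) else 0) + (if P then of_nat m * (\<Sum>r\<le>s. y (i, r) * g r) else 0)"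
      for P m s i and g :: "nat \<Rightarrow> 'f" by (simp add: distrib_right sum.distrib distrib_left)
    show ?thesis unfolding dmap_def e sum.distrib by (simp add: distrib_left)
  qed
  show "dmap (\<lambda>i. a * x i) b = a * dmap x b" for a x b
  proof -
    have e: "(if P then of_nat m * (\<Sum>r\<le>s. (a * x (i, r)) * g r) else 0) =
      a * (if P then of_nat m * (\<Sum>r\<le>s. x (i, r) * g r) else 0)"
      for P m s i and g :: "nat \<Rightarrow> 'f" by (simp add: sum_distrib_left mult_ac)
    show ?thesis unfolding dmap_def e sum_distrib_left[symmetric] by (simp add: distrib_left mult_ac)
  qed
qed

lemma dmap_eps:
  assumes a: "i \<in> I" and b: "i' \<in> I"
  shows "dmap (eps (i, r)) (i', r') = of_nat r' * eps (i, r) (i', r') +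
    (\<Sum>j | j \<le> n \<and> i j > 0. \<Sum>l\<le>n. if move_index i j l = i' \<and> r \<le> r'
       then of_nat (i j) * gcoef j ((n + 1) * (r' - r) + l) else 0)"
proof -
  have e: "(\<Sum>s\<le>r'. eps (i, r) (i0, s) * gcoef j ((n + 1) * (r' - s) + l)) =
      (if i0 = i \<and> r \<le> r' then gcoef j ((n + 1) * (r' - r) + l) else 0)" for i0 j l
  proof -
    have "(\<Sum>s\<le>r'. eps (i, r) (i0, s) * gcoef j ((n + 1) * (r' - s) + l)) =
        (\<Sum>s\<le>r'. if s = r then (if i0 = i then gcoef j ((n + 1) * (r' - r) + l) else 0) else 0)"
      by (intro sum.cong) (auto simp: eps_def)
    then show ?thesis by auto
  qed
  have "(\<Sum>i0\<in>I. \<Sum>j | j \<le> n \<and> i0 j > 0. \<Sum>l\<le>n. if move_index i0 j l = i'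
        then of_nat (i0 j) * (if i0 = i \<and> r \<le> r' then gcoef j ((n + 1) * (r' - r) + l) else 0) else 0) =
      (\<Sum>i0\<in>I. if i0 = i then (\<Sum>j | j \<le> n \<and> i j > 0. \<Sum>l\<le>n. if move_index i j l = i' \<and> r \<le> r'
       then of_nat (i j) * gcoef j ((n + 1) * (r' - r) + l) else 0) else 0)"
    by (intro sum.cong refl) (auto intro!: sum.cong sum.neutral)
  then show ?thesis unfolding dmap_def fst_conv snd_conv e if_P[OF b] using a finite_sym_index by simp
qed

text \<open>The column at \<tau>^r e^i consists of moves weighted by \<open>gcoef\<close>, which
  modulo p is 1 at position j + 1 and 0 elsewhere; \<open>next_ix_iff\<close> identifies that
  position. The diagonal is left out because there t d/dt contributes r, a term of degree -1 in the
  shifted grading.\<close>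

lemma dmap_eps_mod_p:
  assumes a: "a \<in> J" and b: "b \<in> J" and ab: "a \<noteq> b"
  shows "vb 1 (dmap (eps a) b - of_int (conn_mat n a b))"
proof -
  obtain i r i' r' where e: "a = (i, r)" "b = (i', r')" by (cases a, cases b)
  have i: "i \<in> I" "i' \<in> I" using a b e by auto
  let ?g = "\<lambda>j l. gcoef j ((n + 1) * (r' - r) + l)"
  have "vb 1 ((\<Sum>l\<le>n. if move_index i j l = i' \<and> r \<le> r' then of_nat (i j) * ?g j l else 0) -
      of_int (if move_index i j (next_ix n j) = i' \<and> r' = r + (if j = n then 1 else 0) then int (i j) else 0))"
    if j: "j \<le> n" for j
  proof -
    have "(of_int (if move_index i j (next_ix n j) = i' \<and> r' = r + (if j = n then 1 else 0) then int (i j) else 0) :: 'f) =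
      (\<Sum>l\<le>n. if l = next_ix n j then (if move_index i j l = i' \<and> r' = r + (if j = n then 1 else 0) then of_nat (i j) else 0) else 0)"
      using next_ix_le[OF j] by (subst sum.delta) auto
    also have "\<dots> = (\<Sum>l\<le>n. if move_index i j l = i' \<and> r \<le> r' then of_nat (i j) * (if (n + 1) * (r' - r) + l = j + 1 then 1 else 0) else 0)"
    proof (rule sum.cong[OF refl])
      fix l assume "l \<in> {..n}"
      then have l: "l \<le> n" by simp
      have "r \<le> r' \<and> (n + 1) * (r' - r) + l = j + 1 \<longleftrightarrow> r \<le> r' \<and> l = next_ix n j \<and> r' - r = (if j = n then 1 else 0)"
        using next_ix_iff[OF l j] by metis
      also have "\<dots> \<longleftrightarrow> l = next_ix n j \<and> r' = r + (if j = n then 1 else 0)"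
        by (cases "j = n") auto
      finally have e: "r \<le> r' \<and> (n + 1) * (r' - r) + l = j + 1 \<longleftrightarrow> l = next_ix n j \<and> r' = r + (if j = n then 1 else 0)" .
      have "(if move_index i j l = i' \<and> r \<le> r' then of_nat (i j) * (if (n + 1) * (r' - r) + l = j + 1 then 1 else 0) else 0) =
        (if move_index i j l = i' \<and> (r \<le> r' \<and> (n + 1) * (r' - r) + l = j + 1) then of_nat (i j) else 0 :: 'f)"
        by (cases "(n + 1) * (r' - r) + l = j + 1") (simp_all only: if_True if_False mult_1_right mult_zero_right simp_thms if_cancel)
      then show "(if l = next_ix n j then (if move_index i j l = i' \<and> r' = r + (if j = n then 1 else 0) then of_nat (i j) else 0) else 0 :: 'f) =
        (if move_index i j l = i' \<and> r \<le> r' then of_nat (i j) * (if (n + 1) * (r' - r) + l = j + 1 then 1 else 0) else 0)"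
        unfolding e by (cases "l = next_ix n j") (simp_all only: simp_thms if_True if_False)
    qed
    finally have s: "(of_int (if move_index i j (next_ix n j) = i' \<and> r' = r + (if j = n then 1 else 0) then int (i j) else 0) :: 'f) =
      (\<Sum>l\<le>n. if move_index i j l = i' \<and> r \<le> r' then of_nat (i j) * (if (n + 1) * (r' - r) + l = j + 1 then 1 else 0) else 0)" .
    show ?thesis unfolding s sum_subtractf[symmetric]
    proof (rule vb_sum)
      fix l
      have "vb 1 (of_nat (i j) * (?g j l - (if (n + 1) * (r' - r) + l = j + 1 then 1 else 0)))"
        using gcoef_props(3)[OF j] by (rule vb_mult0(1)[OF vb_of_nat])
      then show "vb 1 ((if move_index i j l = i' \<and> r \<le> r' then of_nat (i j) * ?g j l else 0) -
        (if move_index i j l = i' \<and> r \<le> r' then of_nat (i j) * (if (n + 1) * (r' - r) + l = j + 1 then 1 else 0) else 0))"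
        unfolding right_diff_distrib
        by (cases "move_index i j l = i' \<and> r \<le> r'") (simp_all only: if_True if_False diff_self vb_zero simp_thms)
    qed
  qed
  then have "vb 1 (\<Sum>j | j \<le> n \<and> i j > 0. (\<Sum>l\<le>n. if move_index i j l = i' \<and> r \<le> r' then of_nat (i j) * ?g j l else 0) -
      of_int (if move_index i j (next_ix n j) = i' \<and> r' = r + (if j = n then 1 else 0) then int (i j) else 0))"
    by (intro vb_sum) auto
  moreover have "eps (i, r) (i', r') = 0" using ab e by (auto simp: eps_def)
  ultimately show ?thesis
    unfolding e dmap_eps[OF i] conn_mat_def fst_conv snd_conv of_int_sum sum_subtractf by simp
qed

text \<open>A move from j to l together with \<tau>^d changes the degree by (n + 1) d + l - j, so
  the difference of degrees, lowered by one, is exactly the bound for \<open>gcoef j\<close> at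
  position (n + 1) d + l. On the diagonal only order -1 is asked.\<close>

lemma dmap_eps_bound:
  assumes a: "a \<in> J" and b: "b \<in> J"
  shows "vb (real (ix_deg n b) - real (Suc (ix_deg n a))) (dmap (eps a) b)"
proof -
  obtain i r i' r' where e: "a = (i, r)" "b = (i', r')" by (cases a, cases b)
  have i: "i \<in> I" "i' \<in> I" using a b e by auto
  let ?v = "real (ix_deg n b) - real (Suc (ix_deg n a))"
  have "vb ?v (of_nat r' * eps (i, r) (i', r'))"
  proof (cases "a = b")
    case True
    then have "eps (i, r) (i', r') = 1" using e by (simp add: eps_def)
    then show ?thesis using True vb_mono[OF vb_of_nat] by simp
  next
    case False
    then have "eps (i, r) (i', r') = 0" using e by (auto simp: eps_def)
    then show ?thesis by simp
  qed
  moreover have "vb ?v (if move_index i j l = i' \<and> r \<le> r' then of_nat (i j) * gcoef j ((n + 1) * (r' - r) + l) else 0)"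
    if j: "j \<le> n" "i j > 0" and l: "l \<le> n" for j l
  proof (cases "move_index i j l = i' \<and> r \<le> r'")
    case True
    have w: "index_weight n i' + j = index_weight n i + l"
      using index_weight_move[of j n i l, OF j l] True by simp
    obtain d where d: "r' = r + d" using True le_Suc_ex by blast
    have "ix_deg n b + (j + 1) = Suc (ix_deg n a) + ((n + 1) * d + l)"
      using w by (simp add: ix_deg_def e d algebra_simps)
    then have "?v = real ((n + 1) * d + l) - real (j + 1)" by linarith
    then have "vb ?v (of_nat (i j) * gcoef j ((n + 1) * d + l))"
      using vb_mult0(1)[OF vb_of_nat gcoef_props(2)[OF j(1)]] by metis
    moreover have "r' - r = d" using d by simp
    ultimately show ?thesis unfolding if_P[OF True] by metis
  next
    case False
    then show ?thesis unfolding if_not_P[OF False] by (intro vb_zero)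
  qed
  ultimately show ?thesis unfolding e dmap_eps[OF i] by (intro vb_add vb_sum) auto
qed

end

section \<open>The cohomology of S_k: decomposition along B_k and the filtration\<close>

locale kloosterman_sym_basis = kloosterman_sym ord p L n \<gamma> k
  for ord :: "'f::field \<Rightarrow> ereal" and p L n \<gamma> k +
  fixes B :: "(nat \<Rightarrow> nat) set"
    and U :: "(nat \<Rightarrow> nat) \<times> nat \<Rightarrow> (nat \<Rightarrow> nat) \<times> nat + (nat \<Rightarrow> nat) \<Rightarrow> int"
  assumes B_sub: "B \<subseteq> sym_index n k"
    and U_left: "j \<in> {b \<in> sym_index n k \<times> UNIV. ix_deg n b = N} \<Longrightarrow> j' \<in> {b \<in> sym_index n k \<times> UNIV. ix_deg n b = N} \<Longrightarrow>
      int p dvd (\<Sum>s\<in>{s \<in> (sym_index n k \<times> UNIV) <+> B. src_deg n s = N}. U j s * src_mat n s j') - (if j = j' then 1 else 0)"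
    and U_right: "s \<in> {s \<in> (sym_index n k \<times> UNIV) <+> B. src_deg n s = N} \<Longrightarrow> s' \<in> {s \<in> (sym_index n k \<times> UNIV) <+> B. src_deg n s = N} \<Longrightarrow>
      int p dvd (\<Sum>j\<in>{b \<in> sym_index n k \<times> UNIV. ix_deg n b = N}. src_mat n s j * U j s') - (if s = s' then 1 else 0)"
begin

abbreviation "src \<equiv> J <+> B"

lemma finite_B: "finite B"
  using B_sub finite_sym_index finite_subset by blast

text \<open>The coefficient c_i is placed at the pair (i, 0), that is, at \<tau>^0 e^i; the rest is
  \<partial> \<eta> in coordinates.\<close>

definition decomp :: "((nat \<Rightarrow> nat) \<times> nat + (nat \<Rightarrow> nat) \<Rightarrow> 'f) \<Rightarrow> (nat \<Rightarrow> nat) \<times> nat \<Rightarrow> 'f" where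
  "decomp x b = dmap (\<lambda>a. x (Inl a)) b + (\<Sum>i\<in>B. if b = (i, 0) then x (Inr i) else 0)"

lemma src_left: "x \<in> nfun src \<Longrightarrow> (\<lambda>a. x (Inl a)) \<in> nfun J"
proof (rule nfunI)
  assume x: "x \<in> nfun src"
  show "x (Inl a) \<in> Oint" for a using nfunD(5)[OF x] .
  show "a \<notin> J \<Longrightarrow> x (Inl a) = 0" for a by (rule nfunD(4)[OF x]) auto
  show "finite {a \<in> J. \<not> vb (real s) (x (Inl a))}" for s
    by (rule finite_subset[OF _ finite_vimageI[OF nfunD(6)[OF x, of s], of Inl]]) auto
qed

lemma src_case:
  assumes f: "f \<in> nfun J" and d: "\<And>i. i \<in> B \<Longrightarrow> d i \<in> Oint" "\<And>i. i \<notin> B \<Longrightarrow> d i = 0"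
  shows "case_sum f d \<in> nfun src"
proof (rule nfunI)
  show "s \<in> src \<Longrightarrow> case_sum f d s \<in> Oint" for s using nfunD(5)[OF f] d by auto
  show "s \<notin> src \<Longrightarrow> case_sum f d s = 0" for s using nfunD(4)[OF f] d(2) by (cases s) auto
  show "finite {x \<in> src. \<not> vb (real s) (case_sum f d x)}" for s
  proof (rule finite_subset)
    show "{x \<in> src. \<not> vb (real s) (case_sum f d x)} \<subseteq> Inl ` {b. \<not> vb (real s) (f b)} \<union> Inr ` B" by auto
    show "finite (Inl ` {b. \<not> vb (real s) (f b)} \<union> Inr ` B)" using nfunD(6)[OF f] finite_B by blast
  qed
qed

lemma nlinear_decomp: "nlinear src J decomp"
proof (rule nlinearI)
  show "decomp x \<in> nfun J" if x: "x \<in> nfun src" for x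
  proof -
    have "(\<lambda>b. \<Sum>i\<in>B. if b = (i, 0) then x (Inr i) else 0) \<in> nfun J"
    proof (rule nfun_sum)
      fix i assume i: "i \<in> B"
      show "(\<lambda>b. if b = (i, 0) then x (Inr i) else 0) \<in> nfun J"
        by (rule nfun_finite[of "{(i, 0)}"]) (use i B_sub nfunD(5)[OF x] in auto)
    qed
    then show ?thesis unfolding decomp_def[abs_def] using nlinearD(1)[OF dmap_nlinear src_left[OF x]]
      by (intro nfun_add)
  qed
  show "decomp (\<lambda>s. x s + y s) b = decomp x b + decomp y b" if "x \<in> nfun src" "y \<in> nfun src" for x y b
  proof -
    have "(\<Sum>i\<in>B. if b = (i, 0) then x (Inr i) + y (Inr i) else 0) =
      (\<Sum>i\<in>B. if b = (i, 0) then x (Inr i) else 0) + (\<Sum>i\<in>B. if b = (i, 0) then y (Inr i) else 0)"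
      unfolding sum.distrib[symmetric] by (rule sum.cong) auto
    then show ?thesis unfolding decomp_def nlinearD(2)[OF dmap_nlinear src_left[OF that(1)] src_left[OF that(2)]] by simp
  qed
  show "decomp (\<lambda>s. a * x s) b = a * decomp x b" if "a \<in> Oint" "x \<in> nfun src" for a x b
  proof -
    have "(\<Sum>i\<in>B. if b = (i, 0) then a * x (Inr i) else 0) = a * (\<Sum>i\<in>B. if b = (i, 0) then x (Inr i) else 0)"
      unfolding sum_distrib_left by (rule sum.cong) auto
    then show ?thesis unfolding decomp_def nlinearD(3)[OF dmap_nlinear that(1) src_left[OF that(2)]]
      by (simp add: distrib_left)
  qed
qed

lemma decomp_Inl: "decomp (eps (Inl a)) = dmap (eps a)"
proof
  fix b :: "(nat \<Rightarrow> nat) \<times> nat"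
  have "(\<lambda>a'. eps (Inl a :: _ + (nat \<Rightarrow> nat)) (Inl a')) = eps a" by (auto simp: eps_def)
  moreover have "(\<Sum>i\<in>B. if b = (i, 0) then eps (Inl a) (Inr i) else 0) = 0" by (rule sum.neutral) (simp add: eps_def)
  ultimately show "decomp (eps (Inl a)) b = dmap (eps a) b" by (simp add: decomp_def)
qed

lemma decomp_Inr:
  assumes "i \<in> B"
  shows "decomp (eps (Inr i)) b = (if b = (i, 0) then 1 else 0)"
proof -
  have "(\<lambda>a. eps (Inr i :: (nat \<Rightarrow> nat) \<times> nat + _) (Inl a)) = (\<lambda>_. 0)" by (auto simp: eps_def)
  moreover have "(\<Sum>i'\<in>B. if b = (i', 0) then eps (Inr i :: (nat \<Rightarrow> nat) \<times> nat + _) (Inr i') else 0) = (\<Sum>i'\<in>B. if i' = i then (if b = (i, 0) then 1 else 0) else 0)"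
    by (rule sum.cong) (auto simp: eps_def)
  ultimately show ?thesis using assms finite_B nlinear_zero[OF dmap_nlinear] by (simp add: decomp_def)
qed

end

text \<open>On \<open>Inl\<close> the congruence and the bound are those of \<open>dmap\<close>, and
  on \<open>Inr\<close> the columns are unit vectors of the same degree. The diagonal excluded in
  \<open>dmap_eps_mod_p\<close> does not arise: for \<open>Inl\<close> the inequality of degrees in
  the congruence makes the target degree strictly larger than that of the monomial.\<close>

sublocale kloosterman_sym_basis \<subseteq> G: graded_map ord p L "(sym_index n k \<times> (UNIV :: nat set)) <+> B" "sym_index n k \<times> (UNIV :: nat set)"
  "src_deg n" "ix_deg n" decomp "src_mat n" U
proof (unfold_locales, goal_cases)
  case 1 show ?case by (rule nlinear_decomp)
next
  case (2 N)
  have "{s \<in> src. src_deg n s = N} \<subseteq> Inl ` {a \<in> J. ix_deg n a = N - 1} \<union> Inr ` B" by auto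
  moreover have "finite (Inl ` {a \<in> J. ix_deg n a = N - 1} \<union> Inr ` B :: ((nat \<Rightarrow> nat) \<times> nat + (nat \<Rightarrow> nat)) set)"
    using finite_ix finite_B by blast
  ultimately show ?case by (rule finite_subset)
next
  case (3 N) show ?case by (rule finite_ix)
next
  case (4 i j)
  then show ?case by (cases i) (auto simp: conn_mat_hom ix_deg_def)
next
  case (5 i j)
  then show ?case
  proof (cases i)
    case (Inl a)
    then have "a \<in> J" "a \<noteq> j" using 5 by auto
    from dmap_eps_mod_p[OF this(1) 5(2) this(2)] show ?thesis by (simp only: Inl decomp_Inl src_simps)
  next
    case (Inr i')
    then have "i' \<in> B" using 5 by auto
    then show ?thesis using Inr by (simp add: decomp_Inr)
  qed
next
  case (6 i j)
  then show ?case
  proof (cases i)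
    case (Inl a)
    then have a: "a \<in> J" using 6 by auto
    show ?thesis using dmap_eps_bound[OF a 6(2)] by (simp only: Inl decomp_Inl src_simps)
  next
    case (Inr i')
    then have i: "i' \<in> B" using 6 by auto
    show ?thesis
    proof (cases "j = (i', 0)")
      case True
      then show ?thesis unfolding Inr decomp_Inr[OF i] by (simp add: ix_deg_def)
    next
      case False
      then show ?thesis unfolding Inr decomp_Inr[OF i] by simp
    qed
  qed
next
  case (7 j j')
  then show ?case by (intro U_left) auto
next
  case (8 i i')
  then show ?case by (intro U_right) auto
qed

context kloosterman_sym_basis
begin

lemma decomp_case: "decomp (case_sum (cf \<eta>) d) b = cf (del \<eta>) b + (\<Sum>i\<in>B. if b = (i, 0) then d i else 0)"
  if "\<eta> \<in> carrier SM"
  using cf_del[OF that] by (simp add: decomp_def cong: if_cong)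

text \<open>If \<partial> \<eta> vanishes, the pair (\<eta>, 0) lies in the kernel of the injective
  map \<open>decomp\<close>.\<close>

lemma del_zero_iff:
  assumes \<eta>: "\<eta> \<in> carrier SM"
  shows "del \<eta> = \<zero>\<^bsub>SM\<^esub> \<longleftrightarrow> \<eta> = \<zero>\<^bsub>SM\<^esub>"
proof -
  have z: "cf (del \<zero>\<^bsub>SM\<^esub>) = cf \<zero>\<^bsub>SM\<^esub>"
    unfolding cf_del[OF SK.P.M.zero_closed] cf_zero using nlinear_zero[OF dmap_nlinear] .
  have d0: "del \<zero>\<^bsub>SM\<^esub> = \<zero>\<^bsub>SM\<^esub>"
    using z by (intro cf_inj del_closed SK.P.M.zero_closed)
  have "\<eta> = \<zero>\<^bsub>SM\<^esub>" if h: "del \<eta> = \<zero>\<^bsub>SM\<^esub>"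
  proof -
    have n: "case_sum (cf \<eta>) (\<lambda>_. 0) \<in> nfun src" by (rule src_case[OF cf_nfun[OF \<eta>]]) auto
    have "decomp (case_sum (cf \<eta>) (\<lambda>_. 0)) b = 0" for b
      unfolding decomp_case[OF \<eta>] h cf_zero by simp
    then have "decomp (case_sum (cf \<eta>) (\<lambda>_. 0)) b = decomp (\<lambda>_. 0) b" for b
      by (simp add: nlinear_zero[OF nlinear_decomp])
    note dz = this
    have "case_sum (cf \<eta>) (\<lambda>_ :: nat \<Rightarrow> nat. 0) = (\<lambda>_. 0)" by (rule G.injective[OF n nfun_zero]) (rule dz)
    then have "cf \<eta> a = 0" for a by (metis old.sum.simps(5))
    then show ?thesis using \<eta> by (intro cf_inj) (auto simp: cf_zero)
  qed
  then show ?thesis using d0 by auto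
qed

lemma del_linear:
  assumes x: "x \<in> carrier SM" and y: "y \<in> carrier SM"
  shows "del (x \<oplus>\<^bsub>SM\<^esub> y) = del x \<oplus>\<^bsub>SM\<^esub> del y"
    and "a \<in> Oint \<Longrightarrow> del (fps_const a \<odot>\<^bsub>SM\<^esub> x) = fps_const a \<odot>\<^bsub>SM\<^esub> del x"
proof -
  have s: "x \<oplus>\<^bsub>SM\<^esub> y \<in> carrier SM" using x y by simp
  show "del (x \<oplus>\<^bsub>SM\<^esub> y) = del x \<oplus>\<^bsub>SM\<^esub> del y"
  proof (rule cf_inj)
    show "cf (del (x \<oplus>\<^bsub>SM\<^esub> y)) = cf (del x \<oplus>\<^bsub>SM\<^esub> del y)"
      unfolding cf_del[OF s] cf_add[OF x y] cf_add[OF del_closed[OF x] del_closed[OF y]] cf_del[OF x] cf_del[OF y]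
      by (rule nlinearD(2)[OF dmap_nlinear cf_nfun[OF x] cf_nfun[OF y]])
  qed (use del_closed s x y in auto)
  assume a: "a \<in> Oint"
  have t: "fps_const a \<odot>\<^bsub>SM\<^esub> x \<in> carrier SM" using SK.P.smult_closed[of "fps_const a" x] const_O[OF a] x by simp
  have t': "fps_const a \<odot>\<^bsub>SM\<^esub> del x \<in> carrier SM"
    using SK.P.smult_closed[of "fps_const a" "del x"] const_O[OF a] del_closed[OF x] by simp
  show "del (fps_const a \<odot>\<^bsub>SM\<^esub> x) = fps_const a \<odot>\<^bsub>SM\<^esub> del x"
  proof (rule cf_inj)
    show "cf (del (fps_const a \<odot>\<^bsub>SM\<^esub> x)) = cf (fps_const a \<odot>\<^bsub>SM\<^esub> del x)"
      unfolding cf_del[OF t] cf_smult[OF a x] cf_smult[OF a del_closed[OF x]] cf_del[OF x]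
      by (rule nlinearD(3)[OF dmap_nlinear a cf_nfun[OF x]])
  qed (use del_closed[OF t] t' in auto)
qed

abbreviation "SO \<equiv> restrict_scalars fps_const SM"
abbreviation "im \<equiv> del ` carrier SM"

lemma quot_mod_H1: "quot_mod (Oq_ring Oint) SO im"
proof -
  have "submodule im sm.A.RS SO"
    by (rule sm.submodule_image[OF SK.P.module_axioms del_closed del_linear])
  moreover have "module sm.A.RS SO" by (rule sm.module_restrict_scalars[OF SK.P.module_axioms])
  ultimately show ?thesis by (simp add: quot_mod_def quot_mod_axioms_def Oq_ring_def)
qed

end

sublocale kloosterman_sym_basis \<subseteq> H: quot_mod "Oq_ring Oint" "restrict_scalars fps_const SM" "del ` carrier SM"
  by (rule quot_mod_H1)

context kloosterman_sym_basis
begin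

lemma H1_eq: "H1 ord Oint p n \<gamma> k = H.Q"
  by (simp add: H1_def Sk_over_Oq_def Sk_eq)

lemma H1_class_eq: "H1_class ord Oint p n \<gamma> k \<eta> = im +>\<^bsub>SO\<^esub> \<eta>"
  unfolding H1_class_def Sk_eq restrict_scalars_cong(2)[OF refl] ..

lemma carrier_Oq [simp]: "carrier (Oq_ring Oint) = Oint"
  by (simp add: Oq_ring_def)

lemma decomposition_iff:
  assumes x: "x \<in> carrier SM" and y: "y \<in> carrier SM" and d: "\<And>i. i \<in> B \<Longrightarrow> d i \<in> Oint" "\<And>i. i \<notin> B \<Longrightarrow> d i = 0"
  shows "x \<ominus>\<^bsub>SO\<^esub> (\<Oplus>\<^bsub>SO\<^esub>i\<in>B. d i \<odot>\<^bsub>SO\<^esub> SK.smon i) = del y \<longleftrightarrow> cf x = decomp (case_sum (cf y) d)"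
proof -
  let ?L = "\<Oplus>\<^bsub>SM\<^esub>i\<in>B. fps_const (d i) \<odot>\<^bsub>SM\<^esub> SK.smon i"
  have t: "fps_const (d i) \<odot>\<^bsub>SM\<^esub> SK.smon i \<in> carrier SM" if "i \<in> B" for i
    using SK.P.smult_closed[of "fps_const (d i)" "SK.smon i"] const_O[OF d(1)[OF that]] that B_sub by auto
  then have L: "?L \<in> carrier SM" by (intro SK.P.M.finsum_closed) auto
  have Lc: "cf ?L b = (\<Sum>i\<in>B. if b = (i, 0) then d i else 0)" for b
  proof (cases "fst b \<in> I")
    case True
    have ns: "ncoef (sum f A) r = (\<Sum>a\<in>A. ncoef (f a) r)" for f :: "'x \<Rightarrow> 'f fps" and A r
      by (simp add: ncoef_def fps_sum_nth sum_divide_distrib)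
    have nc: "ncoef (fps_const a) r = (if r = 0 then a else 0)" for a r
      by (simp add: ncoef_def)
    have "SK.SP.co ?L (fst b) = (\<Sum>i\<in>B. SK.SP.co (fps_const (d i) \<odot>\<^bsub>SM\<^esub> SK.smon i) (fst b))"
      using SK.SP.coords_finsum[of B "\<lambda>i. fps_const (d i) \<odot>\<^bsub>SM\<^esub> SK.smon i", OF finite_B t True]
        OS.finsum_RS[of B "\<lambda>i. SK.SP.co (fps_const (d i) \<odot>\<^bsub>SM\<^esub> SK.smon i) (fst b)"] co_O[OF t True] finite_B by simp
    then have "cf ?L b = (\<Sum>i\<in>B. cf (fps_const (d i) \<odot>\<^bsub>SM\<^esub> SK.smon i) b)"
      using True by (simp add: cf_def ns)
    also have "\<dots> = (\<Sum>i\<in>B. if b = (i, 0) then d i else 0)"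
    proof (rule sum.cong[OF refl])
      fix i assume "i \<in> B"
      then show "cf (fps_const (d i) \<odot>\<^bsub>SM\<^esub> SK.smon i) b = (if b = (i, 0) then d i else 0)"
        using cf_monom[of i "fps_const (d i)" b] B_sub const_O[OF d(1)] by (cases b) (auto simp: nc)
    qed
    finally show ?thesis .
  next
    case False
    have "(\<Sum>i\<in>B. if b = (i, 0) then d i else 0) = 0"
      by (rule sum.neutral) (use False B_sub in auto)
    then show ?thesis using False by (simp add: cf_def)
  qed
  have e: "(\<Oplus>\<^bsub>SO\<^esub>i\<in>B. d i \<odot>\<^bsub>SO\<^esub> SK.smon i) = ?L"
    unfolding restrict_scalars_cong(1) by simp
  have "x \<ominus>\<^bsub>SM\<^esub> ?L = del y \<longleftrightarrow> x = del y \<oplus>\<^bsub>SM\<^esub> ?L"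
    by (rule SK.P.M.minus_eq_iff_add[OF x del_closed[OF y] L])
  also have "\<dots> \<longleftrightarrow> cf x = cf (del y \<oplus>\<^bsub>SM\<^esub> ?L)"
    using cf_inj[OF x SK.P.M.a_closed[OF del_closed[OF y] L]] by auto
  also have "cf (del y \<oplus>\<^bsub>SM\<^esub> ?L) = decomp (case_sum (cf y) d)"
    unfolding cf_add[OF del_closed[OF y] L] using decomp_case[OF y, of d] Lc by (auto simp: fun_eq_iff)
  finally show ?thesis unfolding e restrict_scalars_minus .
qed

text \<open>The component at B of the preimage under \<open>decomp\<close>; for \<xi> these are the
  constants C(i, \<xi>).\<close>

definition cls :: "('f series set multiset \<Rightarrow> 'f fps) set \<Rightarrow> (nat \<Rightarrow> nat) \<Rightarrow> 'f" where
  "cls \<eta> i = G.inv_map (cf \<eta>) (Inr i)"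

lemma cls:
  assumes x: "x \<in> carrier SM"
  shows "cls x i \<in> Oint" "x \<ominus>\<^bsub>SO\<^esub> (\<Oplus>\<^bsub>SO\<^esub>i\<in>B. cls x i \<odot>\<^bsub>SO\<^esub> SK.smon i) \<in> im"
proof -
  note iv = G.inv_map[OF cf_nfun[OF x]]
  show c: "cls x i \<in> Oint" for i unfolding cls_def by (rule nfunD(5)[OF iv(1)])
  have c0: "cls x i = 0" if "i \<notin> B" for i unfolding cls_def by (rule nfunD(4)[OF iv(1)]) (use that in auto)
  let ?y = "ser (\<lambda>a. G.inv_map (cf x) (Inl a))"
  note y = ser[OF src_left[OF iv(1)]]
  have "case_sum (cf ?y) (cls x) = G.inv_map (cf x)"
    unfolding y(2) by (auto simp: fun_eq_iff cls_def split: sum.split)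
  then have "cf x = decomp (case_sum (cf ?y) (cls x))" using iv(2) by metis
  then have "x \<ominus>\<^bsub>SO\<^esub> (\<Oplus>\<^bsub>SO\<^esub>i\<in>B. cls x i \<odot>\<^bsub>SO\<^esub> SK.smon i) = del ?y"
    by (intro iffD2[OF decomposition_iff[of x ?y "cls x", OF x y(1) c c0]])
  then show "x \<ominus>\<^bsub>SO\<^esub> (\<Oplus>\<^bsub>SO\<^esub>i\<in>B. cls x i \<odot>\<^bsub>SO\<^esub> SK.smon i) \<in> im" using y(1) by blast
qed

lemma smon_closed: "i \<in> B \<Longrightarrow> SK.smon i \<in> carrier SO"
  using B_sub by auto

text \<open>Surjectivity of \<open>decomp\<close> gives the coefficients \<open>cls\<close>. Any
  other admissible family, extended by zero and paired with its \<eta>, is a preimage of the same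
  element, so injectivity gives uniqueness.\<close>

theorem H1_free: "free_with_basis (Oq_ring Oint) (H1 ord Oint p n \<gamma> k) B
    (\<lambda>i. H1_class ord Oint p n \<gamma> k (Sk_basis ord Oint p n \<gamma> k i))"
  unfolding H1_eq H1_class_eq Sk_basis_eq
proof (rule iffD2[OF H.quot_free_iff[of B SK.smon, OF finite_B]], rule smon_closed, assumption, unfold carrier_Oq, rule ballI)
  fix x assume "x \<in> carrier SO"
  then have x: "x \<in> carrier SM" by simp
  have e: "(\<Oplus>\<^bsub>SO\<^esub>i\<in>B. restrict d B i \<odot>\<^bsub>SO\<^esub> SK.smon i) = (\<Oplus>\<^bsub>SO\<^esub>i\<in>B. d i \<odot>\<^bsub>SO\<^esub> SK.smon i)"
    if d: "\<And>i. i \<in> B \<Longrightarrow> d i \<in> Oint" for d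
  proof (rule H.M.finsum_cong')
    show "(\<lambda>i. d i \<odot>\<^bsub>SO\<^esub> SK.smon i) \<in> B \<rightarrow> carrier SO"
      using H.smult_closed smon_closed d by auto
  qed auto
  show "\<exists>!d. d \<in> B \<rightarrow>\<^sub>E Oint \<and> x \<ominus>\<^bsub>SO\<^esub> (\<Oplus>\<^bsub>SO\<^esub>i\<in>B. d i \<odot>\<^bsub>SO\<^esub> SK.smon i) \<in> im"
  proof (rule ex1I[of _ "restrict (cls x) B"])
    show "restrict (cls x) B \<in> B \<rightarrow>\<^sub>E Oint \<and> x \<ominus>\<^bsub>SO\<^esub> (\<Oplus>\<^bsub>SO\<^esub>i\<in>B. restrict (cls x) B i \<odot>\<^bsub>SO\<^esub> SK.smon i) \<in> im"
      unfolding e[OF cls(1)[OF x]] using cls[OF x] by auto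
    fix d assume d: "d \<in> B \<rightarrow>\<^sub>E Oint \<and> x \<ominus>\<^bsub>SO\<^esub> (\<Oplus>\<^bsub>SO\<^esub>i\<in>B. d i \<odot>\<^bsub>SO\<^esub> SK.smon i) \<in> im"
    define d' where "d' i = (if i \<in> B then d i else 0)" for i
    have d': "d' i \<in> Oint" "i \<notin> B \<Longrightarrow> d' i = 0" for i using d by (auto simp: d'_def)
    have r: "restrict d' B = d" using d by (auto simp: d'_def fun_eq_iff PiE_def extensional_def)
    obtain y where y: "y \<in> carrier SM" "x \<ominus>\<^bsub>SO\<^esub> (\<Oplus>\<^bsub>SO\<^esub>i\<in>B. d i \<odot>\<^bsub>SO\<^esub> SK.smon i) = del y" using d by blast
    have "x \<ominus>\<^bsub>SO\<^esub> (\<Oplus>\<^bsub>SO\<^esub>i\<in>B. d' i \<odot>\<^bsub>SO\<^esub> SK.smon i) = del y"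
      using y(2) e[of d'] d'(1) unfolding r by simp
    moreover have "x \<ominus>\<^bsub>SO\<^esub> (\<Oplus>\<^bsub>SO\<^esub>i\<in>B. d' i \<odot>\<^bsub>SO\<^esub> SK.smon i) = del y \<longleftrightarrow> cf x = decomp (case_sum (cf y) d')"
      by (rule decomposition_iff[OF x y(1)]) (simp_all add: d')
    ultimately have "cf x = decomp (case_sum (cf y) d')" by blast
    then have "G.inv_map (cf x) = case_sum (cf y) d'"
      using G.inv_map_eqI[OF src_case[OF cf_nfun[OF y(1)] d']] by simp
    then have "cls x = d'" by (simp add: cls_def fun_eq_iff)
    then show "d = restrict (cls x) B" using r by simp
  qed
qed

theorem H0_zero: "H0 ord Oint p n \<gamma> k = {\<zero>\<^bsub>Sk ord Oint p n \<gamma> k\<^esub>}"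
  unfolding H0_def Sk_eq using del_zero_iff by auto

lemma H1_class_cls:
  assumes x: "x \<in> carrier SM"
  shows "H1_class ord Oint p n \<gamma> k x = (\<Oplus>\<^bsub>H1 ord Oint p n \<gamma> k\<^esub>i\<in>B. cls x i \<odot>\<^bsub>H1 ord Oint p n \<gamma> k\<^esub>
     H1_class ord Oint p n \<gamma> k (Sk_basis ord Oint p n \<gamma> k i))"
proof -
  have c: "cls x i \<in> carrier (Oq_ring Oint)" for i using cls(1)[OF x] by simp
  have L: "(\<Oplus>\<^bsub>SO\<^esub>i\<in>B. cls x i \<odot>\<^bsub>SO\<^esub> SK.smon i) \<in> carrier SO"
    using H.smult_closed[OF c] smon_closed by (intro H.M.finsum_closed) auto
  have "(\<Oplus>\<^bsub>H.Q\<^esub>i\<in>B. cls x i \<odot>\<^bsub>H.Q\<^esub> (im +>\<^bsub>SO\<^esub> SK.smon i)) = im +>\<^bsub>SO\<^esub> (\<Oplus>\<^bsub>SO\<^esub>i\<in>B. cls x i \<odot>\<^bsub>SO\<^esub> SK.smon i)"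
    by (rule H.quot_lincomb[OF finite_B smon_closed c])
  moreover have "im +>\<^bsub>SO\<^esub> x = im +>\<^bsub>SO\<^esub> (\<Oplus>\<^bsub>SO\<^esub>i\<in>B. cls x i \<odot>\<^bsub>SO\<^esub> SK.smon i)"
    using x by (intro iffD2[OF H.quot_eq_iff[OF _ L]] cls(2)[OF x]) simp_all
  ultimately show ?thesis unfolding H1_eq H1_class_eq Sk_basis_eq by simp
qed

text \<open>The elements obeying the bound form an O_q-submodule, and it contains the generators:
  their only nonzero coefficient is 1, in a degree at most N, where the required order is not
  positive.\<close>

lemma Fil_level:
  assumes \<xi>: "\<xi> \<in> Fil ord Oint p n \<gamma> k N"
  shows "\<xi> \<in> carrier SM" "in_level (ix_deg n) {real_of_int N} (cf \<xi>)"
proof -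
  let ?T = "{x \<in> carrier SM. in_level (ix_deg n) {real_of_int N} (cf x)}"
  have "submodule ?T (Oq_ring Oint) SO"
  proof (rule H.submoduleI)
    show "\<zero>\<^bsub>SO\<^esub> \<in> ?T" by (simp add: cf_zero)
    fix a assume a: "a \<in> ?T"
    have m: "fps_const (- 1) \<odot>\<^bsub>SM\<^esub> a = \<ominus>\<^bsub>SO\<^esub> a"
      using H.smult_l_minus[of "\<one>\<^bsub>Oq_ring Oint\<^esub>" a] H.smult_one[of a] a
      by (simp add: Oq_ring_def sm.A.a_inv_RS)
    have "in_level (ix_deg n) {real_of_int N} (cf (fps_const (- 1) \<odot>\<^bsub>SM\<^esub> a))"
      using a by (simp only: cf_smult[OF Oint_1(3)] in_level_smult[OF Oint_1(3)] mem_Collect_eq)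
    then show "\<ominus>\<^bsub>SO\<^esub> a \<in> ?T" unfolding m using H.M.a_inv_closed[of a] a by simp
  next
    fix a b assume "a \<in> ?T" "b \<in> ?T"
    then show "a \<oplus>\<^bsub>SO\<^esub> b \<in> ?T" by (auto simp: cf_add intro: in_level_add)
  next
    fix a x assume "a \<in> carrier (Oq_ring Oint)" "x \<in> ?T"
    then show "a \<odot>\<^bsub>SO\<^esub> x \<in> ?T"
      using H.smult_closed[of a x] by (auto simp: cf_smult intro: in_level_smult)
  qed auto
  moreover have "{(fps_const (\<gamma> ^ ((n + 1) * r)) * fps_X ^ r) \<odot>\<^bsub>SM\<^esub> SK.smon i | r i.
        i \<in> sym_index n k \<and> int ((n + 1) * r + index_weight n i) \<le> N} \<subseteq> ?T"
  proof clarify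
    fix r i assume i: "i \<in> I" and N: "int ((n + 1) * r + index_weight n i) \<le> N"
    let ?a = "fps_const (\<gamma> ^ ((n + 1) * r)) * fps_X ^ r"
    have nc: "ncoef ?a = eps r"
      by (auto simp: ncoef_def fun_eq_iff eps_def fps_X_power_nth mult.commute)
    have a: "?a \<in> OS" unfolding O_set_iff nc by (rule eps_nfun) simp
    have "?a \<odot>\<^bsub>SM\<^esub> SK.smon i \<in> carrier SM" using SK.P.smult_closed[of ?a] a i by simp
    moreover have "in_level (ix_deg n) {real_of_int N} (cf (?a \<odot>\<^bsub>SM\<^esub> SK.smon i))"
      unfolding in_level_def
    proof (intro ballI allI)
      fix M b assume "M \<in> {real_of_int N}"
      then have M: "M = real_of_int N" by simp
      show "vb (real (ix_deg n b) - M) (cf (?a \<odot>\<^bsub>SM\<^esub> SK.smon i) b)"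
      proof (cases "b = (i, r)")
        case True
        have "real ((n + 1) * r + index_weight n i) \<le> M" unfolding M using N by (metis of_int_le_iff of_int_of_nat_eq)
        then have "real (ix_deg n b) - M \<le> 0" using True by (simp add: ix_deg_def algebra_simps)
        then show ?thesis unfolding cf_monom[OF i a] nc using True vb_mono[OF vb_one] by (simp add: eps_def)
      next
        case False
        then have "cf (?a \<odot>\<^bsub>SM\<^esub> SK.smon i) b = 0" unfolding cf_monom[OF i a] nc by (cases b) (auto simp: eps_def)
        then show ?thesis by simp
      qed
    qed
    ultimately show "?a \<odot>\<^bsub>SM\<^esub> SK.smon i \<in> carrier SM \<and> in_level (ix_deg n) {real_of_int N} (cf (?a \<odot>\<^bsub>SM\<^esub> SK.smon i))" by blast
  qed
  ultimately have "Fil ord Oint p n \<gamma> k N \<subseteq> ?T"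
    unfolding Fil_def Sk_over_Oq_def Sk_eq Sk_basis_eq by (rule module_span_min)
  then show "\<xi> \<in> carrier SM" "in_level (ix_deg n) {real_of_int N} (cf \<xi>)" using \<xi> by auto
qed

text \<open>The inverse of \<open>decomp\<close> preserves levels, and the index
  \<open>Inr i\<close> has degree w(i).\<close>

theorem Fil_estimate:
  assumes \<xi>: "\<xi> \<in> Fil ord Oint p n \<gamma> k N"
  shows "cls \<xi> i \<in> Oint" "i \<in> B \<Longrightarrow> ereal (real (index_weight n i) - real_of_int N) \<le> ord (cls \<xi> i)"
proof -
  note f = Fil_level[OF \<xi>]
  show "cls \<xi> i \<in> Oint" by (rule cls(1)[OF f(1)])
  have "in_level (src_deg n) {real_of_int N} (G.inv_map (cf \<xi>))"
    by (rule G.inv_map_level[OF cf_nfun[OF f(1)] f(2)])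
  then have "vb (real (src_deg n (Inr i)) - real_of_int N) (G.inv_map (cf \<xi>) (Inr i))"
    unfolding in_level_def by blast
  then show "ereal (real (index_weight n i) - real_of_int N) \<le> ord (cls \<xi> i)"
    by (simp add: cls_def vb_def)
qed

end

theorem theorem4p15:
  fixes p a n k :: nat
    and ord :: "'k::field_char_0 alg_closure \<Rightarrow> ereal"
    and Qq Oq :: "'k alg_closure set"
    and \<gamma> \<rho> :: "'k alg_closure"
    and \<zeta> :: "'q::finite_field alg_closure"
    and B :: "(nat \<Rightarrow> nat) set"
  assumes "prime p" and "a \<ge> 1" and "n \<ge> 1" and "k \<ge> 1" and "coprime (n + 1) p"
    and "padic_closure p ord"
    and "unramified_extension ord a Qq"
    and "((\<lambda>i. ord (gamma_part p \<gamma> i)) \<longlongrightarrow> \<infinity>) sequentially"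
    and "ord \<gamma> = ereal (1 / (real p - 1))"
    and "\<rho> ^ (p ^ a) = \<gamma>"
    and "Oq = ring_of_integers ord (generate_field ring_of_type_algebra (insert \<rho> Qq))"
    and "card (UNIV :: 'q set) = p ^ a"
    and "primitive_root_of_unity (n + 1) \<zeta>"
    and "reduced_basis_set TYPE('q) n k B"
    and "d_number n k \<zeta> = 0"
  shows "H0 ord Oq p n \<gamma> k = {\<zero>\<^bsub>Sk ord Oq p n \<gamma> k\<^esub>} \<and>
    free_with_basis (Oq_ring Oq) (H1 ord Oq p n \<gamma> k) B
      (\<lambda>i. H1_class ord Oq p n \<gamma> k (Sk_basis ord Oq p n \<gamma> k i)) \<and>
    real (card B) = 1 / real (n + 1) * real ((n + k) choose n) \<and>
    (\<forall>N. \<forall>\<xi> \<in> Fil ord Oq p n \<gamma> k N. \<exists>C.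
       (\<forall>i\<in>B. C i \<in> Oq \<and> ord (C i) \<ge> ereal (real (index_weight n i) - real_of_int N)) \<and>
       H1_class ord Oq p n \<gamma> k \<xi> =
         (\<Oplus>\<^bsub>H1 ord Oq p n \<gamma> k\<^esub>i\<in>B. C i \<odot>\<^bsub>H1 ord Oq p n \<gamma> k\<^esub>
            H1_class ord Oq p n \<gamma> k (Sk_basis ord Oq p n \<gamma> k i)))"
proof -
  let ?L = "generate_field ring_of_type_algebra (insert \<rho> Qq)"
  have p2: "p \<ge> 2" using \<open>prime p\<close> by (rule prime_ge_2_nat)
  interpret cv: complete_valued ord p ?L
    by (rule complete_valued_extension[OF \<open>padic_closure p ord\<close> \<open>unramified_extension ord a Qq\<close>])
  have "\<rho> \<in> ?L" by (rule generate_field.incl) simp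
  then have \<gamma>_L: "\<gamma> \<in> ?L" using \<open>\<rho> ^ (p ^ a) = \<gamma>\<close> cv.power_L by blast
  have \<gamma>_0: "\<gamma> \<noteq> 0" using \<open>ord \<gamma> = ereal (1 / (real p - 1))\<close> cv.ord_inf[of \<gamma>] by auto
  interpret kl: kloosterman ord p ?L n \<gamma>
    using p2 \<open>n \<ge> 1\<close> \<gamma>_L \<gamma>_0 gamma_part_estimate[OF cv.valued_axioms p2 assms(8) assms(9)]
    by unfold_locales auto
  have Oq: "Oq = cv.Oint" by fact
  interpret rb: reduction_basis n k "TYPE('q)" B p a
    by unfold_locales fact+
  obtain U where U: "\<And>N j j'. j \<in> {b \<in> sym_index n k \<times> UNIV. ix_deg n b = N} \<Longrightarrow> j' \<in> {b \<in> sym_index n k \<times> UNIV. ix_deg n b = N} \<Longrightarrow>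
      int p dvd (\<Sum>s\<in>{s \<in> (sym_index n k \<times> UNIV) <+> B. src_deg n s = N}. U j s * src_mat n s j') - (if j = j' then 1 else 0)"
    "\<And>N s s'. s \<in> {s \<in> (sym_index n k \<times> UNIV) <+> B. src_deg n s = N} \<Longrightarrow> s' \<in> {s \<in> (sym_index n k \<times> UNIV) <+> B. src_deg n s = N} \<Longrightarrow>
      int p dvd (\<Sum>j\<in>{b \<in> sym_index n k \<times> UNIV. ix_deg n b = N}. src_mat n s j * U j s') - (if s = s' then 1 else 0)"
    by (rule rb.integer_inverse) (rule that)
  interpret ks: kloosterman_sym_basis ord p ?L n \<gamma> k B U
    using rb.B_sub U by unfold_locales
  have "real (n + 1) * real (card B) = real ((n + k) choose n)"
    unfolding of_nat_mult[symmetric] rb.card_B ..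
  then have "real (card B) = 1 / real (n + 1) * real ((n + k) choose n)"
    by (simp add: field_simps)
  moreover have "\<forall>N. \<forall>\<xi> \<in> Fil ord Oq p n \<gamma> k N. \<exists>C.
       (\<forall>i\<in>B. C i \<in> Oq \<and> ord (C i) \<ge> ereal (real (index_weight n i) - real_of_int N)) \<and>
       H1_class ord Oq p n \<gamma> k \<xi> =
         (\<Oplus>\<^bsub>H1 ord Oq p n \<gamma> k\<^esub>i\<in>B. C i \<odot>\<^bsub>H1 ord Oq p n \<gamma> k\<^esub>
            H1_class ord Oq p n \<gamma> k (Sk_basis ord Oq p n \<gamma> k i))"
    unfolding Oq
  proof (intro allI ballI)
    fix N \<xi> assume \<xi>: "\<xi> \<in> Fil ord cv.Oint p n \<gamma> k N"
    show "\<exists>C. (\<forall>i\<in>B. C i \<in> cv.Oint \<and> ord (C i) \<ge> ereal (real (index_weight n i) - real_of_int N)) \<and>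
       H1_class ord cv.Oint p n \<gamma> k \<xi> =
         (\<Oplus>\<^bsub>H1 ord cv.Oint p n \<gamma> k\<^esub>i\<in>B. C i \<odot>\<^bsub>H1 ord cv.Oint p n \<gamma> k\<^esub>
            H1_class ord cv.Oint p n \<gamma> k (Sk_basis ord cv.Oint p n \<gamma> k i))"
      using ks.Fil_estimate[OF \<xi>] ks.H1_class_cls[OF ks.Fil_level(1)[OF \<xi>]]
      by (intro exI[of _ "ks.cls \<xi>"] conjI ballI)
  qed
  ultimately show ?thesis using ks.H0_zero ks.H1_free unfolding Oq by blast
qed

end
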